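(* Let $\mathrm{m}\in\{1,2\}$, let $\Omega\subset\mathbb{R}^2$ be a bounded polygonal domain with Lipschitz continuous boundary, let $0<T<\infty$, let $f\in L^2(0,T;L^2(\Omega))$, and let $V=H^{\mathrm{m}}_0(\Omega)$. Suppose that $u_0\in L^2(\Omega)$. Then there exists a function $$u\in L^\infty(0,T;L^2(\Omega))\cap L^2(0,T;V)\cap L^4(0,T;L^4(\Omega))\quad\text{with}\quad \partial_t u\in L^{4/3}(0,T;V^{\ast})$$ such that for all $v\in V$ and almost every $t\in(0,T)$, $$\langle\partial_t u,v\rangle+\mathcal{A}_{\mathrm{m}}(u,v)+(\phi(u),v)=(f(t,\cdot),v).$$
   Context: All functions are real valued. $(\cdot,\cdot)$ denotes the $L^2(\Omega)$ inner product, and more generally $(g,v)=\int_\Omega g\,v\,\mathrm{d}x$ whenever $gv\in L^1(\Omega)$. $V=H^{\mathrm{m}}_0(\Omega)$ carries the norm $\|v\|_V=\|\mathrm{D}^{\mathrm{m}}v\|_{L^2(\Omega)}$, where $\mathrm{D}^1$ is the gradient and $\mathrm{D}^2$ is the Hessian. $V^{\ast}$ is the dual of $V$, and $\langle\cdot,\cdot\rangle$ is the duality pairing between $V^{\ast}$ and $V$; $L^2(\Omega)$ is identified with its dual, so that $V\hookrightarrow L^2(\Omega)\hookrightarrow V^{\ast}$. Define $\mathcal{A}_{\mathrm{m}}(v,w)=(\mathrm{D}^{\mathrm{m}}v,\mathrm{D}^{\mathrm{m}}w)$ for $v,w\in V$, and $\phi(s)=s^3-s$. $\partial_t u$ is the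 weak time derivative of $u$ as a $V^{\ast}$-valued function. The equation is the weak form of $\partial_t u+(-1)^{\mathrm{m}}\Delta^{\mathrm{m}}u+\phi(u)=f$ in $(0,T]\times\Omega$ with homogeneous Dirichlet boundary conditions $\partial^j u/\partial\boldsymbol{n}^j=0$ on $\partial\Omega$ for $0\le j\le\mathrm{m}-1$, where $\boldsymbol{n}$ is the unit outward normal to $\partial\Omega$; $u_0$ is the prescribed initial datum of this problem. The statement itself does not include an assertion about the value of $u$ at $t=0$. *)

theory Defs
  imports "HOL-Analysis.Analysis"
begin

section \<open>Lebesgue and Sobolev spaces\<close>

text \<open>
  Function spaces are given by a carrier of representatives (functions, not equivalence classes)
  together with a seminorm that vanishes exactly on the functions that are zero almost everywhere.
\<close>

definition Lp :: "'a measure \<Rightarrow> real \<Rightarrow> ('a \<Rightarrow> real) set" where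
  "Lp M p = {g \<in> borel_measurable M. integrable M (\<lambda>x. \<bar>g x\<bar> powr p)}"

definition Lp_norm :: "'a measure \<Rightarrow> real \<Rightarrow> ('a \<Rightarrow> real) \<Rightarrow> real" where
  "Lp_norm M p g = (\<integral>x. \<bar>g x\<bar> powr p \<partial>M) powr (1 / p)"

definition pairing :: "'a::euclidean_space set \<Rightarrow> ('a \<Rightarrow> real) \<Rightarrow> ('a \<Rightarrow> real) \<Rightarrow> real" where
  "pairing \<Omega> g v = (\<integral>x. g x * v x \<partial>(lebesgue_on \<Omega>))"

text \<open>
  A list of basis vectors of length \<open>k\<close> stands for a partial derivative of order \<open>k\<close>, that is, for
  one entry of the tensor \<open>D\<^sup>k\<close> (so mixed second derivatives occur twice, as they do in the Hessian).
\<close>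

primrec partials :: "'a::euclidean_space list \<Rightarrow> ('a \<Rightarrow> real) \<Rightarrow> 'a \<Rightarrow> real" where
  "partials [] \<phi> = \<phi>"
| "partials (b # \<alpha>) \<phi> = (\<lambda>x. frechet_derivative (partials \<alpha> \<phi>) (at x) b)"

definition indices :: "nat \<Rightarrow> 'a::euclidean_space list set" where
  "indices k = {\<alpha>. set \<alpha> \<subseteq> Basis \<and> length \<alpha> = k}"

definition smooth :: "('a::euclidean_space \<Rightarrow> real) \<Rightarrow> bool" where
  "smooth \<phi> \<longleftrightarrow> (\<forall>k. \<forall>\<alpha>\<in>indices k. \<forall>x. partials \<alpha> \<phi> differentiable at x)"

definition test_functions :: "'a::euclidean_space set \<Rightarrow> ('a \<Rightarrow> real) set" where
  "test_functions \<Omega> =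
     {\<phi>. smooth \<phi> \<and> compact (closure {x. \<phi> x \<noteq> 0}) \<and> closure {x. \<phi> x \<noteq> 0} \<subseteq> \<Omega>}"

definition is_weak_deriv ::
  "'a::euclidean_space set \<Rightarrow> 'a list \<Rightarrow> ('a \<Rightarrow> real) \<Rightarrow> ('a \<Rightarrow> real) \<Rightarrow> bool" where
  "is_weak_deriv \<Omega> \<alpha> v g \<longleftrightarrow>
     g \<in> Lp (lebesgue_on \<Omega>) 2 \<and>
     (\<forall>\<phi>\<in>test_functions \<Omega>. pairing \<Omega> v (partials \<alpha> \<phi>) = (-1) ^ length \<alpha> * pairing \<Omega> g \<phi>)"

text \<open>The choice is immaterial: weak derivatives are unique up to null sets.\<close>

definition weak_deriv :: "'a::euclidean_space set \<Rightarrow> 'a list \<Rightarrow> ('a \<Rightarrow> real) \<Rightarrow> 'a \<Rightarrow> real" where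
  "weak_deriv \<Omega> \<alpha> v = (SOME g. is_weak_deriv \<Omega> \<alpha> v g)"

definition sobolev_H :: "nat \<Rightarrow> 'a::euclidean_space set \<Rightarrow> ('a \<Rightarrow> real) set" where
  "sobolev_H m \<Omega> = {v \<in> Lp (lebesgue_on \<Omega>) 2. \<forall>k\<le>m. \<forall>\<alpha>\<in>indices k. \<exists>g. is_weak_deriv \<Omega> \<alpha> v g}"

text \<open>The form \<open>(D\<^sup>m v, D\<^sup>m w)\<close>, with the Euclidean (Frobenius) product of tensors.\<close>

definition form_A ::
  "nat \<Rightarrow> 'a::euclidean_space set \<Rightarrow> ('a \<Rightarrow> real) \<Rightarrow> ('a \<Rightarrow> real) \<Rightarrow> real" where
  "form_A m \<Omega> v w =
     (\<integral>x. (\<Sum>\<alpha>\<in>indices m. weak_deriv \<Omega> \<alpha> v x * weak_deriv \<Omega> \<alpha> w x) \<partial>(lebesgue_on \<Omega>))"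

definition sobolev_norm :: "nat \<Rightarrow> 'a::euclidean_space set \<Rightarrow> ('a \<Rightarrow> real) \<Rightarrow> real" where
  "sobolev_norm m \<Omega> v = sqrt (\<Sum>k\<le>m. form_A k \<Omega> v v)"

definition sobolev_H0 :: "nat \<Rightarrow> 'a::euclidean_space set \<Rightarrow> ('a \<Rightarrow> real) set" where
  "sobolev_H0 m \<Omega> = {v \<in> sobolev_H m \<Omega>.
     \<exists>\<phi>. (\<forall>n::nat. \<phi> n \<in> test_functions \<Omega>) \<and> (\<lambda>n. sobolev_norm m \<Omega> (v - \<phi> n)) \<longlonglongrightarrow> 0}"

definition V_norm :: "nat \<Rightarrow> 'a::euclidean_space set \<Rightarrow> ('a \<Rightarrow> real) \<Rightarrow> real" where
  "V_norm m \<Omega> v = sqrt (form_A m \<Omega> v v)"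


section \<open>Dual spaces\<close>

text \<open>
  Functionals are HOL functions on all of \<open>'a \<Rightarrow> real\<close>, but only their values on the carrier \<open>X\<close>
  matter. Boundedness makes them respect equality almost everywhere.
\<close>

definition dual_space :: "('a \<Rightarrow> real) set \<Rightarrow> (('a \<Rightarrow> real) \<Rightarrow> real) \<Rightarrow> (('a \<Rightarrow> real) \<Rightarrow> real) set" where
  "dual_space X N = {l.
     (\<forall>v\<in>X. \<forall>w\<in>X. l (\<lambda>x. v x + w x) = l v + l w) \<and>
     (\<forall>c. \<forall>v\<in>X. l (\<lambda>x. c * v x) = c * l v) \<and>
     (\<exists>C. \<forall>v\<in>X. \<bar>l v\<bar> \<le> C * N v)}"

definition dual_norm ::
  "('a \<Rightarrow> real) set \<Rightarrow> (('a \<Rightarrow> real) \<Rightarrow> real) \<Rightarrow> (('a \<Rightarrow> real) \<Rightarrow> real) \<Rightarrow> real" where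
  "dual_norm X N l = (SUP v\<in>{v\<in>X. N v \<le> 1}. \<bar>l v\<bar>)"

abbreviation V_dual :: "nat \<Rightarrow> 'a::euclidean_space set \<Rightarrow> (('a \<Rightarrow> real) \<Rightarrow> real) set" where
  "V_dual m \<Omega> \<equiv> dual_space (sobolev_H0 m \<Omega>) (V_norm m \<Omega>)"

abbreviation V_dual_norm :: "nat \<Rightarrow> 'a::euclidean_space set \<Rightarrow> (('a \<Rightarrow> real) \<Rightarrow> real) \<Rightarrow> real" where
  "V_dual_norm m \<Omega> \<equiv> dual_norm (sobolev_H0 m \<Omega>) (V_norm m \<Omega>)"


section \<open>Bochner spaces\<close>

text \<open>
  The library's Bochner integral needs a Banach space type as codomain. The following is the same
  construction relative to a carrier \<open>X\<close> of real functions with a seminorm \<open>N\<close>, over a finite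
  measure \<open>M\<close>.
\<close>

definition simple_in :: "'t measure \<Rightarrow> ('b \<Rightarrow> real) set \<Rightarrow> ('t \<Rightarrow> 'b \<Rightarrow> real) \<Rightarrow> bool" where
  "simple_in M X s \<longleftrightarrow> simple_function M s \<and> s ` space M \<subseteq> X"

definition simple_integral_in :: "'t measure \<Rightarrow> ('t \<Rightarrow> 'b \<Rightarrow> real) \<Rightarrow> 'b \<Rightarrow> real" where
  "simple_integral_in M s = (\<lambda>z. \<Sum>y\<in>s ` space M. measure M {t\<in>space M. s t = y} * y z)"

definition strongly_measurable_in ::
  "'t measure \<Rightarrow> ('b \<Rightarrow> real) set \<Rightarrow> (('b \<Rightarrow> real) \<Rightarrow> real) \<Rightarrow> ('t \<Rightarrow> 'b \<Rightarrow> real) \<Rightarrow> bool" where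
  "strongly_measurable_in M X N g \<longleftrightarrow>
     (AE t in M. g t \<in> X) \<and>
     (\<exists>s. (\<forall>n::nat. simple_in M X (s n)) \<and> (AE t in M. (\<lambda>n. N (g t - s n t)) \<longlonglongrightarrow> 0))"

definition has_bochner_integral_in ::
  "'t measure \<Rightarrow> ('b \<Rightarrow> real) set \<Rightarrow> (('b \<Rightarrow> real) \<Rightarrow> real) \<Rightarrow> ('t \<Rightarrow> 'b \<Rightarrow> real) \<Rightarrow> ('b \<Rightarrow> real) \<Rightarrow> bool"
  where
  "has_bochner_integral_in M X N g y \<longleftrightarrow>
     y \<in> X \<and> strongly_measurable_in M X N g \<and>
     (\<exists>s. (\<forall>n::nat. simple_in M X (s n)) \<and>
          (\<forall>n. integrable M (\<lambda>t. N (g t - s n t))) \<and>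
          (\<lambda>n. \<integral>t. N (g t - s n t) \<partial>M) \<longlonglongrightarrow> 0 \<and>
          (\<lambda>n. N (y - simple_integral_in M (s n))) \<longlonglongrightarrow> 0)"

definition bochner_Lp ::
  "'t measure \<Rightarrow> real \<Rightarrow> ('b \<Rightarrow> real) set \<Rightarrow> (('b \<Rightarrow> real) \<Rightarrow> real) \<Rightarrow> ('t \<Rightarrow> 'b \<Rightarrow> real) set" where
  "bochner_Lp M p X N =
     {g. strongly_measurable_in M X N g \<and> integrable M (\<lambda>t. N (g t) powr p)}"

definition bochner_Linf ::
  "'t measure \<Rightarrow> ('b \<Rightarrow> real) set \<Rightarrow> (('b \<Rightarrow> real) \<Rightarrow> real) \<Rightarrow> ('t \<Rightarrow> 'b \<Rightarrow> real) set" where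
  "bochner_Linf M X N = {g. strongly_measurable_in M X N g \<and> (\<exists>C. AE t in M. N (g t) \<le> C)}"

text \<open>
  \<open>u'\<close> is the weak time derivative of \<open>u\<close>: for all \<open>\<theta>\<close> in \<open>C\<^sub>c\<^sup>\<infinity>(0,T)\<close> the Bochner integrals satisfy
  \<open>\<integral> \<theta>' u dt = - \<integral> \<theta> u' dt\<close> in \<open>V\<^sup>*\<close>, where \<open>u t\<close> is embedded in \<open>V\<^sup>*\<close> as \<open>pairing \<Omega> (u t)\<close>.
\<close>

definition is_weak_time_deriv ::
  "nat \<Rightarrow> 'a::euclidean_space set \<Rightarrow> real \<Rightarrow>
   (real \<Rightarrow> 'a \<Rightarrow> real) \<Rightarrow> (real \<Rightarrow> ('a \<Rightarrow> real) \<Rightarrow> real) \<Rightarrow> bool" where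
  "is_weak_time_deriv m \<Omega> T u u' \<longleftrightarrow>
     (\<forall>\<theta>\<in>test_functions {0<..<T}. \<exists>y.
        has_bochner_integral_in (lebesgue_on {0<..<T}) (V_dual m \<Omega>) (V_dual_norm m \<Omega>)
          (\<lambda>t v. deriv \<theta> t * pairing \<Omega> (u t) v) y \<and>
        has_bochner_integral_in (lebesgue_on {0<..<T}) (V_dual m \<Omega>) (V_dual_norm m \<Omega>)
          (\<lambda>t v. \<theta> t * u' t v) (\<lambda>v. - y v))"


section \<open>Domains\<close>

text \<open>
  Near each boundary point, \<open>\<Omega>\<close> is the region above the graph of a Lipschitz function in
  coordinates whose last axis is \<open>\<nu>\<close>; \<open>y - (y \<bullet> \<nu>) *\<^sub>R \<nu>\<close> is the projection of \<open>y\<close> to the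
  hyperplane orthogonal to \<open>\<nu>\<close>.
\<close>

definition lipschitz_boundary :: "'a::euclidean_space set \<Rightarrow> bool" where
  "lipschitz_boundary \<Omega> \<longleftrightarrow>
     (\<forall>x\<in>frontier \<Omega>. \<exists>r>0. \<exists>\<nu> \<gamma> L. norm \<nu> = 1 \<and> L-lipschitz_on UNIV \<gamma> \<and>
        \<Omega> \<inter> ball x r = {y\<in>ball x r. \<gamma> (y - (y \<bullet> \<nu>) *\<^sub>R \<nu>) < y \<bullet> \<nu>})"

definition polygonal_boundary :: "(real^2) set \<Rightarrow> bool" where
  "polygonal_boundary \<Omega> \<longleftrightarrow>
     (\<exists>S. finite S \<and> frontier \<Omega> = (\<Union>(a, b)\<in>S. closed_segment a b))"

definition lipschitz_polygonal_domain :: "(real^2) set \<Rightarrow> bool" where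
  "lipschitz_polygonal_domain \<Omega> \<longleftrightarrow>
     open \<Omega> \<and> connected \<Omega> \<and> \<Omega> \<noteq> {} \<and> bounded \<Omega> \<and>
     polygonal_boundary \<Omega> \<and> lipschitz_boundary \<Omega>"


section \<open>The nonlinearity\<close>

definition phi :: "real \<Rightarrow> real" where
  "phi s = s ^ 3 - s"

end

theory Submission
  imports Defs "HOL-Library.Function_Algebras"
begin

text \<open>
  The equation is the gradient flow, with source \<open>f\<close>, of the Ginzburg-Landau energy
  \<open>A(v, v) / 2 + \<integral> (v\<^sup>2 - 1)\<^sup>2 / 4\<close>, and it is solved by implicit Euler schemes. The conclusion does
  not prescribe \<open>u\<close> at time 0, so the schemes start from 0, which lies in \<open>V\<close> and has finite energy.

  A step of size \<open>h\<close> from \<open>w\<close> with source \<open>F\<close> minimises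
  \<open>\<parallel>u - w\<parallel>\<^sup>2 / (2 h) + energy u - (F, u)\<close>, only up to a small tolerance and among test functions. A
  near-minimiser satisfies the Euler-Lagrange equation up to \<open>\<epsilon> \<parallel>v\<parallel>\<^sub>V\<close> (\<open>euler_step_exists\<close>). As the
  energy is nonnegative, summing the decrease of the functional bounds the scheme in \<open>V\<close> uniformly in
  time, and the sum of its squared increments in \<open>L\<^sup>2\<close> by a multiple of \<open>h\<close> (\<open>euler_energy\<close>).

  The function \<open>s \<mapsto> phi s + s\<close> is increasing. Two schemes, one on a refinement of the
  mesh of the other, are therefore compared by testing both with their difference, and a discrete
  Gronwall inequality shows that they are close in \<open>L\<^sup>2(0,T;V)\<close> (\<open>euler_comparison\<close>). On dyadic meshes
  the schemes form a Cauchy sequence, and a subsequence converges in \<open>V\<close> at almost every time to a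
  function \<open>u\<close> (\<open>limit_exists\<close>), which inherits the bounds.

  On a bounded open set in the plane, the Poincare and Ladyzhenskaya inequalities
  embed \<open>V\<close> into \<open>L\<^sup>2\<close> and \<open>L\<^sup>4\<close> (\<open>H0_poincare\<close>, \<open>H0_L4\<close>), so that
  \<open>flux g w = (g, \<cdot>) - A(w, \<cdot>) - (phi w, \<cdot>)\<close> is an element of \<open>V\<^sup>*\<close> that depends on \<open>g\<close> and \<open>w\<close> in a
  locally Lipschitz way. The function \<open>u' t = flux (f t) (u t)\<close> satisfies the equation by
  definition and has the asserted integrability. That it is the weak time derivative of \<open>u\<close>
  follows by summation by parts in the scheme and passage to the limit, first against test functions
  in space (\<open>weak_form_test\<close>), then on \<open>V\<close> by density. A Bochner integral in \<open>V\<^sup>*\<close> is determined by its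
  values on \<open>V\<close> (\<open>has_bochner_integral_dual\<close>), so these scalar identities give the vector-valued one
  (\<open>u_weak_time_deriv\<close>).

  The function spaces rest on the fundamental lemma of the calculus of variations, which makes weak
  derivatives unique, on integration by parts for test functions, and on the Riesz-Fischer theorem,
  which provides limits in \<open>V\<close> (\<open>H0_complete\<close>).
\<close>

text \<open>
  Pointwise scalar multiplication makes real-valued functions a real vector space. Subspaces,
  semi-inner products and seminorms on sets of functions can then be stated in general vector
  spaces.
\<close>

instantiation "fun" :: (type, real_vector) real_vector
begin
definition scaleR_fun_def: "scaleR c f = (\<lambda>x. c *\<^sub>R f x)"
instance by standard (auto simp: scaleR_fun_def plus_fun_def scaleR_add_right scaleR_add_left)
end

lemma scaleR_apply [simp]: "(c *\<^sub>R f) x = c *\<^sub>R f x"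
  by (simp add: scaleR_fun_def)

section \<open>Smooth functions and test functions\<close>

lemma partials_append: "partials (\<alpha> @ \<beta>) \<phi> = partials \<alpha> (partials \<beta> \<phi>)"
  by (induction \<alpha>) auto

text \<open>
  Smoothness speaks of all iterated partial derivatives. Exhibiting a class of differentiable
  functions that is closed under one derivative replaces an induction on the order in each
  concrete case.
\<close>

lemma smooth_coinduct:
  assumes "\<phi> \<in> F"
    and "\<And>g x. g \<in> F \<Longrightarrow> g differentiable at x"
    and "\<And>g b. g \<in> F \<Longrightarrow> b \<in> Basis \<Longrightarrow> partials [b] g \<in> F"
  shows "smooth \<phi>"
proof -
  have "set \<alpha> \<subseteq> Basis \<Longrightarrow> partials \<alpha> \<phi> \<in> F" for \<alpha>
  proof (induction \<alpha>)
    case (Cons b \<alpha>)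
    then show ?case using assms(3)[of "partials \<alpha> \<phi>" b] by simp
  qed (use assms in simp)
  then show ?thesis unfolding smooth_def indices_def using assms(2) by blast
qed

lemma smooth_differentiable: "smooth \<phi> \<Longrightarrow> \<phi> differentiable at x"
  unfolding smooth_def indices_def by (drule spec[of _ 0]) auto

lemma smooth_partials: "smooth \<phi> \<Longrightarrow> set \<beta> \<subseteq> Basis \<Longrightarrow> smooth (partials \<beta> \<phi>)"
  unfolding smooth_def indices_def by (auto simp flip: partials_append)

lemma smooth_continuous: "smooth \<phi> \<Longrightarrow> continuous_on UNIV \<phi>"
  by (meson continuous_at_imp_continuous_on differentiable_imp_continuous_within smooth_differentiable)

lemma partials_add1:
  fixes f g :: "'a::euclidean_space \<Rightarrow> real"
  assumes "\<And>x. f differentiable at x" "\<And>x. g differentiable at x"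
  shows "partials [b] (f + g) = partials [b] f + partials [b] g"
proof
  fix x
  have "((\<lambda>x. f x + g x) has_derivative (\<lambda>h. frechet_derivative f (at x) h + frechet_derivative g (at x) h)) (at x)"
    using assms by (intro has_derivative_add) (auto simp flip: frechet_derivative_works)
  from fun_cong[OF frechet_derivative_at[OF this], of b]
  show "partials [b] (f + g) x = (partials [b] f + partials [b] g) x"
    by (simp add: plus_fun_def)
qed

lemma partials_mult1:
  fixes f g :: "'a::euclidean_space \<Rightarrow> real"
  assumes "\<And>x. f differentiable at x" "\<And>x. g differentiable at x"
  shows "partials [b] (\<lambda>x. f x * g x) = (\<lambda>x. f x * partials [b] g x) + (\<lambda>x. partials [b] f x * g x)"
proof
  fix x
  have "((\<lambda>x. f x * g x) has_derivative (\<lambda>h. f x * frechet_derivative g (at x) h + frechet_derivative f (at x) h * g x)) (at x)"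
    using assms by (intro has_derivative_mult) (auto simp flip: frechet_derivative_works)
  from fun_cong[OF frechet_derivative_at[OF this], of b]
  show "partials [b] (\<lambda>x. f x * g x) x = ((\<lambda>x. f x * partials [b] g x) + (\<lambda>x. partials [b] f x * g x)) x"
    by simp
qed

lemma partials_scale1:
  fixes f :: "'a::euclidean_space \<Rightarrow> real"
  assumes "\<And>x. f differentiable at x"
  shows "partials [b] (c *\<^sub>R f) = c *\<^sub>R partials [b] f"
proof
  fix x
  have "((\<lambda>x. c * f x) has_derivative (\<lambda>h. c * frechet_derivative f (at x) h)) (at x)"
    using assms by (intro has_derivative_mult_right) (auto simp flip: frechet_derivative_works)
  from fun_cong[OF frechet_derivative_at[OF this], of b]
  show "partials [b] (c *\<^sub>R f) x = (c *\<^sub>R partials [b] f) x"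
    by (simp add: scaleR_fun_def)
qed

lemma partials_const: "partials [b] (\<lambda>x. c) = (\<lambda>x. 0)"
  by (auto simp: frechet_derivative_const)

lemma differentiable_add_fun:
  fixes f g :: "'a::euclidean_space \<Rightarrow> real"
  shows "f differentiable at x \<Longrightarrow> g differentiable at x \<Longrightarrow> (f + g) differentiable at x"
  using differentiable_add[of f "at x" g] by (simp add: plus_fun_def)

text \<open>
  The derivative of a product is a sum of products, so a class that is closed under derivatives
  and products has to be closed under sums as well.
\<close>

inductive_set product_algebra :: "('a::euclidean_space \<Rightarrow> real) set \<Rightarrow> ('a \<Rightarrow> real) set"
  for F :: "('a \<Rightarrow> real) set" where
  base: "f \<in> F \<Longrightarrow> f \<in> product_algebra F"
| add: "f \<in> product_algebra F \<Longrightarrow> g \<in> product_algebra F \<Longrightarrow> f + g \<in> product_algebra F"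
| mult: "f \<in> product_algebra F \<Longrightarrow> g \<in> product_algebra F \<Longrightarrow> (\<lambda>x. f x * g x) \<in> product_algebra F"

lemma smooth_product_algebra:
  fixes F :: "('a::euclidean_space \<Rightarrow> real) set"
  assumes "f \<in> product_algebra F"
    and diff: "\<And>g x. g \<in> F \<Longrightarrow> g differentiable at x"
    and closed: "\<And>g b. g \<in> F \<Longrightarrow> b \<in> Basis \<Longrightarrow> partials [b] g \<in> product_algebra F"
  shows "smooth f"
proof (rule smooth_coinduct[where F="product_algebra F"])
  have d: "g \<in> product_algebra F \<Longrightarrow> (\<forall>x. g differentiable at x)" for g
    by (induction rule: product_algebra.induct) (auto intro!: diff differentiable_mult differentiable_add_fun)
  then show "g \<in> product_algebra F \<Longrightarrow> g differentiable at x" for g x by blast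
  show "partials [b] g \<in> product_algebra F" if "g \<in> product_algebra F" "b \<in> Basis" for g b
    using that(1)
  proof (induction rule: product_algebra.induct)
    case (base f) then show ?case using closed that(2) by blast
  next
    case (add f g)
    have "partials [b] (f + g) = partials [b] f + partials [b] g"
      using d[OF add.hyps(1)] d[OF add.hyps(2)] by (intro partials_add1) blast+
    with add.IH show ?case by (simp only: product_algebra.add)
  next
    case (mult f g)
    have "partials [b] (\<lambda>x. f x * g x) = (\<lambda>x. f x * partials [b] g x) + (\<lambda>x. partials [b] f x * g x)"
      using d[OF mult.hyps(1)] d[OF mult.hyps(2)] by (intro partials_mult1) blast+
    with mult show ?case by (simp only: product_algebra.add product_algebra.mult)
  qed
qed fact

lemma smooth_in_algebra: "f \<in> product_algebra {g. smooth g} \<Longrightarrow> smooth f"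
proof (erule smooth_product_algebra)
  fix g :: "'a \<Rightarrow> real" and b :: 'a assume "g \<in> {g. smooth g}" "b \<in> Basis"
  then have "smooth (partials [b] g)" by (intro smooth_partials) simp_all
  then show "partials [b] g \<in> product_algebra {g. smooth g}" by (simp only: product_algebra.base mem_Collect_eq)
qed (simp add: smooth_differentiable)

lemma smooth_add: "smooth f \<Longrightarrow> smooth g \<Longrightarrow> smooth (f + g)"
  by (rule smooth_in_algebra) (auto intro: product_algebra.intros)

lemma smooth_mult: "smooth f \<Longrightarrow> smooth g \<Longrightarrow> smooth (\<lambda>x. f x * g x)"
  by (rule smooth_in_algebra) (auto intro: product_algebra.intros)

lemma smooth_const: "smooth (\<lambda>x. c)"
  by (rule smooth_coinduct[of _ "{\<lambda>x. c | c. True}"])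
   (auto simp: partials_const simp del: partials.simps)

lemma smooth_scale: "smooth f \<Longrightarrow> smooth (c *\<^sub>R f)"
  using smooth_mult[OF smooth_const[of c]] by (simp add: scaleR_fun_def)

lemma partials_add:
  assumes "smooth f" "smooth g" "set \<alpha> \<subseteq> Basis"
  shows "partials \<alpha> (f + g) = partials \<alpha> f + partials \<alpha> g"
  using assms(3)
proof (induction \<alpha>)
  case (Cons b \<alpha>)
  have "partials (b # \<alpha>) (f + g) = partials [b] (partials \<alpha> f + partials \<alpha> g)"
    using Cons by (simp only: partials.simps list.set insert_subset)
  also have "\<dots> = partials (b # \<alpha>) f + partials (b # \<alpha>) g"
    using partials_add1[OF smooth_differentiable smooth_differentiable, OF smooth_partials smooth_partials, of f \<alpha> g \<alpha> b]
      Cons.prems assms by (simp only: partials.simps list.set insert_subset)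
  finally show ?case .
qed simp

lemma partials_scale:
  assumes "smooth f" "set \<alpha> \<subseteq> Basis"
  shows "partials \<alpha> (c *\<^sub>R f) = c *\<^sub>R partials \<alpha> f"
  using assms(2)
proof (induction \<alpha>)
  case (Cons b \<alpha>)
  have "partials (b # \<alpha>) (c *\<^sub>R f) = partials [b] (c *\<^sub>R partials \<alpha> f)"
    using Cons by (simp only: partials.simps list.set insert_subset)
  also have "\<dots> = c *\<^sub>R partials (b # \<alpha>) f"
    using partials_scale1[OF smooth_differentiable, OF smooth_partials, of f \<alpha> b c]
      Cons.prems assms by (simp only: partials.simps list.set insert_subset)
  finally show ?case .
qed simp

text \<open>
  Any compact set outside which \<open>\<phi>\<close> vanishes may replace the closed support,
  which is awkward to compute for sums and products.
\<close>

lemma test_functions_iff: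
  fixes \<Omega> :: "'a::euclidean_space set"
  shows "\<phi> \<in> test_functions \<Omega> \<longleftrightarrow> smooth \<phi> \<and> (\<exists>K. compact K \<and> K \<subseteq> \<Omega> \<and> (\<forall>x. x \<notin> K \<longrightarrow> \<phi> x = 0))"
proof
  assume "\<phi> \<in> test_functions \<Omega>"
  then show "smooth \<phi> \<and> (\<exists>K. compact K \<and> K \<subseteq> \<Omega> \<and> (\<forall>x. x \<notin> K \<longrightarrow> \<phi> x = 0))"
    unfolding test_functions_def using closure_subset[of "{x. \<phi> x \<noteq> 0}"] by blast
next
  assume "smooth \<phi> \<and> (\<exists>K. compact K \<and> K \<subseteq> \<Omega> \<and> (\<forall>x. x \<notin> K \<longrightarrow> \<phi> x = 0))"
  then obtain K where K: "smooth \<phi>" "compact K" "K \<subseteq> \<Omega>" "\<And>x. x \<notin> K \<Longrightarrow> \<phi> x = 0" by blast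
  have "closure {x. \<phi> x \<noteq> 0} \<subseteq> K"
    by (rule closure_minimal) (use K compact_imp_closed in auto)
  moreover from this have "compact (closure {x. \<phi> x \<noteq> 0})"
    using compact_Int_closed[OF K(2) closed_closure, of "{x. \<phi> x \<noteq> 0}"] by (simp add: Int_absorb1)
  ultimately show "\<phi> \<in> test_functions \<Omega>" unfolding test_functions_def using K by blast
qed

lemma partials_zero_outside:
  fixes \<phi> :: "'a::euclidean_space \<Rightarrow> real"
  assumes "closed K" "\<And>x. x \<notin> K \<Longrightarrow> \<phi> x = 0" "x \<notin> K"
  shows "partials \<alpha> \<phi> x = 0"
proof -
  have "x \<notin> K \<Longrightarrow> partials \<alpha> \<phi> x = 0" for x
  proof (induction \<alpha> arbitrary: x)
    case (Cons b \<alpha>)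
    have "((\<lambda>x. 0) has_derivative (\<lambda>h. 0)) (at x)" by simp
    then have "(partials \<alpha> \<phi> has_derivative (\<lambda>h. 0)) (at x)"
      by (rule has_derivative_transform_within_open[of _ _ _ _ "- K"]) (use Cons assms in auto)
    from frechet_derivative_at[OF this] show ?case by (metis partials.simps(2))
  qed (use assms in simp)
  then show ?thesis using assms by blast
qed

lemma test_partials:
  assumes "\<phi> \<in> test_functions \<Omega>" "set \<alpha> \<subseteq> Basis" shows "partials \<alpha> \<phi> \<in> test_functions \<Omega>"
  using assms unfolding test_functions_iff
  by (metis compact_imp_closed partials_zero_outside smooth_partials)

lemma test_add: "f \<in> test_functions \<Omega> \<Longrightarrow> g \<in> test_functions \<Omega> \<Longrightarrow> f + g \<in> test_functions \<Omega>"
  unfolding test_functions_iff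
proof (elim conjE exE, intro conjI exI allI impI)
  fix K L x assume "x \<notin> K \<union> L" "\<forall>x. x \<notin> K \<longrightarrow> f x = 0" "\<forall>x. x \<notin> L \<longrightarrow> g x = 0" 
  then show "(f + g) x = 0" by auto
qed (auto intro: smooth_add)

lemma test_mult: "f \<in> test_functions \<Omega> \<Longrightarrow> smooth g \<Longrightarrow> (\<lambda>x. f x * g x) \<in> test_functions \<Omega>"
  unfolding test_functions_iff using smooth_mult by (metis mult_zero_left)

lemma test_scale: "f \<in> test_functions \<Omega> \<Longrightarrow> c *\<^sub>R f \<in> test_functions \<Omega>"
  unfolding test_functions_iff using smooth_scale by (metis scaleR_apply scaleR_zero_right)

lemma test_zero: "0 \<in> test_functions \<Omega>"
  unfolding test_functions_iff using smooth_const[of 0] by (auto simp: zero_fun_def)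

lemma subspace_test_functions: "subspace (test_functions \<Omega>)"
  by (auto simp: subspace_def test_add test_scale test_zero)

lemma test_smooth: "\<phi> \<in> test_functions \<Omega> \<Longrightarrow> smooth \<phi>"
  by (simp add: test_functions_iff)

lemma test_zero_outside: "\<phi> \<in> test_functions \<Omega> \<Longrightarrow> x \<notin> \<Omega> \<Longrightarrow> \<phi> x = 0"
  unfolding test_functions_iff by auto

lemma test_continuous: "\<phi> \<in> test_functions \<Omega> \<Longrightarrow> continuous_on UNIV \<phi>"
  using smooth_continuous test_smooth by blast

lemma test_measurable: "\<phi> \<in> test_functions \<Omega> \<Longrightarrow> \<phi> \<in> borel_measurable borel"
  by (intro borel_measurable_continuous_onI test_continuous)

lemma bounded_of_compact_support:
  fixes \<phi> :: "'a::euclidean_space \<Rightarrow> real"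
  assumes "continuous_on UNIV \<phi>" "compact K" "\<And>x. x \<notin> K \<Longrightarrow> \<phi> x = 0"
  shows "\<exists>B>0. \<forall>x. \<bar>\<phi> x\<bar> \<le> B"
proof -
  have "compact (\<phi> ` K)" using assms by (meson compact_continuous_image continuous_on_subset subset_UNIV)
  then obtain B where B: "B > 0" "\<And>y. y \<in> \<phi> ` K \<Longrightarrow> norm y \<le> B" by (meson bounded_pos compact_imp_bounded)
  have "\<bar>\<phi> x\<bar> \<le> B" for x using B assms(3)[of x] by (cases "x \<in> K") auto
  then show ?thesis using B by blast
qed

lemma test_bounded:
  assumes "\<phi> \<in> test_functions \<Omega>" shows "\<exists>B>0. \<forall>x. \<bar>\<phi> x\<bar> \<le> B"
  using assms bounded_of_compact_support[of \<phi>] smooth_continuous unfolding test_functions_iff by metis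

section \<open>Integration by parts\<close>

lemma directional_derivative:
  fixes f :: "'a::euclidean_space \<Rightarrow> real"
  assumes "f differentiable at (x + s *\<^sub>R b)"
  shows "((\<lambda>s. f (x + s *\<^sub>R b)) has_real_derivative partials [b] f (x + s *\<^sub>R b)) (at s)"
proof -
  have 1: "(f has_derivative frechet_derivative f (at (x + s *\<^sub>R b))) (at (x + s *\<^sub>R b))"
    using assms frechet_derivative_works by blast
  have 2: "((\<lambda>s. x + s *\<^sub>R b) has_derivative (\<lambda>h. h *\<^sub>R b)) (at s)"
    by (auto intro!: derivative_eq_intros)
  have "((\<lambda>s. f (x + s *\<^sub>R b)) has_derivative (\<lambda>h. frechet_derivative f (at (x + s *\<^sub>R b)) (h *\<^sub>R b))) (at s)"
    by (rule has_derivative_compose[OF 2 1])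
  moreover have "linear (frechet_derivative f (at (x + s *\<^sub>R b)))"
    using assms by (simp add: linear_frechet_derivative)
  ultimately show ?thesis
    by (simp add: has_field_derivative_def linear_cmul mult.commute[of _ "frechet_derivative f (at (x + s *\<^sub>R b)) b"])
qed

text \<open>
  The difference quotients of \<open>f\<close> have integral 0, because Lebesgue measure is
  invariant under translations. By the mean value theorem they are bounded by a constant on a
  fixed ball and vanish outside it, so dominated convergence carries the integral over to the
  derivative.
\<close>

lemma integral_partial_eq_0:
  fixes f :: "'a::euclidean_space \<Rightarrow> real"
  assumes diff: "\<And>x. f differentiable at x" and cont: "continuous_on UNIV (partials [b] f)"
    and K: "compact K" "\<And>x. x \<notin> K \<Longrightarrow> f x = 0"
  shows "(\<integral>x. partials [b] f x \<partial>lborel) = 0"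
proof -
  define q where "q n x = real (Suc n) * (f (x + (1 / real (Suc n)) *\<^sub>R b) - f x)" for n x
  have fc: "continuous_on UNIV f"
    by (meson continuous_at_imp_continuous_on diff differentiable_imp_continuous_within)
  then have fm: "f \<in> borel_measurable borel" by (rule borel_measurable_continuous_onI)
  have zero: "partials [b] f x = 0" if "x \<notin> K" for x
    using partials_zero_outside[of K f x "[b]"] K compact_imp_closed that by blast
  obtain B where B: "B > 0" "\<And>x. \<bar>partials [b] f x\<bar> \<le> B"
    using bounded_of_compact_support[OF cont K(1) zero] by blast
  obtain R where R: "R > 0" "\<And>x. x \<in> K \<Longrightarrow> norm x \<le> R"
    using compact_imp_bounded[OF K(1)] unfolding bounded_pos by blast
  define K' where "K' = cball (0::'a) (R + norm b)"
  have bound: "\<bar>q n x\<bar> \<le> B * indicator K' x" for n x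
  proof (cases "x \<in> K'")
    case True
    have "\<exists>z>0. z < 1 / real (Suc n) \<and> f (x + (1 / real (Suc n)) *\<^sub>R b) - f (x + 0 *\<^sub>R b)
        = (1 / real (Suc n) - 0) * partials [b] f (x + z *\<^sub>R b)"
      by (rule MVT2[where f="\<lambda>s. f (x + s *\<^sub>R b)" and f'="\<lambda>s. partials [b] f (x + s *\<^sub>R b)"])
        (simp_all only: directional_derivative[OF diff], simp)
    then obtain z where "f (x + (1 / real (Suc n)) *\<^sub>R b) - f x = (1 / real (Suc n)) * partials [b] f (x + z *\<^sub>R b)"
      by (auto simp only: scaleR_zero_left add_0_right diff_0_right)
    then have "q n x = partials [b] f (x + z *\<^sub>R b)" unfolding q_def by (simp del: of_nat_Suc partials.simps)
    then show ?thesis using B True by simp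
  next
    case False
    have "norm (x + (1 / real (Suc n)) *\<^sub>R b) > R"
    proof -
      have "norm ((1 / real (Suc n)) *\<^sub>R b) \<le> norm b" by (simp add: divide_le_eq mult_right_le_one_le)
        (metis le_add_same_cancel1 mult_le_cancel_left1 norm_ge_zero not_less of_nat_0_le_iff add.commute mult.commute linorder_not_less)
      moreover have "norm x > R + norm b" using False unfolding K'_def by simp
      ultimately show ?thesis using norm_diff_ineq[of x "(1 / real (Suc n)) *\<^sub>R b"] by linarith
    qed
    moreover have "norm x > R" using False unfolding K'_def using norm_ge_zero[of b] by (auto simp del: norm_ge_zero)
    ultimately have "f (x + (1 / real (Suc n)) *\<^sub>R b) = 0" "f x = 0" using R K(2) by (meson not_less)+
    then show ?thesis unfolding q_def using B(1) by (simp add: indicator_def)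
  qed
  have int_f: "integrable lborel f"
  proof -
    have iK: "integrable lborel (\<lambda>x. C * indicator K x)" for C :: real
      using K(1) by (auto simp: compact_imp_closed intro!: integrable_mult_right integrable_real_indicator emeasure_compact_finite borel_closed)
    obtain C where C: "C > 0" "\<And>x. \<bar>f x\<bar> \<le> C" using bounded_of_compact_support[OF fc K] by blast
    show ?thesis
    proof (rule Bochner_Integration.integrable_bound[OF iK[of C]])
      show "AE x in lborel. norm (f x) \<le> norm (C * indicator K x)"
        using C K by (intro AE_I2) (auto simp: indicator_def)
    qed (use fm in simp)
  qed
  have q0: "integral\<^sup>L lborel (q n) = 0" for n
  proof -
    have *: "(\<integral>x. f (x + (1 / real (Suc n)) *\<^sub>R b) \<partial>lborel) = (\<integral>x. f x \<partial>lborel)"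
      "integrable lborel (\<lambda>x. f (x + (1 / real (Suc n)) *\<^sub>R b))"
      using integral_distr[of "(+) ((1 / real (Suc n)) *\<^sub>R b)" lborel borel f] fm int_f
        integrable_distr_eq[of "(+) ((1 / real (Suc n)) *\<^sub>R b)" lborel borel f]
      by (auto simp: lborel_distr_plus add.commute)
    show ?thesis unfolding q_def using * int_f by simp
  qed
  have "(\<lambda>n. integral\<^sup>L lborel (q n)) \<longlonglongrightarrow> (\<integral>x. partials [b] f x \<partial>lborel)"
  proof (rule integral_dominated_convergence)
    show "partials [b] f \<in> borel_measurable lborel" using borel_measurable_continuous_onI[OF cont] by simp
    show "q n \<in> borel_measurable lborel" for n unfolding q_def using fm by measurable
    show "integrable lborel (\<lambda>x. B * indicator K' x)"
      unfolding K'_def by (auto intro!: integrable_mult_right integrable_real_indicator emeasure_compact_finite simp del: integrable_mult_right_iff)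
    show "AE x in lborel. norm (q n x) \<le> B * indicator K' x" for n using bound by simp
    show "AE x in lborel. (\<lambda>n. q n x) \<longlonglongrightarrow> partials [b] f x"
    proof (intro AE_I2)
      fix x
      have "((\<lambda>s. (f (x + s *\<^sub>R b) - f x) / s) \<longlongrightarrow> partials [b] f x) (at 0)"
        using directional_derivative[of f x 0 b] diff by (simp add: has_field_derivative_iff del: partials.simps)
      moreover have "filterlim (\<lambda>n. 1 / real (Suc n)) (at 0) sequentially"
        unfolding filterlim_at using LIMSEQ_inverse_real_of_nat by (auto simp: inverse_eq_divide)
      ultimately have "(\<lambda>n. (f (x + (1 / real (Suc n)) *\<^sub>R b) - f x) / (1 / real (Suc n))) \<longlonglongrightarrow> partials [b] f x"
        by (rule filterlim_compose)
      then show "(\<lambda>n. q n x) \<longlonglongrightarrow> partials [b] f x" unfolding q_def by (simp add: mult.commute del: of_nat_Suc partials.simps)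
    qed
  qed
  then show ?thesis unfolding q0 by (simp add: LIMSEQ_const_iff del: partials.simps)
qed


lemma integral_lebesgue_on_eq_lborel:
  fixes g :: "'a::euclidean_space \<Rightarrow> real"
  assumes "g \<in> borel_measurable borel" "\<Omega> \<in> sets lebesgue" "\<And>x. x \<notin> \<Omega> \<Longrightarrow> g x = 0"
  shows "(\<integral>x. g x \<partial>lebesgue_on \<Omega>) = (\<integral>x. g x \<partial>lborel)"
proof -
  have "(\<integral>x. g x \<partial>lebesgue_on \<Omega>) = (\<integral>x. indicator \<Omega> x *\<^sub>R g x \<partial>lebesgue)"
    using assms(2) by (subst integral_restrict_space) auto
  also have "(\<lambda>x. indicator \<Omega> x *\<^sub>R g x) = g" using assms(3) by (auto simp: indicator_def fun_eq_iff)
  also have "(\<integral>x. g x \<partial>lebesgue) = (\<integral>x. g x \<partial>lborel)"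
    using assms(1) by (intro integral_completion) simp
  finally show ?thesis .
qed

locale bounded_open =
  fixes \<Omega> :: "'a::euclidean_space set"
  assumes open_\<Omega>: "open \<Omega>" and bounded_\<Omega>: "bounded \<Omega>"
begin

abbreviation "M \<equiv> lebesgue_on \<Omega>"
abbreviation "\<D> \<equiv> test_functions \<Omega>"

lemma \<Omega>_sets: "\<Omega> \<in> sets lebesgue"
  using open_\<Omega> by (simp add: borel_open sets_completionI_sets)

lemma \<Omega>_lmeasurable: "\<Omega> \<in> lmeasurable"
  using bounded_\<Omega> open_\<Omega> by (simp add: bounded_set_imp_lmeasurable \<Omega>_sets)

sublocale finite_measure M
  using \<Omega>_lmeasurable by (rule finite_measure_lebesgue_on)

lemma borel_imp_M: "g \<in> borel_measurable borel \<Longrightarrow> g \<in> borel_measurable M"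
  by (simp add: measurable_completion measurable_restrict_space1)

lemma test_M [measurable]: "\<phi> \<in> \<D> \<Longrightarrow> \<phi> \<in> borel_measurable M"
  by (intro borel_imp_M test_measurable)

lemma integrable_bounded:
  fixes g :: "'a \<Rightarrow> real"
  assumes "g \<in> borel_measurable M" "\<And>x. \<bar>g x\<bar> \<le> B" shows "integrable M g"
  using assms by (intro integrable_const_bound[of _ B]) auto

lemma integrable_test: 
  assumes "\<phi> \<in> \<D>" shows "integrable M \<phi>"
  using test_bounded[OF assms] integrable_bounded[OF test_M[OF assms]] by blast

lemma integrable_test_mult: 
  assumes "\<phi> \<in> \<D>" "\<psi> \<in> \<D>" shows "integrable M (\<lambda>x. \<phi> x * \<psi> x)"
  using test_mult[OF assms(1) test_smooth[OF assms(2)]] by (rule integrable_test)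

lemma coordinate_bounded: "\<exists>R>0. \<forall>x\<in>\<Omega>. \<forall>b\<in>Basis. \<bar>x \<bullet> b\<bar> \<le> R"
proof -
  obtain R where "R > 0" "\<And>x. x \<in> \<Omega> \<Longrightarrow> norm x \<le> R" using bounded_\<Omega> unfolding bounded_pos by blast
  then show ?thesis by (meson Basis_le_norm order_trans)
qed

lemma integral_partial_test:
  assumes "\<phi> \<in> \<D>" "b \<in> Basis"
  shows "(\<integral>x. partials [b] \<phi> x \<partial>M) = 0"
proof -
  have t: "partials [b] \<phi> \<in> \<D>" using assms by (intro test_partials) auto
  obtain K where K: "compact K" "\<And>x. x \<notin> K \<Longrightarrow> \<phi> x = 0" using assms(1) unfolding test_functions_iff by blast
  have "(\<integral>x. partials [b] \<phi> x \<partial>M) = (\<integral>x. partials [b] \<phi> x \<partial>lborel)"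
    by (rule integral_lebesgue_on_eq_lborel[OF test_measurable[OF t] \<Omega>_sets test_zero_outside[OF t]])
  also have "\<dots> = 0"
    by (rule integral_partial_eq_0[OF smooth_differentiable[OF test_smooth[OF assms(1)]] test_continuous[OF t] K])
  finally show ?thesis .
qed

lemma integration_by_parts:
  assumes "\<phi> \<in> \<D>" "smooth \<psi>" "b \<in> Basis"
  shows "(\<integral>x. \<phi> x * partials [b] \<psi> x \<partial>M) = - (\<integral>x. partials [b] \<phi> x * \<psi> x \<partial>M)"
proof -
  have t1: "(\<lambda>x. \<phi> x * partials [b] \<psi> x) \<in> \<D>" using assms by (intro test_mult smooth_partials) auto
  have t2: "(\<lambda>x. partials [b] \<phi> x * \<psi> x) \<in> \<D>" using assms by (intro test_mult test_partials) auto
  have "0 = (\<integral>x. partials [b] (\<lambda>x. \<phi> x * \<psi> x) x \<partial>M)"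
    using assms by (simp add: integral_partial_test test_mult del: partials.simps)
  also have "\<dots> = (\<integral>x. \<phi> x * partials [b] \<psi> x + partials [b] \<phi> x * \<psi> x \<partial>M)"
    using assms test_smooth smooth_differentiable by (subst partials_mult1) (auto simp: plus_fun_def simp del: partials.simps)
  also have "\<dots> = (\<integral>x. \<phi> x * partials [b] \<psi> x \<partial>M) + (\<integral>x. partials [b] \<phi> x * \<psi> x \<partial>M)"
    by (intro Bochner_Integration.integral_add integrable_test t1 t2)
  finally show ?thesis by simp
qed

text \<open>
  Integration by parts moves the outermost derivative of \<open>\<phi>\<close> first, and there
  it becomes the innermost derivative of \<open>v\<close>; hence the reversed list.
\<close>

lemma test_weak_derivative:
  assumes "v \<in> \<D>" "\<phi> \<in> \<D>" "set \<alpha> \<subseteq> Basis"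
  shows "(\<integral>x. v x * partials \<alpha> \<phi> x \<partial>M) = (-1) ^ length \<alpha> * (\<integral>x. partials (rev \<alpha>) v x * \<phi> x \<partial>M)"
  using assms
proof (induction \<alpha> arbitrary: v)
  case (Cons b \<alpha>)
  have s: "smooth (partials \<alpha> \<phi>)" "partials [b] v \<in> \<D>" 
    using Cons.prems smooth_partials[OF test_smooth, of \<phi> \<Omega> \<alpha>] test_partials[of v \<Omega> "[b]"] by auto
  have "(\<integral>x. v x * partials (b # \<alpha>) \<phi> x \<partial>M) = - (\<integral>x. partials [b] v x * partials \<alpha> \<phi> x \<partial>M)"
    using integration_by_parts[OF Cons.prems(1) s(1), of b] Cons.prems by simp
  also have "\<dots> = - ((-1) ^ length \<alpha> * (\<integral>x. partials (rev \<alpha>) (partials [b] v) x * \<phi> x \<partial>M))"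
    using Cons.IH[OF s(2)] Cons.prems by simp
  finally show ?case by (simp add: partials_append)
qed simp

end

section \<open>Poincare and Ladyzhenskaya inequalities for test functions\<close>

lemma smooth_coordinate: "smooth (\<lambda>x::'a::euclidean_space. x \<bullet> b)"
proof (rule smooth_coinduct[where F="insert (\<lambda>x. x \<bullet> b) {\<lambda>x. c | c. True}"])
  have d: "((\<lambda>x::'a. x \<bullet> b) has_derivative (\<lambda>h. h \<bullet> b)) (at x)" for x
    by (auto intro!: derivative_eq_intros)
  then have p: "partials [d] (\<lambda>x::'a. x \<bullet> b) = (\<lambda>x. d \<bullet> b)" for d
    using fun_cong[OF frechet_derivative_at[OF d], of d] by auto
  show "g differentiable at x" if "g \<in> insert (\<lambda>x. x \<bullet> b) {\<lambda>x. c | c. True}" for g x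
    using that d differentiable_def by fastforce
  show "partials [d] g \<in> insert (\<lambda>x. x \<bullet> b) {\<lambda>x. c | c. True}"
    if "g \<in> insert (\<lambda>x. x \<bullet> b) {\<lambda>x. c | c. True}" for g d
    using that p[of d] partials_const by fastforce
qed simp

text \<open>
  The function \<open>x \<bullet> b\<close> has derivative 1 in direction \<open>b\<close>, so
  integration by parts turns \<open>\<integral> \<phi>\<^sup>2\<close> into \<open>- \<integral>
  2 \<phi> (\<partial>\<^sub>b \<phi>) (x \<bullet> b)\<close>. The coordinate is bounded on
  \<open>\<Omega>\<close>, and Young's inequality absorbs half of \<open>\<integral>
  \<phi>\<^sup>2\<close>.
\<close>

lemma (in bounded_open) poincare_test:
  shows "\<exists>C>0. \<forall>\<phi>\<in>\<D>. \<forall>b\<in>Basis. (\<integral>x. (\<phi> x)\<^sup>2 \<partial>M) \<le> C * (\<integral>x. (partials [b] \<phi> x)\<^sup>2 \<partial>M)"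
proof -
  obtain R where R: "R > 0" "\<And>x b. x \<in> \<Omega> \<Longrightarrow> b \<in> Basis \<Longrightarrow> \<bar>x \<bullet> b\<bar> \<le> R" using coordinate_bounded by blast
  have "(\<integral>x. (\<phi> x)\<^sup>2 \<partial>M) \<le> (4 * R\<^sup>2) * (\<integral>x. (partials [b] \<phi> x)\<^sup>2 \<partial>M)" if phi: "\<phi> \<in> \<D>" and b: "b \<in> Basis" for \<phi> b
  proof -
    let ?d = "partials [b] \<phi>"
    have d: "?d \<in> \<D>" using phi b by (intro test_partials) auto
    have sq: "(\<lambda>x. \<phi> x * \<phi> x) \<in> \<D>" using phi test_smooth test_mult by blast
    have "partials [b] (\<lambda>x::'a. x \<bullet> b) = (\<lambda>x. 1)"
    proof
      fix x :: 'a
      have "((\<lambda>x::'a. x \<bullet> b) has_derivative (\<lambda>h. h \<bullet> b)) (at x)" by (auto intro!: derivative_eq_intros)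
      from fun_cong[OF frechet_derivative_at[OF this], of b] b show "partials [b] (\<lambda>x::'a. x \<bullet> b) x = 1" by simp
    qed
    moreover have "partials [b] (\<lambda>x. \<phi> x * \<phi> x) = (\<lambda>x. 2 * \<phi> x * ?d x)"
      using phi test_smooth smooth_differentiable by (subst partials_mult1) (auto simp del: partials.simps)
    ultimately have "(\<integral>x. (\<phi> x)\<^sup>2 \<partial>M) = (\<integral>x. - (2 * \<phi> x * ?d x * (x \<bullet> b)) \<partial>M)"
      using integration_by_parts[OF sq smooth_coordinate[of b] b] by (simp add: power2_eq_square del: partials.simps)
    also have "\<dots> \<le> (\<integral>x. (1/2) * (\<phi> x * \<phi> x) + (2 * R\<^sup>2) * (?d x * ?d x) \<partial>M)"
    proof (rule integral_mono)
      have "(\<lambda>x. (\<phi> x * ?d x) * (x \<bullet> b)) \<in> \<D>"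
        by (intro test_mult phi test_smooth[OF d] smooth_coordinate)
      then show "integrable M (\<lambda>x. - (2 * \<phi> x * ?d x * (x \<bullet> b)))"
        using integrable_mult_right[of "-2", OF integrable_test] by (simp add: mult.assoc del: partials.simps)
      show "integrable M (\<lambda>x. (1/2) * (\<phi> x * \<phi> x) + (2 * R\<^sup>2) * (?d x * ?d x))"
        by (intro Bochner_Integration.integrable_add integrable_mult_right integrable_test_mult phi d)
      fix x assume "x \<in> space M"
      then have "\<bar>x \<bullet> b\<bar> \<le> R" using R b by simp
      then have "(x \<bullet> b)\<^sup>2 \<le> R\<^sup>2" by (metis abs_ge_zero power2_abs power_mono)
      then have "(2 * ?d x * (x \<bullet> b))\<^sup>2 \<le> (2 * ?d x)\<^sup>2 * R\<^sup>2" by (simp add: power_mult_distrib mult_left_mono del: partials.simps)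
      moreover have "- (2 * \<phi> x * ?d x * (x \<bullet> b)) \<le> (1/2) * (\<phi> x)\<^sup>2 + (1/2) * (2 * ?d x * (x \<bullet> b))\<^sup>2"
        using sum_squares_ge_zero[of "\<phi> x + 2 * ?d x * (x \<bullet> b)" 0] by (simp add: power2_eq_square algebra_simps del: partials.simps)
      ultimately show "- (2 * \<phi> x * ?d x * (x \<bullet> b)) \<le> (1/2) * (\<phi> x * \<phi> x) + (2 * R\<^sup>2) * (?d x * ?d x)"
        by (simp add: power2_eq_square algebra_simps del: partials.simps)
    qed
    also have "\<dots> = (1/2) * (\<integral>x. (\<phi> x)\<^sup>2 \<partial>M) + (2 * R\<^sup>2) * (\<integral>x. (?d x)\<^sup>2 \<partial>M)"
      using integrable_test_mult[OF phi phi] integrable_test_mult[OF d d] by (simp add: power2_eq_square del: partials.simps)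
    finally show ?thesis by simp
  qed
  then show ?thesis using R(1) by (intro exI[of _ "4 * R\<^sup>2"]) auto
qed

text \<open>
  The identification of \<open>\<real> \<times> \<real>\<close> with the Euclidean plane,
  through which Fubini's theorem applies to integrals over the plane.
\<close>

definition planar :: "real \<times> real \<Rightarrow> real^2" where
  "planar p = fst p *\<^sub>R axis 1 1 + snd p *\<^sub>R axis 2 1"

lemma Basis_real2: "(Basis :: (real^2) set) = {axis 1 1, axis 2 1}"
  by (auto simp: Basis_vec_def exhaust_2) (metis exhaust_2)

lemma axis_neq: "axis 1 1 \<noteq> (axis 2 1 :: real^2)"
  by (simp add: axis_eq_axis)

lemma continuous_planar: "continuous_on UNIV planar"
  unfolding planar_def by (intro continuous_intros)

lemma planar_borel [measurable]: "planar \<in> borel \<rightarrow>\<^sub>M borel"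
  by (intro borel_measurable_continuous_onI continuous_planar)

lemma planar_inner: "planar p \<bullet> axis 1 1 = fst p" "planar p \<bullet> axis 2 1 = snd p"
  unfolding planar_def by (simp_all add: inner_add_left inner_axis_axis)

lemma lborel_real2: "lborel = distr (lborel :: (real \<times> real) measure) borel planar"
proof (rule lborel_eqI)
  fix l u :: "real^2" assume le: "\<And>b. b \<in> Basis \<Longrightarrow> l \<bullet> b \<le> u \<bullet> b"
  let ?l = "(l \<bullet> axis 1 1, l \<bullet> axis 2 1)" and ?u = "(u \<bullet> axis 1 1, u \<bullet> axis 2 1)"
  have "planar -` box l u = box ?l ?u"
    unfolding box_def by (auto simp: Basis_real2 planar_inner Basis_prod_def)
  then have "emeasure (distr (lborel :: (real \<times> real) measure) borel planar) (box l u) = emeasure lborel (box ?l ?u)"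
    by (subst emeasure_distr) auto
  also have "\<dots> = ennreal (\<Prod>b\<in>Basis. (?u - ?l) \<bullet> b)"
    using le[of "axis 1 1"] le[of "axis 2 1"] by (intro emeasure_lborel_box) (auto simp: Basis_real2 Basis_prod_def)
  also have "(\<Prod>b\<in>Basis. (?u - ?l) \<bullet> b) = prod ((\<bullet>) (u - l)) Basis"
    using axis_neq by (simp add: Basis_real2 Basis_prod_def inner_diff_left)
  finally show "emeasure (distr (lborel :: (real \<times> real) measure) borel planar) (box l u) = ennreal (prod ((\<bullet>) (u - l)) Basis)" .
qed simp

lemma nn_integral_real2:
  assumes [measurable]: "g \<in> borel_measurable borel"
  shows "(\<integral>\<^sup>+z. g z \<partial>(lborel :: (real^2) measure)) = (\<integral>\<^sup>+p. g (planar p) \<partial>lborel \<Otimes>\<^sub>M lborel)"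
  by (subst lborel_real2, subst nn_integral_distr) (auto simp: lborel_prod)

lemma abs_le_nn_integral_deriv:
  fixes g g' :: "real \<Rightarrow> real"
  assumes d: "\<And>x. (g has_real_derivative g' x) (at x)" and c: "continuous_on UNIV g'"
    and z: "\<And>x. \<bar>x\<bar> > R \<Longrightarrow> g x = 0"
  shows "ennreal \<bar>g x\<bar> \<le> (\<integral>\<^sup>+s. ennreal \<bar>g' s\<bar> \<partial>lborel)"
proof -
  define a where "a = min x (- \<bar>R\<bar> - 1)"
  have a: "a \<le> x" "g a = 0" using z[of a] unfolding a_def by auto
  have gm: "g' \<in> borel_measurable borel" by (rule borel_measurable_continuous_onI[OF c])
  have "g x - g a = (\<integral>s. g' s * indicator {a..x} s \<partial>lborel)"
    using integral_FTC_Icc_real[of a x g g'] a d c by (simp add: continuous_on_eq_continuous_at)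
  then have "\<bar>g x\<bar> \<le> (\<integral>s. \<bar>g' s * indicator {a..x} s\<bar> \<partial>lborel)"
    using integral_norm_bound[of lborel "\<lambda>s. g' s * indicator {a..x} s"] a by simp
  moreover have "integrable lborel (\<lambda>s. \<bar>g' s * indicator {a..x} s\<bar>)"
    using borel_integrable_compact[of "{a..x}" g'] continuous_on_subset[OF c]
    by (intro integrable_abs) (simp add: set_integrable_def mult.commute)
  ultimately have "ennreal \<bar>g x\<bar> \<le> (\<integral>\<^sup>+s. ennreal \<bar>g' s * indicator {a..x} s\<bar> \<partial>lborel)"
    by (subst nn_integral_eq_integral) (auto simp: ennreal_leI)
  also have "\<dots> \<le> (\<integral>\<^sup>+s. ennreal \<bar>g' s\<bar> \<partial>lborel)"
    by (intro nn_integral_mono ennreal_leI) (auto simp: indicator_def)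
  finally show ?thesis .
qed

text \<open>
  At \<open>(x, y)\<close> the value of \<open>f\<^sup>2\<close> is at most the integral of
  \<open>\<bar>\<partial>\<^sub>1 f\<^sup>2\<bar>\<close> over the horizontal line through this
  point, which depends on \<open>y\<close> only, and at most the integral of
  \<open>\<bar>\<partial>\<^sub>2 f\<^sup>2\<bar>\<close> over the vertical line, which depends
  on \<open>x\<close> only. The product of the two bounds dominates \<open>f\<^sup>4\<close>,
  and its integral factorises.
\<close>

lemma nn_integral_pow4_le:
  fixes f :: "real^2 \<Rightarrow> real"
  assumes diff: "\<And>x. f differentiable at x"
    and cont: "continuous_on UNIV (partials [axis 1 1] f)" "continuous_on UNIV (partials [axis 2 1] f)"
    and K: "compact K" "\<And>x. x \<notin> K \<Longrightarrow> f x = 0"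
  shows "(\<integral>\<^sup>+x. ennreal (f x ^ 4) \<partial>lborel)
    \<le> (\<integral>\<^sup>+x. ennreal \<bar>2 * f x * partials [axis 1 1] f x\<bar> \<partial>lborel) * (\<integral>\<^sup>+x. ennreal \<bar>2 * f x * partials [axis 2 1] f x\<bar> \<partial>lborel)"
proof -
  obtain R where R: "\<And>x. x \<in> K \<Longrightarrow> norm x \<le> R" using compact_imp_bounded[OF K(1)] unfolding bounded_pos by blast
  have fc: "continuous_on UNIV f"
    by (meson continuous_at_imp_continuous_on diff differentiable_imp_continuous_within)
  define p where "p b x = 2 * f x * partials [b] f x" for b x
  have pc: "continuous_on UNIV (p (axis 1 1))" "continuous_on UNIV (p (axis 2 1))"
    unfolding p_def by (intro continuous_intros fc cont)+
  have pm [measurable]: "p (axis 1 1) \<in> borel_measurable borel" "p (axis 2 1) \<in> borel_measurable borel" 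
    and fm [measurable]: "f \<in> borel_measurable borel"
    by (intro borel_measurable_continuous_onI pc fc)+
  have planar_zero: "f (planar q) = 0" if "\<bar>fst q\<bar> > R \<or> \<bar>snd q\<bar> > R" for q
  proof -
    have "\<bar>fst q\<bar> \<le> norm (planar q)" "\<bar>snd q\<bar> \<le> norm (planar q)"
      using Basis_le_norm[of "axis 1 1" "planar q"] Basis_le_norm[of "axis 2 1" "planar q"]
      by (auto simp: planar_inner Basis_real2)
    then have "planar q \<notin> K" using that R by fastforce
    then show ?thesis by (rule K)
  qed
  have line: "((\<lambda>s. (f (z + s *\<^sub>R b))\<^sup>2) has_real_derivative p b (z + s *\<^sub>R b)) (at s)" for z b s
  proof -
    have d: "((\<lambda>s. f (z + s *\<^sub>R b)) has_real_derivative partials [b] f (z + s *\<^sub>R b)) (at s)"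
      by (rule directional_derivative[OF diff])
    show ?thesis unfolding p_def power2_eq_square
      using DERIV_mult[OF d d] by (simp add: algebra_simps del: partials.simps)
  qed
  have 1: "ennreal ((f (planar (x, y)))\<^sup>2) \<le> (\<integral>\<^sup>+s. ennreal \<bar>p (axis 1 1) (planar (s, y))\<bar> \<partial>lborel)" for x y
  proof -
    have eq: "planar (s, y) = y *\<^sub>R axis 2 1 + s *\<^sub>R axis 1 1" for s unfolding planar_def by (simp add: add.commute)
    have "ennreal \<bar>(f (planar (x, y)))\<^sup>2\<bar> \<le> (\<integral>\<^sup>+s. ennreal \<bar>p (axis 1 1) (planar (s, y))\<bar> \<partial>lborel)"
    proof (rule abs_le_nn_integral_deriv[where R=R and g="\<lambda>s. (f (planar (s, y)))\<^sup>2"])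
      show "((\<lambda>s. (f (planar (s, y)))\<^sup>2) has_real_derivative p (axis 1 1) (planar (s, y))) (at s)" for s
        unfolding eq by (rule line)
      show "continuous_on UNIV (\<lambda>s. p (axis 1 1) (planar (s, y)))"
        unfolding eq by (intro continuous_on_compose2[OF pc(1)] continuous_intros) auto
    qed (simp add: planar_zero)
    then show ?thesis by simp
  qed
  have 2: "ennreal ((f (planar (x, y)))\<^sup>2) \<le> (\<integral>\<^sup>+s. ennreal \<bar>p (axis 2 1) (planar (x, s))\<bar> \<partial>lborel)" for x y
  proof -
    have eq: "planar (x, s) = x *\<^sub>R axis 1 1 + s *\<^sub>R axis 2 1" for s unfolding planar_def by simp
    have "ennreal \<bar>(f (planar (x, y)))\<^sup>2\<bar> \<le> (\<integral>\<^sup>+s. ennreal \<bar>p (axis 2 1) (planar (x, s))\<bar> \<partial>lborel)"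
    proof (rule abs_le_nn_integral_deriv[where R=R and g="\<lambda>s. (f (planar (x, s)))\<^sup>2"])
      show "((\<lambda>s. (f (planar (x, s)))\<^sup>2) has_real_derivative p (axis 2 1) (planar (x, s))) (at s)" for s
        unfolding eq by (rule line)
      show "continuous_on UNIV (\<lambda>s. p (axis 2 1) (planar (x, s)))"
        unfolding eq by (intro continuous_on_compose2[OF pc(2)] continuous_intros) auto
    qed (simp add: planar_zero)
    then show ?thesis by simp
  qed
  define P where "P y = (\<integral>\<^sup>+s. ennreal \<bar>p (axis 1 1) (planar (s, y))\<bar> \<partial>lborel)" for y
  define Q where "Q x = (\<integral>\<^sup>+s. ennreal \<bar>p (axis 2 1) (planar (x, s))\<bar> \<partial>lborel)" for x
  have [measurable]: "planar \<in> lborel \<Otimes>\<^sub>M lborel \<rightarrow>\<^sub>M borel" by (simp add: lborel_prod)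
  have Pm [measurable]: "P \<in> borel_measurable lborel" and Qm [measurable]: "Q \<in> borel_measurable lborel"
    unfolding P_def Q_def by measurable
  have "(\<integral>\<^sup>+z. ennreal (f z ^ 4) \<partial>lborel) = (\<integral>\<^sup>+x. \<integral>\<^sup>+y. ennreal (f (planar (x, y)) ^ 4) \<partial>lborel \<partial>lborel)"
    by (subst nn_integral_real2, simp, subst lborel.nn_integral_fst[symmetric]) auto
  also have "\<dots> \<le> (\<integral>\<^sup>+x. \<integral>\<^sup>+y. Q x * P y \<partial>lborel \<partial>lborel)"
  proof (intro nn_integral_mono)
    fix x y
    have "ennreal (f (planar (x, y)) ^ 4) = ennreal ((f (planar (x, y)))\<^sup>2) * ennreal ((f (planar (x, y)))\<^sup>2)"
      by (subst ennreal_mult[symmetric]) (auto simp flip: power_add)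
    also have "\<dots> \<le> Q x * P y" unfolding P_def Q_def by (intro mult_mono 1 2) auto
    finally show "ennreal (f (planar (x, y)) ^ 4) \<le> Q x * P y" .
  qed
  also have "\<dots> = (\<integral>\<^sup>+x. Q x \<partial>lborel) * (\<integral>\<^sup>+y. P y \<partial>lborel)"
    by (simp add: nn_integral_cmult nn_integral_multc)
  also have "(\<integral>\<^sup>+x. Q x \<partial>lborel) = (\<integral>\<^sup>+z. ennreal \<bar>p (axis 2 1) z\<bar> \<partial>lborel)"
    unfolding Q_def by (subst nn_integral_real2, simp, subst lborel.nn_integral_fst[symmetric]) auto
  also have "(\<integral>\<^sup>+x. P x \<partial>lborel) = (\<integral>\<^sup>+z. ennreal \<bar>p (axis 1 1) z\<bar> \<partial>lborel)"
    unfolding P_def by (subst nn_integral_real2, simp, subst lborel_pair.nn_integral_snd[symmetric]) auto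
  finally show ?thesis unfolding p_def by (simp add: mult.commute del: partials.simps)
qed

locale planar_domain = bounded_open \<Omega> for \<Omega> :: "(real^2) set"
begin

text \<open>
  In \<open>nn_integral_pow4_le\<close>, each factor is at most \<open>\<integral>
  \<phi>\<^sup>2 + \<integral> (\<partial>\<^sub>b \<phi>)\<^sup>2\<close>, and Poincare's
  inequality in the same direction \<open>b\<close> absorbs the first term.
\<close>

lemma ladyzhenskaya_test:
  "\<exists>C>0. \<forall>\<phi>\<in>\<D>. (\<integral>x. \<phi> x ^ 4 \<partial>M)
     \<le> C * (\<integral>x. (partials [axis 1 1] \<phi> x)\<^sup>2 \<partial>M) * (\<integral>x. (partials [axis 2 1] \<phi> x)\<^sup>2 \<partial>M)"
proof -
  obtain C where C: "C > 0" "\<And>\<phi> b. \<phi> \<in> \<D> \<Longrightarrow> b \<in> Basis \<Longrightarrow> (\<integral>x. (\<phi> x)\<^sup>2 \<partial>M) \<le> C * (\<integral>x. (partials [b] \<phi> x)\<^sup>2 \<partial>M)"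
    using poincare_test by blast
  have "(\<integral>x. \<phi> x ^ 4 \<partial>M)
     \<le> ((C + 1) * (\<integral>x. (partials [axis 1 1] \<phi> x)\<^sup>2 \<partial>M)) * ((C + 1) * (\<integral>x. (partials [axis 2 1] \<phi> x)\<^sup>2 \<partial>M))"
    if phi: "\<phi> \<in> \<D>" for \<phi>
  proof -
    have bas: "axis 1 1 \<in> (Basis :: (real^2) set)" "axis 2 1 \<in> (Basis :: (real^2) set)" by (auto simp: Basis_real2)
    have pt: "partials [b] \<phi> \<in> \<D>" if "b \<in> Basis" for b using phi that by (intro test_partials) auto
    have I: "ennreal (\<integral>x. g x \<partial>M) = (\<integral>\<^sup>+x. ennreal (g x) \<partial>lborel)"
      if "continuous_on UNIV g" "\<And>x. x \<notin> \<Omega> \<Longrightarrow> g x = 0" "\<And>x. g x \<ge> 0" "integrable M g" for g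
    proof -
      have gm: "g \<in> borel_measurable borel" by (rule borel_measurable_continuous_onI[OF that(1)])
      have "ennreal (\<integral>x. g x \<partial>M) = (\<integral>\<^sup>+x. ennreal (g x) \<partial>M)" using that by (simp add: nn_integral_eq_integral)
      also have "\<dots> = (\<integral>\<^sup>+x. ennreal (g x) * indicator \<Omega> x \<partial>lebesgue)"
        by (rule nn_integral_restrict_space) (use \<Omega>_sets in simp)
      also have "(\<lambda>x. ennreal (g x) * indicator \<Omega> x) = (\<lambda>x. ennreal (g x))" using that by (auto simp: indicator_def fun_eq_iff)
      also have "(\<integral>\<^sup>+x. ennreal (g x) \<partial>lebesgue) = (\<integral>\<^sup>+x. ennreal (g x) \<partial>lborel)"
        using gm by (intro nn_integral_completion)
      finally show ?thesis .
    qed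
    have pc: "continuous_on UNIV (partials [b] \<phi>)" if "b \<in> Basis" for b using test_continuous[OF pt[OF that]] .
    note tc = test_continuous[OF phi]
    have int2: "integrable M (\<lambda>x. \<bar>2 * \<phi> x * partials [b] \<phi> x\<bar>)" if "b \<in> Basis" for b
      using integrable_mult_right[of 2, OF integrable_test_mult[OF phi pt[OF that]]] 
      by (intro integrable_abs) (simp add: mult.assoc del: partials.simps)
    have int4: "integrable M (\<lambda>x. \<phi> x ^ 4)"
    proof -
      have "(\<lambda>x. \<phi> x * (\<phi> x * (\<phi> x * \<phi> x))) \<in> \<D>" by (intro test_mult phi smooth_mult test_smooth[OF phi])
      from integrable_test[OF this] show ?thesis by (simp add: power4_eq_xxxx mult.assoc)
    qed
    have mixed: "(\<integral>x. \<bar>2 * \<phi> x * partials [b] \<phi> x\<bar> \<partial>M) \<le> (C + 1) * (\<integral>x. (partials [b] \<phi> x)\<^sup>2 \<partial>M)" if b: "b \<in> Basis" for b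
    proof -
      have i: "integrable M (\<lambda>x. (\<phi> x)\<^sup>2)" "integrable M (\<lambda>x. (partials [b] \<phi> x)\<^sup>2)"
        using integrable_test_mult[OF phi phi] integrable_test_mult[OF pt[OF b] pt[OF b]] by (simp_all add: power2_eq_square del: partials.simps)
      have "(\<integral>x. \<bar>2 * \<phi> x * partials [b] \<phi> x\<bar> \<partial>M) \<le> (\<integral>x. (\<phi> x)\<^sup>2 + (partials [b] \<phi> x)\<^sup>2 \<partial>M)"
        by (intro integral_mono int2 b Bochner_Integration.integrable_add i)
          (use sum_squares_bound[of "\<bar>\<phi> _\<bar>" "\<bar>partials [b] \<phi> _\<bar>"] in \<open>simp add: abs_mult del: partials.simps\<close>)
      also have "\<dots> = (\<integral>x. (\<phi> x)\<^sup>2 \<partial>M) + (\<integral>x. (partials [b] \<phi> x)\<^sup>2 \<partial>M)"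
        by (rule Bochner_Integration.integral_add[OF i])
      finally show ?thesis using C(2)[OF phi b] by (simp add: algebra_simps del: partials.simps)
    qed
    obtain K where K: "compact K" "\<And>x. x \<notin> K \<Longrightarrow> \<phi> x = 0" using phi unfolding test_functions_iff by blast
    have "ennreal (\<integral>x. \<phi> x ^ 4 \<partial>M) = (\<integral>\<^sup>+x. ennreal (\<phi> x ^ 4) \<partial>lborel)"
      by (rule I) (auto intro!: continuous_intros tc int4 simp: test_zero_outside[OF phi])
    also have "\<dots> \<le> (\<integral>\<^sup>+x. ennreal \<bar>2 * \<phi> x * partials [axis 1 1] \<phi> x\<bar> \<partial>lborel) * (\<integral>\<^sup>+x. ennreal \<bar>2 * \<phi> x * partials [axis 2 1] \<phi> x\<bar> \<partial>lborel)"
      by (rule nn_integral_pow4_le[OF smooth_differentiable[OF test_smooth[OF phi]] pc[OF bas(1)] pc[OF bas(2)] K])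
    also have "(\<integral>\<^sup>+x. ennreal \<bar>2 * \<phi> x * partials [axis 1 1] \<phi> x\<bar> \<partial>lborel) = ennreal (\<integral>x. \<bar>2 * \<phi> x * partials [axis 1 1] \<phi> x\<bar> \<partial>M)"
      by (rule I[symmetric], (intro continuous_intros tc pc bas)) (auto intro!: int2 bas simp: test_zero_outside[OF phi] simp del: partials.simps)
    also have "(\<integral>\<^sup>+x. ennreal \<bar>2 * \<phi> x * partials [axis 2 1] \<phi> x\<bar> \<partial>lborel) = ennreal (\<integral>x. \<bar>2 * \<phi> x * partials [axis 2 1] \<phi> x\<bar> \<partial>M)"
      by (rule I[symmetric], (intro continuous_intros tc pc bas)) (auto intro!: int2 bas simp: test_zero_outside[OF phi] simp del: partials.simps)
    also have "ennreal (\<integral>x. \<bar>2 * \<phi> x * partials [axis 1 1] \<phi> x\<bar> \<partial>M) * ennreal (\<integral>x. \<bar>2 * \<phi> x * partials [axis 2 1] \<phi> x\<bar> \<partial>M)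
        = ennreal ((\<integral>x. \<bar>2 * \<phi> x * partials [axis 1 1] \<phi> x\<bar> \<partial>M) * (\<integral>x. \<bar>2 * \<phi> x * partials [axis 2 1] \<phi> x\<bar> \<partial>M))"
      by (rule ennreal_mult[symmetric]) (auto intro!: integral_nonneg_AE)
    finally have "(\<integral>x. \<phi> x ^ 4 \<partial>M) \<le> (\<integral>x. \<bar>2 * \<phi> x * partials [axis 1 1] \<phi> x\<bar> \<partial>M) * (\<integral>x. \<bar>2 * \<phi> x * partials [axis 2 1] \<phi> x\<bar> \<partial>M)"
      by (subst (asm) ennreal_le_iff) (auto intro!: integral_nonneg_AE mult_nonneg_nonneg simp del: partials.simps)
    also have "\<dots> \<le> ((C + 1) * (\<integral>x. (partials [axis 1 1] \<phi> x)\<^sup>2 \<partial>M)) * ((C + 1) * (\<integral>x. (partials [axis 2 1] \<phi> x)\<^sup>2 \<partial>M))"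
      by (intro mult_mono mixed bas) (use C(1) in \<open>auto intro!: integral_nonneg_AE mult_nonneg_nonneg\<close>)
    finally show ?thesis .
  qed
  then show ?thesis using C(1) by (intro exI[of _ "(C + 1) * (C + 1)"] conjI) (auto simp: ac_simps simp del: partials.simps intro: mult_pos_pos)
qed

end

section \<open>Bump functions and the fundamental lemma\<close>

text \<open>
  The functions \<open>p (1 / x) exp (- c / x)\<close> for \<open>x > 0\<close>, continued by 0.
  The polynomial factor makes the class closed under differentiation.
\<close>

definition flat :: "real \<Rightarrow> real poly \<Rightarrow> real \<Rightarrow> real" where
  "flat c p x = (if x > 0 then poly p (1 / x) * exp (- c / x) else 0)"

text \<open>
  By the chain rule, differentiation turns \<open>p (1 / x) exp (- c / x)\<close> into
  \<open>x\<^sup>-\<^sup>2 (c p (1 / x) - p' (1 / x)) exp (- c / x)\<close>; the factor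
  \<open>[:0, 0, 1:]\<close> is \<open>x\<^sup>-\<^sup>2\<close>.
\<close>

definition flat_deriv :: "real \<Rightarrow> real poly \<Rightarrow> real poly" where
  "flat_deriv c p = [:0, 0, 1:] * (smult c p - pderiv p)"

lemma poly_times_exp_tendsto_0:
  fixes p :: "real poly" assumes "c > 0"
  shows "((\<lambda>y. poly p y * exp (- c * y)) \<longlongrightarrow> 0) at_top"
proof -
  have "((\<lambda>y. coeff p i * y ^ i * exp (- c * y)) \<longlongrightarrow> 0) at_top" for i
  proof -
    have "filterlim (\<lambda>y. c * y) at_top at_top"
      using assms by (intro filterlim_tendsto_pos_mult_at_top[OF tendsto_const]) (auto simp: filterlim_ident)
    then have "((\<lambda>y. (c * y) ^ i / exp (c * y)) \<longlongrightarrow> 0) at_top"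
      by (rule filterlim_compose[OF tendsto_power_div_exp_0])
    then have "((\<lambda>y. (coeff p i / c ^ i) * ((c * y) ^ i / exp (c * y))) \<longlongrightarrow> 0) at_top"
      by (rule tendsto_mult_right_zero)
    moreover have "(coeff p i / c ^ i) * ((c * y) ^ i / exp (c * y)) = coeff p i * y ^ i * exp (- c * y)" for y
      using assms by (simp add: power_mult_distrib exp_minus field_simps)
    ultimately show ?thesis by simp
  qed
  then have "((\<lambda>y. \<Sum>i\<le>degree p. coeff p i * y ^ i * exp (- c * y)) \<longlongrightarrow> 0) at_top"
    by (rule tendsto_null_sum)
  then show ?thesis by (simp add: poly_altdef sum_distrib_right)
qed

text \<open>
  The only delicate point is 0: there the right difference quotient is a polynomial in \<open>1
  / x\<close> times \<open>exp (- c / x)\<close>, and the exponential wins.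
\<close>

lemma flat_has_derivative:
  assumes c: "c > 0"
  shows "(flat c p has_real_derivative flat c (flat_deriv c p) x) (at x)"
proof -
  consider "x > 0" | "x < 0" | "x = 0" by linarith
  then show ?thesis
  proof cases
    case 1
    have "((\<lambda>x. poly p (1 / x) * exp (- c / x)) has_real_derivative flat c (flat_deriv c p) x) (at x)"
      using 1 by (auto intro!: derivative_eq_intros simp: flat_def flat_deriv_def field_simps power2_eq_square)
    then show ?thesis
      by (rule DERIV_cong_ev[THEN iffD1, OF refl _ refl, rotated])
        (use 1 eventually_nhds_in_open[of "{0<..}" x] in \<open>auto simp: flat_def elim!: eventually_mono\<close>)
  next
    case 2
    have "((\<lambda>x. 0) has_real_derivative flat c (flat_deriv c p) x) (at x)"
      using 2 by (auto simp: flat_def)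
    then show ?thesis
      by (rule DERIV_cong_ev[THEN iffD1, OF refl _ refl, rotated])
        (use 2 eventually_nhds_in_open[of "{..<0}" x] in \<open>auto simp: flat_def elim!: eventually_mono\<close>)
  next
    case 3
    have "((\<lambda>h. flat c p h / h) \<longlongrightarrow> 0) (at_right 0)"
    proof -
      have "((\<lambda>h. poly (pCons 0 p) (inverse h) * exp (- c * inverse h)) \<longlongrightarrow> 0) (at_right 0)"
        by (rule filterlim_compose[OF poly_times_exp_tendsto_0[OF c] filterlim_inverse_at_top_right])
      then show ?thesis
        by (rule Lim_transform_eventually)
          (auto simp: eventually_at_right_field flat_def field_simps intro!: exI[of _ 1])
    qed
    moreover have "((\<lambda>h. flat c p h / h) \<longlongrightarrow> 0) (at_left 0)"
      by (rule tendsto_eventually) (auto simp: eventually_at_left_field flat_def intro!: exI[of _ "-1"])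
    ultimately have "((\<lambda>h. flat c p h / h) \<longlongrightarrow> 0) (at 0)"
      by (simp add: filterlim_split_at)
    then show ?thesis using 3 by (simp add: has_field_derivative_iff flat_def)
  qed
qed

lemma smooth_flat:
  fixes b :: "'a::euclidean_space" assumes "c > 0"
  shows "smooth (\<lambda>x. flat c p (r + s * (x \<bullet> b)))"
proof (rule smooth_coinduct[where F="{\<lambda>x. k * flat c p (r + s * (x \<bullet> b)) | p k. True}"])
  have d: "((\<lambda>x. k * flat c p (r + s * (x \<bullet> b))) has_derivative (\<lambda>h. k * (flat c (flat_deriv c p) (r + s * (x \<bullet> b)) * (s * (h \<bullet> b))))) (at x)"
    for p k x
  proof -
    have 1: "((\<lambda>x. r + s * (x \<bullet> b)) has_derivative (\<lambda>h. s * (h \<bullet> b))) (at x)" by (auto intro!: derivative_eq_intros)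
    have 2: "(flat c p has_derivative (*) (flat c (flat_deriv c p) (r + s * (x \<bullet> b)))) (at (r + s * (x \<bullet> b)))"
      using flat_has_derivative[OF assms] by (simp add: has_field_derivative_def)
    show ?thesis by (rule has_derivative_mult_right[OF has_derivative_compose[OF 1 2]])
  qed
  show "g differentiable at x" if "g \<in> {\<lambda>x. k * flat c p (r + s * (x \<bullet> b)) | p k. True}" for g x
    using that d differentiable_def by blast
  show "partials [e] g \<in> {\<lambda>x. k * flat c p (r + s * (x \<bullet> b)) | p k. True}"
    if "g \<in> {\<lambda>x. k * flat c p (r + s * (x \<bullet> b)) | p k. True}" for g e
  proof -
    from that obtain k p where g: "g = (\<lambda>x. k * flat c p (r + s * (x \<bullet> b)))" by blast
    have "partials [e] g x = (k * (s * (e \<bullet> b))) * flat c (flat_deriv c p) (r + s * (x \<bullet> b))" for x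
      using fun_cong[OF frechet_derivative_at[OF d[of k p x]], of e] unfolding g by (simp add: ac_simps)
    then have "partials [e] g = (\<lambda>x. (k * (s * (e \<bullet> b))) * flat c (flat_deriv c p) (r + s * (x \<bullet> b)))" ..
    then show ?thesis by blast
  qed
  show "(\<lambda>x. flat c p (r + s * (x \<bullet> b))) \<in> {\<lambda>x. k * flat c p (r + s * (x \<bullet> b)) | p k. True}"
    by (rule CollectI, rule exI[of _ p], rule exI[of _ 1]) simp
qed

lemma smooth_prod: "finite I \<Longrightarrow> (\<And>i. i \<in> I \<Longrightarrow> smooth (f i)) \<Longrightarrow> smooth (\<lambda>x. \<Prod>i\<in>I. f i x)"
  by (induction I rule: finite_induct) (auto intro: smooth_const smooth_mult)

lemma smooth_one_minus: "smooth f \<Longrightarrow> smooth (\<lambda>x. 1 - f x)"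
  using smooth_add[OF smooth_const[of 1] smooth_scale[of f "-1"]] by (simp add: plus_fun_def)

text \<open>
  The parameter \<open>c\<close> has two roles. It moves every face of the box inwards by
  \<open>c\<close>, so that the support is a compact subset of the open box, and it makes the
  profile \<open>exp (- c / x)\<close> steep, so that the bumps converge to the indicator of the
  box as \<open>c\<close> tends to 0.
\<close>

definition box_bump :: "real \<Rightarrow> 'a::euclidean_space \<Rightarrow> 'a \<Rightarrow> 'a \<Rightarrow> real" where
  "box_bump c a b x = (\<Prod>i\<in>Basis. flat c 1 (x \<bullet> i - a \<bullet> i - c) * flat c 1 (b \<bullet> i - c - x \<bullet> i))"

lemma flat_1_bounds: "c > 0 \<Longrightarrow> 0 \<le> flat c 1 x \<and> flat c 1 x \<le> 1"
  by (auto simp: flat_def)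

lemma smooth_box_bump: "c > 0 \<Longrightarrow> smooth (box_bump c a b)"
proof -
  assume c: "c > 0"
  have "smooth (\<lambda>x. flat c 1 (x \<bullet> i - a \<bullet> i - c))" "smooth (\<lambda>x. flat c 1 (b \<bullet> i - c - x \<bullet> i))" for i
    using smooth_flat[OF c, of 1 "- a \<bullet> i - c" 1 i] smooth_flat[OF c, of 1 "b \<bullet> i - c" "-1" i] by (simp_all add: algebra_simps)
  then show ?thesis unfolding box_bump_def[abs_def] by (intro smooth_prod smooth_mult) auto
qed

lemma box_bump_bounds: "c > 0 \<Longrightarrow> 0 \<le> box_bump c a b x \<and> box_bump c a b x \<le> 1"
  unfolding box_bump_def by (auto intro!: prod_nonneg prod_le_1 mult_le_one simp: flat_1_bounds)

lemma box_bump_support: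
  assumes "c > 0"
  obtains K where "compact K" "K \<subseteq> box a b" "\<And>x. x \<notin> K \<Longrightarrow> box_bump c a b x = 0"
proof (rule that[of "cbox (a + c *\<^sub>R \<Sum>Basis) (b - c *\<^sub>R \<Sum>Basis)"])
  have s: "i \<in> Basis \<Longrightarrow> (\<Sum>Basis) \<bullet> i = 1" for i :: 'a by (simp add: inner_sum_left_Basis)
  show "cbox (a + c *\<^sub>R \<Sum>Basis) (b - c *\<^sub>R \<Sum>Basis) \<subseteq> box a b"
    using assms by (fastforce simp: mem_box algebra_simps s)
  fix x assume "x \<notin> cbox (a + c *\<^sub>R \<Sum>Basis) (b - c *\<^sub>R \<Sum>Basis)"
  then obtain i where "i \<in> Basis" "x \<bullet> i - a \<bullet> i - c \<le> 0 \<or> b \<bullet> i - c - x \<bullet> i \<le> 0"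
    by (fastforce simp: mem_box algebra_simps s)
  then show "box_bump c a b x = 0"
    unfolding box_bump_def by (auto simp: flat_def intro!: bexI[of _ i])
qed (rule compact_cbox)

lemma box_bump_tendsto:
  assumes "x \<in> box a b"
  shows "(\<lambda>n. box_bump (1 / real (Suc n)) a b x) \<longlonglongrightarrow> 1"
proof -
  have "(\<lambda>n. flat (1 / real (Suc n)) 1 (t - 1 / real (Suc n))) \<longlonglongrightarrow> 1" if t: "t > 0" for t
  proof -
    have z: "(\<lambda>n. 1 / real (Suc n)) \<longlonglongrightarrow> 0" using LIMSEQ_inverse_real_of_nat by (simp add: inverse_eq_divide)
    have "(\<lambda>n. exp (- (1 / real (Suc n)) / (t - 1 / real (Suc n)))) \<longlonglongrightarrow> exp (- 0 / (t - 0))"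
      using t by (intro tendsto_exp tendsto_divide tendsto_minus tendsto_diff tendsto_const z) auto
    then have "(\<lambda>n. exp (- (1 / real (Suc n)) / (t - 1 / real (Suc n)))) \<longlonglongrightarrow> 1" by simp
    moreover have "\<forall>\<^sub>F n in sequentially. 1 / real (Suc n) < t" using order_tendstoD(2)[OF z t] .
    ultimately show ?thesis
      by (rule Lim_transform_eventually[OF _ eventually_mono]) (auto simp: flat_def)
  qed
  note lim = this
  have "(\<lambda>n. box_bump (1 / real (Suc n)) a b x) \<longlonglongrightarrow> (\<Prod>i\<in>(Basis::'a set). 1 * 1)"
    unfolding box_bump_def
  proof (intro tendsto_prod tendsto_mult)
    fix i :: 'a assume "i \<in> Basis"
    then have "x \<bullet> i - a \<bullet> i > 0" "b \<bullet> i - x \<bullet> i > 0" using assms by (auto simp: mem_box)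
    from lim[OF this(1)] lim[OF this(2)]
    show "(\<lambda>n. flat (1 / real (Suc n)) 1 (x \<bullet> i - a \<bullet> i - 1 / real (Suc n))) \<longlonglongrightarrow> 1"
      "(\<lambda>n. flat (1 / real (Suc n)) 1 (b \<bullet> i - 1 / real (Suc n) - x \<bullet> i)) \<longlonglongrightarrow> 1"
      by (simp_all add: algebra_simps)
  qed
  then show ?thesis by simp
qed

context bounded_open begin

text \<open>
  An open set is a countable union of open boxes. For bumps \<open>\<psi>\<^sub>i\<close> on the
  first \<open>n\<close> of them, \<open>1 - \<Prod>\<^sub>i (1 - \<psi>\<^sub>i)\<close> takes
  values in \<open>[0, 1]\<close>, vanishes where all bumps do, and is at least each
  \<open>\<psi>\<^sub>i\<close>.
\<close>

lemma open_approx_by_test: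
  assumes U: "open U" "U \<subseteq> \<Omega>"
  obtains \<phi> where "\<And>n::nat. \<phi> n \<in> \<D>" "\<And>n x. 0 \<le> \<phi> n x \<and> \<phi> n x \<le> 1" "\<And>x. (\<lambda>n. \<phi> n x) \<longlonglongrightarrow> indicator U x"
proof (cases "U = {}")
  case True
  then show ?thesis using that[of "\<lambda>n. 0"] by (simp add: test_zero)
next
  case False
  obtain \<B> where B: "countable \<B>" "\<B> \<subseteq> Pow U" "\<And>X. X \<in> \<B> \<Longrightarrow> \<exists>a b. X = box a b" "\<Union>\<B> = U"
    using open_countable_Union_open_box[OF U(1)] by metis
  have ne: "\<B> \<noteq> {}" using False B(4) by blast
  have "\<forall>i. \<exists>a b. from_nat_into \<B> i = box a b" using B(3) from_nat_into[OF ne] by blast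
  then obtain a b where ab: "\<And>i::nat. from_nat_into \<B> i = box (a i) (b i)" by metis
  have sub: "box (a i) (b i) \<subseteq> U" for i using B(2) from_nat_into[OF ne, of i] by (auto simp: ab)
  have cover: "\<exists>i. x \<in> box (a i) (b i)" if "x \<in> U" for x
  proof -
    from that B(4) obtain X where "X \<in> \<B>" "x \<in> X" by blast
    then show ?thesis using from_nat_into_surj[OF B(1)] ab by metis
  qed
  define \<psi> where "\<psi> n i = box_bump (1 / real (Suc n)) (a i) (b i)" for n i
  define \<phi> where "\<phi> n x = 1 - (\<Prod>i<n. 1 - \<psi> n i x)" for n x
  have pos: "1 / real (Suc n) > 0" for n by simp
  have bd: "0 \<le> \<psi> n i x \<and> \<psi> n i x \<le> 1" for n i x unfolding \<psi>_def by (rule box_bump_bounds[OF pos])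
  have prod_bd: "0 \<le> (\<Prod>i<n. 1 - \<psi> n i x) \<and> (\<Prod>i<n. 1 - \<psi> n i x) \<le> 1" for n x
    using bd by (auto intro!: prod_nonneg prod_le_1)
  have "smooth (\<phi> n)" for n
    unfolding \<phi>_def[abs_def] \<psi>_def using pos by (intro smooth_one_minus smooth_prod smooth_box_bump) auto
  moreover have "\<exists>K. compact K \<and> K \<subseteq> \<Omega> \<and> (\<forall>x. x \<notin> K \<longrightarrow> \<phi> n x = 0)" for n
  proof -
    have "\<forall>i. \<exists>K. compact K \<and> K \<subseteq> box (a i) (b i) \<and> (\<forall>x. x \<notin> K \<longrightarrow> \<psi> n i x = 0)"
      using box_bump_support[OF pos] unfolding \<psi>_def by metis
    then obtain K where K: "\<And>i. compact (K i)" "\<And>i. K i \<subseteq> box (a i) (b i)" "\<And>i x. x \<notin> K i \<Longrightarrow> \<psi> n i x = 0"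
      by metis
    have "compact (\<Union>i<n. K i)" using K by auto
    moreover have "(\<Union>i<n. K i) \<subseteq> \<Omega>" using K(2) sub U(2) by blast
    moreover have "\<phi> n x = 0" if "x \<notin> (\<Union>i<n. K i)" for x using that K(3) unfolding \<phi>_def by (simp add: prod.neutral)
    ultimately show ?thesis by blast
  qed
  ultimately have "\<phi> n \<in> \<D>" for n unfolding test_functions_iff by blast
  moreover have "0 \<le> \<phi> n x \<and> \<phi> n x \<le> 1" for n x unfolding \<phi>_def using prod_bd by simp
  moreover have "(\<lambda>n. \<phi> n x) \<longlonglongrightarrow> indicator U x" for x
  proof (cases "x \<in> U")
    case True
    then obtain j where j: "x \<in> box (a j) (b j)" using cover by blast
    have "(\<lambda>n. \<Prod>i<n. 1 - \<psi> n i x) \<longlonglongrightarrow> 0"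
    proof (rule tendsto_sandwich)
      show "\<forall>\<^sub>F n in sequentially. 0 \<le> (\<Prod>i<n. 1 - \<psi> n i x)" using prod_bd by simp
      show "\<forall>\<^sub>F n in sequentially. (\<Prod>i<n. 1 - \<psi> n i x) \<le> 1 - \<psi> n j x"
        using eventually_gt_at_top[of j]
      proof eventually_elim
        case (elim n)
        have "(\<Prod>i<n. 1 - \<psi> n i x) = (1 - \<psi> n j x) * (\<Prod>i\<in>{..<n} - {j}. 1 - \<psi> n i x)"
          using elim by (intro prod.remove) auto
        also have "\<dots> \<le> (1 - \<psi> n j x) * 1"
          using bd by (intro mult_left_mono prod_le_1) auto
        finally show ?case by simp
      qed
      show "(\<lambda>n. 1 - \<psi> n j x) \<longlonglongrightarrow> 0"
        using tendsto_diff[OF tendsto_const[of 1] box_bump_tendsto[OF j]] unfolding \<psi>_def by simp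
    qed (rule tendsto_const)
    from tendsto_diff[OF tendsto_const[of 1] this] show ?thesis using True unfolding \<phi>_def by simp
  next
    case False
    have "\<psi> n i x = 0" for n i
    proof -
      obtain K where "K \<subseteq> box (a i) (b i)" "\<And>x. x \<notin> K \<Longrightarrow> \<psi> n i x = 0"
        unfolding \<psi>_def using box_bump_support[OF pos[of n], of "a i" "b i"] by metis
      then show ?thesis using sub[of i] False by blast
    qed
    then show ?thesis using False unfolding \<phi>_def by simp
  qed
  ultimately show ?thesis using that by blast
qed

text \<open>
  Dominated convergence along \<open>open_approx_by_test\<close> shows that \<open>g\<close>
  integrates to 0 over every open subset of \<open>\<Omega>\<close>. A measurable set is, up to
  a null set, a decreasing limit of open sets, so the same holds for all measurable sets.
\<close>

lemma fundamental_lemma: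
  fixes g :: "'a \<Rightarrow> real"
  assumes g: "integrable M g" and zero: "\<And>\<phi>. \<phi> \<in> \<D> \<Longrightarrow> (\<integral>x. g x * \<phi> x \<partial>M) = 0"
  shows "AE x in M. g x = 0"
proof -
  have gm [measurable]: "g \<in> borel_measurable M" using g by auto
  have U0: "(\<integral>x. g x * indicator U x \<partial>M) = 0" if U: "open U" "U \<subseteq> \<Omega>" for U
  proof -
    obtain \<phi> where phi: "\<And>n::nat. \<phi> n \<in> \<D>" "\<And>n x. 0 \<le> \<phi> n x \<and> \<phi> n x \<le> 1" "\<And>x. (\<lambda>n. \<phi> n x) \<longlonglongrightarrow> indicator U x"
      using open_approx_by_test[OF U] by blast
    have "(\<lambda>n. \<integral>x. g x * \<phi> n x \<partial>M) \<longlonglongrightarrow> (\<integral>x. g x * indicator U x \<partial>M)"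
    proof (rule integral_dominated_convergence)
      show "integrable M (\<lambda>x. \<bar>g x\<bar>)" using g by simp
      have "indicat_real U \<in> borel_measurable M" using U(1) by (intro borel_imp_M) auto
      then show "(\<lambda>x. g x * indicator U x) \<in> borel_measurable M" by simp
      show "(\<lambda>x. g x * \<phi> n x) \<in> borel_measurable M" for n using test_M[OF phi(1)] by simp
      show "AE x in M. (\<lambda>n. g x * \<phi> n x) \<longlonglongrightarrow> g x * indicator U x"
        by (intro AE_I2 tendsto_mult tendsto_const phi(3))
      show "AE x in M. norm (g x * \<phi> n x) \<le> \<bar>g x\<bar>" for n
        using phi(2)[of n] by (intro AE_I2) (auto simp: abs_mult intro!: mult_left_le)
    qed
    then show ?thesis using zero[OF phi(1)] by (simp add: LIMSEQ_const_iff)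
  qed
  show ?thesis
  proof (rule density_unique_real)
    fix A assume A: "A \<in> sets M"
    then have A': "A \<in> sets lebesgue" "A \<subseteq> \<Omega>" using \<Omega>_sets by (auto simp: sets_restrict_space)
    obtain C N where C: "gdelta C" "N \<in> null_sets lebesgue" "A \<union> N = C" "disjnt A N"
      using lebesgue_set_almost_gdelta[OF A'(1)] by metis
    from C(1) obtain F where F: "\<And>n::nat. open (F n)" "C = \<Inter>(range F)" by (auto simp: gdelta.simps)
    define G where "G n = \<Omega> \<inter> (\<Inter>k\<le>n. F k)" for n
    have G: "open (G n)" "G n \<subseteq> \<Omega>" for n unfolding G_def using F open_\<Omega> by (auto intro!: open_Int open_INT)
    have "(\<lambda>n. \<integral>x. g x * indicator (G n) x \<partial>M) \<longlonglongrightarrow> (\<integral>x. g x * indicator A x \<partial>M)"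
    proof (rule integral_dominated_convergence)
      show "integrable M (\<lambda>x. \<bar>g x\<bar>)" using g by simp
      show "(\<lambda>x. g x * indicator A x) \<in> borel_measurable M" using A by simp
      have "indicat_real (G n) \<in> borel_measurable M" for n using G by (intro borel_imp_M) auto
      then show "(\<lambda>x. g x * indicator (G n) x) \<in> borel_measurable M" for n by simp
      show "AE x in M. norm (g x * indicator (G n) x) \<le> \<bar>g x\<bar>" for n
        by (intro AE_I2) (auto simp: indicator_def)
      have "AE x in lebesgue. x \<notin> N" using C(2) by (rule AE_not_in)
      then have "AE x in M. x \<notin> N" using \<Omega>_sets by (auto simp: AE_restrict_space_iff elim: eventually_mono)
      then show "AE x in M. (\<lambda>n. g x * indicator (G n) x) \<longlonglongrightarrow> g x * indicator A x"
        using AE_space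
      proof eventually_elim
        case (elim x)
        have "(\<lambda>n. indicator (G n) x) \<longlonglongrightarrow> (indicator A x :: real)"
        proof (cases "x \<in> A")
          case True
          then have "x \<in> G n" for n using elim C F unfolding G_def by auto
          then show ?thesis using True by simp
        next
          case False
          then have "x \<notin> C" using elim C(3) by blast
          then obtain k where k: "x \<notin> F k" using F(2) by blast
          have "\<forall>\<^sub>F n in sequentially. indicator (G n) x = (0::real)"
            using eventually_ge_at_top[of k] by eventually_elim (use k in \<open>auto simp: G_def indicator_def\<close>)
          then show ?thesis using False by (simp add: tendsto_eventually)
        qed
        then show ?case by (intro tendsto_mult tendsto_const)
      qed
    qed
    then have "(\<integral>x. g x * indicator A x \<partial>M) = 0" using U0[OF G] by (simp add: LIMSEQ_const_iff)
    then show "set_lebesgue_integral M A g = set_lebesgue_integral M A (\<lambda>x. 0)"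
      by (simp add: set_lebesgue_integral_def mult.commute)
  qed (use g in auto)
qed

end

section \<open>Semi-inner products\<close>

text \<open>
  On representatives, the \<open>L\<^sup>2\<close> product and the Sobolev forms are
  semidefinite only: they vanish on functions that are 0 almost everywhere.
\<close>

locale semi_inner =
  fixes W :: "'v::real_vector set" and B :: "'v \<Rightarrow> 'v \<Rightarrow> real"
  assumes W_subspace: "subspace W"
    and B_add: "x \<in> W \<Longrightarrow> y \<in> W \<Longrightarrow> z \<in> W \<Longrightarrow> B (x + y) z = B x z + B y z"
    and B_scale: "x \<in> W \<Longrightarrow> z \<in> W \<Longrightarrow> B (c *\<^sub>R x) z = c * B x z"
    and B_sym: "x \<in> W \<Longrightarrow> y \<in> W \<Longrightarrow> B x y = B y x"
    and B_nonneg: "x \<in> W \<Longrightarrow> 0 \<le> B x x"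
begin

definition nrm :: "'v \<Rightarrow> real" where "nrm x = sqrt (B x x)"

lemma W_intros [simp, intro]: 
  "0 \<in> W" "x \<in> W \<Longrightarrow> y \<in> W \<Longrightarrow> x + y \<in> W" "x \<in> W \<Longrightarrow> y \<in> W \<Longrightarrow> x - y \<in> W" "x \<in> W \<Longrightarrow> c *\<^sub>R x \<in> W"
  using W_subspace by (auto simp: subspace_0 subspace_add subspace_diff subspace_scale)

lemma B_add2: "x \<in> W \<Longrightarrow> y \<in> W \<Longrightarrow> z \<in> W \<Longrightarrow> B z (x + y) = B z x + B z y"
  using B_add[of x y z] B_sym by (metis W_intros(2))

lemma B_scale2: "x \<in> W \<Longrightarrow> z \<in> W \<Longrightarrow> B z (c *\<^sub>R x) = c * B z x"
  using B_scale[of x z c] B_sym by (metis W_intros(4))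

lemma B_diff: "x \<in> W \<Longrightarrow> y \<in> W \<Longrightarrow> z \<in> W \<Longrightarrow> B (x - y) z = B x z - B y z"
  using B_add[of x "(-1) *\<^sub>R y" z] B_scale[of y z "-1"] W_intros(4)[of y "-1"] by simp

lemma B_diff2: "x \<in> W \<Longrightarrow> y \<in> W \<Longrightarrow> z \<in> W \<Longrightarrow> B z (x - y) = B z x - B z y"
  using B_diff[of x y z] B_sym by (metis W_intros(3))

lemma nrm_nonneg [simp]: "x \<in> W \<Longrightarrow> 0 \<le> nrm x" by (simp add: nrm_def B_nonneg)

lemma nrm_sq: "x \<in> W \<Longrightarrow> (nrm x)\<^sup>2 = B x x" by (simp add: nrm_def B_nonneg)

lemma B_quadratic: "x \<in> W \<Longrightarrow> y \<in> W \<Longrightarrow> B (x + t *\<^sub>R y) (x + t *\<^sub>R y) = B x x + 2 * t * B x y + t\<^sup>2 * B y y"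
  by (simp add: B_add B_add2 B_scale B_scale2 B_sym[of y x] power2_eq_square algebra_simps)

lemma cauchy_schwarz_sq: assumes "x \<in> W" "y \<in> W" shows "(B x y)\<^sup>2 \<le> B x x * B y y"
proof -
  have q: "0 \<le> B x x + 2 * t * B x y + t\<^sup>2 * B y y" for t
    using B_nonneg[of "x + t *\<^sub>R y"] B_quadratic[OF assms] assms by simp
  show ?thesis
  proof (cases "B y y = 0")
    case True
    have "B x y = 0"
    proof (rule ccontr)
      assume "B x y \<noteq> 0"
      then show False using q[of "- (B x x + 1) / (2 * B x y)"] True by (simp add: field_simps)
    qed
    then show ?thesis using True by simp
  next
    case False
    then have p: "B y y > 0" using B_nonneg[OF assms(2)] by simp
    have "0 \<le> B x x - (B x y)\<^sup>2 / B y y"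
      using q[of "- B x y / B y y"] p by (simp add: power2_eq_square field_simps)
    then show ?thesis using p by (simp add: field_simps)
  qed
qed

lemma cauchy_schwarz: assumes "x \<in> W" "y \<in> W" shows "\<bar>B x y\<bar> \<le> nrm x * nrm y"
  using real_sqrt_le_mono[OF cauchy_schwarz_sq[OF assms]] by (simp add: nrm_def real_sqrt_mult)

lemma nrm_scale: "x \<in> W \<Longrightarrow> nrm (c *\<^sub>R x) = \<bar>c\<bar> * nrm x"
proof -
  assume "x \<in> W"
  then have "B (c *\<^sub>R x) (c *\<^sub>R x) = c\<^sup>2 * B x x" by (simp add: B_scale B_scale2 power2_eq_square)
  then show ?thesis by (simp add: nrm_def real_sqrt_mult)
qed

lemma nrm_triangle: assumes "x \<in> W" "y \<in> W" shows "nrm (x + y) \<le> nrm x + nrm y"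
proof (rule power2_le_imp_le)
  have "(nrm (x + y))\<^sup>2 = (nrm x)\<^sup>2 + 2 * B x y + (nrm y)\<^sup>2"
    using B_quadratic[OF assms, of 1] assms by (simp add: nrm_sq)
  also have "\<dots> \<le> (nrm x + nrm y)\<^sup>2"
    using cauchy_schwarz[OF assms] by (simp add: power2_eq_square algebra_simps)
  finally show "(nrm (x + y))\<^sup>2 \<le> (nrm x + nrm y)\<^sup>2" .
qed (use assms in simp)

lemma nrm_zero [simp]: "nrm 0 = 0" using nrm_scale[of 0 0] by simp

lemma nrm_minus: assumes "x \<in> W" "y \<in> W" shows "nrm (x - y) = nrm (y - x)"
  using nrm_scale[of "y - x" "-1"] assms by simp

lemma nrm_triangle_diff: assumes "x \<in> W" "y \<in> W" "z \<in> W" shows "nrm (x - z) \<le> nrm (x - y) + nrm (y - z)"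
  using nrm_triangle[of "x - y" "y - z"] assms by simp

lemma nrm_diff_ineq: assumes "x \<in> W" "y \<in> W" shows "\<bar>nrm x - nrm y\<bar> \<le> nrm (x - y)"
  using nrm_triangle[of "x - y" y] nrm_triangle[of "y - x" x] nrm_minus[OF assms] assms by simp

lemma nrm_diff_le: assumes "x \<in> W" "y \<in> W" shows "nrm (x - y) \<le> nrm x + nrm y"
  using nrm_triangle[of x "(-1) *\<^sub>R y"] nrm_scale[of y "-1"] assms W_intros(4)[of y "-1"] by simp

lemma nrm_sq_triangle: assumes "x \<in> W" "y \<in> W" shows "(nrm (x + y))\<^sup>2 \<le> 2 * (nrm x)\<^sup>2 + 2 * (nrm y)\<^sup>2"
proof -
  have "(nrm (x + y))\<^sup>2 \<le> (nrm x + nrm y)\<^sup>2" using nrm_triangle[OF assms] assms by (intro power_mono) auto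
  also have "\<dots> \<le> 2 * (nrm x)\<^sup>2 + 2 * (nrm y)\<^sup>2" using sum_squares_bound[of "nrm x" "nrm y"] by (simp add: power2_sum)
  finally show ?thesis .
qed

lemma nrm_tendsto:
  assumes "x \<in> W" "\<And>n. y n \<in> W" "(\<lambda>n. nrm (x - y n)) \<longlonglongrightarrow> 0"
  shows "(\<lambda>n. nrm (y n)) \<longlonglongrightarrow> nrm x"
proof (rule LIM_zero_cancel, rule Lim_null_comparison[OF _ assms(3)])
  show "\<forall>\<^sub>F n in sequentially. norm (nrm (y n) - nrm x) \<le> nrm (x - y n)"
    using nrm_diff_ineq[OF assms(1,2)] by (simp add: abs_minus_commute)
qed

lemma B_tendsto:
  assumes "x \<in> W" "z \<in> W" "\<And>n. y n \<in> W" "(\<lambda>n. nrm (x - y n)) \<longlonglongrightarrow> 0"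
  shows "(\<lambda>n. B (y n) z) \<longlonglongrightarrow> B x z"
proof (rule LIM_zero_cancel, rule Lim_null_comparison)
  show "(\<lambda>n. nrm (x - y n) * nrm z) \<longlonglongrightarrow> 0" by (rule tendsto_mult_left_zero[OF assms(4)])
  show "\<forall>\<^sub>F n in sequentially. norm (B (y n) z - B x z) \<le> nrm (x - y n) * nrm z"
    using cauchy_schwarz[of "y n - x" z for n] assms by (simp add: B_diff nrm_minus[of _ x])
qed

end

section \<open>The spaces L2 and L4\<close>

lemma abs_powr_2: "\<bar>x::real\<bar> powr 2 = x\<^sup>2"
  by (cases "x = 0") (simp_all add: powr_numeral)

lemma abs_powr_4: "\<bar>x::real\<bar> powr 4 = x ^ 4"
  by (cases "x = 0") (simp_all add: powr_numeral)

lemma Lp2_iff: "g \<in> Lp N 2 \<longleftrightarrow> g \<in> borel_measurable N \<and> integrable N (\<lambda>x. (g x)\<^sup>2)"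
  by (simp add: Lp_def abs_powr_2)

lemma Lp4_iff: "g \<in> Lp N 4 \<longleftrightarrow> g \<in> borel_measurable N \<and> integrable N (\<lambda>x. g x ^ 4)"
  by (simp add: Lp_def abs_powr_4)

lemma Lp_norm_2: "Lp_norm N 2 g = sqrt (\<integral>x. (g x)\<^sup>2 \<partial>N)"
  by (simp add: Lp_norm_def abs_powr_2 powr_half_sqrt integral_nonneg_AE)

lemma Lp_norm_4: "Lp_norm N 4 g = (\<integral>x. g x ^ 4 \<partial>N) powr (1 / 4)"
  by (simp add: Lp_norm_def abs_powr_4)

lemma L2_mult_integrable:
  fixes g h :: "'a \<Rightarrow> real"
  assumes "g \<in> Lp N 2" "h \<in> Lp N 2" shows "integrable N (\<lambda>x. g x * h x)"
proof (rule Bochner_Integration.integrable_bound)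
  show "integrable N (\<lambda>x. (g x)\<^sup>2 + (h x)\<^sup>2)" using assms by (simp add: Lp2_iff)
  show "(\<lambda>x. g x * h x) \<in> borel_measurable N" using assms by (auto simp: Lp2_iff)
  have "norm (g x * h x) \<le> norm ((g x)\<^sup>2 + (h x)\<^sup>2)" for x
  proof -
    have "2 * (\<bar>g x\<bar> * \<bar>h x\<bar>) \<le> (g x)\<^sup>2 + (h x)\<^sup>2"
      using sum_squares_bound[of "\<bar>g x\<bar>" "\<bar>h x\<bar>"] by (simp add: mult.assoc)
    moreover have "0 \<le> \<bar>g x\<bar> * \<bar>h x\<bar>" by simp
    ultimately have "\<bar>g x\<bar> * \<bar>h x\<bar> \<le> (g x)\<^sup>2 + (h x)\<^sup>2" by linarith
    then show ?thesis by (simp add: abs_mult)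
  qed
  then show "AE x in N. norm (g x * h x) \<le> norm ((g x)\<^sup>2 + (h x)\<^sup>2)" by simp
qed

lemma L2_add: assumes "g \<in> Lp N 2" "h \<in> Lp N 2" shows "g + h \<in> Lp N 2"
proof -
  have "integrable N (\<lambda>x. (g x)\<^sup>2 + 2 * (g x * h x) + (h x)\<^sup>2)"
    using assms L2_mult_integrable[OF assms] by (simp add: Lp2_iff)
  then show ?thesis using assms by (auto simp: Lp2_iff power2_eq_square algebra_simps plus_fun_def)
qed

lemma L2_scale: assumes "g \<in> Lp N 2" shows "c *\<^sub>R g \<in> Lp N 2"
  using assms by (auto simp: Lp2_iff scaleR_fun_def power_mult_distrib)

lemma L2_subspace: "subspace (Lp N 2)"
  unfolding subspace_def by (intro conjI ballI allI L2_add L2_scale) (auto simp: Lp2_iff zero_fun_def)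

interpretation L2: semi_inner "Lp N 2" "\<lambda>g h. \<integral>x. g x * h x \<partial>N" for N :: "'a measure"
proof
  show "(\<integral>x. (g + h) x * k x \<partial>N) = (\<integral>x. g x * k x \<partial>N) + (\<integral>x. h x * k x \<partial>N)"
    if "g \<in> Lp N 2" "h \<in> Lp N 2" "k \<in> Lp N 2" for g h k
    using L2_mult_integrable[OF that(1,3)] L2_mult_integrable[OF that(2,3)] by (simp add: distrib_right)
  show "(\<integral>x. (c *\<^sub>R g) x * h x \<partial>N) = c * (\<integral>x. g x * h x \<partial>N)" for g h c
    by (simp add: mult.assoc)
qed (auto simp: L2_subspace mult.commute)

lemma L2_nrm: "L2.nrm N g = Lp_norm N 2 g"
  by (simp add: L2.nrm_def Lp_norm_2 power2_eq_square)

text \<open>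
  Fatou's lemma, in the form that transfers integrability and norm bounds from an approximating
  sequence to its almost everywhere limit.
\<close>

lemma fatou_bound:
  fixes f :: "nat \<Rightarrow> 'a \<Rightarrow> real"
  assumes "\<And>n. integrable N (f n)" "\<And>n x. 0 \<le> f n x" "\<And>n. (\<integral>x. f n x \<partial>N) \<le> C n"
    and "g \<in> borel_measurable N" "AE x in N. (\<lambda>n. f n x) \<longlonglongrightarrow> g x" "C \<longlonglongrightarrow> c"
  shows "integrable N g \<and> (\<integral>x. g x \<partial>N) \<le> c"
proof -
  have g0: "AE x in N. 0 \<le> g x"
    using assms(5) by eventually_elim (auto intro: LIMSEQ_le_const simp: assms(2))
  have c0: "0 \<le> c"
    using order_trans[OF Bochner_Integration.integral_nonneg[OF assms(2)] assms(3)] by (intro LIMSEQ_le_const[OF assms(6)]) auto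
  have "(\<integral>\<^sup>+x. ennreal (g x) \<partial>N) = (\<integral>\<^sup>+x. liminf (\<lambda>n. ennreal (f n x)) \<partial>N)"
  proof (intro nn_integral_cong_AE)
    show "AE x in N. ennreal (g x) = liminf (\<lambda>n. ennreal (f n x))"
      using assms(5) by eventually_elim (rule lim_imp_Liminf[symmetric], auto intro: tendsto_ennrealI)
  qed
  also have "\<dots> \<le> liminf (\<lambda>n. \<integral>\<^sup>+x. ennreal (f n x) \<partial>N)"
    using assms(1) by (intro nn_integral_liminf) auto
  also have "\<dots> \<le> liminf (\<lambda>n. ennreal (C n))"
    using assms(1-3) by (intro Liminf_mono always_eventually allI) (simp add: nn_integral_eq_integral ennreal_leI)
  also have "\<dots> = ennreal c"
    using assms(6) by (intro lim_imp_Liminf) (auto intro: tendsto_ennrealI)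
  finally have le: "(\<integral>\<^sup>+x. ennreal (g x) \<partial>N) \<le> ennreal c" .
  then have "(\<integral>\<^sup>+x. ennreal (g x) \<partial>N) < \<infinity>" by (simp add: le_less_trans)
  then have i: "integrable N g" using assms(4) g0 by (simp add: integrableI_nonneg)
  then have "ennreal (\<integral>x. g x \<partial>N) \<le> ennreal c" using le g0 by (simp add: nn_integral_eq_integral)
  then show ?thesis using i c0 by simp
qed

text \<open>
  The weighted sum of \<open>(3/2)\<^sup>n f\<^sub>n\<close> is still integrable, hence finite
  almost everywhere, and \<open>sqrt f\<^sub>n \<le> (2/3)\<^sup>n + (3/2)\<^sup>n
  f\<^sub>n\<close> by the inequality of the means. With squared increments as
  \<open>f\<^sub>n\<close>, fast convergence in the mean square thus gives almost everywhere
  summable increments.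
\<close>

lemma AE_summable_sqrt:
  fixes f :: "nat \<Rightarrow> 'a \<Rightarrow> real"
  assumes "\<And>n. integrable N (f n)" "\<And>n x. 0 \<le> f n x" "\<And>n. (\<integral>x. f n x \<partial>N) \<le> (1 / 4) ^ n"
  shows "AE x in N. summable (\<lambda>n. sqrt (f n x))"
proof -
  have "(\<integral>\<^sup>+x. (\<Sum>n. ennreal ((3 / 2) ^ n * f n x)) \<partial>N) = (\<Sum>n. \<integral>\<^sup>+x. ennreal ((3 / 2) ^ n * f n x) \<partial>N)"
    using assms(1) by (intro nn_integral_suminf) auto
  also have "\<dots> \<le> (\<Sum>n. ennreal ((3 / 8) ^ n))"
  proof (intro suminf_le summableI)
    fix n
    have "(\<integral>\<^sup>+x. ennreal ((3 / 2) ^ n * f n x) \<partial>N) = ennreal ((3 / 2) ^ n * (\<integral>x. f n x \<partial>N))"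
      using assms(1,2) by (subst nn_integral_eq_integral) auto
    also have "\<dots> \<le> ennreal ((3 / 2) ^ n * (1 / 4) ^ n)" using assms(3) by (intro ennreal_leI mult_left_mono) auto
    also have "(3 / 2) ^ n * (1 / 4) ^ n = (3 / 8 :: real) ^ n" by (simp flip: power_mult_distrib)
    finally show "(\<integral>\<^sup>+x. ennreal ((3 / 2) ^ n * f n x) \<partial>N) \<le> ennreal ((3 / 8) ^ n)" .
  qed
  also have "\<dots> < \<infinity>" using summable_geometric[of "3 / 8 :: real"] by (simp add: suminf_ennreal2)
  finally have "AE x in N. (\<Sum>n. ennreal ((3 / 2) ^ n * f n x)) \<noteq> \<infinity>"
    using assms(1) by (intro nn_integral_PInf_AE) auto
  then show ?thesis
  proof eventually_elim
    case (elim x)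
    then have s: "summable (\<lambda>n. (3 / 2) ^ n * f n x)"
      using assms(2) by (intro summable_suminf_not_top) auto
    have "summable (\<lambda>n. (2 / 3) ^ n + (3 / 2) ^ n * f n x)"
      by (intro summable_add s summable_geometric) simp
    then show ?case
    proof (rule summable_comparison_test')
      fix n
      have "2 * (sqrt ((2 / 3) ^ n) * sqrt ((3 / 2) ^ n * f n x)) \<le> (sqrt ((2 / 3) ^ n))\<^sup>2 + (sqrt ((3 / 2) ^ n * f n x))\<^sup>2"
        using sum_squares_bound[of "sqrt ((2 / 3) ^ n)" "sqrt ((3 / 2) ^ n * f n x)"] by (simp add: mult.assoc)
      moreover have "sqrt ((2 / 3) ^ n) * sqrt ((3 / 2) ^ n * f n x) = sqrt (f n x)"
        by (simp add: mult.assoc[symmetric] flip: real_sqrt_mult power_mult_distrib)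
      moreover have nn: "0 \<le> sqrt (f n x)" "0 \<le> f n x" using assms(2) by auto
      ultimately have "2 * sqrt (f n x) \<le> (2 / 3) ^ n + (3 / 2) ^ n * f n x" by simp
      then have "sqrt (f n x) \<le> (2 / 3) ^ n + (3 / 2) ^ n * f n x" using nn(1) by linarith
      then show "norm (sqrt (f n x)) \<le> (2 / 3) ^ n + (3 / 2) ^ n * f n x" using nn by simp
    qed
  qed
qed

lemma rapid_subsequence:
  fixes d :: "nat \<Rightarrow> nat \<Rightarrow> real"
  assumes "\<And>e. e > 0 \<Longrightarrow> \<exists>N. \<forall>m\<ge>N. \<forall>n\<ge>m. d m n \<le> e"
  obtains r where "strict_mono (r::nat \<Rightarrow> nat)" "\<And>k n. n \<ge> r k \<Longrightarrow> d (r k) n \<le> (1 / 4) ^ k"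
proof -
  have "\<exists>N. \<forall>m\<ge>N. \<forall>n\<ge>m. d m n \<le> (1 / 4) ^ k" for k using assms[of "(1 / 4) ^ k"] by simp
  then obtain N where N: "\<And>k m n. m \<ge> N k \<Longrightarrow> n \<ge> m \<Longrightarrow> d m n \<le> (1 / 4) ^ k" by metis
  define r where "r k = k + (\<Sum>i\<le>k. N i)" for k
  have "strict_mono r" unfolding strict_mono_Suc_iff r_def by simp
  moreover have "r k \<ge> N k" for k unfolding r_def by (simp add: member_le_sum trans_le_add2)
  ultimately show ?thesis using that N by blast
qed

text \<open>
  A rapid subsequence has almost everywhere summable increments, so it converges almost
  everywhere. Fatou's lemma bounds the distance of \<open>g\<^sub>n\<close> to the limit by the
  Cauchy estimate.
\<close>

lemma riesz_fischer:
  fixes g :: "nat \<Rightarrow> 'a \<Rightarrow> real"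
  assumes g: "\<And>n. g n \<in> Lp N 2"
    and cauchy: "\<And>e. e > 0 \<Longrightarrow> \<exists>K. \<forall>m\<ge>K. \<forall>n\<ge>K. (\<integral>x. (g m x - g n x)\<^sup>2 \<partial>N) \<le> e"
  obtains h where "h \<in> Lp N 2" "(\<lambda>n. \<integral>x. (h x - g n x)\<^sup>2 \<partial>N) \<longlonglongrightarrow> 0"
proof -
  have [measurable]: "g n \<in> borel_measurable N" for n using g by (simp add: Lp2_iff)
  have int: "integrable N (\<lambda>x. (g m x - g n x)\<^sup>2)" for m n
    using L2.W_intros(3)[OF g g, of m n] by (simp add: Lp2_iff)
  obtain r where r: "strict_mono r" "\<And>k n. n \<ge> r k \<Longrightarrow> (\<integral>x. (g (r k) x - g n x)\<^sup>2 \<partial>N) \<le> (1 / 4) ^ k"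
    by (rule rapid_subsequence[of "\<lambda>m n. \<integral>x. (g m x - g n x)\<^sup>2 \<partial>N"]) (use cauchy in \<open>meson order_trans\<close>)+
  have "AE x in N. summable (\<lambda>k. sqrt ((g (r k) x - g (r (Suc k)) x)\<^sup>2))"
    using r by (intro AE_summable_sqrt int) (auto simp: strict_mono_leD)
  then have conv: "AE x in N. convergent (\<lambda>k. g (r k) x)"
  proof eventually_elim
    case (elim x)
    then have "summable (\<lambda>k. \<bar>g (r (Suc k)) x - g (r k) x\<bar>)" by (simp add: abs_minus_commute)
    then have "summable (\<lambda>k. g (r (Suc k)) x - g (r k) x)" by (rule summable_rabs_cancel)
    then have "convergent (\<lambda>k. \<Sum>i<k. g (r (Suc i)) x - g (r i) x)" by (simp add: summable_iff_convergent)
    then have "convergent (\<lambda>k. g (r k) x - g (r 0) x)" using sum_lessThan_telescope[of "\<lambda>i. g (r i) x"] by simp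
    then show ?case using convergent_diff_const_right_iff by blast
  qed
  define h where "h x = lim (\<lambda>k. g (r k) x)" for x
  have [measurable]: "h \<in> borel_measurable N" unfolding h_def by measurable
  have lim: "AE x in N. (\<lambda>k. g (r k) x) \<longlonglongrightarrow> h x"
    using conv by eventually_elim (simp add: h_def convergent_LIMSEQ_iff)
  have bd: "integrable N (\<lambda>x. (g n x - h x)\<^sup>2) \<and> (\<integral>x. (g n x - h x)\<^sup>2 \<partial>N) \<le> e"
    if n: "\<And>m. m \<ge> K \<Longrightarrow> (\<integral>x. (g n x - g m x)\<^sup>2 \<partial>N) \<le> e" for n K e
  proof (rule fatou_bound[where f="\<lambda>k x. (g n x - g (r (k + K)) x)\<^sup>2" and C="\<lambda>_. e"])
    show "(\<integral>x. (g n x - g (r (k + K)) x)\<^sup>2 \<partial>N) \<le> e" for k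
      by (rule n) (meson add_leE le_trans r(1) seq_suble)
    show "AE x in N. (\<lambda>k. (g n x - g (r (k + K)) x)\<^sup>2) \<longlonglongrightarrow> (g n x - h x)\<^sup>2"
      using lim by eventually_elim (intro tendsto_intros LIMSEQ_ignore_initial_segment)
  qed (use int in auto)
  obtain K1 where "\<forall>m\<ge>K1. \<forall>n\<ge>K1. (\<integral>x. (g m x - g n x)\<^sup>2 \<partial>N) \<le> 1" using cauchy[of 1] by auto
  then have "g K1 - h \<in> Lp N 2" using bd[of K1 K1 1] by (simp add: Lp2_iff fun_diff_def)
  from L2.W_intros(3)[OF g[of K1] this] have h: "h \<in> Lp N 2" by simp
  have "(\<lambda>n. \<integral>x. (h x - g n x)\<^sup>2 \<partial>N) \<longlonglongrightarrow> 0"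
  proof (rule LIMSEQ_I)
    fix e :: real assume "0 < e"
    then obtain K where K: "\<forall>m\<ge>K. \<forall>n\<ge>K. (\<integral>x. (g m x - g n x)\<^sup>2 \<partial>N) \<le> e / 2" using cauchy[of "e/2"] by auto
    have "norm ((\<integral>x. (h x - g n x)\<^sup>2 \<partial>N) - 0) < e" if "n \<ge> K" for n
    proof -
      have "(\<integral>x. (g n x - h x)\<^sup>2 \<partial>N) \<le> e / 2" using bd[of K n "e/2"] K that by blast
      moreover have "(\<integral>x. (g n x - h x)\<^sup>2 \<partial>N) = (\<integral>x. (h x - g n x)\<^sup>2 \<partial>N)" by (simp add: power2_commute)
      moreover have "0 \<le> (\<integral>x. (h x - g n x)\<^sup>2 \<partial>N)" by simp
      ultimately show ?thesis using \<open>0 < e\<close> by simp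
    qed
    then show "\<exists>no. \<forall>n\<ge>no. norm ((\<integral>x. (h x - g n x)\<^sup>2 \<partial>N) - 0) < e" by blast
  qed
  then show ?thesis using that h by blast
qed

section \<open>Weak derivatives and the space H0\<close>

context bounded_open begin

lemma test_L2: "\<phi> \<in> \<D> \<Longrightarrow> \<phi> \<in> Lp M 2"
  using integrable_test_mult[of \<phi> \<phi>] by (auto simp: Lp2_iff power2_eq_square)

lemma L2_integrable: "g \<in> Lp M 2 \<Longrightarrow> integrable M g"
  using L2_mult_integrable[of g M "\<lambda>x. 1"] by (simp add: Lp2_iff)

lemma weak_deriv_unique:
  assumes "is_weak_deriv \<Omega> \<alpha> v g" "is_weak_deriv \<Omega> \<alpha> v h"
  shows "AE x in M. g x = h x"
proof -
  have gh: "g \<in> Lp M 2" "h \<in> Lp M 2" using assms by (auto simp: is_weak_deriv_def)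
  have "AE x in M. (g - h) x = 0"
  proof (rule fundamental_lemma)
    show "integrable M (g - h)" using L2_integrable[OF L2.W_intros(3)[OF gh]] .
    fix \<phi> assume phi: "\<phi> \<in> \<D>"
    have "pairing \<Omega> g \<phi> = pairing \<Omega> h \<phi>"
      using assms phi unfolding is_weak_deriv_def by (metis mult_cancel_left power_not_zero zero_neq_neg_one)
    then show "(\<integral>x. (g - h) x * \<phi> x \<partial>M) = 0"
      using L2.B_diff[OF gh test_L2[OF phi]] by (simp add: pairing_def)
  qed
  then show ?thesis by simp
qed

lemma is_weak_deriv_add:
  assumes "is_weak_deriv \<Omega> \<alpha> v g" "is_weak_deriv \<Omega> \<alpha> w h" "v \<in> Lp M 2" "w \<in> Lp M 2" "set \<alpha> \<subseteq> Basis"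
  shows "is_weak_deriv \<Omega> \<alpha> (v + w) (g + h)"
proof -
  have gh: "g \<in> Lp M 2" "h \<in> Lp M 2" using assms by (auto simp: is_weak_deriv_def)
  have "pairing \<Omega> (v + w) (partials \<alpha> \<phi>) = (-1) ^ length \<alpha> * pairing \<Omega> (g + h) \<phi>" if "\<phi> \<in> \<D>" for \<phi>
    using assms(1,2) that L2.B_add[OF gh test_L2[OF that]] L2.B_add[OF assms(3,4) test_L2[OF test_partials[OF that assms(5)]]]
    unfolding pairing_def is_weak_deriv_def by (simp add: algebra_simps)
  then show ?thesis using gh unfolding is_weak_deriv_def by blast
qed

lemma is_weak_deriv_scale:
  assumes "is_weak_deriv \<Omega> \<alpha> v g"
  shows "is_weak_deriv \<Omega> \<alpha> (c *\<^sub>R v) (c *\<^sub>R g)"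
  using assms unfolding is_weak_deriv_def pairing_def by (auto simp: mult.assoc)

lemma is_weak_deriv_test:
  assumes "\<phi> \<in> \<D>" "set \<alpha> \<subseteq> Basis"
  shows "is_weak_deriv \<Omega> \<alpha> \<phi> (partials (rev \<alpha>) \<phi>)"
  using test_weak_derivative[OF assms(1) _ assms(2)] test_L2[OF test_partials, OF assms(1), of "rev \<alpha>"] assms(2)
  unfolding is_weak_deriv_def pairing_def by simp

lemma finite_indices: "finite (indices k :: 'a list set)"
  unfolding indices_def by (rule finite_lists_length_eq) simp

lemma sobolev_weak_deriv:
  assumes "v \<in> sobolev_H m \<Omega>" "\<alpha> \<in> indices k" "k \<le> m"
  shows "is_weak_deriv \<Omega> \<alpha> v (weak_deriv \<Omega> \<alpha> v)"
proof -
  have "\<exists>g. is_weak_deriv \<Omega> \<alpha> v g" using assms unfolding sobolev_H_def by blast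
  then show ?thesis unfolding weak_deriv_def by (rule someI_ex)
qed

lemma weak_deriv_eq:
  assumes "is_weak_deriv \<Omega> \<alpha> v g" shows "AE x in M. weak_deriv \<Omega> \<alpha> v x = g x"
  using weak_deriv_unique[OF _ assms] someI[of "is_weak_deriv \<Omega> \<alpha> v", OF assms] unfolding weak_deriv_def by blast

lemma sobolev_weak_deriv_L2:
  assumes "v \<in> sobolev_H m \<Omega>" "\<alpha> \<in> indices k" "k \<le> m" shows "weak_deriv \<Omega> \<alpha> v \<in> Lp M 2"
  using sobolev_weak_deriv[OF assms] by (simp add: is_weak_deriv_def)

lemma sobolev_L2: "v \<in> sobolev_H m \<Omega> \<Longrightarrow> v \<in> Lp M 2" by (simp add: sobolev_H_def)

lemma indices_Basis: "\<alpha> \<in> indices k \<Longrightarrow> set \<alpha> \<subseteq> Basis" by (simp add: indices_def)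

lemma sobolev_subspace: "subspace (sobolev_H m \<Omega>)"
proof (unfold subspace_def, intro conjI ballI allI)
  show "0 \<in> sobolev_H m \<Omega>"
    using is_weak_deriv_test[OF test_zero] by (auto simp: sobolev_H_def indices_def)
  show "v + w \<in> sobolev_H m \<Omega>" if "v \<in> sobolev_H m \<Omega>" "w \<in> sobolev_H m \<Omega>" for v w
    using that is_weak_deriv_add[of _ v _ w] unfolding sobolev_H_def by (auto dest: indices_Basis) (metis indices_Basis)
  show "c *\<^sub>R v \<in> sobolev_H m \<Omega>" if "v \<in> sobolev_H m \<Omega>" for v c
    using that is_weak_deriv_scale[of _ v] unfolding sobolev_H_def by (auto, metis)
qed

lemma test_sobolev: "\<phi> \<in> \<D> \<Longrightarrow> \<phi> \<in> sobolev_H m \<Omega>"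
  using is_weak_deriv_test[of \<phi>] by (auto simp: sobolev_H_def test_L2 dest: indices_Basis)

lemma form_A_sum:
  assumes "v \<in> sobolev_H m \<Omega>" "w \<in> sobolev_H m \<Omega>" "k \<le> m"
  shows "form_A k \<Omega> v w = (\<Sum>\<alpha>\<in>indices k. \<integral>x. weak_deriv \<Omega> \<alpha> v x * weak_deriv \<Omega> \<alpha> w x \<partial>M)"
  unfolding form_A_def using assms
  by (intro Bochner_Integration.integral_sum L2_mult_integrable sobolev_weak_deriv_L2[of _ m _ k]) auto

text \<open>
  Weak derivatives are unique almost everywhere, so the form may be computed with any of them
  instead of the chosen ones.
\<close>

lemma form_A_cong:
  assumes "v \<in> sobolev_H m \<Omega>" "w \<in> sobolev_H m \<Omega>" "k \<le> m"
    and "\<And>\<alpha>. \<alpha> \<in> indices k \<Longrightarrow> is_weak_deriv \<Omega> \<alpha> v (f \<alpha>)" "\<And>\<alpha>. \<alpha> \<in> indices k \<Longrightarrow> is_weak_deriv \<Omega> \<alpha> w (g \<alpha>)"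
  shows "form_A k \<Omega> v w = (\<Sum>\<alpha>\<in>indices k. \<integral>x. f \<alpha> x * g \<alpha> x \<partial>M)"
  unfolding form_A_sum[OF assms(1-3)]
proof (intro sum.cong refl integral_cong_AE)
  fix \<alpha> :: "'a list" assume a: "\<alpha> \<in> indices k"
  have m: "h \<in> borel_measurable M" if "is_weak_deriv \<Omega> \<alpha> u h" for u h using that by (simp add: is_weak_deriv_def Lp2_iff)
  show "(\<lambda>x. weak_deriv \<Omega> \<alpha> v x * weak_deriv \<Omega> \<alpha> w x) \<in> borel_measurable M"
    using m[OF sobolev_weak_deriv[OF assms(1) a assms(3)]] m[OF sobolev_weak_deriv[OF assms(2) a assms(3)]] by simp
  show "(\<lambda>x. f \<alpha> x * g \<alpha> x) \<in> borel_measurable M" using m[OF assms(4)[OF a]] m[OF assms(5)[OF a]] by simp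
  show "AE x in M. weak_deriv \<Omega> \<alpha> v x * weak_deriv \<Omega> \<alpha> w x = f \<alpha> x * g \<alpha> x"
    using weak_deriv_eq[OF assms(4)[OF a]] weak_deriv_eq[OF assms(5)[OF a]] by eventually_elim simp
qed

lemma semi_inner_form_A:
  assumes "k \<le> m" shows "semi_inner (sobolev_H m \<Omega>) (form_A k \<Omega>)"
proof
  note sd = sobolev_weak_deriv[OF _ _ assms]
  note l2 = sobolev_weak_deriv_L2[OF _ _ assms]
  show "subspace (sobolev_H m \<Omega>)" by (rule sobolev_subspace)
  fix v w z c assume v: "v \<in> sobolev_H m \<Omega>" and z: "z \<in> sobolev_H m \<Omega>"
  show "form_A k \<Omega> (c *\<^sub>R v) z = c * form_A k \<Omega> v z"
  proof -
    have "form_A k \<Omega> (c *\<^sub>R v) z = (\<Sum>\<alpha>\<in>indices k. \<integral>x. (c *\<^sub>R weak_deriv \<Omega> \<alpha> v) x * weak_deriv \<Omega> \<alpha> z x \<partial>M)"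
      by (intro form_A_cong[OF _ z assms] is_weak_deriv_scale sd v z) (use v sobolev_subspace in \<open>auto simp: subspace_scale\<close>)
    then show ?thesis by (simp add: form_A_sum[OF v z assms] sum_distrib_left mult.assoc)
  qed
  show "form_A k \<Omega> v z = form_A k \<Omega> z v" unfolding form_A_def by (simp add: mult.commute)
  show "0 \<le> form_A k \<Omega> v v" unfolding form_A_def by (intro Bochner_Integration.integral_nonneg sum_nonneg) simp
  assume w: "w \<in> sobolev_H m \<Omega>"
  show "form_A k \<Omega> (v + w) z = form_A k \<Omega> v z + form_A k \<Omega> w z"
  proof -
    have "form_A k \<Omega> (v + w) z = (\<Sum>\<alpha>\<in>indices k. \<integral>x. (weak_deriv \<Omega> \<alpha> v + weak_deriv \<Omega> \<alpha> w) x * weak_deriv \<Omega> \<alpha> z x \<partial>M)"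
      by (intro form_A_cong[OF _ z assms] is_weak_deriv_add sd v w z sobolev_L2[OF v] sobolev_L2[OF w] indices_Basis)
        (use v w sobolev_subspace in \<open>auto simp: subspace_add\<close>)
    also have "\<dots> = (\<Sum>\<alpha>\<in>indices k. (\<integral>x. weak_deriv \<Omega> \<alpha> v x * weak_deriv \<Omega> \<alpha> z x \<partial>M) + (\<integral>x. weak_deriv \<Omega> \<alpha> w x * weak_deriv \<Omega> \<alpha> z x \<partial>M))"
      by (intro sum.cong refl L2.B_add l2 v w z)
    finally show ?thesis by (simp add: form_A_sum[OF v z assms] form_A_sum[OF w z assms] sum.distrib)
  qed
qed

lemma semi_inner_sobolev: "semi_inner (sobolev_H m \<Omega>) (\<lambda>v w. \<Sum>k\<le>m. form_A k \<Omega> v w)"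
proof
  have s: "semi_inner (sobolev_H m \<Omega>) (form_A k \<Omega>)" if "k \<in> {..m}" for k using that semi_inner_form_A by simp
  show "subspace (sobolev_H m \<Omega>)" by (rule sobolev_subspace)
  fix v w z c assume v: "v \<in> sobolev_H m \<Omega>" and z: "z \<in> sobolev_H m \<Omega>"
  show "(\<Sum>k\<le>m. form_A k \<Omega> (c *\<^sub>R v) z) = c * (\<Sum>k\<le>m. form_A k \<Omega> v z)"
    unfolding sum_distrib_left by (intro sum.cong refl semi_inner.B_scale[OF s] v z)
  show "(\<Sum>k\<le>m. form_A k \<Omega> v z) = (\<Sum>k\<le>m. form_A k \<Omega> z v)"
    by (intro sum.cong refl semi_inner.B_sym[OF s] v z)
  show "0 \<le> (\<Sum>k\<le>m. form_A k \<Omega> v v)" by (intro sum_nonneg semi_inner.B_nonneg[OF s] v)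
  assume w: "w \<in> sobolev_H m \<Omega>"
  show "(\<Sum>k\<le>m. form_A k \<Omega> (v + w) z) = (\<Sum>k\<le>m. form_A k \<Omega> v z) + (\<Sum>k\<le>m. form_A k \<Omega> w z)"
    unfolding sum.distrib[symmetric] by (intro sum.cong refl semi_inner.B_add[OF s] v w z)
qed

text \<open>
  A test function has the weak derivative \<open>partials (rev \<alpha>) \<phi>\<close> along
  \<open>\<alpha>\<close>. The form sums over all lists of length \<open>k\<close>, and
  reversing the lists only permutes the summands.
\<close>

lemma form_A_test:
  assumes "\<phi> \<in> \<D>" "\<psi> \<in> \<D>"
  shows "form_A k \<Omega> \<phi> \<psi> = (\<Sum>\<alpha>\<in>indices k. \<integral>x. partials \<alpha> \<phi> x * partials \<alpha> \<psi> x \<partial>M)"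
proof -
  have "form_A k \<Omega> \<phi> \<psi> = (\<Sum>\<alpha>\<in>indices k. \<integral>x. partials (rev \<alpha>) \<phi> x * partials (rev \<alpha>) \<psi> x \<partial>M)"
    by (rule form_A_cong[OF test_sobolev test_sobolev order_refl]) (auto intro!: is_weak_deriv_test assms dest: indices_Basis)
  also have "\<dots> = (\<Sum>\<alpha>\<in>indices k. \<integral>x. partials \<alpha> \<phi> x * partials \<alpha> \<psi> x \<partial>M)"
    by (rule sum.reindex_bij_witness[of _ rev rev]) (auto simp: indices_def)
  finally show ?thesis .
qed

text \<open>
  Poincare's inequality for \<open>\<partial>\<^sup>\<alpha> \<phi>\<close> in one fixed
  direction \<open>b\<close> bounds its norm by that of the derivative along \<open>b #
  \<alpha>\<close>; iterating this raises the order from \<open>k\<close> to \<open>m\<close>.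
\<close>

lemma form_A_test_mono: "\<exists>C>0. \<forall>k\<le>m. \<forall>\<phi>\<in>\<D>. form_A k \<Omega> \<phi> \<phi> \<le> C * form_A m \<Omega> \<phi> \<phi>"
proof -
  obtain C where C: "C > 0" "\<And>\<phi> b. \<phi> \<in> \<D> \<Longrightarrow> b \<in> Basis \<Longrightarrow> (\<integral>x. (\<phi> x)\<^sup>2 \<partial>M) \<le> C * (\<integral>x. (partials [b] \<phi> x)\<^sup>2 \<partial>M)"
    using poincare_test by blast
  obtain b :: 'a where b: "b \<in> Basis" using nonempty_Basis by blast
  have step: "form_A k \<Omega> \<phi> \<phi> \<le> C * form_A (Suc k) \<Omega> \<phi> \<phi>" if phi: "\<phi> \<in> \<D>" for k \<phi>
  proof -
    have "form_A k \<Omega> \<phi> \<phi> = (\<Sum>\<alpha>\<in>indices k. \<integral>x. (partials \<alpha> \<phi> x)\<^sup>2 \<partial>M)"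
      by (simp add: form_A_test[OF phi phi] power2_eq_square)
    also have "\<dots> \<le> (\<Sum>\<alpha>\<in>indices k. C * (\<integral>x. (partials (b # \<alpha>) \<phi> x)\<^sup>2 \<partial>M))"
    proof (rule sum_mono)
      fix \<alpha> :: "'a list" assume "\<alpha> \<in> indices k"
      then show "(\<integral>x. (partials \<alpha> \<phi> x)\<^sup>2 \<partial>M) \<le> C * (\<integral>x. (partials (b # \<alpha>) \<phi> x)\<^sup>2 \<partial>M)"
        using C(2)[OF test_partials[OF phi indices_Basis] b] by simp
    qed
    also have "\<dots> = C * (\<Sum>\<beta>\<in>(#) b ` indices k. \<integral>x. (partials \<beta> \<phi> x)\<^sup>2 \<partial>M)"
      by (simp add: sum_distrib_left sum.reindex)
    also have "\<dots> \<le> C * (\<Sum>\<beta>\<in>indices (Suc k). \<integral>x. (partials \<beta> \<phi> x)\<^sup>2 \<partial>M)"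
    proof (intro mult_left_mono sum_mono2 finite_indices)
      show "(#) b ` indices k \<subseteq> indices (Suc k)" using b by (auto simp: indices_def)
    qed (use C in auto)
    also have "\<dots> = C * form_A (Suc k) \<Omega> \<phi> \<phi>"
      by (simp add: form_A_test[OF phi phi] power2_eq_square)
    finally show ?thesis .
  qed
  show ?thesis
  proof (induction m)
    case 0 show ?case by (rule exI[of _ 1]) auto
  next
    case (Suc m)
    then obtain D where D: "D > 0" "\<And>k \<phi>. k \<le> m \<Longrightarrow> \<phi> \<in> \<D> \<Longrightarrow> form_A k \<Omega> \<phi> \<phi> \<le> D * form_A m \<Omega> \<phi> \<phi>" by blast
    have nn: "0 \<le> form_A (Suc m) \<Omega> \<phi> \<phi>" if "\<phi> \<in> \<D>" for \<phi>
      using semi_inner.B_nonneg[OF semi_inner_form_A[OF order_refl] test_sobolev[OF that]] .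
    have "form_A k \<Omega> \<phi> \<phi> \<le> (1 + D * C) * form_A (Suc m) \<Omega> \<phi> \<phi>" if "k \<le> Suc m" "\<phi> \<in> \<D>" for k \<phi>
    proof (cases "k = Suc m")
      case True
      have "0 \<le> (D * C) * form_A (Suc m) \<Omega> \<phi> \<phi>" using nn[OF that(2)] D(1) C(1) by simp
      then show ?thesis using True by (simp add: distrib_right)
    next
      case False
      then have "form_A k \<Omega> \<phi> \<phi> \<le> D * form_A m \<Omega> \<phi> \<phi>" using D(2) that by simp
      also have "\<dots> \<le> D * (C * form_A (Suc m) \<Omega> \<phi> \<phi>)" using step[OF that(2)] D(1) by simp
      finally show ?thesis using nn[OF that(2)] by (simp add: algebra_simps)
    qed
    moreover have "1 + D * C > 0" using C(1) D(1) by (simp add: add_pos_pos)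
    ultimately show ?case by blast
  qed
qed

lemma H0_sobolev: "v \<in> sobolev_H0 m \<Omega> \<Longrightarrow> v \<in> sobolev_H m \<Omega>"
  by (simp add: sobolev_H0_def)

lemma test_H0: "\<phi> \<in> \<D> \<Longrightarrow> \<phi> \<in> sobolev_H0 m \<Omega>"
proof -
  interpret S: semi_inner "sobolev_H m \<Omega>" "\<lambda>v w. \<Sum>k\<le>m. form_A k \<Omega> v w" by (rule semi_inner_sobolev)
  assume "\<phi> \<in> \<D>"
  then show ?thesis using S.nrm_zero unfolding sobolev_H0_def S.nrm_def sobolev_norm_def
    by (auto intro!: exI[of _ "\<lambda>n. \<phi>"] test_sobolev simp: zero_fun_def)
qed

lemma H0_subspace: "subspace (sobolev_H0 m \<Omega>)"
proof -
  interpret S: semi_inner "sobolev_H m \<Omega>" "\<lambda>v w. \<Sum>k\<le>m. form_A k \<Omega> v w" by (rule semi_inner_sobolev)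
  have nrm: "sobolev_norm m \<Omega> v = S.nrm v" for v by (simp add: S.nrm_def sobolev_norm_def)
  show ?thesis
  proof (unfold subspace_def, intro conjI ballI allI)
    show "0 \<in> sobolev_H0 m \<Omega>" by (intro test_H0 test_zero)
    fix v assume "v \<in> sobolev_H0 m \<Omega>"
    then obtain \<phi> where v: "v \<in> sobolev_H m \<Omega>" "\<And>n. \<phi> n \<in> \<D>" "(\<lambda>n. S.nrm (v - \<phi> n)) \<longlonglongrightarrow> 0"
      unfolding sobolev_H0_def nrm by blast
    show "c *\<^sub>R v \<in> sobolev_H0 m \<Omega>" for c
    proof -
      have "(\<lambda>n. \<bar>c\<bar> * S.nrm (v - \<phi> n)) \<longlonglongrightarrow> 0" by (rule tendsto_mult_right_zero[OF v(3)])
      moreover have "\<bar>c\<bar> * S.nrm (v - \<phi> n) = S.nrm (c *\<^sub>R v - c *\<^sub>R \<phi> n)" for n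
        using S.nrm_scale[OF S.W_intros(3)[OF v(1) test_sobolev[OF v(2)]], of c n] by (simp add: scaleR_diff_right)
      ultimately have "(\<lambda>n. S.nrm (c *\<^sub>R v - c *\<^sub>R \<phi> n)) \<longlonglongrightarrow> 0" by simp
      then show ?thesis unfolding sobolev_H0_def nrm
        by (intro CollectI conjI exI[of _ "\<lambda>n. c *\<^sub>R \<phi> n"] allI test_scale v(2) S.W_intros(4) v(1))
    qed
    fix w assume "w \<in> sobolev_H0 m \<Omega>"
    then obtain \<psi> where w: "w \<in> sobolev_H m \<Omega>" "\<And>n. \<psi> n \<in> \<D>" "(\<lambda>n. S.nrm (w - \<psi> n)) \<longlonglongrightarrow> 0"
      unfolding sobolev_H0_def nrm by blast
    have "(\<lambda>n. S.nrm ((v + w) - (\<phi> n + \<psi> n))) \<longlonglongrightarrow> 0"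
    proof (rule Lim_null_comparison)
      show "(\<lambda>n. S.nrm (v - \<phi> n) + S.nrm (w - \<psi> n)) \<longlonglongrightarrow> 0" using tendsto_add[OF v(3) w(3)] by simp
      have i: "v - \<phi> n \<in> sobolev_H m \<Omega>" "w - \<psi> n \<in> sobolev_H m \<Omega>" for n using v w test_sobolev by auto
      have "norm (S.nrm ((v - \<phi> n) + (w - \<psi> n))) \<le> S.nrm (v - \<phi> n) + S.nrm (w - \<psi> n)" for n
        using S.nrm_triangle[OF i] S.nrm_nonneg[OF S.W_intros(2)[OF i]] by simp
      moreover have "(v - \<phi> n) + (w - \<psi> n) = (v + w) - (\<phi> n + \<psi> n)" for n by simp
      ultimately show "\<forall>\<^sub>F n in sequentially. norm (S.nrm ((v + w) - (\<phi> n + \<psi> n))) \<le> S.nrm (v - \<phi> n) + S.nrm (w - \<psi> n)"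
        by (simp only: eventually_True)
    qed
    then show "v + w \<in> sobolev_H0 m \<Omega>" unfolding sobolev_H0_def nrm
      by (intro CollectI conjI exI[of _ "\<lambda>n. \<phi> n + \<psi> n"] allI test_add v(2) w(2) S.W_intros(2) v(1) w(1))
  qed
qed

lemma semi_inner_H0: "k \<le> m \<Longrightarrow> semi_inner (sobolev_H0 m \<Omega>) (form_A k \<Omega>)"
proof -
  assume "k \<le> m"
  then interpret A: semi_inner "sobolev_H m \<Omega>" "form_A k \<Omega>" by (rule semi_inner_form_A)
  show ?thesis
    by unfold_locales
      (simp_all add: H0_subspace H0_sobolev A.B_add A.B_scale A.B_nonneg, intro A.B_sym H0_sobolev)
qed

lemma form_A_0: 
  assumes "v \<in> Lp M 2" "w \<in> Lp M 2" 
  shows "form_A 0 \<Omega> v w = (\<integral>x. v x * w x \<partial>M)"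
proof -
  have i: "(indices 0 :: 'a list set) = {[]}" by (auto simp: indices_def)
  have wd: "is_weak_deriv \<Omega> \<alpha> v v" if "v \<in> Lp M 2" "\<alpha> \<in> indices 0" for v and \<alpha> :: "'a list"
    using that by (simp add: is_weak_deriv_def i)
  have "v \<in> sobolev_H 0 \<Omega>" if "v \<in> Lp M 2" for v using that wd[OF that] by (auto simp: sobolev_H_def)
  then have "form_A 0 \<Omega> v w = (\<Sum>\<alpha>\<in>(indices 0 :: 'a list set). \<integral>x. v x * w x \<partial>M)"
    using assms wd by (intro form_A_cong[of _ 0]) auto
  then show ?thesis by (simp add: i)
qed

lemma H0_approx:
  assumes "v \<in> sobolev_H0 m \<Omega>"
  obtains \<phi> where "\<And>n::nat. \<phi> n \<in> \<D>" "\<And>k. k \<le> m \<Longrightarrow> (\<lambda>n. semi_inner.nrm (form_A k \<Omega>) (v - \<phi> n)) \<longlonglongrightarrow> 0"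
proof -
  interpret S: semi_inner "sobolev_H m \<Omega>" "\<lambda>v w. \<Sum>k\<le>m. form_A k \<Omega> v w" by (rule semi_inner_sobolev)
  have v: "v \<in> sobolev_H m \<Omega>" using assms by (rule H0_sobolev)
  obtain \<phi> where phi: "\<And>n. \<phi> n \<in> \<D>" "(\<lambda>n. S.nrm (v - \<phi> n)) \<longlonglongrightarrow> 0"
    using assms unfolding sobolev_H0_def S.nrm_def sobolev_norm_def by blast
  have "(\<lambda>n. semi_inner.nrm (form_A k \<Omega>) (v - \<phi> n)) \<longlonglongrightarrow> 0" if k: "k \<le> m" for k
  proof (rule Lim_null_comparison[OF _ phi(2)], rule always_eventually, rule allI)
    fix n
    interpret A: semi_inner "sobolev_H m \<Omega>" "form_A k \<Omega>" by (rule semi_inner_form_A[OF k])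
    have i: "v - \<phi> n \<in> sobolev_H m \<Omega>" using v test_sobolev[OF phi(1)] by blast
    have "form_A k \<Omega> (v - \<phi> n) (v - \<phi> n) \<le> (\<Sum>k\<le>m. form_A k \<Omega> (v - \<phi> n) (v - \<phi> n))"
      using k semi_inner.B_nonneg[OF semi_inner_form_A i] by (intro member_le_sum) auto
    then show "norm (A.nrm (v - \<phi> n)) \<le> S.nrm (v - \<phi> n)"
      using A.nrm_nonneg[OF i] by (simp add: A.nrm_def S.nrm_def)
  qed
  then show ?thesis using that phi(1) by blast
qed

lemma V_norm_nrm: "V_norm m \<Omega> v = semi_inner.nrm (form_A m \<Omega>) v"
  by (simp add: semi_inner.nrm_def[OF semi_inner_H0[of m m]] V_norm_def)

text \<open>
  Both sides of \<open>form_A_test_mono\<close> are continuous for the full Sobolev norm, in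
  which test functions are dense.
\<close>

lemma H0_form_mono: "\<exists>C>0. \<forall>k\<le>m. \<forall>v\<in>sobolev_H0 m \<Omega>. form_A k \<Omega> v v \<le> C * form_A m \<Omega> v v"
proof -
  obtain C where C: "C > 0" "\<And>k \<phi>. k \<le> m \<Longrightarrow> \<phi> \<in> \<D> \<Longrightarrow> form_A k \<Omega> \<phi> \<phi> \<le> C * form_A m \<Omega> \<phi> \<phi>" using form_A_test_mono by metis
  have "form_A k \<Omega> v v \<le> C * form_A m \<Omega> v v" if k: "k \<le> m" and v: "v \<in> sobolev_H0 m \<Omega>" for k v
  proof -
    obtain \<phi> where phi: "\<And>n::nat. \<phi> n \<in> \<D>" "\<And>k. k \<le> m \<Longrightarrow> (\<lambda>n. semi_inner.nrm (form_A k \<Omega>) (v - \<phi> n)) \<longlonglongrightarrow> 0"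
      using H0_approx[OF v] by metis
    have lim: "(\<lambda>n. form_A k \<Omega> (\<phi> n) (\<phi> n)) \<longlonglongrightarrow> form_A k \<Omega> v v" if "k \<le> m" for k
    proof -
      interpret A: semi_inner "sobolev_H0 m \<Omega>" "form_A k \<Omega>" by (rule semi_inner_H0[OF that])
      have "(\<lambda>n. (A.nrm (\<phi> n))\<^sup>2) \<longlonglongrightarrow> (A.nrm v)\<^sup>2"
        by (intro tendsto_power A.nrm_tendsto v test_H0 phi that)
      then show ?thesis using A.nrm_sq v test_H0[OF phi(1)] by simp
    qed
    show ?thesis
      by (rule LIMSEQ_le[OF lim[OF k] tendsto_mult_left[OF lim[OF order_refl]]]) (use C(2)[OF k phi(1)] in auto)
  qed
  then show ?thesis using C(1) by blast
qed

lemma H0_poincare: "\<exists>C>0. \<forall>v\<in>sobolev_H0 m \<Omega>. (\<integral>x. (v x)\<^sup>2 \<partial>M) \<le> C * form_A m \<Omega> v v"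
proof -
  obtain C where C: "C > 0" "\<And>v. v \<in> sobolev_H0 m \<Omega> \<Longrightarrow> form_A 0 \<Omega> v v \<le> C * form_A m \<Omega> v v" using H0_form_mono[of m] by blast
  have "form_A 0 \<Omega> v v = (\<integral>x. (v x)\<^sup>2 \<partial>M)" if "v \<in> sobolev_H0 m \<Omega>" for v
    using form_A_0[OF sobolev_L2[OF H0_sobolev[OF that]] sobolev_L2[OF H0_sobolev[OF that]]] by (simp add: power2_eq_square)
  then show ?thesis using C by force
qed

text \<open>
  By \<open>form_A_test_mono\<close>, test functions that form a Cauchy sequence for the norm of
  \<open>V\<close> do so in \<open>L\<^sup>2\<close> together with all derivatives of order at
  most \<open>m\<close>. The Riesz-Fischer theorem provides the limits \<open>g
  \<alpha>\<close>, and passing to the limit in the integration by parts shows that they are the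
  weak derivatives of \<open>g []\<close>.
\<close>

lemma H0_complete:
  assumes phi: "\<And>n. \<phi> n \<in> \<D>"
    and cauchy: "\<And>e. e > 0 \<Longrightarrow> \<exists>K. \<forall>i\<ge>K. \<forall>j\<ge>K. V_norm m \<Omega> (\<phi> i - \<phi> j) \<le> e"
  obtains v where "v \<in> sobolev_H0 m \<Omega>" "(\<lambda>n. V_norm m \<Omega> (v - \<phi> n)) \<longlonglongrightarrow> 0"
proof -
  obtain C where C: "C > 0" "\<And>k \<phi>. k \<le> m \<Longrightarrow> \<phi> \<in> \<D> \<Longrightarrow> form_A k \<Omega> \<phi> \<phi> \<le> C * form_A m \<Omega> \<phi> \<phi>" using form_A_test_mono by metis
  have "\<exists>g. g \<in> Lp M 2 \<and> (\<lambda>n. \<integral>x. (g x - partials (rev \<alpha>) (\<phi> n) x)\<^sup>2 \<partial>M) \<longlonglongrightarrow> 0"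
    if a: "k \<le> m" "\<alpha> \<in> indices k" for k and \<alpha> :: "'a list"
  proof -
    have b: "set (rev \<alpha>) \<subseteq> Basis" "rev \<alpha> \<in> indices k" using a by (auto simp: indices_def)
    have "\<exists>K. \<forall>i\<ge>K. \<forall>j\<ge>K. (\<integral>x. (partials (rev \<alpha>) (\<phi> i) x - partials (rev \<alpha>) (\<phi> j) x)\<^sup>2 \<partial>M) \<le> e" if "e > 0" for e
    proof -
      obtain K where K: "\<And>i j. i \<ge> K \<Longrightarrow> j \<ge> K \<Longrightarrow> V_norm m \<Omega> (\<phi> i - \<phi> j) \<le> sqrt (e / C)"
        using cauchy[of "sqrt (e / C)"] \<open>e > 0\<close> C(1) by auto
      have "(\<integral>x. (partials (rev \<alpha>) (\<phi> i) x - partials (rev \<alpha>) (\<phi> j) x)\<^sup>2 \<partial>M) \<le> e" if "i \<ge> K" "j \<ge> K" for i j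
      proof -
        have d: "\<phi> i - \<phi> j \<in> \<D>" using phi subspace_test_functions subspace_diff by blast
        have "partials (rev \<alpha>) (\<phi> i - \<phi> j) = partials (rev \<alpha>) (\<phi> i) - partials (rev \<alpha>) (\<phi> j)"
          using partials_add[OF test_smooth[OF phi] test_smooth[OF test_scale[OF phi]] b(1), of i "-1" j]
            partials_scale[OF test_smooth[OF phi] b(1), of "-1" j] by simp
        then have "(\<integral>x. (partials (rev \<alpha>) (\<phi> i) x - partials (rev \<alpha>) (\<phi> j) x)\<^sup>2 \<partial>M)
            = (\<integral>x. partials (rev \<alpha>) (\<phi> i - \<phi> j) x * partials (rev \<alpha>) (\<phi> i - \<phi> j) x \<partial>M)"
          by (simp add: power2_eq_square)
        also have "\<dots> \<le> form_A k \<Omega> (\<phi> i - \<phi> j) (\<phi> i - \<phi> j)"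
          unfolding form_A_test[OF d d] by (rule member_le_sum[OF b(2)]) (auto intro: finite_indices)
        also have "\<dots> \<le> C * form_A m \<Omega> (\<phi> i - \<phi> j) (\<phi> i - \<phi> j)" using C(2)[OF a(1) d] .
        also have "\<dots> \<le> C * (e / C)" using K[OF that] C(1) unfolding V_norm_def by (simp del: times_divide_eq_right)
        finally show ?thesis using C(1) by simp
      qed
      then show ?thesis by blast
    qed
    then show ?thesis
      by (rule riesz_fischer[OF test_L2[OF test_partials[OF phi b(1)]]]) blast+
  qed
  note ex = this
  define g where "g \<alpha> = (SOME g. g \<in> Lp M 2 \<and> (\<lambda>n. \<integral>x. (g x - partials (rev \<alpha>) (\<phi> n) x)\<^sup>2 \<partial>M) \<longlonglongrightarrow> 0)" for \<alpha>
  have g: "\<And>k \<alpha>. k \<le> m \<Longrightarrow> \<alpha> \<in> indices k \<Longrightarrow> g \<alpha> \<in> Lp M 2"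
    "\<And>k \<alpha>. k \<le> m \<Longrightarrow> \<alpha> \<in> indices k \<Longrightarrow> (\<lambda>n. \<integral>x. (g \<alpha> x - partials (rev \<alpha>) (\<phi> n) x)\<^sup>2 \<partial>M) \<longlonglongrightarrow> 0"
    using someI_ex[OF ex] unfolding g_def by blast+
  have L2_lim: "(\<lambda>n. \<integral>x. partials (rev \<alpha>) (\<phi> n) x * h x \<partial>M) \<longlonglongrightarrow> (\<integral>x. g \<alpha> x * h x \<partial>M)"
    if "h \<in> Lp M 2" "k \<le> m" "\<alpha> \<in> indices k" for h k and \<alpha> :: "'a list"
  proof (rule L2.B_tendsto[OF g(1)[OF that(2,3)] that(1)])
    show "partials (rev \<alpha>) (\<phi> n) \<in> Lp M 2" for n using indices_Basis[OF that(3)] by (intro test_L2 test_partials phi) auto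
    have "(\<lambda>n. sqrt (\<integral>x. (g \<alpha> x - partials (rev \<alpha>) (\<phi> n) x)\<^sup>2 \<partial>M)) \<longlonglongrightarrow> sqrt 0"
      by (intro tendsto_real_sqrt g(2)[OF that(2,3)])
    then show "(\<lambda>n. L2.nrm M (g \<alpha> - partials (rev \<alpha>) (\<phi> n))) \<longlonglongrightarrow> 0" by (simp add: L2.nrm_def power2_eq_square)
  qed
  have e: "([] :: 'a list) \<in> indices 0" by (simp add: indices_def)
  define v where "v = g []"
  have wd: "is_weak_deriv \<Omega> \<alpha> v (g \<alpha>)" if a: "k \<le> m" "\<alpha> \<in> indices k" for k and \<alpha> :: "'a list"
  proof -
    have "pairing \<Omega> v (partials \<alpha> \<psi>) = (-1) ^ length \<alpha> * pairing \<Omega> (g \<alpha>) \<psi>" if psi: "\<psi> \<in> \<D>" for \<psi>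
    proof (rule LIMSEQ_unique)
      have "(\<lambda>n. \<integral>x. partials (rev []) (\<phi> n) x * partials \<alpha> \<psi> x \<partial>M) \<longlonglongrightarrow> (\<integral>x. g [] x * partials \<alpha> \<psi> x \<partial>M)"
        using L2_lim[OF test_L2[OF test_partials[OF psi indices_Basis[OF a(2)]]] _ e] by simp
      then show "(\<lambda>n. \<integral>x. \<phi> n x * partials \<alpha> \<psi> x \<partial>M) \<longlonglongrightarrow> pairing \<Omega> v (partials \<alpha> \<psi>)" by (simp add: v_def pairing_def)
      have "(\<lambda>n. (-1) ^ length \<alpha> * (\<integral>x. partials (rev \<alpha>) (\<phi> n) x * \<psi> x \<partial>M)) \<longlonglongrightarrow> (-1) ^ length \<alpha> * pairing \<Omega> (g \<alpha>) \<psi>"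
        unfolding pairing_def by (intro tendsto_mult_left L2_lim[OF test_L2[OF psi] a])
      then show "(\<lambda>n. \<integral>x. \<phi> n x * partials \<alpha> \<psi> x \<partial>M) \<longlonglongrightarrow> (-1) ^ length \<alpha> * pairing \<Omega> (g \<alpha>) \<psi>"
        by (simp add: test_weak_derivative[OF phi psi indices_Basis[OF a(2)]])
    qed
    then show ?thesis using g(1)[OF a] unfolding is_weak_deriv_def by blast
  qed
  have v: "v \<in> sobolev_H m \<Omega>" unfolding sobolev_H_def using wd g(1)[OF _ e] v_def by auto
  have lim: "(\<lambda>n. form_A k \<Omega> (v - \<phi> n) (v - \<phi> n)) \<longlonglongrightarrow> 0" if k: "k \<le> m" for k
  proof -
    have "form_A k \<Omega> (v - \<phi> n) (v - \<phi> n) = (\<Sum>\<alpha>\<in>indices k. \<integral>x. (g \<alpha> x - partials (rev \<alpha>) (\<phi> n) x)\<^sup>2 \<partial>M)" for n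
    proof -
      have d: "v - \<phi> n \<in> sobolev_H m \<Omega>" using v test_sobolev[OF phi] sobolev_subspace subspace_diff by blast
      have w: "is_weak_deriv \<Omega> \<alpha> (v - \<phi> n) (g \<alpha> - partials (rev \<alpha>) (\<phi> n))" if "\<alpha> \<in> indices k" for \<alpha>
        using is_weak_deriv_add[OF wd[OF k that] is_weak_deriv_scale[OF is_weak_deriv_test[OF phi indices_Basis[OF that]], of "-1" n]
          sobolev_L2[OF v] test_L2[OF test_scale[OF phi]] indices_Basis[OF that]] by simp
      have "form_A k \<Omega> (v - \<phi> n) (v - \<phi> n) = (\<Sum>\<alpha>\<in>indices k. \<integral>x. (g \<alpha> - partials (rev \<alpha>) (\<phi> n)) x * (g \<alpha> - partials (rev \<alpha>) (\<phi> n)) x \<partial>M)"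
        by (rule form_A_cong[OF d d k w w])
      then show ?thesis by (simp add: power2_eq_square)
    qed
    moreover have "(\<lambda>n. \<Sum>\<alpha>\<in>indices k. \<integral>x. (g \<alpha> x - partials (rev \<alpha>) (\<phi> n) x)\<^sup>2 \<partial>M) \<longlonglongrightarrow> 0"
      by (rule tendsto_null_sum) (rule g(2)[OF k])
    ultimately show ?thesis by simp
  qed
  have "(\<lambda>n. sqrt (\<Sum>k\<le>m. form_A k \<Omega> (v - \<phi> n) (v - \<phi> n))) \<longlonglongrightarrow> sqrt 0"
    by (intro tendsto_real_sqrt tendsto_null_sum lim) simp
  then have "v \<in> sobolev_H0 m \<Omega>" unfolding sobolev_H0_def sobolev_norm_def using v phi by auto
  moreover have "(\<lambda>n. V_norm m \<Omega> (v - \<phi> n)) \<longlonglongrightarrow> 0"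
    unfolding V_norm_def using tendsto_real_sqrt[OF lim[OF order_refl]] by simp
  ultimately show ?thesis using that by blast
qed

end


context planar_domain begin

text \<open>
  Ladyzhenskaya's inequality holds for an approximating sequence of test functions; along an
  almost everywhere convergent subsequence Fatou's lemma carries it over to the limit.
\<close>

lemma H0_L4:
  assumes m: "m \<ge> 1"
  shows "\<exists>C>0. \<forall>v\<in>sobolev_H0 m \<Omega>. v \<in> Lp M 4 \<and> (\<integral>x. v x ^ 4 \<partial>M) \<le> C * (form_A m \<Omega> v v)\<^sup>2"
proof -
  obtain C where C: "C > 0" "\<And>\<phi>. \<phi> \<in> \<D> \<Longrightarrow> (\<integral>x. \<phi> x ^ 4 \<partial>M)
     \<le> C * (\<integral>x. (partials [axis 1 1] \<phi> x)\<^sup>2 \<partial>M) * (\<integral>x. (partials [axis 2 1] \<phi> x)\<^sup>2 \<partial>M)"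
    using ladyzhenskaya_test by blast
  obtain B where B: "B > 0" "\<And>k \<phi>. k \<le> m \<Longrightarrow> \<phi> \<in> \<D> \<Longrightarrow> form_A k \<Omega> \<phi> \<phi> \<le> B * form_A m \<Omega> \<phi> \<phi>" using form_A_test_mono by metis
  have tst: "(\<integral>x. \<phi> x ^ 4 \<partial>M) \<le> (C * B\<^sup>2) * (form_A m \<Omega> \<phi> \<phi>)\<^sup>2" if phi: "\<phi> \<in> \<D>" for \<phi>
  proof -
    have le: "(\<integral>x. (partials [b] \<phi> x)\<^sup>2 \<partial>M) \<le> B * form_A m \<Omega> \<phi> \<phi>" if "b \<in> Basis" for b
    proof -
      have "(\<integral>x. partials [b] \<phi> x * partials [b] \<phi> x \<partial>M) \<le> form_A 1 \<Omega> \<phi> \<phi>"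
        unfolding form_A_test[OF phi phi]
        by (rule member_le_sum[of "[b]" _ "\<lambda>\<alpha>. \<integral>x. partials \<alpha> \<phi> x * partials \<alpha> \<phi> x \<partial>M"]) (use \<open>b \<in> Basis\<close> finite_indices in \<open>auto simp: indices_def\<close>)
      also have "\<dots> \<le> B * form_A m \<Omega> \<phi> \<phi>" using B(2)[OF m phi] .
      finally show ?thesis by (simp add: power2_eq_square)
    qed
    have "(\<integral>x. \<phi> x ^ 4 \<partial>M) \<le> C * ((\<integral>x. (partials [axis 1 1] \<phi> x)\<^sup>2 \<partial>M) * (\<integral>x. (partials [axis 2 1] \<phi> x)\<^sup>2 \<partial>M))"
      using C(2)[OF phi] by (simp add: mult.assoc del: partials.simps)
    also have "\<dots> \<le> C * ((B * form_A m \<Omega> \<phi> \<phi>) * (B * form_A m \<Omega> \<phi> \<phi>))"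
      using C(1) le[of "axis 1 1"] le[of "axis 2 1"]
        mult_nonneg_nonneg[OF less_imp_le[OF B(1)] semi_inner.B_nonneg[OF semi_inner_H0[OF order_refl] test_H0[OF phi]]]
      by (intro mult_left_mono mult_mono) (auto simp: Basis_real2 simp del: partials.simps)
    finally show ?thesis by (simp add: power2_eq_square algebra_simps)
  qed
  have "v \<in> Lp M 4 \<and> (\<integral>x. v x ^ 4 \<partial>M) \<le> (C * B\<^sup>2) * (form_A m \<Omega> v v)\<^sup>2" if v: "v \<in> sobolev_H0 m \<Omega>" for v
  proof -
    obtain \<phi> where phi: "\<And>n::nat. \<phi> n \<in> \<D>" "\<And>k. k \<le> m \<Longrightarrow> (\<lambda>n. semi_inner.nrm (form_A k \<Omega>) (v - \<phi> n)) \<longlonglongrightarrow> 0"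
      using H0_approx[OF v] by metis
    note v2 = sobolev_L2[OF H0_sobolev[OF v]]
    interpret A0: semi_inner "sobolev_H0 m \<Omega>" "form_A 0 \<Omega>" by (rule semi_inner_H0) simp
    interpret A: semi_inner "sobolev_H0 m \<Omega>" "form_A m \<Omega>" by (rule semi_inner_H0) simp
    have "A0.nrm (v - \<phi> n) = sqrt (\<integral>x. (v x - \<phi> n x)\<^sup>2 \<partial>M)" for n
      using form_A_0[OF L2.W_intros(3)[OF v2 test_L2[OF phi(1)]] L2.W_intros(3)[OF v2 test_L2[OF phi(1)]], of n n]
      by (simp add: A0.nrm_def power2_eq_square)
    then have "(\<lambda>n. (sqrt (\<integral>x. (v x - \<phi> n x)\<^sup>2 \<partial>M))\<^sup>2) \<longlonglongrightarrow> 0\<^sup>2"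
      using phi(2)[of 0] by (intro tendsto_power) simp
    then have l0: "(\<lambda>n. \<integral>x. norm ((v x - \<phi> n x)\<^sup>2) \<partial>M) \<longlonglongrightarrow> 0" by simp
    have "\<exists>r. strict_mono r \<and> (AE x in M. (\<lambda>n. (v x - \<phi> (r n) x)\<^sup>2) \<longlonglongrightarrow> 0)"
      using L2.W_intros(3)[OF v2 test_L2[OF phi(1)]] l0 
      by (intro tendsto_L1_AE_subseq[of M "\<lambda>n x. (v x - \<phi> n x)\<^sup>2"]) (auto simp: Lp2_iff)
    then obtain r where r: "strict_mono r" "AE x in M. (\<lambda>n. (v x - \<phi> (r n) x)\<^sup>2) \<longlonglongrightarrow> 0" by blast
    have lim: "AE x in M. (\<lambda>n. \<phi> (r n) x ^ 4) \<longlonglongrightarrow> v x ^ 4"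
      using r(2)
    proof eventually_elim
      case (elim x)
      then have "(\<lambda>n. sqrt ((v x - \<phi> (r n) x)\<^sup>2)) \<longlonglongrightarrow> sqrt 0" by (rule tendsto_real_sqrt)
      then have "(\<lambda>n. v x - \<phi> (r n) x) \<longlonglongrightarrow> 0" by (simp add: tendsto_rabs_zero_iff)
      from tendsto_diff[OF tendsto_const this, of "v x"] have "(\<lambda>n. \<phi> (r n) x) \<longlonglongrightarrow> v x" by simp
      then show ?case by (rule tendsto_power)
    qed
    have lA: "(\<lambda>n. (C * B\<^sup>2) * (form_A m \<Omega> (\<phi> (r n)) (\<phi> (r n)))\<^sup>2) \<longlonglongrightarrow> (C * B\<^sup>2) * (form_A m \<Omega> v v)\<^sup>2"
    proof -
      have "(\<lambda>n. ((A.nrm (\<phi> (r n)))\<^sup>2)\<^sup>2) \<longlonglongrightarrow> ((A.nrm v)\<^sup>2)\<^sup>2"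
        using LIMSEQ_subseq_LIMSEQ[OF A.nrm_tendsto[OF v test_H0[OF phi(1)] phi(2)[OF order_refl]] r(1)]
        by (intro tendsto_power) (simp add: o_def)
      then show ?thesis using A.nrm_sq[OF v] A.nrm_sq[OF test_H0[OF phi(1)]] by (intro tendsto_mult_left) simp
    qed
    have "integrable M (\<lambda>x. v x ^ 4) \<and> (\<integral>x. v x ^ 4 \<partial>M) \<le> (C * B\<^sup>2) * (form_A m \<Omega> v v)\<^sup>2"
    proof (rule fatou_bound[OF _ _ tst _ lim lA])
      show "integrable M (\<lambda>x. \<phi> (r n) x ^ 4)" for n
      proof -
        have "(\<lambda>x. \<phi> (r n) x * (\<phi> (r n) x * (\<phi> (r n) x * \<phi> (r n) x))) \<in> \<D>"
          by (intro test_mult phi smooth_mult test_smooth[OF phi(1)])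
        from integrable_test[OF this] show ?thesis by (simp add: power4_eq_xxxx mult.assoc)
      qed
      show "(\<lambda>x. v x ^ 4) \<in> borel_measurable M" using v2 by (auto simp: Lp2_iff)
    qed (auto simp: phi)
    then show ?thesis using v2 by (simp add: Lp4_iff Lp2_iff)
  qed
  then show ?thesis using C(1) B(1) by (intro exI[of _ "C * B\<^sup>2"]) auto
qed

end

section \<open>The implicit Euler scheme\<close>

text \<open>
  The Taylor expansion of the double-well potential, whose derivative is \<open>phi\<close>. All
  terms beyond first order contain \<open>s\<^sup>2 y\<^sup>2\<close>, and for
  \<open>\<bar>s\<bar> \<le> 1\<close> the remaining factor grows at most quadratically in
  \<open>x\<close> and \<open>y\<close>.
\<close>

lemma double_well_expansion:
  fixes x y s :: real assumes "\<bar>s\<bar> \<le> 1"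
  shows "((x + s * y)\<^sup>2 - 1)\<^sup>2 / 4 \<le> (x\<^sup>2 - 1)\<^sup>2 / 4 + s * (phi x * y) + s\<^sup>2 * (2 * (x ^ 4 + y ^ 4))"
proof -
  have s2: "s\<^sup>2 \<le> 1" using assms by (simp add: abs_square_le_1)
  have e: "((x + s * y)\<^sup>2 - 1)\<^sup>2 / 4 = (x\<^sup>2 - 1)\<^sup>2 / 4 + s * (phi x * y) + s\<^sup>2 * ((3 * x\<^sup>2 - 1) * y\<^sup>2 / 2 + x * (s * y) * y\<^sup>2 + s\<^sup>2 * y ^ 4 / 4)"
    unfolding phi_def by (simp add: field_simps power2_eq_square power3_eq_cube power4_eq_xxxx)
  have q: "a\<^sup>2 * b\<^sup>2 \<le> (a ^ 4 + b ^ 4) / 2" for a b :: real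
    using sum_squares_bound[of "a\<^sup>2" "b\<^sup>2"] by simp
  have "x * (s * y) \<le> (x\<^sup>2 + (s * y)\<^sup>2) / 2" using sum_squares_bound[of x "s * y"] by simp
  also have "\<dots> \<le> (x\<^sup>2 + y\<^sup>2) / 2" using s2 by (simp add: power_mult_distrib mult_left_le_one_le)
  finally have "x * (s * y) * y\<^sup>2 \<le> (x\<^sup>2 + y\<^sup>2) / 2 * y\<^sup>2" by (rule mult_right_mono) simp
  moreover have "s\<^sup>2 * y ^ 4 / 4 \<le> y ^ 4 / 4" using s2 by (simp add: mult_left_le_one_le)
  moreover have "y\<^sup>2 * y\<^sup>2 = y ^ 4" by (simp flip: power_add)
  ultimately have "(3 * x\<^sup>2 - 1) * y\<^sup>2 / 2 + x * (s * y) * y\<^sup>2 + s\<^sup>2 * y ^ 4 / 4 \<le> 2 * (x\<^sup>2 * y\<^sup>2) + 3 / 4 * y ^ 4"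
  proof -
    assume 1: "x * (s * y) * y\<^sup>2 \<le> (x\<^sup>2 + y\<^sup>2) / 2 * y\<^sup>2" and 2: "s\<^sup>2 * y ^ 4 / 4 \<le> y ^ 4 / 4" and 3: "y\<^sup>2 * y\<^sup>2 = y ^ 4"
    have "(x\<^sup>2 + y\<^sup>2) / 2 * y\<^sup>2 = (x\<^sup>2 * y\<^sup>2) / 2 + y ^ 4 / 2" unfolding 3[symmetric] by (simp add: algebra_simps)
    moreover have "(3 * x\<^sup>2 - 1) * y\<^sup>2 / 2 = 3 / 2 * (x\<^sup>2 * y\<^sup>2) - y\<^sup>2 / 2" by (simp add: algebra_simps diff_divide_distrib)
    ultimately show ?thesis using 1 2 zero_le_power2[of y] by linarith
  qed
  also have "\<dots> \<le> 2 * (x ^ 4 + y ^ 4)"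
  proof -
    have "2 * p + 3 / 4 * b \<le> 2 * (a + b)" if "p \<le> (a + b) / 2" "0 \<le> a" "0 \<le> b" for p a b :: real
      using that by simp
    from this[OF q[of x y]] show ?thesis by simp
  qed
  finally show ?thesis unfolding e by (simp add: mult_left_mono)
qed

text \<open>
  Adding \<open>s\<close> to \<open>phi s\<close> gives the increasing function
  \<open>s\<^sup>3\<close>.
\<close>

lemma phi_almost_monotone: "(phi x - phi y) * (x - y) \<ge> - ((x - y)\<^sup>2)"
proof -
  have "(phi x - phi y) * (x - y) = (x - y)\<^sup>2 * ((x + y / 2)\<^sup>2 + 3 / 4 * y\<^sup>2) - (x - y)\<^sup>2"
    unfolding phi_def by (simp add: field_simps power2_eq_square power3_eq_cube)
  then show ?thesis by simp
qed

text \<open>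
  The terms \<open>y j\<close> are the dissipation; they are kept on the left-hand side because
  their sum, rather than \<open>x n\<close>, is what the comparison of two schemes is about.
\<close>

lemma discrete_gronwall:
  fixes x y b :: "nat \<Rightarrow> real"
  assumes "x 0 = 0" "0 \<le> a" "\<And>j. 0 \<le> b j" "\<And>j. 0 \<le> y j"
    and step: "\<And>j. j < n \<Longrightarrow> x (Suc j) + y j \<le> (1 + a) * x j + b j"
  shows "x n + (\<Sum>j<n. y j) \<le> (1 + a) ^ n * (\<Sum>j<n. b j)"
  using step
proof (induction n)
  case (Suc n)
  have "x (Suc n) + (\<Sum>j<Suc n. y j) \<le> (1 + a) * x n + b n + (\<Sum>j<n. y j)"
    using Suc.prems[of n] by simp
  also have "\<dots> \<le> (1 + a) * (x n + (\<Sum>j<n. y j)) + b n"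
    using assms(2) sum_nonneg[of "{..<n}" y] assms(4) by (simp add: algebra_simps)
  also have "\<dots> \<le> (1 + a) * ((1 + a) ^ n * (\<Sum>j<n. b j)) + (1 + a) ^ Suc n * b n"
    using Suc assms(2,3) one_le_power[of "1 + a" "Suc n"] by (intro add_mono mult_left_mono) (auto intro: mult_right_mono[of 1 _ "b n", simplified])
  finally show ?case by (simp add: algebra_simps)
qed (use assms in simp)

lemma sum_div_block:
  fixes g :: "nat \<Rightarrow> real" assumes "r > 0"
  shows "(\<Sum>j<r * N. g (j div r)) = real r * (\<Sum>k<N. g k)"
proof -
  have "(\<Sum>j<N * r. g (j div r)) = (\<Sum>k<N. sum (\<lambda>j. g (j div r)) {k * r..<k * r + r})"
    by (rule sum.nat_group[symmetric])
  also have "\<dots> = (\<Sum>k<N. sum (\<lambda>j. g k) {k * r..<k * r + r})"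
  proof (intro sum.cong refl)
    fix k j assume "j \<in> {k * r..<k * r + r}"
    then have "j div r = k" using assms by (intro div_nat_eqI) (auto simp: mult.commute)
    then show "g (j div r) = g k" by simp
  qed
  finally show ?thesis by (simp add: mult.commute sum_distrib_left)
qed

text \<open>
  The setting of the scheme: a space of functions with a form that controls the norms of
  \<open>L\<^sup>2\<close> and \<open>L\<^sup>4\<close>. It has two instances, with the test
  functions as \<open>W\<close> for the schemes and with \<open>H\<^sub>0\<^sup>m\<close> as
  \<open>W\<close> for their limit.
\<close>

locale ginzburg_landau = finite_measure M + A: semi_inner W A
  for M :: "'a measure" and W :: "('a \<Rightarrow> real) set" and A +
  fixes C\<^sub>2 C\<^sub>4 :: real
  assumes C2_pos: "0 < C\<^sub>2" and C4_pos: "0 < C\<^sub>4"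
    and W_L2: "v \<in> W \<Longrightarrow> v \<in> Lp M 2" and W_L4: "v \<in> W \<Longrightarrow> v \<in> Lp M 4"
    and embed2: "v \<in> W \<Longrightarrow> (\<integral>x. (v x)\<^sup>2 \<partial>M) \<le> C\<^sub>2 * A v v"
    and embed4: "v \<in> W \<Longrightarrow> (\<integral>x. v x ^ 4 \<partial>M) \<le> C\<^sub>4 * (A v v)\<^sup>2"
begin

abbreviation ip (infix \<open>\<bullet>\<^sub>2\<close> 70) where "ip u v \<equiv> (\<integral>x. u x * v x \<partial>M)"
abbreviation "nrm2 \<equiv> L2.nrm M"
text \<open>
  The potential \<open>(s\<^sup>2 - 1)\<^sup>2 / 4\<close> is nonnegative and has the derivative
  \<open>phi\<close>. So the energy is nonnegative, and \<open>A u + dwell u\<close> is its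
  derivative at \<open>u\<close>.
\<close>

definition well :: "('a \<Rightarrow> real) \<Rightarrow> real" where "well v = (\<integral>x. ((v x)\<^sup>2 - 1)\<^sup>2 / 4 \<partial>M)"
definition dwell :: "('a \<Rightarrow> real) \<Rightarrow> ('a \<Rightarrow> real) \<Rightarrow> real" where "dwell u v = (\<integral>x. phi (u x) * v x \<partial>M)"
definition energy :: "('a \<Rightarrow> real) \<Rightarrow> real" where "energy v = A v v / 2 + well v"

lemma embed2_nrm: "v \<in> W \<Longrightarrow> nrm2 v \<le> sqrt C\<^sub>2 * A.nrm v"
  using real_sqrt_le_mono[OF embed2] by (simp add: L2.nrm_def A.nrm_def real_sqrt_mult power2_eq_square)

lemma integrable_poly4:
  assumes "u \<in> Lp M 4" "v \<in> Lp M 4" "g \<in> borel_measurable M" "\<And>x. \<bar>g x\<bar> \<le> C * (1 + u x ^ 4 + v x ^ 4)"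
  shows "integrable M g"
proof (rule Bochner_Integration.integrable_bound)
  show "integrable M (\<lambda>x. C * (1 + u x ^ 4 + v x ^ 4))" using assms(1,2) by (auto simp: Lp4_iff)
  show "AE x in M. norm (g x) \<le> norm (C * (1 + u x ^ 4 + v x ^ 4))"
    using assms(4) by (intro AE_I2) (metis abs_ge_self order_trans real_norm_def)
qed fact

lemma quartic_bounds:
  fixes x y :: real
  shows "\<bar>(x\<^sup>2 - 1)\<^sup>2 / 4\<bar> \<le> 1 * (1 + x ^ 4 + y ^ 4)" "\<bar>phi x * y\<bar> \<le> 2 * (1 + x ^ 4 + y ^ 4)"
proof -
  have xy: "x ^ 4 = (x\<^sup>2)\<^sup>2" "y ^ 4 = (y\<^sup>2)\<^sup>2" by simp_all
  have b: "(x\<^sup>2 - 1)\<^sup>2 \<le> 2 * (x\<^sup>2)\<^sup>2 + 2" using zero_le_power2[of "x\<^sup>2 + 1"] by (simp add: power2_eq_square algebra_simps)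
  have gen: "\<bar>t / 4\<bar> \<le> 1 * (1 + a + b)" if "t \<le> 2 * a + 2" "0 \<le> a" "0 \<le> b" "0 \<le> t" for t a b :: real
    using that by simp
  show "\<bar>(x\<^sup>2 - 1)\<^sup>2 / 4\<bar> \<le> 1 * (1 + x ^ 4 + y ^ 4)"
    unfolding xy by (rule gen[OF b]) simp_all
  have "\<bar>phi x * y\<bar> = \<bar>x * y\<bar> * \<bar>x\<^sup>2 - 1\<bar>" unfolding phi_def
    by (simp add: abs_mult[symmetric] power2_eq_square power3_eq_cube algebra_simps)
  also have "\<dots> \<le> ((x\<^sup>2 + y\<^sup>2) / 2) * (x\<^sup>2 + 1)"
    using sum_squares_bound[of "\<bar>x\<bar>" "\<bar>y\<bar>"] by (intro mult_mono) (auto simp: abs_mult abs_le_iff mult.assoc)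
  also have "\<dots> \<le> 2 * (1 + (x\<^sup>2)\<^sup>2 + (y\<^sup>2)\<^sup>2)"
  proof -
    have "0 \<le> (x\<^sup>2 - 1)\<^sup>2" "0 \<le> (y\<^sup>2 - 1)\<^sup>2" "0 \<le> (x\<^sup>2 - y\<^sup>2)\<^sup>2" "0 \<le> (y\<^sup>2)\<^sup>2" "0 \<le> (x\<^sup>2)\<^sup>2" by simp_all
    then show ?thesis by (simp add: power2_eq_square algebra_simps)
  qed
  finally show "\<bar>phi x * y\<bar> \<le> 2 * (1 + x ^ 4 + y ^ 4)" unfolding xy .
qed

lemma phi_borel [measurable]: "phi \<in> borel_measurable borel"
  unfolding phi_def[abs_def] by measurable

lemma integrable_well: "v \<in> Lp M 4 \<Longrightarrow> integrable M (\<lambda>x. ((v x)\<^sup>2 - 1)\<^sup>2 / 4)"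
  by (rule integrable_poly4[OF _ _ _ quartic_bounds(1)]) (auto simp: Lp4_iff)

lemma integrable_dwell: "u \<in> Lp M 4 \<Longrightarrow> v \<in> Lp M 4 \<Longrightarrow> integrable M (\<lambda>x. phi (u x) * v x)"
  by (rule integrable_poly4[OF _ _ _ quartic_bounds(2)]) (auto simp: Lp4_iff)

lemma well_nonneg: "0 \<le> well v"
  unfolding well_def by (rule Bochner_Integration.integral_nonneg) simp

lemma energy_nonneg: "v \<in> W \<Longrightarrow> 0 \<le> energy v" "v \<in> W \<Longrightarrow> A v v \<le> 2 * energy v"
  using well_nonneg A.B_nonneg by (simp_all add: energy_def)

lemma dwell_add: "u \<in> W \<Longrightarrow> v \<in> W \<Longrightarrow> w \<in> W \<Longrightarrow> dwell u (v + w) = dwell u v + dwell u w"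
  unfolding dwell_def using integrable_dwell W_L4 by (simp add: distrib_left)

lemma dwell_scale: "dwell u (c *\<^sub>R v) = c * dwell u v"
  unfolding dwell_def by (simp add: mult.left_commute)

lemma well_expansion:
  assumes "u \<in> W" "v \<in> W" "\<bar>s\<bar> \<le> 1"
  shows "well (u + s *\<^sub>R v) \<le> well u + s * dwell u v + s\<^sup>2 * (2 * C\<^sub>4 * ((A u u)\<^sup>2 + (A v v)\<^sup>2))"
proof -
  note L = W_L4[OF assms(1)] W_L4[OF assms(2)]
  have i: "integrable M (\<lambda>x. u x ^ 4)" "integrable M (\<lambda>x. v x ^ 4)" using L by (auto simp: Lp4_iff)
  have "well (u + s *\<^sub>R v) \<le> (\<integral>x. ((u x)\<^sup>2 - 1)\<^sup>2 / 4 + s * (phi (u x) * v x) + s\<^sup>2 * (2 * (u x ^ 4 + v x ^ 4)) \<partial>M)"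
    unfolding well_def
  proof (rule integral_mono)
    show "integrable M (\<lambda>x. (((u + s *\<^sub>R v) x)\<^sup>2 - 1)\<^sup>2 / 4)" by (intro integrable_well W_L4 A.W_intros assms)
    show "integrable M (\<lambda>x. ((u x)\<^sup>2 - 1)\<^sup>2 / 4 + s * (phi (u x) * v x) + s\<^sup>2 * (2 * (u x ^ 4 + v x ^ 4)))"
      using i by (intro Bochner_Integration.integrable_add integrable_well integrable_mult_right integrable_dwell L) auto
    show "(((u + s *\<^sub>R v) x)\<^sup>2 - 1)\<^sup>2 / 4 \<le> ((u x)\<^sup>2 - 1)\<^sup>2 / 4 + s * (phi (u x) * v x) + s\<^sup>2 * (2 * (u x ^ 4 + v x ^ 4))" for x
      using double_well_expansion[OF assms(3), of "u x" "v x"] by simp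
  qed
  also have "\<dots> = well u + s * dwell u v + s\<^sup>2 * (2 * ((\<integral>x. u x ^ 4 \<partial>M) + (\<integral>x. v x ^ 4 \<partial>M)))"
    unfolding well_def dwell_def using i integrable_well[OF L(1)] integrable_dwell[OF L] by simp
  also have "\<dots> \<le> well u + s * dwell u v + s\<^sup>2 * (2 * (C\<^sub>4 * (A u u)\<^sup>2 + C\<^sub>4 * (A v v)\<^sup>2))"
    using embed4[OF assms(1)] embed4[OF assms(2)] by (intro add_left_mono mult_left_mono add_mono) auto
  finally show ?thesis by (simp add: algebra_simps)
qed

lemma dwell_almost_monotone:
  assumes "u \<in> W" "w \<in> W"
  shows "dwell u (u - w) - dwell w (u - w) \<ge> - (nrm2 (u - w))\<^sup>2"
proof -
  note L = W_L4[OF assms(1)] W_L4[OF assms(2)] W_L4[OF A.W_intros(3)[OF assms]]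
  have i2: "integrable M (\<lambda>x. (u x - w x)\<^sup>2)" using W_L2[OF A.W_intros(3)[OF assms]] by (simp add: Lp2_iff)
  have "- (nrm2 (u - w))\<^sup>2 = (\<integral>x. - ((u x - w x)\<^sup>2) \<partial>M)"
    using L2.nrm_sq[OF W_L2[OF A.W_intros(3)[OF assms]]] by (simp add: power2_eq_square)
  also have "\<dots> \<le> (\<integral>x. phi (u x) * (u - w) x - phi (w x) * (u - w) x \<partial>M)"
  proof (rule integral_mono)
    show "integrable M (\<lambda>x. - ((u x - w x)\<^sup>2))" using i2 by simp
    show "integrable M (\<lambda>x. phi (u x) * (u - w) x - phi (w x) * (u - w) x)"
      by (intro Bochner_Integration.integrable_diff integrable_dwell L)
    show "- ((u x - w x)\<^sup>2) \<le> phi (u x) * (u - w) x - phi (w x) * (u - w) x" for x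
      using phi_almost_monotone[of "u x" "w x"] by (simp add: algebra_simps)
  qed
  also have "\<dots> = dwell u (u - w) - dwell w (u - w)"
    unfolding dwell_def by (intro Bochner_Integration.integral_diff integrable_dwell L)
  finally show ?thesis .
qed

text \<open>
  The defect of \<open>u\<close> in the weak form of one implicit Euler step of size
  \<open>h\<close> from \<open>u0\<close> with source \<open>F\<close>.
\<close>

definition residual where
  "residual h u0 F u v = (u - u0) \<bullet>\<^sub>2 v / h + A u v + dwell u v - F \<bullet>\<^sub>2 v"

lemma residual_scale:
  assumes "u0 \<in> W" "F \<in> Lp M 2" "u \<in> W" "v \<in> W"
  shows "residual h u0 F u (c *\<^sub>R v) = c * residual h u0 F u v"
  using assms L2.B_scale2[of v M "u - u0" c] L2.B_scale2[of v M F c] W_L2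
  by (simp add: residual_def dwell_scale A.B_scale2 algebra_simps)

text \<open>
  The functional \<open>J\<close> is bounded below, so some \<open>u\<close> in \<open>W\<close>
  comes within \<open>\<delta>\<close> of its infimum. For \<open>v\<close> in the unit ball,
  \<open>J (u + t v) \<le> J u + t residual + t\<^sup>2 K\<close>, so that \<open>t residual
  \<ge> - \<delta> - t\<^sup>2 K\<close> for \<open>t\<close> of either sign; at \<open>t =
  s\<close> and \<open>t = - s\<close> this gives \<open>\<bar>residual\<bar> \<le> \<delta> / s
  + s K \<le> \<epsilon>\<close>. The argument stays within \<open>W\<close>, which may be an
  incomplete space such as that of the test functions.
\<close>

lemma euler_step_exists:
  assumes h: "h > 0" and u0: "u0 \<in> W" and F: "F \<in> Lp M 2" and \<epsilon>: "\<epsilon> > 0"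
  shows "\<exists>u\<in>W. (nrm2 (u - u0))\<^sup>2 / (2 * h) + energy u - F \<bullet>\<^sub>2 u \<le> energy u0 - F \<bullet>\<^sub>2 u0 + \<epsilon>
    \<and> (\<forall>v\<in>W. \<bar>residual h u0 F u v\<bar> \<le> \<epsilon> * A.nrm v)"
proof -
  define J where "J u = (nrm2 (u - u0))\<^sup>2 / (2 * h) + energy u - F \<bullet>\<^sub>2 u" for u
  define b where "b = nrm2 F * sqrt C\<^sub>2"
  have coercive: "(A.nrm u)\<^sup>2 / 4 - b\<^sup>2 \<le> J u" if u: "u \<in> W" for u
  proof -
    have "F \<bullet>\<^sub>2 u \<le> nrm2 F * nrm2 u" using L2.cauchy_schwarz[OF F W_L2[OF u]] by (simp add: abs_le_iff)
    also have "\<dots> \<le> b * A.nrm u" unfolding b_def using embed2_nrm[OF u] L2.nrm_nonneg[OF F] by (simp add: mult_left_mono mult.assoc)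
    also have "\<dots> \<le> b\<^sup>2 + (A.nrm u)\<^sup>2 / 4" using zero_le_power2[of "b - A.nrm u / 2"] by (simp add: power2_eq_square algebra_simps)
    finally have "F \<bullet>\<^sub>2 u \<le> b\<^sup>2 + (A.nrm u)\<^sup>2 / 4" .
    moreover have "(A.nrm u)\<^sup>2 / 2 \<le> energy u" using well_nonneg u by (simp add: energy_def A.nrm_sq)
    moreover have "0 \<le> (nrm2 (u - u0))\<^sup>2 / (2 * h)" using h by simp
    ultimately show ?thesis unfolding J_def by simp
  qed
  \<comment> \<open>\<open>R\<close> bounds \<open>A u u\<close> for near-minimisers, \<open>K\<close> the second-order term of \<open>J\<close> at \<open>u\<close>\<close>
  define R where "R = 4 * (J u0 + 1 + b\<^sup>2)"
  define K where "K = C\<^sub>2 / (2 * h) + 1 / 2 + 2 * C\<^sub>4 * (R\<^sup>2 + 1)"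
  have K: "K > 0" unfolding K_def using h C2_pos C4_pos by (intro add_pos_nonneg add_pos_pos) auto
  define s where "s = min 1 (\<epsilon> / (2 * K))"
  have s: "s > 0" "s \<le> 1" "s * K \<le> \<epsilon> / 2" using \<epsilon> K by (auto simp: s_def field_simps min_def)
  define \<delta> where "\<delta> = min (min 1 \<epsilon>) (\<epsilon> * s / 2)"
  have \<delta>: "\<delta> > 0" "\<delta> \<le> 1" "\<delta> \<le> \<epsilon>" "\<delta> \<le> \<epsilon> * s / 2" using \<epsilon> s by (auto simp: \<delta>_def)
  have bdd: "bdd_below (J ` W)" using coercive by (intro bdd_belowI[of _ "- b\<^sup>2"]) (force intro: order_trans[rotated])
  obtain u where u: "u \<in> W" "J u < Inf (J ` W) + \<delta>"
    using cInf_lessD[of "J ` W" "Inf (J ` W) + \<delta>"] u0 \<delta>(1) by auto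
  have low: "J u \<le> J w + \<delta>" if "w \<in> W" for w using u(2) cInf_lower[OF _ bdd, of "J w"] that by force
  have Au: "A u u \<le> R" using coercive[OF u(1)] low[OF u0] \<delta>(2) u(1) unfolding R_def by (simp add: A.nrm_sq)
  have resid: "\<bar>residual h u0 F u v\<bar> \<le> \<epsilon>" if v: "v \<in> W" and n: "A.nrm v \<le> 1" for v
  proof -
    have Av: "A v v \<le> 1" using n A.nrm_sq[OF v] A.nrm_nonneg[OF v] power_le_one by metis
    have ex: "- \<delta> \<le> t * residual h u0 F u v + t\<^sup>2 * K" if t: "\<bar>t\<bar> \<le> 1" for t
    proof -
      have w: "u + t *\<^sub>R v \<in> W" using u v by auto
      have "J (u + t *\<^sub>R v) = (nrm2 ((u - u0) + t *\<^sub>R v))\<^sup>2 / (2 * h) + A (u + t *\<^sub>R v) (u + t *\<^sub>R v) / 2 + well (u + t *\<^sub>R v) - (F \<bullet>\<^sub>2 u + t * (F \<bullet>\<^sub>2 v))"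
        unfolding J_def energy_def using L2.B_add2[OF W_L2[OF u(1)] L2.W_intros(4)[OF W_L2[OF v]] F, of t] L2.B_scale2[OF W_L2[OF v] F, of t]
        by (simp add: algebra_simps)
      also have "(nrm2 ((u - u0) + t *\<^sub>R v))\<^sup>2 = (nrm2 (u - u0))\<^sup>2 + 2 * t * ((u - u0) \<bullet>\<^sub>2 v) + t\<^sup>2 * (v \<bullet>\<^sub>2 v)"
      proof -
        have d: "u - u0 \<in> Lp M 2" using u u0 by (intro W_L2) auto
        show ?thesis
          using L2.B_quadratic[OF d W_L2[OF v], of t] L2.nrm_sq[OF d] L2.nrm_sq[OF L2.W_intros(2)[OF d L2.W_intros(4)[OF W_L2[OF v]]], of t]
          by simp
      qed
      also have "A (u + t *\<^sub>R v) (u + t *\<^sub>R v) = A u u + 2 * t * A u v + t\<^sup>2 * A v v" by (rule A.B_quadratic[OF u(1) v])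
      also have "((nrm2 (u - u0))\<^sup>2 + 2 * t * ((u - u0) \<bullet>\<^sub>2 v) + t\<^sup>2 * (v \<bullet>\<^sub>2 v)) / (2 * h) + (A u u + 2 * t * A u v + t\<^sup>2 * A v v) / 2
          + well (u + t *\<^sub>R v) - (F \<bullet>\<^sub>2 u + t * (F \<bullet>\<^sub>2 v))
        \<le> ((nrm2 (u - u0))\<^sup>2 + 2 * t * ((u - u0) \<bullet>\<^sub>2 v) + t\<^sup>2 * (v \<bullet>\<^sub>2 v)) / (2 * h) + (A u u + 2 * t * A u v + t\<^sup>2 * A v v) / 2
          + (well u + t * dwell u v + t\<^sup>2 * (2 * C\<^sub>4 * ((A u u)\<^sup>2 + (A v v)\<^sup>2))) - (F \<bullet>\<^sub>2 u + t * (F \<bullet>\<^sub>2 v))"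
        using well_expansion[OF u(1) v t] by simp
      also have "\<dots> = J u + t * residual h u0 F u v + t\<^sup>2 * ((v \<bullet>\<^sub>2 v) / (2 * h) + A v v / 2 + 2 * C\<^sub>4 * ((A u u)\<^sup>2 + (A v v)\<^sup>2))"
        unfolding J_def residual_def energy_def using h by (simp add: field_simps)
      also have "\<dots> \<le> J u + t * residual h u0 F u v + t\<^sup>2 * K"
      proof -
        have "v \<bullet>\<^sub>2 v \<le> C\<^sub>2 * A v v" using embed2[OF v] by (simp add: power2_eq_square)
        also have "\<dots> \<le> C\<^sub>2 * 1" using Av C2_pos by (intro mult_left_mono) auto
        finally have "(v \<bullet>\<^sub>2 v) / (2 * h) \<le> C\<^sub>2 / (2 * h)" using h by (simp add: divide_right_mono)
        moreover have "(A u u)\<^sup>2 \<le> R\<^sup>2" "(A v v)\<^sup>2 \<le> 1\<^sup>2" using Au Av A.B_nonneg[OF u(1)] A.B_nonneg[OF v] by (intro power_mono; simp)+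
        then have "2 * C\<^sub>4 * ((A u u)\<^sup>2 + (A v v)\<^sup>2) \<le> 2 * C\<^sub>4 * (R\<^sup>2 + 1)" using C4_pos by (intro mult_left_mono) auto
        ultimately have "(v \<bullet>\<^sub>2 v) / (2 * h) + A v v / 2 + 2 * C\<^sub>4 * ((A u u)\<^sup>2 + (A v v)\<^sup>2) \<le> K"
          unfolding K_def using Av by linarith
        then show ?thesis by (intro add_left_mono mult_left_mono) simp_all
      qed
      finally show ?thesis using low[OF w] by linarith
    qed
    have sc: "\<delta> + s\<^sup>2 * K \<le> \<epsilon> * s"
    proof -
      have "\<delta> \<le> \<epsilon> / 2 * s" using \<delta>(4) by simp
      moreover have "s * (s * K) \<le> s * (\<epsilon> / 2)" using s by (intro mult_left_mono) auto
      ultimately show ?thesis by (simp add: power2_eq_square algebra_simps)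
    qed
    have "- \<delta> \<le> s * residual h u0 F u v + s\<^sup>2 * K" "- \<delta> \<le> - (s * residual h u0 F u v) + s\<^sup>2 * K"
      using ex[of s] ex[of "- s"] s(1,2) by simp_all
    then have "s * residual h u0 F u v \<le> s * \<epsilon>" "s * (- residual h u0 F u v) \<le> s * \<epsilon>"
      using sc unfolding mult.commute[of s \<epsilon>] mult_minus_right by linarith+
    then show ?thesis using mult_left_le_imp_le[OF _ s(1)] by (simp only: abs_le_iff)
  qed
  have "\<bar>residual h u0 F u v\<bar> \<le> \<epsilon> * A.nrm v" if v: "v \<in> W" for v
  proof (rule field_le_epsilon)
    fix e :: real assume e: "e > 0"
    define c where "c = A.nrm v + e / \<epsilon>"
    have c: "c > 0" unfolding c_def using e \<epsilon> A.nrm_nonneg[OF v] by (simp add: add_nonneg_pos)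
    have "A.nrm ((1 / c) *\<^sub>R v) \<le> 1"
      using c e \<epsilon> A.nrm_nonneg[OF v] unfolding A.nrm_scale[OF v] by (simp add: c_def)
    from resid[OF A.W_intros(4)[OF v] this] have "\<bar>residual h u0 F u v\<bar> / c \<le> \<epsilon>"
      using c by (simp add: residual_scale[OF u0 F u(1) v] abs_mult)
    then have "\<bar>residual h u0 F u v\<bar> \<le> \<epsilon> * c" using c by (simp add: divide_le_eq)
    also have "\<epsilon> * c = \<epsilon> * A.nrm v + e" using \<epsilon> by (simp add: c_def distrib_left)
    finally show "\<bar>residual h u0 F u v\<bar> \<le> \<epsilon> * A.nrm v + e" .
  qed
  moreover have "J u \<le> energy u0 - F \<bullet>\<^sub>2 u0 + \<epsilon>"
  proof -
    have "J u0 = energy u0 - F \<bullet>\<^sub>2 u0" unfolding J_def diff_self L2.nrm_zero by simp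
    then show ?thesis using low[OF u0] \<delta>(3) by linarith
  qed
  ultimately show ?thesis using u(1) unfolding J_def by blast
qed

text \<open>
  Both properties of near-minimisers are recorded: the decrease of the functional yields the
  energy bounds, the small residual yields the equation.
\<close>

definition euler :: "real \<Rightarrow> real \<Rightarrow> (nat \<Rightarrow> 'a \<Rightarrow> real) \<Rightarrow> (nat \<Rightarrow> 'a \<Rightarrow> real) \<Rightarrow> bool" where
  "euler h \<epsilon> F U \<longleftrightarrow> U 0 = 0 \<and> (\<forall>k. U k \<in> W) \<and>
    (\<forall>k. (nrm2 (U (Suc k) - U k))\<^sup>2 / (2 * h) + energy (U (Suc k)) - F k \<bullet>\<^sub>2 U (Suc k) \<le> energy (U k) - F k \<bullet>\<^sub>2 U k + \<epsilon>) \<and>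
    (\<forall>k. \<forall>v\<in>W. \<bar>residual h (U k) (F k) (U (Suc k)) v\<bar> \<le> \<epsilon> * A.nrm v)"

lemma euler_exists:
  assumes "h > 0" "\<epsilon> > 0" "\<And>k. F k \<in> Lp M 2"
  shows "\<exists>U. euler h \<epsilon> F U"
proof -
  have "\<exists>U. \<forall>n. (U n \<in> W \<and> (n = 0 \<longrightarrow> U n = 0)) \<and>
    ((nrm2 (U (Suc n) - U n))\<^sup>2 / (2 * h) + energy (U (Suc n)) - F n \<bullet>\<^sub>2 U (Suc n) \<le> energy (U n) - F n \<bullet>\<^sub>2 U n + \<epsilon> \<and>
     (\<forall>v\<in>W. \<bar>residual h (U n) (F n) (U (Suc n)) v\<bar> \<le> \<epsilon> * A.nrm v))"
  proof (rule dependent_nat_choice)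
    show "\<exists>x. x \<in> W \<and> (0 = (0::nat) \<longrightarrow> x = 0)" using A.W_intros(1) by blast
  next
    fix x and n :: nat assume "x \<in> W \<and> (n = 0 \<longrightarrow> x = 0)"
    then show "\<exists>y. (y \<in> W \<and> (Suc n = 0 \<longrightarrow> y = 0)) \<and>
      ((nrm2 (y - x))\<^sup>2 / (2 * h) + energy y - F n \<bullet>\<^sub>2 y \<le> energy x - F n \<bullet>\<^sub>2 x + \<epsilon> \<and>
       (\<forall>v\<in>W. \<bar>residual h x (F n) y v\<bar> \<le> \<epsilon> * A.nrm v))"
      using euler_step_exists[OF assms(1) _ assms(3)[of n] assms(2), of x] by blast
  qed
  then show ?thesis unfolding euler_def by blast
qed

text \<open>
  The energies telescope. A step gains \<open>\<parallel>U\<^sub>k\<^sub>+\<^sub>1 -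
  U\<^sub>k\<parallel>\<^sup>2 / (2 h)\<close>, and Young's inequality spends half of it on the
  work \<open>(F\<^sub>k, U\<^sub>k\<^sub>+\<^sub>1 - U\<^sub>k)\<close> of the source.
\<close>

lemma euler_energy:
  assumes h: "h > 0" and e: "euler h \<epsilon> F U" and F: "\<And>k. F k \<in> Lp M 2"
  shows "energy (U K) + (\<Sum>k<K. (nrm2 (U (Suc k) - U k))\<^sup>2) / (4 * h) \<le> well 0 + h * (\<Sum>k<K. (nrm2 (F k))\<^sup>2) + K * \<epsilon>"
proof (induction K)
  case 0
  have "A 0 0 = 0" using A.nrm_sq[OF A.W_intros(1)] unfolding A.nrm_zero by simp
  then have "energy (U 0) = well 0" using e unfolding euler_def energy_def by simp
  then show ?case
    by (simp only: lessThan_0 sum.empty div_0 mult_zero_right of_nat_0 mult_zero_left add_0_right order_refl)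
next
  case (Suc K)
  have U: "U k \<in> W" for k using e by (simp add: euler_def)
  let ?d = "U (Suc K) - U K"
  have d: "?d \<in> Lp M 2" using U by (intro W_L2) auto
  have "(nrm2 ?d)\<^sup>2 / (2 * h) + energy (U (Suc K)) \<le> energy (U K) + F K \<bullet>\<^sub>2 ?d + \<epsilon>"
  proof -
    have "(nrm2 ?d)\<^sup>2 / (2 * h) + energy (U (Suc K)) - F K \<bullet>\<^sub>2 U (Suc K) \<le> energy (U K) - F K \<bullet>\<^sub>2 U K + \<epsilon>"
      using e unfolding euler_def by blast
    then show ?thesis using L2.B_diff2[OF W_L2[OF U] W_L2[OF U] F, of K "Suc K" K] by linarith
  qed
  also have "F K \<bullet>\<^sub>2 ?d \<le> nrm2 (F K) * nrm2 ?d" using L2.cauchy_schwarz[OF F d, of K] by (simp add: abs_le_iff)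
  also have "nrm2 (F K) * nrm2 ?d \<le> h * (nrm2 (F K))\<^sup>2 + (nrm2 ?d)\<^sup>2 / (4 * h)"
  proof -
    have "0 \<le> (2 * h * nrm2 (F K) - nrm2 ?d)\<^sup>2 / (4 * h)" using h by simp
    also have "\<dots> = h * (nrm2 (F K))\<^sup>2 + (nrm2 ?d)\<^sup>2 / (4 * h) - nrm2 (F K) * nrm2 ?d"
      using h by (simp add: power2_eq_square field_simps)
    finally show ?thesis by simp
  qed
  finally have "(nrm2 ?d)\<^sup>2 / (2 * h) + energy (U (Suc K)) \<le> energy (U K) + (h * (nrm2 (F K))\<^sup>2 + (nrm2 ?d)\<^sup>2 / (4 * h)) + \<epsilon>"
    by simp
  moreover have "(nrm2 ?d)\<^sup>2 / (2 * h) = 2 * ((nrm2 ?d)\<^sup>2 / (4 * h))" by simp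
  moreover have "(\<Sum>k<Suc K. (nrm2 (U (Suc k) - U k))\<^sup>2) / (4 * h) = (\<Sum>k<K. (nrm2 (U (Suc k) - U k))\<^sup>2) / (4 * h) + (nrm2 ?d)\<^sup>2 / (4 * h)"
    unfolding sum.lessThan_Suc add_divide_distrib by (rule refl)
  moreover have "h * (\<Sum>k<Suc K. (nrm2 (F k))\<^sup>2) = h * (\<Sum>k<K. (nrm2 (F k))\<^sup>2) + h * (nrm2 (F K))\<^sup>2"
    unfolding sum.lessThan_Suc distrib_left by (rule refl)
  moreover have "real (Suc K) * \<epsilon> = real K * \<epsilon> + \<epsilon>" by (simp add: algebra_simps)
  ultimately show ?case using Suc by linarith
qed

text \<open>
  The coarse scheme is interpolated linearly to the fine mesh; \<open>w\<close> is the distance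
  of the interpolant to the fine scheme, and \<open>z\<close> is the difference of the values
  that the two implicit equations contain. Testing both equations with \<open>z\<close> produces
  the dissipation \<open>A z z\<close> and, by almost monotonicity, the error
  \<open>\<parallel>z\<parallel>\<^sup>2\<close>. The discrepancy \<open>e = w - z\<close> is at
  most \<open>h\<close> times the slope \<open>D\<close> of the interpolant, and by hypothesis
  the squared increments sum up to \<open>O(h)\<close>. The discrete Gronwall inequality for
  \<open>\<parallel>w\<parallel>\<^sup>2\<close> then bounds the total dissipation.
\<close>

lemma euler_comparison:
  assumes \<tau>: "\<tau> > 0" and r: "r > 0" and h: "h = real r * \<tau>" and \<epsilon>: "0 \<le> \<epsilon>" "0 \<le> \<epsilon>'"
    and U: "euler h \<epsilon> F U" and u: "euler \<tau> \<epsilon>' f u"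
    and F: "\<And>k. F k \<in> Lp M 2" and f: "\<And>j. f j \<in> Lp M 2"
    and E: "(\<Sum>k<N. (nrm2 (U (Suc k) - U k))\<^sup>2) \<le> 4 * h * E"
      "(\<Sum>j<r * N. (nrm2 (u (Suc j) - u j))\<^sup>2) \<le> 4 * \<tau> * E"
  shows "(\<Sum>j<r * N. \<tau> * (A.nrm (U (Suc (j div r)) - u (Suc j)))\<^sup>2)
    \<le> exp (6 * (h * N)) * ((\<Sum>j<r * N. \<tau> * (nrm2 (F (j div r) - f j))\<^sup>2) + h * N * (\<epsilon> + \<epsilon>')\<^sup>2 + 240 * E * (h + h\<^sup>2))"
proof -
  have UW: "U k \<in> W" and uW: "u k \<in> W" for k using U u by (simp_all add: euler_def)
  have hp: "h > 0" "\<tau> \<le> h" using \<tau> r h by auto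
  define D where "D j = (1 / h) *\<^sub>R (U (Suc (j div r)) - U (j div r))" for j
  define d where "d j = (1 / \<tau>) *\<^sub>R (u (Suc j) - u j)" for j
  define w where "w j = (U (j div r) + (real (j mod r) / real r) *\<^sub>R (U (Suc (j div r)) - U (j div r))) - u j" for j
  define z where "z j = U (Suc (j div r)) - u (Suc j)" for j
  have W: "D j \<in> W" "d j \<in> W" "w j \<in> W" "z j \<in> W" for j
    unfolding D_def d_def w_def z_def by (intro A.W_intros UW uW)+
  note L = W[THEN W_L2]
  have w0: "w 0 = 0" using U u by (simp add: w_def euler_def)
  have w_step: "w (Suc j) = w j + \<tau> *\<^sub>R (D j - d j)" for j
  proof -
    have 1: "(U (Suc j div r) + (real (Suc j mod r) / real r) *\<^sub>R (U (Suc (Suc j div r)) - U (Suc j div r)))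
      = U (j div r) + ((real (j mod r) + 1) / real r) *\<^sub>R (U (Suc (j div r)) - U (j div r))"
    proof (cases "Suc (j mod r) = r")
      case True
      then have "Suc j div r = Suc (j div r)" "Suc j mod r = 0" by (simp_all add: div_Suc mod_Suc)
      moreover have "(real (j mod r) + 1) / real r = 1" using True r by (metis add.commute div_self of_nat_0_less_iff of_nat_Suc order_less_irrefl)
      ultimately show ?thesis by simp
    next
      case False
      then have "Suc j div r = j div r" "Suc j mod r = Suc (j mod r)" by (simp_all add: div_Suc mod_Suc)
      then show ?thesis by (simp add: add.commute)
    qed
    have "\<tau> / h = 1 / real r" using h \<tau> r by simp
    have 2: "w (Suc j) = (U (j div r) + ((real (j mod r) + 1) / real r) *\<^sub>R (U (Suc (j div r)) - U (j div r))) - u (Suc j)"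
      by (simp only: w_def[of "Suc j"] 1)
    show ?thesis unfolding 2 unfolding w_def D_def d_def using \<tau> \<open>\<tau> / h = 1 / real r\<close>
      by (simp add: scaleR_diff_right scaleR_left_distrib add_divide_distrib scaleR_add_left del: plus_fun_apply minus_apply scaleR_apply)
  qed
  \<comment> \<open>\<open>w\<close> moves with the slopes \<open>D\<close> and \<open>d\<close>, but the equations are tested with \<open>z\<close>; \<open>e\<close> corrects for this\<close>
  define e where "e j = w (Suc j) - z j" for j
  have eW: "e j \<in> W" for j unfolding e_def by (intro A.W_intros W)
  have e_norm: "nrm2 (e j) \<le> h * nrm2 (D j)" for j
  proof -
    define c where "c = (real (j mod r) + 1) / real r"
    have c: "0 \<le> c" "c \<le> 1" using r mod_less_divisor[of r j] unfolding c_def by (auto simp: divide_le_eq simp del: mod_less_divisor)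
    have rr: "real (j mod r) / real r + 1 / real r = c" unfolding c_def by (simp add: add_divide_distrib)
    have "\<tau> = h / real r" using h r by simp
    then have e1: "e j = ((c - 1) * h) *\<^sub>R D j"
    proof -
      have "w (Suc j) = U (j div r) + (real (j mod r) / real r) *\<^sub>R (h *\<^sub>R D j) - u j + (h / real r) *\<^sub>R D j - (u (Suc j) - u j)"
        unfolding w_step[of j] unfolding w_def using hp(1) r \<tau> \<open>\<tau> = h / real r\<close> unfolding D_def d_def by (simp add: scaleR_diff_right del: plus_fun_apply minus_apply scaleR_apply)
      also have "\<dots> = U (j div r) + (c * h) *\<^sub>R D j - u (Suc j)"
        unfolding rr[symmetric] by (simp add: algebra_simps del: plus_fun_apply minus_apply scaleR_apply)
      finally have w1: "w (Suc j) = U (j div r) + (c * h) *\<^sub>R D j - u (Suc j)" .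
      have "U (Suc (j div r)) = U (j div r) + h *\<^sub>R D j" unfolding D_def using hp(1) by (simp del: plus_fun_apply minus_apply scaleR_apply)
      then have z1: "z j = U (j div r) + h *\<^sub>R D j - u (Suc j)" unfolding z_def by (rule arg_cong)
      show ?thesis unfolding e_def w1 z1 by (simp add: algebra_simps del: plus_fun_apply minus_apply scaleR_apply)
    qed
    have "\<bar>(c - 1) * h\<bar> \<le> h" using c hp(1) by (simp add: abs_mult mult_left_le_one_le abs_le_iff)
    then show ?thesis unfolding e1 L2.nrm_scale[OF L(1)] using L2.nrm_nonneg[OF L(1)] by (simp add: mult_right_mono)
  qed
  define g where "g j = nrm2 (F (j div r) - f j)" for j
  define \<rho> where "\<rho> j = (g j)\<^sup>2 + (\<epsilon> + \<epsilon>')\<^sup>2 + (h + h\<^sup>2) * (48 * (nrm2 (D j))\<^sup>2 + 12 * (nrm2 (d j))\<^sup>2)" for j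
  have step: "(nrm2 (w (Suc j)))\<^sup>2 + \<tau> * (A.nrm (z j))\<^sup>2 \<le> (1 + 6 * \<tau>) * (nrm2 (w j))\<^sup>2 + \<tau> * \<rho> j" for j
  proof -
    let ?nD = "nrm2 (D j)" and ?nd = "nrm2 (d j)" and ?nz = "nrm2 (z j)" and ?az = "A.nrm (z j)"
    have nn: "0 \<le> ?nD" "0 \<le> ?nd" "0 \<le> ?nz" "0 \<le> ?az" using L2.nrm_nonneg[OF L(1)] L2.nrm_nonneg[OF L(2)] L2.nrm_nonneg[OF L(4)] A.nrm_nonneg[OF W(4)] by auto
    have DdW: "D j - d j \<in> W" by (intro A.W_intros W)
    note Dd = W_L2[OF DdW]
    \<comment> \<open>the difference of the two residuals at \<open>z j\<close>\<close>
    have test: "(D j - d j) \<bullet>\<^sub>2 z j \<le> - (?az\<^sup>2) + ?nz\<^sup>2 + g j * ?nz + (\<epsilon> + \<epsilon>') * ?az"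
    proof -
      have "D j \<bullet>\<^sub>2 z j = (U (Suc (j div r)) - U (j div r)) \<bullet>\<^sub>2 z j / h" "d j \<bullet>\<^sub>2 z j = (u (Suc j) - u j) \<bullet>\<^sub>2 z j / \<tau>"
        unfolding D_def d_def by (simp_all add: divide_inverse mult.commute mult.assoc mult.left_commute)
      moreover have "\<bar>residual h (U (j div r)) (F (j div r)) (U (Suc (j div r))) (z j)\<bar> \<le> \<epsilon> * ?az"
        "\<bar>residual \<tau> (u j) (f j) (u (Suc j)) (z j)\<bar> \<le> \<epsilon>' * ?az"
        using U u W(4) unfolding euler_def by blast+
      moreover have "(D j - d j) \<bullet>\<^sub>2 z j = D j \<bullet>\<^sub>2 z j - d j \<bullet>\<^sub>2 z j" by (rule L2.B_diff[OF L(1) L(2) L(4)])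
      moreover have "A (U (Suc (j div r))) (z j) - A (u (Suc j)) (z j) = ?az\<^sup>2"
        unfolding A.nrm_sq[OF W(4)] using A.B_diff[OF UW uW W(4), of "Suc (j div r)" "Suc j" j] unfolding z_def by simp
      moreover have "dwell (U (Suc (j div r))) (z j) - dwell (u (Suc j)) (z j) \<ge> - (?nz\<^sup>2)"
        unfolding z_def by (rule dwell_almost_monotone[OF UW uW])
      moreover have "F (j div r) \<bullet>\<^sub>2 z j - f j \<bullet>\<^sub>2 z j \<le> g j * ?nz"
        using L2.B_diff[OF F f L(4), of "j div r" j j] L2.cauchy_schwarz[OF L2.W_intros(3)[OF F f] L(4), of "j div r" j j] unfolding g_def by linarith
      ultimately show ?thesis unfolding residual_def distrib_right by linarith
    qed
    have young: "a * b \<le> a\<^sup>2 / 2 + b\<^sup>2 / 2" for a b :: real using sum_squares_bound[of a b] by simp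
    have "g j * ?nz \<le> (g j)\<^sup>2 / 2 + ?nz\<^sup>2 / 2" by (rule young)
    moreover have "(\<epsilon> + \<epsilon>') * ?az \<le> (\<epsilon> + \<epsilon>')\<^sup>2 / 2 + ?az\<^sup>2 / 2" by (rule young)
    ultimately have test': "(D j - d j) \<bullet>\<^sub>2 z j \<le> - (?az\<^sup>2) / 2 + 3 / 2 * ?nz\<^sup>2 + (g j)\<^sup>2 / 2 + (\<epsilon> + \<epsilon>')\<^sup>2 / 2" using test by linarith
    have Ddn: "nrm2 (D j - d j) \<le> ?nD + ?nd" by (rule L2.nrm_diff_le[OF L(1,2)])
    have "(D j - d j) \<bullet>\<^sub>2 e j \<le> nrm2 (D j - d j) * nrm2 (e j)"
      using L2.cauchy_schwarz[OF Dd W_L2[OF eW[of j]]] by (simp only: abs_le_iff)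
    also have "\<dots> \<le> (?nD + ?nd) * (h * ?nD)"
      using nn by (intro mult_mono Ddn e_norm L2.nrm_nonneg[OF W_L2[OF eW]] add_nonneg_nonneg)
    also have "\<dots> = h * (?nD\<^sup>2 + ?nd * ?nD)" by (simp add: algebra_simps power2_eq_square)
    also have "\<dots> \<le> h * (2 * ?nD\<^sup>2 + ?nd\<^sup>2)"
    proof (rule mult_left_mono)
      show "?nD\<^sup>2 + ?nd * ?nD \<le> 2 * ?nD\<^sup>2 + ?nd\<^sup>2"
        using young[of ?nd ?nD] zero_le_power2[of ?nD] zero_le_power2[of ?nd] by linarith
    qed (use hp in simp)
    finally have corr: "(D j - d j) \<bullet>\<^sub>2 e j \<le> h * (2 * ?nD\<^sup>2 + ?nd\<^sup>2)" .
    have znorm: "?nz\<^sup>2 \<le> 2 * (nrm2 (w j))\<^sup>2 + h\<^sup>2 * (16 * ?nD\<^sup>2 + 4 * ?nd\<^sup>2)"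
    proof -
      let ?b = "\<tau> *\<^sub>R (D j - d j) - e j"
      have b: "?b \<in> Lp M 2" by (intro W_L2 A.W_intros DdW eW)
      have "z j = w j + ?b" unfolding e_def w_step by simp
      then have "?nz\<^sup>2 \<le> 2 * (nrm2 (w j))\<^sup>2 + 2 * (nrm2 ?b)\<^sup>2" using L2.nrm_sq_triangle[OF L(3)[of j] b] by (simp only:)
      also have "(nrm2 ?b)\<^sup>2 \<le> (h * (2 * ?nD + ?nd))\<^sup>2"
      proof (intro power_mono L2.nrm_nonneg b)
        have "nrm2 ?b \<le> nrm2 (\<tau> *\<^sub>R (D j - d j)) + nrm2 (e j)" by (intro L2.nrm_diff_le W_L2 A.W_intros DdW eW)
        also have "nrm2 (\<tau> *\<^sub>R (D j - d j)) \<le> h * (?nD + ?nd)"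
          unfolding L2.nrm_scale[OF Dd] using \<tau> hp Ddn L2.nrm_nonneg[OF Dd] by (intro mult_mono) auto
        finally show "nrm2 ?b \<le> h * (2 * ?nD + ?nd)" using e_norm[of j] by (simp add: algebra_simps)
      qed
      also have "(h * (2 * ?nD + ?nd))\<^sup>2 \<le> h\<^sup>2 * (8 * ?nD\<^sup>2 + 2 * ?nd\<^sup>2)"
        using sum_squares_bound[of "2 * ?nD" ?nd] unfolding power_mult_distrib
        by (intro mult_left_mono) (simp_all add: power2_sum power_mult_distrib)
      finally show ?thesis by (simp add: algebra_simps)
    qed
    have "(nrm2 (w (Suc j)))\<^sup>2 \<le> (nrm2 (w j))\<^sup>2 + 2 * \<tau> * ((D j - d j) \<bullet>\<^sub>2 w (Suc j))"
    proof -
      have "w j = w (Suc j) + (- \<tau>) *\<^sub>R (D j - d j)" unfolding w_step by simp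
      then have "w j \<bullet>\<^sub>2 w j = w (Suc j) \<bullet>\<^sub>2 w (Suc j) + 2 * (- \<tau>) * (w (Suc j) \<bullet>\<^sub>2 (D j - d j)) + (- \<tau>)\<^sup>2 * ((D j - d j) \<bullet>\<^sub>2 (D j - d j))"
        using L2.B_quadratic[OF L(3)[of "Suc j"] Dd, of "- \<tau>"] by (simp only:)
      moreover have "0 \<le> (- \<tau>)\<^sup>2 * ((D j - d j) \<bullet>\<^sub>2 (D j - d j))" by (intro mult_nonneg_nonneg L2.B_nonneg[OF Dd]) simp
      moreover have "w (Suc j) \<bullet>\<^sub>2 (D j - d j) = (D j - d j) \<bullet>\<^sub>2 w (Suc j)" by (rule L2.B_sym[OF L(3) Dd])
      ultimately show ?thesis unfolding L2.nrm_sq[OF L(3)] by simp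
    qed
    also have "(D j - d j) \<bullet>\<^sub>2 w (Suc j) = (D j - d j) \<bullet>\<^sub>2 z j + (D j - d j) \<bullet>\<^sub>2 e j"
    proof -
      have "z j + e j = w (Suc j)" unfolding e_def by simp
      then show ?thesis using L2.B_add2[OF L(4)[of j] W_L2[OF eW[of j]] Dd] by (simp only:)
    qed
    also have "(nrm2 (w j))\<^sup>2 + 2 * \<tau> * ((D j - d j) \<bullet>\<^sub>2 z j + (D j - d j) \<bullet>\<^sub>2 e j)
      \<le> (nrm2 (w j))\<^sup>2 + 2 * \<tau> * (- (?az\<^sup>2) / 2 + 3 * (nrm2 (w j))\<^sup>2 + \<rho> j / 2)"
    proof (intro add_left_mono mult_left_mono)
      have "0 \<le> ?nD\<^sup>2" "0 \<le> ?nd\<^sup>2" by simp_all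
      then have "0 \<le> h * ?nD\<^sup>2" "0 \<le> h * ?nd\<^sup>2" using hp(1) by simp_all
      moreover have "\<rho> j = (g j)\<^sup>2 + (\<epsilon> + \<epsilon>')\<^sup>2 + 48 * (h * ?nD\<^sup>2) + 12 * (h * ?nd\<^sup>2) + 48 * (h\<^sup>2 * ?nD\<^sup>2) + 12 * (h\<^sup>2 * ?nd\<^sup>2)"
        unfolding \<rho>_def by (simp add: algebra_simps)
      moreover have "h * (2 * ?nD\<^sup>2 + ?nd\<^sup>2) = 2 * (h * ?nD\<^sup>2) + h * ?nd\<^sup>2" by (simp add: algebra_simps)
      moreover have "h\<^sup>2 * (16 * ?nD\<^sup>2 + 4 * ?nd\<^sup>2) = 16 * (h\<^sup>2 * ?nD\<^sup>2) + 4 * (h\<^sup>2 * ?nd\<^sup>2)" by (simp add: algebra_simps)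
      ultimately show "(D j - d j) \<bullet>\<^sub>2 z j + (D j - d j) \<bullet>\<^sub>2 e j \<le> - (?az\<^sup>2) / 2 + 3 * (nrm2 (w j))\<^sup>2 + \<rho> j / 2"
        using test' corr znorm by linarith
    qed (use \<tau> in simp)
    finally show ?thesis by (simp add: algebra_simps)
  qed
  have \<rho>0: "0 \<le> \<rho> j" for j unfolding \<rho>_def using hp(1) by (intro add_nonneg_nonneg mult_nonneg_nonneg) auto
  have "(nrm2 (w (r * N)))\<^sup>2 + (\<Sum>j<r * N. \<tau> * (A.nrm (z j))\<^sup>2) \<le> (1 + 6 * \<tau>) ^ (r * N) * (\<Sum>j<r * N. \<tau> * \<rho> j)"
    by (rule discrete_gronwall) (use step \<rho>0 \<tau> w0 L2.nrm_zero in \<open>auto simp del: zero_fun_apply\<close>)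
  moreover have "0 \<le> (nrm2 (w (r * N)))\<^sup>2" by simp
  ultimately have "(\<Sum>j<r * N. \<tau> * (A.nrm (z j))\<^sup>2) \<le> (1 + 6 * \<tau>) ^ (r * N) * (\<Sum>j<r * N. \<tau> * \<rho> j)" by linarith
  also have "\<dots> \<le> exp (6 * (h * N)) * (\<Sum>j<r * N. \<tau> * \<rho> j)"
  proof (intro mult_right_mono sum_nonneg mult_nonneg_nonneg \<rho>0)
    have "(1 + 6 * \<tau>) ^ (r * N) \<le> exp (6 * \<tau>) ^ (r * N)" using \<tau> exp_ge_add_one_self[of "6 * \<tau>"] by (intro power_mono) auto
    also have "\<dots> = exp (6 * (h * N))" by (simp add: h exp_of_nat_mult[symmetric] algebra_simps)
    finally show "(1 + 6 * \<tau>) ^ (r * N) \<le> exp (6 * (h * N))" .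
  qed (use \<tau> in simp)
  also have "(\<Sum>j<r * N. \<tau> * \<rho> j) \<le> (\<Sum>j<r * N. \<tau> * (g j)\<^sup>2) + h * N * (\<epsilon> + \<epsilon>')\<^sup>2 + 240 * E * (h + h\<^sup>2)"
  proof -
    have nD: "(nrm2 (D j))\<^sup>2 = (nrm2 (U (Suc (j div r)) - U (j div r)))\<^sup>2 / h\<^sup>2" for j
      unfolding D_def L2.nrm_scale[OF W_L2[OF A.W_intros(3)[OF UW UW]]] by (simp add: power_mult_distrib power_divide)
    have nd: "(nrm2 (d j))\<^sup>2 = (nrm2 (u (Suc j) - u j))\<^sup>2 / \<tau>\<^sup>2" for j
      unfolding d_def L2.nrm_scale[OF W_L2[OF A.W_intros(3)[OF uW uW]]] by (simp add: power_mult_distrib power_divide)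
    have "(\<Sum>j<r * N. (nrm2 (D j))\<^sup>2) = real r * (\<Sum>k<N. (nrm2 (U (Suc k) - U k))\<^sup>2 / h\<^sup>2)"
      unfolding nD by (rule sum_div_block[OF r])
    also have "\<dots> = real r * ((\<Sum>k<N. (nrm2 (U (Suc k) - U k))\<^sup>2) / h\<^sup>2)" by (simp only: sum_divide_distrib)
    also have "\<dots> \<le> real r * ((4 * h * E) / h\<^sup>2)" using E(1) by (intro mult_left_mono divide_right_mono) auto
    also have "\<dots> = 4 * E / \<tau>" using hp(1) \<tau> r by (simp add: h power2_eq_square field_simps)
    finally have SD: "(\<Sum>j<r * N. (nrm2 (D j))\<^sup>2) \<le> 4 * E / \<tau>" .
    have "(\<Sum>j<r * N. (nrm2 (d j))\<^sup>2) = (\<Sum>j<r * N. (nrm2 (u (Suc j) - u j))\<^sup>2) / \<tau>\<^sup>2" unfolding nd by (simp only: sum_divide_distrib)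
    also have "\<dots> \<le> (4 * \<tau> * E) / \<tau>\<^sup>2" using E(2) by (intro divide_right_mono) auto
    also have "\<dots> = 4 * E / \<tau>" using \<tau> by (simp add: power2_eq_square)
    finally have Sd: "(\<Sum>j<r * N. (nrm2 (d j))\<^sup>2) \<le> 4 * E / \<tau>" .
    have "(\<Sum>j<r * N. \<tau> * \<rho> j) = (\<Sum>j<r * N. \<tau> * (g j)\<^sup>2) + (\<Sum>j<r * N. \<tau> * (\<epsilon> + \<epsilon>')\<^sup>2)
      + \<tau> * ((h + h\<^sup>2) * (48 * (\<Sum>j<r * N. (nrm2 (D j))\<^sup>2) + 12 * (\<Sum>j<r * N. (nrm2 (d j))\<^sup>2)))"
      unfolding \<rho>_def distrib_left sum.distrib sum_distrib_left by (simp only: add.assoc)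
    also have "\<dots> \<le> (\<Sum>j<r * N. \<tau> * (g j)\<^sup>2) + (\<Sum>j<r * N. \<tau> * (\<epsilon> + \<epsilon>')\<^sup>2)
      + \<tau> * ((h + h\<^sup>2) * (48 * (4 * E / \<tau>) + 12 * (4 * E / \<tau>)))"
      using \<tau> hp(1) SD Sd by (intro add_left_mono mult_left_mono add_mono) auto
    also have "(\<Sum>j<r * N. \<tau> * (\<epsilon> + \<epsilon>')\<^sup>2) = h * N * (\<epsilon> + \<epsilon>')\<^sup>2" by (simp add: h)
    also have "\<tau> * ((h + h\<^sup>2) * (48 * (4 * E / \<tau>) + 12 * (4 * E / \<tau>))) = 240 * E * (h + h\<^sup>2)"
      using \<tau> by (simp add: field_simps)
    finally show ?thesis .
  qed
  finally show ?thesis unfolding z_def g_def by simp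
qed

end

section \<open>Strong measurability and Bochner integrals\<close>

locale seminormed =
  fixes X :: "'v::real_vector set" and N :: "'v \<Rightarrow> real"
  assumes X_subspace: "subspace X"
    and N_triangle: "x \<in> X \<Longrightarrow> y \<in> X \<Longrightarrow> N (x + y) \<le> N x + N y"
    and N_scale: "x \<in> X \<Longrightarrow> N (c *\<^sub>R x) = \<bar>c\<bar> * N x"
begin

lemma X_intros [intro]: 
  "0 \<in> X" "x \<in> X \<Longrightarrow> y \<in> X \<Longrightarrow> x + y \<in> X" "x \<in> X \<Longrightarrow> y \<in> X \<Longrightarrow> x - y \<in> X" "x \<in> X \<Longrightarrow> c *\<^sub>R x \<in> X"
  using X_subspace by (auto simp: subspace_0 subspace_add subspace_diff subspace_scale)

lemma N_zero [simp]: "N 0 = 0" using N_scale[OF X_intros(1), of 0] by simp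

lemma N_minus: "x \<in> X \<Longrightarrow> N (- x) = N x" using N_scale[of x "-1"] by simp

lemma N_nonneg: "x \<in> X \<Longrightarrow> 0 \<le> N x"
proof -
  assume x: "x \<in> X"
  have "N (x + (-1) *\<^sub>R x) \<le> N x + N ((-1) *\<^sub>R x)" by (intro N_triangle x X_intros)
  then show ?thesis using N_scale[OF x, of "-1"] by simp
qed

lemma N_diff: assumes "x \<in> X" "y \<in> X" shows "N (x - y) = N (y - x)"
  using N_minus[OF X_intros(3)[OF assms]] by (simp only: minus_diff_eq)

lemma N_triangle_diff: assumes "x \<in> X" "y \<in> X" "z \<in> X" shows "N (x - z) \<le> N (x - y) + N (y - z)"
proof -
  have "(x - y) + (y - z) = x - z" by (simp del: minus_apply plus_fun_apply)
  then show ?thesis using N_triangle[of "x - y" "y - z"] assms X_intros by metis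
qed

lemma N_diff_le: assumes "x \<in> X" "y \<in> X" shows "N (x - y) \<le> N x + N y"
  using N_triangle_diff[OF assms(1) X_intros(1) assms(2)] N_minus[OF assms(2)] by (simp only: diff_0_right diff_0)

lemma N_diff_ineq: assumes "x \<in> X" "y \<in> X" shows "\<bar>N x - N y\<bar> \<le> N (x - y)"
proof -
  have "(x - y) + y = x" "(y - x) + x = y" by (simp_all del: minus_apply plus_fun_apply)
  then show ?thesis using N_triangle[of "x - y" y] N_triangle[of "y - x" x] N_diff[OF assms] assms X_intros by (metis abs_diff_le_iff abs_le_iff diff_le_eq minus_diff_eq)
qed

lemma N_tendsto:
  assumes "x \<in> X" "\<And>n. y n \<in> X" "(\<lambda>n. N (x - y n)) \<longlonglongrightarrow> 0"
  shows "(\<lambda>n. N (y n)) \<longlonglongrightarrow> N x"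
proof (rule LIM_zero_cancel, rule Lim_null_comparison[OF _ assms(3)])
  show "\<forall>\<^sub>F n in sequentially. norm (N (y n) - N x) \<le> N (x - y n)"
    using N_diff_ineq[OF assms(1,2)] by (simp only: real_norm_def abs_minus_commute[of "N (y _)"] eventually_True)
qed

lemma N_tendsto_diff:
  assumes "x \<in> X" "\<And>n. y n \<in> X" "z \<in> X" "(\<lambda>n. N (x - y n)) \<longlonglongrightarrow> 0"
  shows "(\<lambda>n. N (y n - z)) \<longlonglongrightarrow> N (x - z)"
proof (rule N_tendsto)
  have "(x - z) - (y n - z) = x - y n" for n by (simp del: minus_apply plus_fun_apply)
  then show "(\<lambda>n. N ((x - z) - (y n - z))) \<longlonglongrightarrow> 0" using assms(4) by (simp only:)
qed (use assms X_intros in auto)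

end

lemma (in semi_inner) seminormed: "seminormed W nrm"
  by unfold_locales (simp_all add: W_subspace nrm_triangle nrm_scale)

text \<open>Lebesgue measure is complete, so changes on null sets preserve measurability.\<close>

lemma measurable_lebesgue_on_AE_eq:
  fixes f g :: "'t::euclidean_space \<Rightarrow> real"
  assumes "f \<in> borel_measurable (lebesgue_on I)" "AE x in lebesgue_on I. f x = g x" "I \<in> sets lebesgue"
  shows "g \<in> borel_measurable (lebesgue_on I)"
proof -
  have "(\<lambda>x. if x \<in> I then f x else 0) \<in> borel_measurable lebesgue"
    using assms by (simp add: borel_measurable_if)
  moreover have "AE x in lebesgue. (if x \<in> I then f x else 0) = (if x \<in> I then g x else 0)"
    using assms(2,3) by (subst (asm) AE_restrict_space_iff) (auto elim!: eventually_mono)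
  ultimately have "(\<lambda>x. if x \<in> I then g x else 0) \<in> borel_measurable lebesgue"
    by (rule borel_measurable_AE)
  then show ?thesis using assms by (simp add: borel_measurable_if)
qed

lemma measurable_lebesgue_on_AE_lim:
  fixes f :: "nat \<Rightarrow> 't::euclidean_space \<Rightarrow> real"
  assumes [measurable]: "\<And>n. f n \<in> borel_measurable (lebesgue_on I)"
    and "AE x in lebesgue_on I. (\<lambda>n. f n x) \<longlonglongrightarrow> g x" "I \<in> sets lebesgue"
  shows "g \<in> borel_measurable (lebesgue_on I)"
proof (rule measurable_lebesgue_on_AE_eq)
  show "(\<lambda>x. lim (\<lambda>n. f n x)) \<in> borel_measurable (lebesgue_on I)" by measurable
  show "AE x in lebesgue_on I. lim (\<lambda>n. f n x) = g x" using assms(2) by eventually_elim (rule limI)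
qed fact

lemma simple_measurable: "simple_function M s \<Longrightarrow> (\<lambda>t. h (s t) :: real) \<in> borel_measurable M"
  by (rule borel_measurable_simple_function) (rule simple_function_compose1)

lemma simple_measurable2: "simple_function M s \<Longrightarrow> simple_function M s' \<Longrightarrow> (\<lambda>t. h (s t) (s' t) :: real) \<in> borel_measurable M"
  by (rule borel_measurable_simple_function) (rule simple_function_compose2)

locale time_domain =
  fixes I :: "'t::euclidean_space set"
  assumes I_lmeasurable: "I \<in> lmeasurable"
begin

abbreviation "\<Lambda> \<equiv> lebesgue_on I"

lemma I_sets: "I \<in> sets lebesgue" using I_lmeasurable by blast

sublocale finite_measure \<Lambda> using I_lmeasurable by (rule finite_measure_lebesgue_on)

text \<open>
  The simple functions are replaced by 0 where \<open>N (s n t) > 2 N (g t)\<close>. Where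
  \<open>N (g t) > 0\<close>, this has no effect for large \<open>n\<close>; where \<open>N (g
  t) = 0\<close>, the truncated functions have seminorm 0. The bound \<open>3 N (g t)\<close> is
  the dominating function for convergence in the mean.
\<close>

lemma strongly_measurable_truncated:
  fixes X :: "('b \<Rightarrow> real) set"
  assumes "seminormed X N" and g: "strongly_measurable_in \<Lambda> X N g"
  obtains s where "\<And>n::nat. simple_in \<Lambda> X (s n)" "AE t in \<Lambda>. g t \<in> X"
    "AE t in \<Lambda>. (\<lambda>n. N (g t - s n t)) \<longlonglongrightarrow> 0" "AE t in \<Lambda>. \<forall>n. N (g t - s n t) \<le> 3 * N (g t)"
    "(\<lambda>t. N (g t)) \<in> borel_measurable \<Lambda>" "\<And>s'. simple_in \<Lambda> X s' \<Longrightarrow> (\<lambda>t. N (g t - s' t)) \<in> borel_measurable \<Lambda>"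
proof -
  interpret seminormed X N by fact
  obtain s where s: "\<And>n::nat. simple_in \<Lambda> X (s n)" "AE t in \<Lambda>. (\<lambda>n. N (g t - s n t)) \<longlonglongrightarrow> 0"
    and gX: "AE t in \<Lambda>. g t \<in> X"
    using g unfolding strongly_measurable_in_def by blast
  have sX: "s n t \<in> X" if "t \<in> I" for n t using s(1)[of n] that by (auto simp: simple_in_def)
  have sf: "simple_function \<Lambda> (s n)" for n using s(1) by (simp add: simple_in_def)
  have m1: "(\<lambda>t. N (g t)) \<in> borel_measurable \<Lambda>"
  proof (rule measurable_lebesgue_on_AE_lim[OF _ _ I_sets])
    show "(\<lambda>t. N (s n t)) \<in> borel_measurable \<Lambda>" for n by (rule simple_measurable[OF sf])
    show "AE t in \<Lambda>. (\<lambda>n. N (s n t)) \<longlonglongrightarrow> N (g t)"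
      using s(2) gX AE_space by eventually_elim (rule N_tendsto, auto intro: sX)
  qed
  have m2: "(\<lambda>t. N (g t - s' t)) \<in> borel_measurable \<Lambda>" if s': "simple_in \<Lambda> X s'" for s'
  proof (rule measurable_lebesgue_on_AE_lim[OF _ _ I_sets])
    show "(\<lambda>t. N (s n t - s' t)) \<in> borel_measurable \<Lambda>" for n
      using s' unfolding simple_in_def by (intro simple_measurable2[OF sf, where h="\<lambda>a b. N (a - b)"]) simp
    show "AE t in \<Lambda>. (\<lambda>n. N (s n t - s' t)) \<longlonglongrightarrow> N (g t - s' t)"
      using s(2) gX AE_space
    proof eventually_elim
      case (elim t)
      then show ?case using s' sX by (intro N_tendsto_diff) (auto simp: simple_in_def)
    qed
  qed
  define A where "A n = {t \<in> I. N (s n t) \<le> 2 * N (g t)}" for n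
  have A: "A n \<in> sets \<Lambda>" for n
  proof -
    have [measurable]: "(\<lambda>t. N (s n t)) \<in> borel_measurable \<Lambda>" by (rule simple_measurable[OF sf])
    have "{t \<in> space \<Lambda>. N (s n t) \<le> 2 * N (g t)} \<in> sets \<Lambda>" using m1 by measurable
    then show ?thesis by (simp add: A_def)
  qed
  define r where "r n t = (if t \<in> A n then s n t else 0)" for n t
  have r: "simple_in \<Lambda> X (r n)" for n
  proof -
    have "simple_function \<Lambda> (r n)" unfolding r_def[abs_def]
      using A[of n] sets.sets_into_space[OF A[of n]] by (intro simple_function_If_set sf) (auto simp: Int_absorb2)
    then show ?thesis using sX X_intros(1) by (auto simp: simple_in_def r_def)
  qed
  have lim: "AE t in \<Lambda>. (\<lambda>n. N (g t - r n t)) \<longlonglongrightarrow> 0"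
    using s(2) gX AE_space
  proof eventually_elim
    case (elim t)
    have t: "t \<in> I" using elim by simp
    have Ng: "0 \<le> N (g t)" by (rule N_nonneg[OF elim(2)])
    show ?case
    proof (cases "N (g t) = 0")
      case True
      have "N (g t - r n t) = 0" for n
      proof -
        have rX: "r n t \<in> X" using r[of n] t by (auto simp: simple_in_def)
        have "N (r n t) \<le> 0" using True t sX unfolding r_def A_def by auto
        then have "N (g t - r n t) \<le> 0" using N_diff_le[OF elim(2) rX] True by simp
        then show ?thesis using N_nonneg[OF X_intros(3)[OF elim(2) rX]] by linarith
      qed
      then show ?thesis by simp
    next
      case False
      have "(\<lambda>n. N (s n t)) \<longlonglongrightarrow> N (g t)" using elim sX t by (intro N_tendsto) auto
      moreover have "N (g t) < 2 * N (g t)" using False Ng by simp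
      ultimately have "\<forall>\<^sub>F n in sequentially. N (s n t) < 2 * N (g t)" by (rule order_tendstoD(2))
      then have "\<forall>\<^sub>F n in sequentially. N (g t - s n t) = N (g t - r n t)"
        by eventually_elim (simp add: r_def A_def t)
      then show ?thesis using elim(1) by (rule Lim_transform_eventually[rotated])
    qed
  qed
  have bd: "AE t in \<Lambda>. \<forall>n. N (g t - r n t) \<le> 3 * N (g t)"
    using gX AE_space
  proof eventually_elim
    case (elim t)
    show ?case
    proof
      fix n
      have rX: "r n t \<in> X" using r[of n] elim by (auto simp: simple_in_def)
      have "N (r n t) \<le> 2 * N (g t)" using N_nonneg[OF elim(1)] by (auto simp: r_def A_def)
      then show "N (g t - r n t) \<le> 3 * N (g t)" using N_diff_le[OF elim(1) rX] by simp
    qed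
  qed
  show ?thesis using that[OF r gX lim bd m1 m2] by blast
qed

end

section \<open>Dual spaces\<close>

lemma dual_add: "l \<in> dual_space X N \<Longrightarrow> v \<in> X \<Longrightarrow> w \<in> X \<Longrightarrow> l (v + w) = l v + l w"
  by (simp add: dual_space_def plus_fun_def)

lemma dual_scale: "l \<in> dual_space X N \<Longrightarrow> v \<in> X \<Longrightarrow> l (c *\<^sub>R v) = c * l v"
  by (simp add: dual_space_def scaleR_fun_def)

lemma dual_spaceI:
  assumes "\<And>v w. v \<in> X \<Longrightarrow> w \<in> X \<Longrightarrow> l (v + w) = l v + l w" "\<And>c v. v \<in> X \<Longrightarrow> l (c *\<^sub>R v) = c * l v"
    "\<And>v. v \<in> X \<Longrightarrow> \<bar>l v\<bar> \<le> C * N v"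
  shows "l \<in> dual_space X N"
proof -
  have "\<exists>C. \<forall>v\<in>X. \<bar>l v\<bar> \<le> C * N v" using assms(3) by blast
  then show ?thesis using assms(1,2) unfolding dual_space_def by (simp add: plus_fun_def scaleR_fun_def)
qed

locale normed_dual = seminormed X N for X :: "('a \<Rightarrow> real) set" and N
begin

abbreviation "X' \<equiv> dual_space X N"
abbreviation "N' \<equiv> dual_norm X N"

lemma dual_norm_le:
  assumes "\<And>v. v \<in> X \<Longrightarrow> N v \<le> 1 \<Longrightarrow> \<bar>l v\<bar> \<le> C" shows "N' l \<le> C"
  unfolding dual_norm_def using X_intros(1) by (intro cSUP_least) (auto intro!: assms exI[of _ 0] simp del: zero_fun_apply)

lemma dual_norm_le_mult:
  assumes "\<And>v. v \<in> X \<Longrightarrow> \<bar>l v\<bar> \<le> C * N v" "0 \<le> C" shows "N' l \<le> C"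
proof (rule dual_norm_le)
  fix v assume v: "v \<in> X" "N v \<le> 1"
  have "C * N v \<le> C * 1" using v assms(2) by (intro mult_left_mono)
  then show "\<bar>l v\<bar> \<le> C" using assms(1)[OF v(1)] by simp
qed

lemma dual_bdd_above: assumes l: "l \<in> X'" shows "bdd_above ((\<lambda>v. \<bar>l v\<bar>) ` {v \<in> X. N v \<le> 1})"
proof -
  obtain C where C: "\<And>v. v \<in> X \<Longrightarrow> \<bar>l v\<bar> \<le> C * N v" using l unfolding dual_space_def by blast
  show ?thesis
  proof (rule bdd_aboveI2)
    fix v assume "v \<in> {v \<in> X. N v \<le> 1}"
    then have v: "v \<in> X" "N v \<le> 1" by auto
    have "\<bar>l v\<bar> \<le> \<bar>C\<bar> * N v" using C[OF v(1)] mult_right_mono[OF abs_ge_self N_nonneg[OF v(1)], of C] by linarith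
    also have "\<dots> \<le> \<bar>C\<bar> * 1" using v by (intro mult_left_mono) auto
    finally show "\<bar>l v\<bar> \<le> \<bar>C\<bar>" by simp
  qed
qed

text \<open>
  A vector with \<open>N v = 0\<close> cannot be normalised, but there the boundedness of
  \<open>l\<close> forces \<open>l v = 0\<close>.
\<close>

lemma dual_bound:
  assumes l: "l \<in> X'" and v: "v \<in> X" shows "\<bar>l v\<bar> \<le> N' l * N v"
proof -
  obtain C where C: "\<And>v. v \<in> X \<Longrightarrow> \<bar>l v\<bar> \<le> C * N v" using l unfolding dual_space_def by blast
  show ?thesis
  proof (cases "N v = 0")
    case True then show ?thesis using C[OF v] by simp
  next
    case False
    then have p: "N v > 0" using N_nonneg[OF v] by simp
    have "N ((1 / N v) *\<^sub>R v) = 1" using N_scale[OF v, of "1 / N v"] p by (simp del: scaleR_apply)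
    then have "\<bar>l ((1 / N v) *\<^sub>R v)\<bar> \<le> N' l" unfolding dual_norm_def using X_intros(4)[OF v]
      by (intro cSUP_upper[OF _ dual_bdd_above[OF l]]) simp
    then show ?thesis using dual_scale[OF l v, of "1 / N v"] p by (simp add: field_simps)
  qed
qed

lemma dual_norm_nonneg: assumes l: "l \<in> X'" shows "0 \<le> N' l"
proof -
  have "\<bar>l 0\<bar> \<le> N' l" unfolding dual_norm_def
    by (rule cSUP_upper[OF _ dual_bdd_above[OF l]]) (use X_intros(1) N_zero in \<open>simp del: zero_fun_apply\<close>)
  then show ?thesis by (rule order_trans[OF abs_ge_zero])
qed

lemma dual_subspace: "subspace X'"
  unfolding subspace_def
proof (intro conjI ballI allI)
  show "0 \<in> X'" by (rule dual_spaceI[of _ _ 0]) auto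
  show "l + k \<in> X'" if l: "l \<in> X'" and k: "k \<in> X'" for l k
  proof (rule dual_spaceI[of _ _ "N' l + N' k"])
    show "(l + k) (v + w) = (l + k) v + (l + k) w" if "v \<in> X" "w \<in> X" for v w
      using dual_add[OF l that] dual_add[OF k that] by (simp add: plus_fun_apply[of l k])
    show "(l + k) (c *\<^sub>R v) = c * (l + k) v" if "v \<in> X" for v c
      using dual_scale[OF l that] dual_scale[OF k that] by (simp add: plus_fun_apply[of l k] distrib_left)
    show "\<bar>(l + k) v\<bar> \<le> (N' l + N' k) * N v" if "v \<in> X" for v
      using dual_bound[OF l that] dual_bound[OF k that] abs_triangle_ineq[of "l v" "k v"] by (simp add: distrib_right)
  qed
  show "c *\<^sub>R l \<in> X'" if l: "l \<in> X'" for l and c :: real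
  proof (rule dual_spaceI[of _ _ "\<bar>c\<bar> * N' l"])
    show "(c *\<^sub>R l) (v + w) = (c *\<^sub>R l) v + (c *\<^sub>R l) w" if "v \<in> X" "w \<in> X" for v w
      using dual_add[OF l that] by (simp add: distrib_left)
    show "(c *\<^sub>R l) (d *\<^sub>R v) = d * (c *\<^sub>R l) v" if "v \<in> X" for v d
      using dual_scale[OF l that] by simp
    show "\<bar>(c *\<^sub>R l) v\<bar> \<le> \<bar>c\<bar> * N' l * N v" if "v \<in> X" for v
      using mult_left_mono[OF dual_bound[OF l that], of "\<bar>c\<bar>"] by (simp add: abs_mult mult.assoc)
  qed
qed

lemma seminormed_dual: "seminormed X' N'"
proof
  show "subspace X'" by (rule dual_subspace)
  show tri: "N' (l + k) \<le> N' l + N' k" if l: "l \<in> X'" and k: "k \<in> X'" for l k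
  proof (rule dual_norm_le_mult)
    show "\<bar>(l + k) v\<bar> \<le> (N' l + N' k) * N v" if "v \<in> X" for v
      using dual_bound[OF l that] dual_bound[OF k that] abs_triangle_ineq[of "l v" "k v"] by (simp add: distrib_right)
  qed (use dual_norm_nonneg l k in simp)
  have le: "N' (c *\<^sub>R l) \<le> \<bar>c\<bar> * N' l" if l: "l \<in> X'" for l and c :: real
  proof (rule dual_norm_le_mult)
    show "\<bar>(c *\<^sub>R l) v\<bar> \<le> \<bar>c\<bar> * N' l * N v" if "v \<in> X" for v
      using mult_left_mono[OF dual_bound[OF l that], of "\<bar>c\<bar>"] by (simp add: abs_mult mult.assoc)
  qed (use dual_norm_nonneg l in simp)
  show "N' (c *\<^sub>R l) = \<bar>c\<bar> * N' l" if l: "l \<in> X'" for l and c :: real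
  proof (cases "c = 0")
    case True
    have "N' (0 *\<^sub>R l) \<le> 0" using le[OF l, of 0] by simp
    moreover have "0 \<le> N' (0 *\<^sub>R l)" by (intro dual_norm_nonneg subspace_scale[OF dual_subspace] l)
    ultimately show ?thesis using True by simp
  next
    case False
    have cl: "c *\<^sub>R l \<in> X'" by (intro subspace_scale[OF dual_subspace] l)
    have "(1 / c) *\<^sub>R (c *\<^sub>R l) = l" using False by (simp del: scaleR_apply)
    then have "N' l \<le> \<bar>1 / c\<bar> * N' (c *\<^sub>R l)" using le[OF cl, of "1 / c"] by (simp only:)
    then have "\<bar>c\<bar> * N' l \<le> N' (c *\<^sub>R l)" using False by (simp add: field_simps)
    then show ?thesis using le[OF l, of c] by linarith
  qed
qed

sublocale dual: seminormed X' N' by (rule seminormed_dual)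

end

lemma sum_apply: "(\<Sum>i\<in>A. f i) x = (\<Sum>i\<in>A. f i x)" for f :: "'i \<Rightarrow> 'b \<Rightarrow> real"
  by (induction A rule: infinite_finite_induct) auto

context time_domain begin

lemma simple_integral_eq:
  fixes s :: "'t \<Rightarrow> 'b \<Rightarrow> real"
  assumes "simple_function \<Lambda> s"
  shows "integrable \<Lambda> (\<lambda>t. s t v)" "simple_integral_in \<Lambda> s v = (\<integral>t. s t v \<partial>\<Lambda>)"
proof -
  have fin: "finite (s ` I)" and me: "\<And>y. {t \<in> I. s t = y} \<in> sets \<Lambda>"
  proof -
    show "finite (s ` I)" using simple_functionD(1)[OF assms] by simp
    show "{t \<in> I. s t = y} \<in> sets \<Lambda>" for y using simple_functionD(2)[OF assms, of "{y}"] by (simp add: vimage_def Int_def conj_commute)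
  qed
  have eq: "s t v = (\<Sum>y\<in>s ` I. indicator {t \<in> I. s t = y} t * y v)" if "t \<in> I" for t
  proof -
    have "(\<Sum>y\<in>s ` I. indicator {t \<in> I. s t = y} t * y v) = (\<Sum>y\<in>s ` I. if s t = y then y v else 0)"
      using that by (intro sum.cong refl) (auto simp: indicator_def)
    also have "\<dots> = s t v" using fin that by (simp add: sum.delta')
    finally show ?thesis by simp
  qed
  have int: "integrable \<Lambda> (\<lambda>t. indicator {t \<in> I. s t = y} t * y v)" for y
    using me[of y] by (intro integrable_mult_left integrable_real_indicator) (auto simp: emeasure_finite less_top[symmetric])
  have "integrable \<Lambda> (\<lambda>t. \<Sum>y\<in>s ` I. indicator {t \<in> I. s t = y} t * y v)"
    by (intro Bochner_Integration.integrable_sum int)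
  then show "integrable \<Lambda> (\<lambda>t. s t v)"
    by (rule Bochner_Integration.integrable_cong[THEN iffD1, OF refl, rotated]) (simp add: eq)
  have "(\<integral>t. s t v \<partial>\<Lambda>) = (\<integral>t. (\<Sum>y\<in>s ` I. indicator {t \<in> I. s t = y} t * y v) \<partial>\<Lambda>)"
    by (intro Bochner_Integration.integral_cong refl) (simp add: eq)
  also have "\<dots> = (\<Sum>y\<in>s ` I. measure \<Lambda> {t \<in> I. s t = y} * y v)"
  proof -
    have "{t \<in> I. s t = y} \<inter> I = {t \<in> I. s t = y}" for y by blast
    then show ?thesis using me by (subst Bochner_Integration.integral_sum[OF int]) (simp add: mult.commute)
  qed
  finally show "simple_integral_in \<Lambda> s v = (\<integral>t. s t v \<partial>\<Lambda>)" unfolding simple_integral_in_def by simp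
qed

text \<open>
  A functional-valued integral may be computed by pairing: \<open>y v\<close> differs from the
  pairing of \<open>v\<close> with the integral of a simple function \<open>s\<close> by at most
  \<open>\<integral> N' (g - s)\<close> times \<open>N v\<close>, which is uniform on the unit
  ball. So \<open>y\<close> is the limit in the dual norm of the integrals of the simple
  approximations.
\<close>

lemma has_bochner_integral_dual:
  assumes "normed_dual X N" and g: "strongly_measurable_in \<Lambda> (dual_space X N) (dual_norm X N) g"
    and int: "integrable \<Lambda> (\<lambda>t. dual_norm X N (g t))" and y: "\<And>v. v \<in> X \<Longrightarrow> y v = (\<integral>t. g t v \<partial>\<Lambda>)"
  shows "has_bochner_integral_in \<Lambda> (dual_space X N) (dual_norm X N) g y"
proof -
  interpret normed_dual X N by fact
  obtain s where s: "\<And>n::nat. simple_in \<Lambda> X' (s n)" "AE t in \<Lambda>. g t \<in> X'"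
    "AE t in \<Lambda>. (\<lambda>n. N' (g t - s n t)) \<longlonglongrightarrow> 0" "AE t in \<Lambda>. \<forall>n. N' (g t - s n t) \<le> 3 * N' (g t)"
    "\<And>s'. simple_in \<Lambda> X' s' \<Longrightarrow> (\<lambda>t. N' (g t - s' t)) \<in> borel_measurable \<Lambda>"
    by (rule strongly_measurable_truncated[OF seminormed_dual g]) blast
  have sX: "s n t \<in> X'" if "t \<in> I" for n t using s(1)[of n] that by (auto simp: simple_in_def)
  have sf: "simple_function \<Lambda> (s n)" for n using s(1) by (simp add: simple_in_def)
  have AE_diff: "AE t in \<Lambda>. g t - s n t \<in> X'" for n
    using s(2) AE_space by eventually_elim (rule dual.X_intros, auto intro: sX)
  have int_diff: "integrable \<Lambda> (\<lambda>t. N' (g t - s n t))" for n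
  proof (rule Bochner_Integration.integrable_bound)
    show "integrable \<Lambda> (\<lambda>t. 3 * N' (g t))" using int by simp
    show "AE t in \<Lambda>. norm (N' (g t - s n t)) \<le> norm (3 * N' (g t))"
      using s(4) AE_diff[of n] s(2)
    proof eventually_elim
      case (elim t)
      then show ?case using dual.N_nonneg[OF elim(2)] dual.N_nonneg[OF elim(3)] by simp
    qed
  qed (rule s(5)[OF s(1)])
  have lim: "(\<lambda>n. \<integral>t. N' (g t - s n t) \<partial>\<Lambda>) \<longlonglongrightarrow> 0"
  proof -
    have "(\<lambda>n. \<integral>t. N' (g t - s n t) \<partial>\<Lambda>) \<longlonglongrightarrow> (\<integral>t. 0 \<partial>\<Lambda>)"
    proof (rule integral_dominated_convergence[where w="\<lambda>t. 3 * N' (g t)"])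
      show "AE t in \<Lambda>. norm (N' (g t - s n t)) \<le> 3 * N' (g t)" for n
        using s(4) AE_diff[of n]
      proof eventually_elim
        case (elim t)
        then show ?case using dual.N_nonneg[OF elim(2)] by simp
      qed
    qed (use s int in \<open>auto intro: s(5)\<close>)
    then show ?thesis by simp
  qed
  have g_meas: "(\<lambda>t. g t v) \<in> borel_measurable \<Lambda>" if v: "v \<in> X" for v
  proof (rule measurable_lebesgue_on_AE_lim[OF _ _ I_sets])
    show "(\<lambda>t. s n t v) \<in> borel_measurable \<Lambda>" for n using simple_integral_eq(1)[OF sf] by auto
    show "AE t in \<Lambda>. (\<lambda>n. s n t v) \<longlonglongrightarrow> g t v"
      using s(2,3) AE_space
    proof eventually_elim
      case (elim t)
      show ?case
      proof (rule LIM_zero_cancel, rule Lim_null_comparison)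
        show "(\<lambda>n. N' (g t - s n t) * N v) \<longlonglongrightarrow> 0" by (rule tendsto_mult_left_zero[OF elim(2)])
        have "\<bar>(g t - s n t) v\<bar> \<le> N' (g t - s n t) * N v" for n
          by (rule dual_bound[OF dual.X_intros(3)[OF elim(1) sX] v]) (use elim in simp)
        then show "\<forall>\<^sub>F n in sequentially. norm (s n t v - g t v) \<le> N' (g t - s n t) * N v"
          by (simp add: abs_minus_commute)
      qed
    qed
  qed
  have g_int: "integrable \<Lambda> (\<lambda>t. g t v)" if v: "v \<in> X" for v
  proof (rule Bochner_Integration.integrable_bound)
    show "integrable \<Lambda> (\<lambda>t. N' (g t) * N v)" using int by simp
    show "AE t in \<Lambda>. norm (g t v) \<le> norm (N' (g t) * N v)"
      using s(2) by eventually_elim (use dual_bound[OF _ v] in \<open>metis abs_ge_self order_trans real_norm_def\<close>)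
  qed (rule g_meas[OF v])
  have y_diff: "\<bar>y v - simple_integral_in \<Lambda> (s n) v\<bar> \<le> (\<integral>t. N' (g t - s n t) \<partial>\<Lambda>) * N v" if v: "v \<in> X" for v n
  proof -
    have "y v - simple_integral_in \<Lambda> (s n) v = (\<integral>t. g t v - s n t v \<partial>\<Lambda>)"
      using g_int[OF v] simple_integral_eq[OF sf, of n v] y[OF v] by simp
    also have "\<bar>\<dots>\<bar> \<le> (\<integral>t. \<bar>g t v - s n t v\<bar> \<partial>\<Lambda>)" using integral_norm_bound[of \<Lambda> "\<lambda>t. g t v - s n t v"] by simp
    also have "\<dots> \<le> (\<integral>t. N' (g t - s n t) * N v \<partial>\<Lambda>)"
    proof (rule integral_mono_AE)
      show "integrable \<Lambda> (\<lambda>t. \<bar>g t v - s n t v\<bar>)" using g_int[OF v] simple_integral_eq[OF sf, of n v] by simp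
      show "integrable \<Lambda> (\<lambda>t. N' (g t - s n t) * N v)" using int_diff by simp
      show "AE t in \<Lambda>. \<bar>g t v - s n t v\<bar> \<le> N' (g t - s n t) * N v"
        using AE_diff[of n] by eventually_elim (use dual_bound[OF _ v] in force)
    qed
    finally show ?thesis by simp
  qed
  have yX: "y \<in> X'"
  proof (rule dual_spaceI[of _ _ "\<integral>t. N' (g t) \<partial>\<Lambda>"])
    show "y (v + w) = y v + y w" if "v \<in> X" "w \<in> X" for v w
    proof -
      have "y (v + w) = (\<integral>t. g t v + g t w \<partial>\<Lambda>)"
        unfolding y[OF X_intros(2)[OF that]]
      proof (rule integral_cong_AE)
        show "AE t in \<Lambda>. g t (v + w) = g t v + g t w" using s(2) by eventually_elim (rule dual_add[OF _ that])
      qed (use g_meas that X_intros(2)[OF that] in auto)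
      then show ?thesis using g_int that y by simp
    qed
    show "y (c *\<^sub>R v) = c * y v" if "v \<in> X" for c v
    proof -
      have "y (c *\<^sub>R v) = (\<integral>t. c * g t v \<partial>\<Lambda>)"
        unfolding y[OF X_intros(4)[OF that]]
      proof (rule integral_cong_AE)
        show "AE t in \<Lambda>. g t (c *\<^sub>R v) = c * g t v" using s(2) by eventually_elim (rule dual_scale[OF _ that])
      qed (use g_meas that X_intros(4)[OF that] in auto)
      then show ?thesis using y[OF that] by simp
    qed
    show "\<bar>y v\<bar> \<le> (\<integral>t. N' (g t) \<partial>\<Lambda>) * N v" if v: "v \<in> X" for v
    proof -
      have "\<bar>y v\<bar> \<le> (\<integral>t. \<bar>g t v\<bar> \<partial>\<Lambda>)" unfolding y[OF v] using integral_norm_bound[of \<Lambda> "\<lambda>t. g t v"] by simp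
      also have "\<dots> \<le> (\<integral>t. N' (g t) * N v \<partial>\<Lambda>)"
      proof (rule integral_mono_AE)
        show "AE t in \<Lambda>. \<bar>g t v\<bar> \<le> N' (g t) * N v" using s(2) by eventually_elim (rule dual_bound[OF _ v])
      qed (use g_int[OF v] int in auto)
      finally show ?thesis by simp
    qed
  qed
  have "(\<lambda>n. N' (y - simple_integral_in \<Lambda> (s n))) \<longlonglongrightarrow> 0"
  proof (rule Lim_null_comparison[OF _ lim], rule always_eventually, rule allI)
    fix n
    have nn: "0 \<le> (\<integral>t. N' (g t - s n t) \<partial>\<Lambda>)"
      by (rule integral_nonneg_AE) (use AE_diff[of n] in eventually_elim, rule dual.N_nonneg)
    have le: "N' (y - simple_integral_in \<Lambda> (s n)) \<le> (\<integral>t. N' (g t - s n t) \<partial>\<Lambda>)"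
      using y_diff nn by (intro dual_norm_le_mult) auto
    have "simple_integral_in \<Lambda> (s n) \<in> X'"
    proof -
      have "simple_integral_in \<Lambda> (s n) = (\<Sum>y\<in>s n ` space \<Lambda>. measure \<Lambda> {t\<in>space \<Lambda>. s n t = y} *\<^sub>R y)"
        unfolding simple_integral_in_def by (rule ext) (simp add: sum_apply)
      also have "\<dots> \<in> X'" using sX by (intro subspace_sum[OF dual_subspace] dual.X_intros(4)) auto
      finally show ?thesis .
    qed
    then have "0 \<le> N' (y - simple_integral_in \<Lambda> (s n))" using yX by (intro dual.N_nonneg dual.X_intros)
    then show "norm (N' (y - simple_integral_in \<Lambda> (s n))) \<le> (\<integral>t. N' (g t - s n t) \<partial>\<Lambda>)" using le by simp
  qed
  then show ?thesis unfolding has_bochner_integral_in_def using yX g s(1) int_diff lim by blast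
qed

end

section \<open>Dyadic meshes in time\<close>

locale time_mesh =
  fixes T :: real assumes T_pos: "0 < T"
begin

sublocale time_domain "{0<..<T}"
  by unfold_locales (rule lmeasurable_interval)

abbreviation "\<T> \<equiv> {0<..<T}"

definition mesh :: "nat \<Rightarrow> real" where "mesh n = T / 2 ^ n"
definition cell :: "nat \<Rightarrow> real \<Rightarrow> nat" where "cell n t = nat \<lfloor>t / mesh n\<rfloor>"

lemma mesh_pos: "0 < mesh n" using T_pos by (simp add: mesh_def)

lemma mesh_mult: "mesh n * 2 ^ n = T" by (simp add: mesh_def)

lemma mesh_tendsto: "mesh \<longlonglongrightarrow> 0"
proof -
  have "(\<lambda>n. T * (1 / 2) ^ n) \<longlonglongrightarrow> T * 0" by (intro tendsto_mult_left LIMSEQ_power_zero) simp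
  moreover have "mesh = (\<lambda>n. T * (1 / 2) ^ n)" by (simp add: mesh_def fun_eq_iff power_divide)
  ultimately show ?thesis by simp
qed

lemma cell_bounds:
  assumes "t \<in> \<T>" shows "real (cell n t) * mesh n \<le> t" "t < (real (cell n t) + 1) * mesh n"
proof -
  have p: "0 \<le> \<lfloor>t / mesh n\<rfloor>" using assms mesh_pos[of n] by simp
  have "real (cell n t) = real_of_int \<lfloor>t / mesh n\<rfloor>" unfolding cell_def using p by simp
  then show "real (cell n t) * mesh n \<le> t" "t < (real (cell n t) + 1) * mesh n"
    using mesh_pos[of n] of_int_floor_le[of "t / mesh n"] floor_correct[of "t / mesh n"]
    by (simp_all add: pos_le_divide_eq[symmetric] pos_divide_less_eq[symmetric])
qed

lemma cell_less: assumes "t \<in> \<T>" shows "cell n t < 2 ^ n"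
proof -
  have "real (cell n t) * mesh n < 2 ^ n * mesh n" using cell_bounds(1)[OF assms, of n] assms mesh_mult[of n] by (simp add: mult.commute)
  then have "real (cell n t) < 2 ^ n" using mesh_pos[of n] by simp
  then show ?thesis by (metis of_nat_less_numeral_power_cancel_iff)
qed

lemma cell_unique:
  assumes "real k * mesh n \<le> t" "t < (real k + 1) * mesh n" shows "cell n t = k"
proof -
  have "\<lfloor>t / mesh n\<rfloor> = int k" using assms mesh_pos[of n]
    by (intro floor_unique) (simp_all add: pos_le_divide_eq pos_divide_less_eq)
  then show ?thesis by (simp add: cell_def)
qed

text \<open>
  Dyadic meshes are nested. Integer division is the form in which
  \<open>euler_comparison\<close> relates the fine to the coarse steps.
\<close>

lemma cell_div:
  assumes "n \<le> m" "t \<in> \<T>" shows "cell n t = cell m t div 2 ^ (m - n)"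
proof -
  have "mesh n = mesh m * 2 ^ (m - n)" using assms(1) by (simp add: mesh_def power_diff field_simps)
  then have "\<lfloor>t / mesh n\<rfloor> = \<lfloor>(t / mesh m) / real_of_int (2 ^ (m - n))\<rfloor>" by simp
  also have "\<dots> = \<lfloor>t / mesh m\<rfloor> div 2 ^ (m - n)" by (rule floor_divide_real_eq_div) simp
  finally show ?thesis using assms(2) mesh_pos[of m] unfolding cell_def by (simp add: nat_div_distrib nat_power_eq)
qed

lemma cell_set: "{t \<in> \<T>. cell n t = k} = (if k < 2 ^ n then \<T> \<inter> {real k * mesh n..<(real k + 1) * mesh n} else {})"
proof (cases "k < 2 ^ n")
  case True
  have "{t \<in> \<T>. cell n t = k} = \<T> \<inter> {real k * mesh n..<(real k + 1) * mesh n}"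
  proof (intro set_eqI iffI)
    fix t assume "t \<in> {t \<in> \<T>. cell n t = k}"
    then have t: "t \<in> \<T>" "cell n t = k" by blast+
    show "t \<in> \<T> \<inter> {real k * mesh n..<(real k + 1) * mesh n}"
      using cell_bounds[OF t(1), of n] t(1) unfolding t(2) by simp
  next
    fix t assume "t \<in> \<T> \<inter> {real k * mesh n..<(real k + 1) * mesh n}"
    then show "t \<in> {t \<in> \<T>. cell n t = k}" using cell_unique[of k n t] by simp
  qed
  then show ?thesis using True by (simp only: if_True)
next
  case False
  then have "{t \<in> \<T>. cell n t = k} = {}" using cell_less[of _ n] by blast
  then show ?thesis using False by (simp only: if_False)
qed

lemma cell_simple: "simple_function \<Lambda> (cell n)"
  unfolding simple_function_def
proof (intro conjI ballI)
  have "cell n ` space \<Lambda> \<subseteq> {..<2 ^ n}" using cell_less by auto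
  then show "finite (cell n ` space \<Lambda>)" using finite_subset by blast
  fix k
  have "cell n -` {k} \<inter> space \<Lambda> = {t \<in> \<T>. cell n t = k}" by auto
  also have "\<dots> \<in> sets \<Lambda>" unfolding cell_set by (simp add: sets_restrict_space_iff)
  finally show "cell n -` {k} \<inter> space \<Lambda> \<in> sets \<Lambda>" .
qed

lemma measure_cell: assumes "k < 2 ^ n" shows "measure \<Lambda> {t \<in> \<T>. cell n t = k} = mesh n"
proof -
  have le: "(real k + 1) * mesh n \<le> T"
  proof -
    have "real k + 1 \<le> 2 ^ n" using assms by (metis Suc_leI of_nat_Suc of_nat_le_numeral_power_cancel_iff add.commute)
    then have "(real k + 1) * mesh n \<le> 2 ^ n * mesh n" using mesh_pos[of n] by (intro mult_right_mono) auto
    then show ?thesis using mesh_mult[of n] by (simp add: mult.commute)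
  qed
  let ?a = "real k * mesh n" and ?b = "(real k + 1) * mesh n"
  have ab: "0 \<le> ?a" "?a \<le> ?b" "?b - ?a = mesh n" using mesh_pos[of n] by (simp_all add: algebra_simps)
  have set: "{t \<in> \<T>. cell n t = k} = \<T> \<inter> {?a..<?b}" by (simp only: cell_set assms if_True)
  have "{?a<..<?b} \<subseteq> \<T> \<inter> {?a..<?b}" "\<T> \<inter> {?a..<?b} \<subseteq> {?a..?b}"
    using le le_less_trans[OF ab(1)] by auto
  then have "measure lebesgue {?a<..<?b} \<le> measure lebesgue (\<T> \<inter> {?a..<?b})" "measure lebesgue (\<T> \<inter> {?a..<?b}) \<le> measure lebesgue {?a..?b}"
    by (intro measure_mono_fmeasurable; simp add: fmeasurable_Int_fmeasurable)+
  then have "measure lebesgue (\<T> \<inter> {?a..<?b}) = mesh n" using ab by simp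
  moreover have "measure \<Lambda> (\<T> \<inter> {?a..<?b}) = measure lebesgue (\<T> \<inter> {?a..<?b})"
    by (rule measure_restrict_space) auto
  ultimately show ?thesis unfolding set by simp
qed

lemma integral_cell:
  fixes g :: "nat \<Rightarrow> real"
  shows "integrable \<Lambda> (\<lambda>t. g (cell n t))" "(\<integral>t. g (cell n t) \<partial>\<Lambda>) = mesh n * (\<Sum>k<2 ^ n. g k)"
proof -
  have eq: "g (cell n t) = (\<Sum>k<2 ^ n. indicator {t \<in> \<T>. cell n t = k} t * g k)" if "t \<in> \<T>" for t
  proof -
    have "(\<Sum>k<2 ^ n. indicator {t \<in> \<T>. cell n t = k} t * g k) = (\<Sum>k<2 ^ n. if cell n t = k then g k else 0)"
      using that by (intro sum.cong refl) (auto simp: indicator_def)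
    also have "\<dots> = g (cell n t)" using cell_less[OF that, of n] by (simp add: sum.delta')
    finally show ?thesis by simp
  qed
  have me: "{t \<in> \<T>. cell n t = k} \<in> sets \<Lambda>" for k
    using simple_functionD(2)[OF cell_simple, of n "{k}"] by (simp add: vimage_def Int_def conj_commute)
  have int: "integrable \<Lambda> (\<lambda>t. indicator {t \<in> \<T>. cell n t = k} t * g k)" for k
    using me[of k] by (intro integrable_mult_left integrable_real_indicator) (auto simp: emeasure_finite less_top[symmetric])
  have "integrable \<Lambda> (\<lambda>t. \<Sum>k<2 ^ n. indicator {t \<in> \<T>. cell n t = k} t * g k)"
    by (intro Bochner_Integration.integrable_sum int)
  then show "integrable \<Lambda> (\<lambda>t. g (cell n t))"
    by (rule Bochner_Integration.integrable_cong[THEN iffD1, OF refl, rotated]) (simp add: eq)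
  have "(\<integral>t. g (cell n t) \<partial>\<Lambda>) = (\<integral>t. (\<Sum>k<2 ^ n. indicator {t \<in> \<T>. cell n t = k} t * g k) \<partial>\<Lambda>)"
    by (intro Bochner_Integration.integral_cong refl) (simp add: eq)
  also have "\<dots> = (\<Sum>k<2 ^ n. measure \<Lambda> {t \<in> \<T>. cell n t = k} * g k)"
  proof -
    have "{t \<in> \<T>. cell n t = y} \<inter> \<T> = {t \<in> \<T>. cell n t = y}" for y by blast
    then show ?thesis using me by (subst Bochner_Integration.integral_sum[OF int]) (simp add: mult.commute)
  qed
  also have "\<dots> = mesh n * (\<Sum>k<2 ^ n. g k)" unfolding sum_distrib_left by (intro sum.cong refl) (simp only: measure_cell lessThan_iff)
  finally show "(\<integral>t. g (cell n t) \<partial>\<Lambda>) = mesh n * (\<Sum>k<2 ^ n. g k)" .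
qed

lemma cell_near: assumes "t \<in> \<T>" "s \<in> \<T>" "cell n s = cell n t" shows "\<bar>s - t\<bar> < mesh n"
  using cell_bounds[OF assms(1), of n] cell_bounds[OF assms(2), of n] assms(3) by (simp add: algebra_simps abs_less_iff)

section \<open>Approximation by step functions\<close>

lemma integrable_simple: "simple_function \<Lambda> (s :: real \<Rightarrow> real) \<Longrightarrow> integrable \<Lambda> s"
  by (rule integrable_simple_function) (auto simp: emeasure_finite)

text \<open>
  By outer regularity, \<open>A\<close> is nearly an open set \<open>U\<close>. The step
  functions with value 1 on the cells inside \<open>U\<close> converge pointwise to the
  indicator of \<open>U\<close>, since a point of \<open>U\<close> has a neighbourhood in
  \<open>U\<close> that contains its cell as soon as the mesh is small.
\<close>

lemma indicator_step_approx:
  assumes A: "A \<in> sets \<Lambda>" and e: "e > 0"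
  shows "\<exists>n0. \<forall>n\<ge>n0. \<exists>c :: nat \<Rightarrow> real. (\<integral>t. (indicator A t - c (cell n t))\<^sup>2 \<partial>\<Lambda>) \<le> e"
proof -
  have A': "A \<in> sets lebesgue" "A \<subseteq> \<T>" using A by (auto simp: sets_restrict_space)
  obtain U where U: "open U" "A \<subseteq> U" "U - A \<in> lmeasurable" "emeasure lebesgue (U - A) < ennreal (e / 4)"
    using sets_lebesgue_outer_open[OF A'(1), of "e / 4"] e by auto
  have Us: "U \<in> sets lebesgue" using U(1) by auto
  define c where "c n k = (if {t \<in> \<T>. cell n t = k} \<subseteq> U then 1 else 0 :: real)" for n k
  have 1: "(\<lambda>n. \<integral>t. (indicator U t - c n (cell n t))\<^sup>2 \<partial>\<Lambda>) \<longlonglongrightarrow> (\<integral>t. 0 \<partial>\<Lambda>)"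
  proof (rule integral_dominated_convergence[where w="\<lambda>_. 1"])
    have Um: "indicat_real U \<in> borel_measurable \<Lambda>" using Us by (intro measurable_restrict_space1 borel_measurable_indicator)
    show "(\<lambda>t. (indicat_real U t - c n (cell n t))\<^sup>2) \<in> borel_measurable \<Lambda>" for n
      using Um simple_measurable[OF cell_simple, of "c n" n] by simp
    show "AE t in \<Lambda>. norm ((indicat_real U t - c n (cell n t))\<^sup>2) \<le> 1" for n
      by (intro AE_I2) (auto simp: indicator_def c_def)
    show "AE t in \<Lambda>. (\<lambda>n. (indicat_real U t - c n (cell n t))\<^sup>2) \<longlonglongrightarrow> 0"
    proof (intro AE_I2 tendsto_eventually)
      fix t assume "t \<in> space \<Lambda>"
      then have t: "t \<in> \<T>" by simp
      show "\<forall>\<^sub>F n in sequentially. (indicat_real U t - c n (cell n t))\<^sup>2 = 0"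
      proof (cases "t \<in> U")
        case True
        then obtain d where d: "d > 0" "ball t d \<subseteq> U" using U(1) open_contains_ball by blast
        have "\<forall>\<^sub>F n in sequentially. mesh n < d" using order_tendstoD(2)[OF mesh_tendsto d(1)] .
        then show ?thesis
        proof eventually_elim
          case (elim n)
          have "{s \<in> \<T>. cell n s = cell n t} \<subseteq> ball t d"
            using cell_near[OF t, of _ n] elim by (force simp: dist_real_def)
          then show ?case using d True unfolding c_def by auto
        qed
      next
        case False
        then show ?thesis using t by (intro always_eventually) (auto simp: c_def)
      qed
    qed
  qed simp_all
  then have "\<forall>\<^sub>F n in sequentially. (\<integral>t. (indicator U t - c n (cell n t))\<^sup>2 \<partial>\<Lambda>) < e / 4"
    using order_tendstoD(2)[of _ _ _ "e / 4"] e by fastforce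
  then obtain n0 where n0: "\<And>n. n \<ge> n0 \<Longrightarrow> (\<integral>t. (indicator U t - c n (cell n t))\<^sup>2 \<partial>\<Lambda>) < e / 4" unfolding eventually_sequentially by blast
  have meas: "indicat_real U \<in> borel_measurable \<Lambda>" "indicat_real A \<in> borel_measurable \<Lambda>"
    using Us A by (auto intro: measurable_restrict_space1)
  have bI: "integrable \<Lambda> g" if "g \<in> borel_measurable \<Lambda>" "\<And>t. \<bar>g t\<bar> \<le> 1" for g :: "real \<Rightarrow> real"
    using that by (intro integrable_const_bound[of _ 1]) auto
  have "(\<integral>t. (indicator A t - c n (cell n t))\<^sup>2 \<partial>\<Lambda>) \<le> e" if n: "n \<ge> n0" for n
  proof -
    have cm: "(\<lambda>t. c n (cell n t)) \<in> borel_measurable \<Lambda>" by (rule simple_measurable[OF cell_simple])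
    have i1: "integrable \<Lambda> (\<lambda>t. (indicat_real A t - indicat_real U t)\<^sup>2)"
      by (rule bI, intro borel_measurable_power borel_measurable_diff meas, auto simp: indicator_def)
    have i2: "integrable \<Lambda> (\<lambda>t. (indicat_real U t - c n (cell n t))\<^sup>2)"
      by (rule bI, intro borel_measurable_power borel_measurable_diff meas cm, auto simp: indicator_def c_def)
    have i3: "integrable \<Lambda> (\<lambda>t. (indicat_real A t - c n (cell n t))\<^sup>2)"
      by (rule bI, intro borel_measurable_power borel_measurable_diff meas cm, auto simp: indicator_def c_def)
    note i = i1 i2 i3
    have AU: "(\<integral>t. (indicat_real A t - indicat_real U t)\<^sup>2 \<partial>\<Lambda>) \<le> e / 4"
    proof -
      have "(\<integral>t. (indicat_real A t - indicat_real U t)\<^sup>2 \<partial>\<Lambda>) = (\<integral>t. indicat_real (\<T> \<inter> (U - A)) t \<partial>\<Lambda>)"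
        using U(2) by (intro Bochner_Integration.integral_cong) (auto simp: indicator_def)
      also have "\<dots> = measure \<Lambda> (\<T> \<inter> (U - A))"
      proof -
        have "\<T> \<inter> (U - A) \<inter> space \<Lambda> = \<T> \<inter> (U - A)" by auto
        then show ?thesis using Bochner_Integration.integral_indicator[of \<Lambda> "\<T> \<inter> (U - A)"] by (simp only:)
      qed
      also have "\<dots> = measure lebesgue (\<T> \<inter> (U - A))" by (rule measure_restrict_space) auto
      also have "\<dots> \<le> measure lebesgue (U - A)" using U(3) by (intro measure_mono_fmeasurable) auto
      also have "\<dots> \<le> e / 4" using U(3,4) e by (simp add: emeasure_eq_measure2 ennreal_less_iff)
      finally show ?thesis .
    qed
    have "(\<integral>t. (indicat_real A t - c n (cell n t))\<^sup>2 \<partial>\<Lambda>) \<le> (\<integral>t. 2 * (indicat_real A t - indicat_real U t)\<^sup>2 + 2 * (indicat_real U t - c n (cell n t))\<^sup>2 \<partial>\<Lambda>)"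
    proof (rule integral_mono)
      show "(indicat_real A t - c n (cell n t))\<^sup>2 \<le> 2 * (indicat_real A t - indicat_real U t)\<^sup>2 + 2 * (indicat_real U t - c n (cell n t))\<^sup>2" for t
        by (auto simp: indicator_def c_def)
    qed (use i in auto)
    also have "\<dots> = 2 * (\<integral>t. (indicat_real A t - indicat_real U t)\<^sup>2 \<partial>\<Lambda>) + 2 * (\<integral>t. (indicat_real U t - c n (cell n t))\<^sup>2 \<partial>\<Lambda>)"
      using i by simp
    finally show ?thesis using AU n0[OF n] by simp
  qed
  then show ?thesis by blast
qed

definition step_approximable :: "('b \<Rightarrow> real) set \<Rightarrow> (('b \<Rightarrow> real) \<Rightarrow> real) \<Rightarrow> (real \<Rightarrow> 'b \<Rightarrow> real) \<Rightarrow> bool" where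
  "step_approximable X N s \<longleftrightarrow> (\<forall>e>0. \<exists>n0. \<forall>n\<ge>n0. \<exists>g. (\<forall>k. g k \<in> X) \<and> (\<integral>t. (N (s t - g (cell n t)))\<^sup>2 \<partial>\<Lambda>) \<le> e)"

lemma integrable_simple_norm: "simple_function \<Lambda> s \<Longrightarrow> integrable \<Lambda> (\<lambda>t. (N (s t - g (cell n t)))\<^sup>2 :: real)"
  using integrable_simple[OF simple_function_compose2[OF _ cell_simple, of s "\<lambda>a k. (N (a - g k))\<^sup>2" n]] by simp

lemma step_approximable_add:
  assumes "seminormed X N" "simple_in \<Lambda> X s" "simple_in \<Lambda> X s'" "step_approximable X N s" "step_approximable X N s'"
  shows "step_approximable X N (\<lambda>t. s t + s' t)"
  unfolding step_approximable_def
proof (intro allI impI)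
  interpret seminormed X N by fact
  fix e :: real assume e: "e > 0"
  obtain n1 where n1: "\<forall>n\<ge>n1. \<exists>g. (\<forall>k. g k \<in> X) \<and> (\<integral>t. (N (s t - g (cell n t)))\<^sup>2 \<partial>\<Lambda>) \<le> e / 4"
    using assms(4) e unfolding step_approximable_def by (meson divide_pos_pos zero_less_numeral)
  obtain n2 where n2: "\<forall>n\<ge>n2. \<exists>g. (\<forall>k. g k \<in> X) \<and> (\<integral>t. (N (s' t - g (cell n t)))\<^sup>2 \<partial>\<Lambda>) \<le> e / 4"
    using assms(5) e unfolding step_approximable_def by (meson divide_pos_pos zero_less_numeral)
  have "\<exists>g. (\<forall>k. g k \<in> X) \<and> (\<integral>t. (N (s t + s' t - g (cell n t)))\<^sup>2 \<partial>\<Lambda>) \<le> e" if n: "n \<ge> max n1 n2" for n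
  proof -
    obtain g where g: "\<And>k. g k \<in> X" "(\<integral>t. (N (s t - g (cell n t)))\<^sup>2 \<partial>\<Lambda>) \<le> e / 4" using n1 n by (meson max.bounded_iff)
    obtain g' where g': "\<And>k. g' k \<in> X" "(\<integral>t. (N (s' t - g' (cell n t)))\<^sup>2 \<partial>\<Lambda>) \<le> e / 4" using n2 n by (meson max.bounded_iff)
    have sf: "simple_function \<Lambda> s" "simple_function \<Lambda> s'" using assms(2,3) by (auto simp: simple_in_def)
    have "(\<integral>t. (N (s t + s' t - (g (cell n t) + g' (cell n t))))\<^sup>2 \<partial>\<Lambda>)
      \<le> (\<integral>t. 2 * (N (s t - g (cell n t)))\<^sup>2 + 2 * (N (s' t - g' (cell n t)))\<^sup>2 \<partial>\<Lambda>)"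
    proof (rule integral_mono)
      show "integrable \<Lambda> (\<lambda>t. (N (s t + s' t - (g (cell n t) + g' (cell n t))))\<^sup>2)"
        by (rule integrable_simple_norm[where g="\<lambda>k. g k + g' k"]) (rule simple_function_compose2[OF sf])
      show "integrable \<Lambda> (\<lambda>t. 2 * (N (s t - g (cell n t)))\<^sup>2 + 2 * (N (s' t - g' (cell n t)))\<^sup>2)"
        by (intro Bochner_Integration.integrable_add integrable_mult_right
            integrable_simple_norm[where s=s and g=g and N=N] integrable_simple_norm[where s=s' and g=g' and N=N] sf)
      fix t assume "t \<in> space \<Lambda>"
      then have X: "s t \<in> X" "s' t \<in> X" using assms(2,3) by (auto simp: simple_in_def)
      have D: "s t - g (cell n t) \<in> X" "s' t - g' (cell n t) \<in> X" by (intro X_intros X g g')+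
      have "s t + s' t - (g (cell n t) + g' (cell n t)) = (s t - g (cell n t)) + (s' t - g' (cell n t))" by simp
      then have "N (s t + s' t - (g (cell n t) + g' (cell n t))) \<le> N (s t - g (cell n t)) + N (s' t - g' (cell n t))"
        using N_triangle[OF D] by (simp only:)
      moreover have "0 \<le> N (s t + s' t - (g (cell n t) + g' (cell n t)))" by (intro N_nonneg X_intros X g g')
      ultimately have "(N (s t + s' t - (g (cell n t) + g' (cell n t))))\<^sup>2 \<le> (N (s t - g (cell n t)) + N (s' t - g' (cell n t)))\<^sup>2"
        by (intro power_mono)
      also have "\<dots> \<le> 2 * (N (s t - g (cell n t)))\<^sup>2 + 2 * (N (s' t - g' (cell n t)))\<^sup>2"
        using sum_squares_bound[of "N (s t - g (cell n t))" "N (s' t - g' (cell n t))"] by (simp only: power2_sum)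
      finally show "(N (s t + s' t - (g (cell n t) + g' (cell n t))))\<^sup>2 \<le> 2 * (N (s t - g (cell n t)))\<^sup>2 + 2 * (N (s' t - g' (cell n t)))\<^sup>2" .
    qed
    also have "\<dots> = 2 * (\<integral>t. (N (s t - g (cell n t)))\<^sup>2 \<partial>\<Lambda>) + 2 * (\<integral>t. (N (s' t - g' (cell n t)))\<^sup>2 \<partial>\<Lambda>)"
      by (subst Bochner_Integration.integral_add) (simp_all add: integrable_simple_norm[where s=s and g=g and N=N] integrable_simple_norm[where s=s' and g=g' and N=N] sf)
    also have "\<dots> \<le> e" using g(2) g'(2) by linarith
    finally show ?thesis using g(1) g'(1) X_intros(2) by (intro exI[of _ "\<lambda>k. g k + g' k"]) blast
  qed
  then show "\<exists>n0. \<forall>n\<ge>n0. \<exists>g. (\<forall>k. g k \<in> X) \<and> (\<integral>t. (N (s t + s' t - g (cell n t)))\<^sup>2 \<partial>\<Lambda>) \<le> e" by blast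
qed

lemma step_approximable_indicator:
  assumes "seminormed X N" "y \<in> X" "A \<in> sets \<Lambda>"
  shows "step_approximable X N (\<lambda>t. indicator A t *\<^sub>R y)"
  unfolding step_approximable_def
proof (intro allI impI)
  interpret seminormed X N by fact
  fix e :: real assume e: "e > 0"
  have e': "e / (1 + (N y)\<^sup>2) > 0" using e by (simp add: add_pos_nonneg)
  obtain n0 where n0: "\<forall>n\<ge>n0. \<exists>c :: nat \<Rightarrow> real. (\<integral>t. (indicator A t - c (cell n t))\<^sup>2 \<partial>\<Lambda>) \<le> e / (1 + (N y)\<^sup>2)"
    using indicator_step_approx[OF assms(3) e'] by blast
  have "\<exists>g. (\<forall>k. g k \<in> X) \<and> (\<integral>t. (N (indicator A t *\<^sub>R y - g (cell n t)))\<^sup>2 \<partial>\<Lambda>) \<le> e" if n: "n \<ge> n0" for n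
  proof -
    obtain c :: "nat \<Rightarrow> real" where c: "(\<integral>t. (indicator A t - c (cell n t))\<^sup>2 \<partial>\<Lambda>) \<le> e / (1 + (N y)\<^sup>2)" using n0 n by blast
    have "N (indicator A t *\<^sub>R y - c (cell n t) *\<^sub>R y) = \<bar>indicator A t - c (cell n t)\<bar> * N y" for t
      using N_scale[OF assms(2), of "indicator A t - c (cell n t)"] by (simp only: scaleR_diff_left)
    then have "(\<integral>t. (N (indicator A t *\<^sub>R y - c (cell n t) *\<^sub>R y))\<^sup>2 \<partial>\<Lambda>) = (\<integral>t. (indicator A t - c (cell n t))\<^sup>2 \<partial>\<Lambda>) * (N y)\<^sup>2"
      by (simp only: power_mult_distrib power2_abs integral_mult_left_zero)
    also have "\<dots> \<le> e / (1 + (N y)\<^sup>2) * (1 + (N y)\<^sup>2)" using c e' by (intro mult_mono) auto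
    also have "\<dots> = e" by (simp add: add_pos_nonneg less_imp_neq[symmetric])
    finally show ?thesis using X_intros(4)[OF assms(2)] by (intro exI[of _ "\<lambda>k. c k *\<^sub>R y"]) blast
  qed
  then show "\<exists>n0. \<forall>n\<ge>n0. \<exists>g. (\<forall>k. g k \<in> X) \<and> (\<integral>t. (N (indicator A t *\<^sub>R y - g (cell n t)))\<^sup>2 \<partial>\<Lambda>) \<le> e" by blast
qed

lemma step_approximable_cong:
  assumes "\<And>t. t \<in> \<T> \<Longrightarrow> s t = s' t" "step_approximable X N s" shows "step_approximable X N s'"
proof -
  have "(\<integral>t. (N (s t - g (cell n t)))\<^sup>2 \<partial>\<Lambda>) = (\<integral>t. (N (s' t - g (cell n t)))\<^sup>2 \<partial>\<Lambda>)" for g n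
    using assms(1) by (intro Bochner_Integration.integral_cong) auto
  then show ?thesis using assms(2) unfolding step_approximable_def by simp
qed

lemma step_approximable_simple:
  assumes sn: "seminormed X N" and s: "simple_in \<Lambda> X s" shows "step_approximable X N s"
proof -
  interpret seminormed X N by fact
  have fin: "finite (s ` \<T>)" and me: "\<And>y. {t \<in> \<T>. s t = y} \<in> sets \<Lambda>" and sX: "s ` \<T> \<subseteq> X"
  proof -
    have sf: "simple_function \<Lambda> s" using s by (simp add: simple_in_def)
    show "finite (s ` \<T>)" using simple_functionD(1)[OF sf] by simp
    show "{t \<in> \<T>. s t = y} \<in> sets \<Lambda>" for y using simple_functionD(2)[OF sf, of "{y}"] by (simp add: vimage_def Int_def conj_commute)
    show "s ` \<T> \<subseteq> X" using s by (simp add: simple_in_def)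
  qed
  have "finite S \<Longrightarrow> S \<subseteq> X \<Longrightarrow> simple_in \<Lambda> X (\<lambda>t. \<Sum>y\<in>S. indicator {t \<in> \<T>. s t = y} t *\<^sub>R y) \<and>
      step_approximable X N (\<lambda>t. \<Sum>y\<in>S. indicator {t \<in> \<T>. s t = y} t *\<^sub>R y)" for S
  proof (induction S rule: finite_induct)
    case empty
    have "step_approximable X N (\<lambda>t. 0)"
      unfolding step_approximable_def by (intro allI impI exI[of _ 0] exI[of _ "\<lambda>k. 0"]) (use X_intros(1) in \<open>simp del: zero_fun_apply\<close>)
    then show ?case using X_intros(1) by (auto simp: simple_in_def simp del: zero_fun_apply)
  next
    case (insert y S)
    have yX: "y \<in> X" using insert by blast
    have IH: "simple_in \<Lambda> X (\<lambda>t. \<Sum>y\<in>S. indicator {t \<in> \<T>. s t = y} t *\<^sub>R y)"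
      "step_approximable X N (\<lambda>t. \<Sum>y\<in>S. indicator {t \<in> \<T>. s t = y} t *\<^sub>R y)" using insert by blast+
    have 1: "simple_in \<Lambda> X (\<lambda>t. indicator {t \<in> \<T>. s t = y} t *\<^sub>R y)"
      using simple_function_compose1[OF simple_function_indicator[OF me[of y]], of "\<lambda>c. c *\<^sub>R y"] X_intros(4)[OF yX]
      by (auto simp: simple_in_def simp del: scaleR_apply)
    have 2: "simple_in \<Lambda> X (\<lambda>t. indicator {t \<in> \<T>. s t = y} t *\<^sub>R y + (\<Sum>y\<in>S. indicator {t \<in> \<T>. s t = y} t *\<^sub>R y))"
      unfolding simple_in_def
    proof (intro conjI)
      show "simple_function \<Lambda> (\<lambda>t. indicator {t \<in> \<T>. s t = y} t *\<^sub>R y + (\<Sum>y\<in>S. indicator {t \<in> \<T>. s t = y} t *\<^sub>R y))"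
        using 1 IH(1) unfolding simple_in_def by (intro simple_function_compose2[where h="(+)"]) blast+
      show "(\<lambda>t. indicator {t \<in> \<T>. s t = y} t *\<^sub>R y + (\<Sum>y\<in>S. indicator {t \<in> \<T>. s t = y} t *\<^sub>R y)) ` space \<Lambda> \<subseteq> X"
        using 1 IH(1) unfolding simple_in_def by (intro image_subsetI X_intros(2)) blast+
    qed
    show ?case unfolding sum.insert[OF insert.hyps]
      using 2 step_approximable_add[OF sn 1 IH(1) step_approximable_indicator[OF sn yX me] IH(2)] by blast
  qed
  from this[OF fin sX] have "step_approximable X N (\<lambda>t. \<Sum>y\<in>s ` \<T>. indicator {t \<in> \<T>. s t = y} t *\<^sub>R y)" by blast
  moreover have "(\<Sum>y\<in>s ` \<T>. indicator {t \<in> \<T>. s t = y} t *\<^sub>R y) = s t" if "t \<in> \<T>" for t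
  proof -
    have "(\<Sum>y\<in>s ` \<T>. indicator {t \<in> \<T>. s t = y} t *\<^sub>R y) = (\<Sum>y\<in>s ` \<T>. if s t = y then y else 0)"
      using that by (intro sum.cong refl) (auto simp: indicator_def fun_eq_iff)
    also have "\<dots> = s t" using fin that by (subst sum.delta') auto
    finally show ?thesis .
  qed
  ultimately show ?thesis by (rule step_approximable_cong[rotated])
qed

text \<open>
  Simple functions approximate \<open>f\<close> in the mean square, and step functions on fine
  meshes approximate simple functions. Taking, on the \<open>n\<close>-th mesh, a step function
  within \<open>mesh n\<close> of the best possible one turns the approximation to every
  accuracy into a single sequence.
\<close>

lemma step_approximation:
  fixes X :: "('b \<Rightarrow> real) set"
  assumes sn: "seminormed X N" and f: "f \<in> bochner_Lp \<Lambda> 2 X N"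
  obtains F where "\<And>n k. F n k \<in> X" "\<And>n. integrable \<Lambda> (\<lambda>t. (N (f t - F n (cell n t)))\<^sup>2)"
    "(\<lambda>n. \<integral>t. (N (f t - F n (cell n t)))\<^sup>2 \<partial>\<Lambda>) \<longlonglongrightarrow> 0"
proof -
  interpret seminormed X N by fact
  have sm: "strongly_measurable_in \<Lambda> X N f" and i0: "integrable \<Lambda> (\<lambda>t. N (f t) powr 2)" using f by (auto simp: bochner_Lp_def)
  obtain s where s: "\<And>n::nat. simple_in \<Lambda> X (s n)" "AE t in \<Lambda>. f t \<in> X"
    "AE t in \<Lambda>. (\<lambda>n. N (f t - s n t)) \<longlonglongrightarrow> 0" "AE t in \<Lambda>. \<forall>n. N (f t - s n t) \<le> 3 * N (f t)"
    "(\<lambda>t. N (f t)) \<in> borel_measurable \<Lambda>" "\<And>s'. simple_in \<Lambda> X s' \<Longrightarrow> (\<lambda>t. N (f t - s' t)) \<in> borel_measurable \<Lambda>"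
    by (rule strongly_measurable_truncated[OF sn sm]) blast
  have i: "integrable \<Lambda> (\<lambda>t. (N (f t))\<^sup>2)"
  proof (rule Bochner_Integration.integrable_cong_AE_imp[OF i0])
    show "AE t in \<Lambda>. N (f t) powr 2 = (N (f t))\<^sup>2"
      using s(2) by eventually_elim (use N_nonneg abs_powr_2 in \<open>metis abs_of_nonneg\<close>)
  qed (use s(5) in simp)
  have iF: "integrable \<Lambda> (\<lambda>t. (N (f t - s' t))\<^sup>2)" if s': "simple_in \<Lambda> X s'" for s'
  proof (rule Bochner_Integration.integrable_bound)
    have "integrable \<Lambda> (\<lambda>t. (N (s' t))\<^sup>2)" using s'
      by (intro integrable_simple simple_function_compose1[where g="\<lambda>y. (N y)\<^sup>2"]) (simp add: simple_in_def)
    then show "integrable \<Lambda> (\<lambda>t. 2 * (N (f t))\<^sup>2 + 2 * (N (s' t))\<^sup>2)" using i by simp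
    show "(\<lambda>t. (N (f t - s' t))\<^sup>2) \<in> borel_measurable \<Lambda>" using s(6)[OF s'] by simp
    show "AE t in \<Lambda>. norm ((N (f t - s' t))\<^sup>2) \<le> norm (2 * (N (f t))\<^sup>2 + 2 * (N (s' t))\<^sup>2)"
      using s(2) AE_space
    proof eventually_elim
      case (elim t)
      have sX: "s' t \<in> X" using s' elim by (auto simp: simple_in_def)
      have "(N (f t - s' t))\<^sup>2 \<le> (N (f t) + N (s' t))\<^sup>2"
        by (intro power_mono N_diff_le N_nonneg X_intros(3) elim sX)
      also have "\<dots> \<le> 2 * (N (f t))\<^sup>2 + 2 * (N (s' t))\<^sup>2"
        using sum_squares_bound[of "N (f t)" "N (s' t)"] by (simp only: power2_sum)
      finally show ?case by simp
    qed
  qed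
  define val where "val n g = (\<integral>t. (N (f t - g (cell n t)))\<^sup>2 \<partial>\<Lambda>)" for n and g :: "nat \<Rightarrow> 'b \<Rightarrow> real"
  have step_simple: "simple_in \<Lambda> X (\<lambda>t. g (cell n t))" if "\<And>k. g k \<in> X" for g n
    using that simple_function_compose1[OF cell_simple] by (auto simp: simple_in_def)
  have val_nonneg: "0 \<le> val n g" for n g unfolding val_def by simp
  have key: "\<exists>n0. \<forall>n\<ge>n0. \<exists>g. (\<forall>k. g k \<in> X) \<and> val n g \<le> e" if e: "e > 0" for e
  proof -
    have "(\<lambda>j. \<integral>t. (N (f t - s j t))\<^sup>2 \<partial>\<Lambda>) \<longlonglongrightarrow> (\<integral>t. 0 \<partial>\<Lambda>)"
    proof (rule integral_dominated_convergence[where w="\<lambda>t. 9 * (N (f t))\<^sup>2"])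
      show "AE t in \<Lambda>. norm ((N (f t - s j t))\<^sup>2) \<le> 9 * (N (f t))\<^sup>2" for j
        using s(2,4) AE_space
      proof eventually_elim
        case (elim t)
        have sX: "s j t \<in> X" using s(1)[of j] elim by (auto simp: simple_in_def)
        have "(N (f t - s j t))\<^sup>2 \<le> (3 * N (f t))\<^sup>2"
          by (intro power_mono N_nonneg X_intros(3) elim sX) (use elim in blast)
        then show ?case by (simp add: power_mult_distrib)
      qed
      show "AE t in \<Lambda>. (\<lambda>j. (N (f t - s j t))\<^sup>2) \<longlonglongrightarrow> 0"
        using s(3) by eventually_elim (use tendsto_power[of _ 0 _ 2] in fastforce)
      show "(\<lambda>t. (N (f t - s j t))\<^sup>2) \<in> borel_measurable \<Lambda>" for j using s(6)[OF s(1)] by simp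
    qed (use i in auto)
    then have "\<forall>\<^sub>F j in sequentially. (\<integral>t. (N (f t - s j t))\<^sup>2 \<partial>\<Lambda>) < e / 4"
      using order_tendstoD(2)[of _ _ _ "e / 4"] e by fastforce
    then obtain j where j: "(\<integral>t. (N (f t - s j t))\<^sup>2 \<partial>\<Lambda>) < e / 4" unfolding eventually_sequentially by blast
    obtain n0 where n0: "\<forall>n\<ge>n0. \<exists>g. (\<forall>k. g k \<in> X) \<and> (\<integral>t. (N (s j t - g (cell n t)))\<^sup>2 \<partial>\<Lambda>) \<le> e / 4"
      using step_approximable_simple[OF sn s(1)] e unfolding step_approximable_def by (meson divide_pos_pos zero_less_numeral)
    have "\<exists>g. (\<forall>k. g k \<in> X) \<and> val n g \<le> e" if n: "n \<ge> n0" for n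
    proof -
      obtain g where g: "\<And>k. g k \<in> X" "(\<integral>t. (N (s j t - g (cell n t)))\<^sup>2 \<partial>\<Lambda>) \<le> e / 4" using n0 n by blast
      have ij: "integrable \<Lambda> (\<lambda>t. (N (s j t - g (cell n t)))\<^sup>2)" using s(1) unfolding simple_in_def by (intro integrable_simple_norm[where s="s j" and g=g and N=N]) blast
      have "val n g \<le> (\<integral>t. 2 * (N (f t - s j t))\<^sup>2 + 2 * (N (s j t - g (cell n t)))\<^sup>2 \<partial>\<Lambda>)"
        unfolding val_def
      proof (rule integral_mono_AE)
        show "integrable \<Lambda> (\<lambda>t. (N (f t - g (cell n t)))\<^sup>2)" using iF[OF step_simple[OF g(1)]] .
        show "integrable \<Lambda> (\<lambda>t. 2 * (N (f t - s j t))\<^sup>2 + 2 * (N (s j t - g (cell n t)))\<^sup>2)"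
          using ij iF[OF s(1)] by (intro Bochner_Integration.integrable_add integrable_mult_right)
        show "AE t in \<Lambda>. (N (f t - g (cell n t)))\<^sup>2 \<le> 2 * (N (f t - s j t))\<^sup>2 + 2 * (N (s j t - g (cell n t)))\<^sup>2"
          using s(2) AE_space
        proof eventually_elim
          case (elim t)
          have sX: "s j t \<in> X" using s(1)[of j] elim by (auto simp: simple_in_def)
          have "(N (f t - g (cell n t)))\<^sup>2 \<le> (N (f t - s j t) + N (s j t - g (cell n t)))\<^sup>2"
            by (intro power_mono N_triangle_diff N_nonneg X_intros(3) elim sX g)
          also have "\<dots> \<le> 2 * (N (f t - s j t))\<^sup>2 + 2 * (N (s j t - g (cell n t)))\<^sup>2"
            using sum_squares_bound[of "N (f t - s j t)" "N (s j t - g (cell n t))"] by (simp only: power2_sum)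
          finally show ?case .
        qed
      qed
      also have "\<dots> = 2 * (\<integral>t. (N (f t - s j t))\<^sup>2 \<partial>\<Lambda>) + 2 * (\<integral>t. (N (s j t - g (cell n t)))\<^sup>2 \<partial>\<Lambda>)"
        by (subst Bochner_Integration.integral_add) (use ij iF[OF s(1)] in auto)
      also have "\<dots> \<le> e" using g(2) j e by linarith
      finally show ?thesis using g(1) by blast
    qed
    then show ?thesis by blast
  qed
  define G where "G = {g :: nat \<Rightarrow> 'b \<Rightarrow> real. \<forall>k. g k \<in> X}"
  have G0: "(\<lambda>k. 0) \<in> G" unfolding G_def using X_intros(1) by blast
  have bdd: "bdd_below (val n ` G)" for n using val_nonneg by (intro bdd_belowI2)
  have "\<exists>g\<in>G. val n g < Inf (val n ` G) + mesh n" for n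
    using cInf_lessD[of "val n ` G" "Inf (val n ` G) + mesh n"] G0 mesh_pos[of n] by auto
  then obtain F where F: "\<And>n. F n \<in> G" "\<And>n. val n (F n) < Inf (val n ` G) + mesh n" by metis
  have "(\<lambda>n. val n (F n)) \<longlonglongrightarrow> 0"
  proof (rule LIMSEQ_I)
    fix e :: real assume e: "0 < e"
    obtain n0 where n0: "\<forall>n\<ge>n0. \<exists>g. (\<forall>k. g k \<in> X) \<and> val n g \<le> e / 2" using key[of "e / 2"] e by auto
    obtain n1 where n1: "\<forall>n\<ge>n1. mesh n < e / 2"
      using order_tendstoD(2)[OF mesh_tendsto, of "e / 2"] e unfolding eventually_sequentially by auto
    have "norm (val n (F n) - 0) < e" if n: "n \<ge> max n0 n1" for n
    proof -
      obtain g where g: "g \<in> G" "val n g \<le> e / 2" using n0 n unfolding G_def by auto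
      have "Inf (val n ` G) \<le> e / 2" using cINF_lower[OF bdd g(1)] g(2) by (rule order_trans)
      then have "val n (F n) < e" using F(2)[of n] n1[rule_format, of n] n by simp
      then show ?thesis using val_nonneg[of n "F n"] by simp
    qed
    then show "\<exists>no. \<forall>n\<ge>no. norm (val n (F n) - 0) < e" by blast
  qed
  moreover have FX: "F n k \<in> X" for n k using F(1)[of n] unfolding G_def by blast
  moreover have "integrable \<Lambda> (\<lambda>t. (N (f t - F n (cell n t)))\<^sup>2)" for n using iF[OF step_simple[OF FX]] .
  ultimately show ?thesis using that unfolding val_def by blast
qed

end

section \<open>Continuity of the nonlinearity\<close>

lemma (in semi_inner) nrm_cauchy_of_summable:
  assumes W: "\<And>k. x k \<in> W" and s: "summable (\<lambda>k. nrm (x k - x (Suc k)))" and e: "e > 0"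
  shows "\<exists>K. \<forall>i\<ge>K. \<forall>j\<ge>K. nrm (x i - x j) \<le> e"
proof -
  obtain K where K: "\<And>m n. m \<ge> K \<Longrightarrow> norm (sum (\<lambda>k. nrm (x k - x (Suc k))) {m..<n}) < e"
    using s e unfolding summable_Cauchy by blast
  have tele: "nrm (x i - x (i + d)) \<le> (\<Sum>k\<in>{i..<i + d}. nrm (x k - x (Suc k)))" for i d
  proof (induction d)
    case (Suc d)
    have "nrm (x i - x (Suc (i + d))) \<le> nrm (x i - x (i + d)) + nrm (x (i + d) - x (Suc (i + d)))"
      by (intro nrm_triangle_diff W)
    then show ?case using Suc by (simp del: minus_apply)
  qed (simp del: zero_fun_apply)
  have "nrm (x i - x j) \<le> e" if ij: "K \<le> i" "i \<le> j" for i j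
    using tele[of i "j - i"] K[OF ij(1), of j] ij(2) by simp
  then have "nrm (x i - x j) \<le> e" if "K \<le> i" "K \<le> j" for i j
    using that nrm_minus[OF W W, of i j] by (metis linorder_le_cases)
  then show ?thesis by blast
qed

context ginzburg_landau begin

lemma L4_product_integrable:
  assumes "a \<in> Lp M 4" "b \<in> Lp M 4" "c \<in> Lp M 4" "d \<in> Lp M 4"
  shows "integrable M (\<lambda>x. a x * b x * (c x * d x))" "(\<lambda>x. a x * b x) \<in> Lp M 2"
proof -
  have two: "(\<lambda>x. a x * b x) \<in> Lp M 2" if ab: "a \<in> Lp M 4" "b \<in> Lp M 4" for a b
  proof -
    have "integrable M (\<lambda>x. (a x * b x)\<^sup>2)"
    proof (rule Bochner_Integration.integrable_bound)
      show "integrable M (\<lambda>x. a x ^ 4 + b x ^ 4)" using ab by (simp add: Lp4_iff)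
      have "(a x * b x)\<^sup>2 \<le> a x ^ 4 + b x ^ 4" for x
      proof -
        have "2 * ((a x)\<^sup>2 * (b x)\<^sup>2) \<le> a x ^ 4 + b x ^ 4" using sum_squares_bound[of "(a x)\<^sup>2" "(b x)\<^sup>2"] by (simp add: mult.assoc)
        moreover have "0 \<le> (a x)\<^sup>2 * (b x)\<^sup>2" by simp
        ultimately show ?thesis unfolding power_mult_distrib by linarith
      qed
      then show "AE x in M. norm ((a x * b x)\<^sup>2) \<le> norm (a x ^ 4 + b x ^ 4)" by (intro AE_I2) (simp add: abs_of_nonneg)
    qed (use ab in \<open>auto simp: Lp4_iff\<close>)
    then show ?thesis using ab by (auto simp: Lp2_iff Lp4_iff)
  qed
  show "(\<lambda>x. a x * b x) \<in> Lp M 2" using two assms by blast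
  show "integrable M (\<lambda>x. a x * b x * (c x * d x))" using L2_mult_integrable[OF two two] assms by blast
qed

text \<open>
  Two applications of the Cauchy-Schwarz inequality reduce the integral to the norms in
  \<open>L\<^sup>4\<close>, which the form controls.
\<close>

lemma quartic_form_bound:
  assumes "a \<in> W" "b \<in> W" "c \<in> W" "d \<in> W"
  shows "\<bar>\<integral>x. a x * b x * (c x * d x) \<partial>M\<bar> \<le> C\<^sub>4 * (A.nrm a * A.nrm b * (A.nrm c * A.nrm d))"
proof -
  have sq: "(\<integral>x. (a x * b x) * (a x * b x) \<partial>M) \<le> (C\<^sub>4 * (A.nrm a * A.nrm b)\<^sup>2)" if ab: "a \<in> W" "b \<in> W" for a b
  proof (rule power2_le_imp_le)
    note L = W_L4[OF ab(1)] W_L4[OF ab(2)]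
    have "((\<integral>x. (a x * a x) * (b x * b x) \<partial>M))\<^sup>2 \<le> (\<integral>x. (a x * a x) * (a x * a x) \<partial>M) * (\<integral>x. (b x * b x) * (b x * b x) \<partial>M)"
      using L by (intro L2.cauchy_schwarz_sq L4_product_integrable)
    also have "\<dots> = (\<integral>x. a x ^ 4 \<partial>M) * (\<integral>x. b x ^ 4 \<partial>M)" by (simp add: power4_eq_xxxx mult.assoc)
    also have "\<dots> \<le> (C\<^sub>4 * (A a a)\<^sup>2) * (C\<^sub>4 * (A b b)\<^sup>2)"
      using C4_pos by (intro mult_mono embed4 ab) auto
    also have "\<dots> = (C\<^sub>4 * (A.nrm a * A.nrm b)\<^sup>2)\<^sup>2"
      unfolding A.nrm_sq[OF ab(1), symmetric] A.nrm_sq[OF ab(2), symmetric] by (simp add: power2_eq_square)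
    finally show "((\<integral>x. (a x * b x) * (a x * b x) \<partial>M))\<^sup>2 \<le> (C\<^sub>4 * (A.nrm a * A.nrm b)\<^sup>2)\<^sup>2" by (simp add: mult.assoc mult.left_commute)
    show "0 \<le> C\<^sub>4 * (A.nrm a * A.nrm b)\<^sup>2" using C4_pos by simp
  qed
  note L = assms[THEN W_L4]
  have nn: "0 \<le> A.nrm a" "0 \<le> A.nrm b" "0 \<le> A.nrm c" "0 \<le> A.nrm d" using assms by auto
  have "(\<integral>x. a x * b x * (c x * d x) \<partial>M)\<^sup>2 \<le> (\<integral>x. (a x * b x) * (a x * b x) \<partial>M) * (\<integral>x. (c x * d x) * (c x * d x) \<partial>M)"
    using L by (intro L2.cauchy_schwarz_sq L4_product_integrable(2))
  also have "\<dots> \<le> (C\<^sub>4 * (A.nrm a * A.nrm b)\<^sup>2) * (C\<^sub>4 * (A.nrm c * A.nrm d)\<^sup>2)"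
    using C4_pos by (intro mult_mono sq assms) auto
  also have "\<dots> = (C\<^sub>4 * (A.nrm a * A.nrm b * (A.nrm c * A.nrm d)))\<^sup>2" by (simp add: power2_eq_square)
  finally have "\<bar>\<integral>x. a x * b x * (c x * d x) \<partial>M\<bar>\<^sup>2 \<le> (C\<^sub>4 * (A.nrm a * A.nrm b * (A.nrm c * A.nrm d)))\<^sup>2" by simp
  then show ?thesis using C4_pos nn by (intro power2_le_imp_le[of "\<bar>_\<bar>"]) auto
qed

text \<open>
  The factorisation \<open>phi a - phi b = (a - b) (a\<^sup>2 + a b + b\<^sup>2 - 1)\<close>
  expresses the difference by three quartic integrals and an \<open>L\<^sup>2\<close> product.
\<close>

lemma dwell_diff_bound:
  assumes a: "a \<in> W" and b: "b \<in> W" and v: "v \<in> W"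
  shows "\<bar>dwell a v - dwell b v\<bar> \<le> (C\<^sub>4 * ((A.nrm a)\<^sup>2 + A.nrm a * A.nrm b + (A.nrm b)\<^sup>2) + C\<^sub>2) * A.nrm (a - b) * A.nrm v"
proof -
  have abs4: "\<bar>p + q + r - z\<bar> \<le> \<bar>p\<bar> + \<bar>q\<bar> + \<bar>r\<bar> + \<bar>z\<bar>" for p q r z :: real by linarith
  have d: "a - b \<in> W" using a b by blast
  note L = W_L4[OF a] W_L4[OF b] W_L4[OF v] W_L4[OF d]
  have i: "integrable M (\<lambda>x. (a - b) x * v x * (p x * q x))" if "p \<in> Lp M 4" "q \<in> Lp M 4" for p q
    by (intro L4_product_integrable L that)
  have i2: "integrable M (\<lambda>x. (a - b) x * v x)" by (intro L2_mult_integrable W_L2 d v)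
  note j = i[OF L(1) L(1)] i[OF L(1) L(2)] i[OF L(2) L(2)]
  note j12 = Bochner_Integration.integrable_add[OF j(1,2)]
  note j123 = Bochner_Integration.integrable_add[OF j12 j(3)]
  have ip_le: "\<bar>(a - b) \<bullet>\<^sub>2 v\<bar> \<le> C\<^sub>2 * (A.nrm (a - b) * A.nrm v)"
  proof -
    have "\<bar>(a - b) \<bullet>\<^sub>2 v\<bar> \<le> nrm2 (a - b) * nrm2 v" by (intro L2.cauchy_schwarz W_L2 d v)
    also have "\<dots> \<le> (sqrt C\<^sub>2 * A.nrm (a - b)) * (sqrt C\<^sub>2 * A.nrm v)"
      using C2_pos A.nrm_nonneg[OF d] by (intro mult_mono embed2_nrm d v L2.nrm_nonneg[OF W_L2[OF v]]) (simp del: minus_apply)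
    also have "\<dots> = (sqrt C\<^sub>2)\<^sup>2 * (A.nrm (a - b) * A.nrm v)" by (simp only: power2_eq_square ac_simps)
    finally show ?thesis unfolding real_sqrt_pow2[OF less_imp_le[OF C2_pos]] .
  qed
  have "dwell a v - dwell b v = (\<integral>x. phi (a x) * v x - phi (b x) * v x \<partial>M)"
    unfolding dwell_def using integrable_dwell L by simp
  also have "\<dots> = (\<integral>x. (a - b) x * v x * (a x * a x) + (a - b) x * v x * (a x * b x) + (a - b) x * v x * (b x * b x) - (a - b) x * v x \<partial>M)"
    by (intro Bochner_Integration.integral_cong refl) (simp add: phi_def power3_eq_cube algebra_simps)
  also have "\<dots> = (\<integral>x. (a - b) x * v x * (a x * a x) \<partial>M) + (\<integral>x. (a - b) x * v x * (a x * b x) \<partial>M) + (\<integral>x. (a - b) x * v x * (b x * b x) \<partial>M) - (a - b) \<bullet>\<^sub>2 v"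
    unfolding Bochner_Integration.integral_diff[OF j123 i2] Bochner_Integration.integral_add[OF j12 j(3)]
      Bochner_Integration.integral_add[OF j(1,2)] by (rule refl)
  finally have eq: "dwell a v - dwell b v = (\<integral>x. (a - b) x * v x * (a x * a x) \<partial>M) + (\<integral>x. (a - b) x * v x * (a x * b x) \<partial>M) + (\<integral>x. (a - b) x * v x * (b x * b x) \<partial>M) - (a - b) \<bullet>\<^sub>2 v" .
  have "\<bar>dwell a v - dwell b v\<bar> \<le> \<bar>\<integral>x. (a - b) x * v x * (a x * a x) \<partial>M\<bar> + \<bar>\<integral>x. (a - b) x * v x * (a x * b x) \<partial>M\<bar> + \<bar>\<integral>x. (a - b) x * v x * (b x * b x) \<partial>M\<bar> + \<bar>(a - b) \<bullet>\<^sub>2 v\<bar>"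
    unfolding eq by (rule abs4)
  also have "\<dots> \<le> C\<^sub>4 * (A.nrm (a - b) * A.nrm v * (A.nrm a * A.nrm a)) + C\<^sub>4 * (A.nrm (a - b) * A.nrm v * (A.nrm a * A.nrm b))
      + C\<^sub>4 * (A.nrm (a - b) * A.nrm v * (A.nrm b * A.nrm b)) + C\<^sub>2 * (A.nrm (a - b) * A.nrm v)"
    by (rule add_mono[OF add_mono[OF add_mono[OF quartic_form_bound[OF d v a a] quartic_form_bound[OF d v a b]] quartic_form_bound[OF d v b b]] ip_le])
  also have "\<dots> = (C\<^sub>4 * ((A.nrm a)\<^sup>2 + A.nrm a * A.nrm b + (A.nrm b)\<^sup>2) + C\<^sub>2) * A.nrm (a - b) * A.nrm v"
    by (simp only: algebra_simps power2_eq_square)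
  finally show ?thesis .
qed

text \<open>
  As \<open>s\<^sup>4 - u\<^sup>4 = (s - u) (s + u) (s\<^sup>2 + u\<^sup>2)\<close>, the
  difference of the integrals is a sum of two quartic integrals with a small factor \<open>s -
  u\<close>.
\<close>

lemma L4_norm_tendsto:
  assumes u: "u \<in> W" and s: "\<And>k. s k \<in> W" and lim: "(\<lambda>k. A.nrm (u - s k)) \<longlonglongrightarrow> 0"
  shows "(\<lambda>k. \<integral>x. s k x ^ 4 \<partial>M) \<longlonglongrightarrow> (\<integral>x. u x ^ 4 \<partial>M)"
proof (rule LIM_zero_cancel, rule Lim_null_comparison)
  have lim': "(\<lambda>k. A.nrm (s k)) \<longlonglongrightarrow> A.nrm u" by (rule A.nrm_tendsto[OF u s lim])
  have "(\<lambda>k. C\<^sub>4 * (A.nrm (u - s k) * (A.nrm (s k) + A.nrm u) * ((A.nrm (s k))\<^sup>2 + (A.nrm u)\<^sup>2))) \<longlonglongrightarrow> C\<^sub>4 * (0 * (A.nrm u + A.nrm u) * ((A.nrm u)\<^sup>2 + (A.nrm u)\<^sup>2))"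
    by (intro tendsto_intros lim lim')
  then show "(\<lambda>k. C\<^sub>4 * (A.nrm (u - s k) * (A.nrm (s k) + A.nrm u) * ((A.nrm (s k))\<^sup>2 + (A.nrm u)\<^sup>2))) \<longlonglongrightarrow> 0" by simp
  show "\<forall>\<^sub>F k in sequentially. norm ((\<integral>x. s k x ^ 4 \<partial>M) - (\<integral>x. u x ^ 4 \<partial>M)) \<le> C\<^sub>4 * (A.nrm (u - s k) * (A.nrm (s k) + A.nrm u) * ((A.nrm (s k))\<^sup>2 + (A.nrm u)\<^sup>2))"
  proof (intro always_eventually allI)
    fix k
    have W: "s k - u \<in> W" "s k + u \<in> W" using u s by auto
    note L = W_L4[OF u] W_L4[OF s[of k]] W_L4[OF W(1)] W_L4[OF W(2)]
    have i4: "integrable M (\<lambda>x. s k x ^ 4)" "integrable M (\<lambda>x. u x ^ 4)" using L by (auto simp: Lp4_iff)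
    have "(\<integral>x. s k x ^ 4 \<partial>M) - (\<integral>x. u x ^ 4 \<partial>M) = (\<integral>x. s k x ^ 4 - u x ^ 4 \<partial>M)" using i4 by simp
    also have "\<dots> = (\<integral>x. (s k - u) x * (s k + u) x * (s k x * s k x) + (s k - u) x * (s k + u) x * (u x * u x) \<partial>M)"
      by (intro Bochner_Integration.integral_cong refl) (simp add: power4_eq_xxxx algebra_simps)
    also have "\<dots> = (\<integral>x. (s k - u) x * (s k + u) x * (s k x * s k x) \<partial>M) + (\<integral>x. (s k - u) x * (s k + u) x * (u x * u x) \<partial>M)"
      by (intro Bochner_Integration.integral_add L4_product_integrable L)
    finally have eq: "(\<integral>x. s k x ^ 4 \<partial>M) - (\<integral>x. u x ^ 4 \<partial>M) = (\<integral>x. (s k - u) x * (s k + u) x * (s k x * s k x) \<partial>M) + (\<integral>x. (s k - u) x * (s k + u) x * (u x * u x) \<partial>M)" .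
    have "\<bar>(\<integral>x. s k x ^ 4 \<partial>M) - (\<integral>x. u x ^ 4 \<partial>M)\<bar> \<le> C\<^sub>4 * (A.nrm (s k - u) * A.nrm (s k + u) * (A.nrm (s k) * A.nrm (s k))) + C\<^sub>4 * (A.nrm (s k - u) * A.nrm (s k + u) * (A.nrm u * A.nrm u))"
      unfolding eq by (rule order_trans[OF abs_triangle_ineq add_mono[OF quartic_form_bound[OF W s s] quartic_form_bound[OF W u u]]])
    also have "\<dots> = C\<^sub>4 * (A.nrm (u - s k) * A.nrm (s k + u) * ((A.nrm (s k))\<^sup>2 + (A.nrm u)\<^sup>2))"
      using A.nrm_minus[OF s u, of k] by (simp only: power2_eq_square distrib_left)
    also have "\<dots> \<le> C\<^sub>4 * (A.nrm (u - s k) * (A.nrm (s k) + A.nrm u) * ((A.nrm (s k))\<^sup>2 + (A.nrm u)\<^sup>2))"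
      using C4_pos u s by (intro mult_left_mono mult_right_mono A.nrm_triangle A.nrm_nonneg A.W_intros) auto
    finally show "norm ((\<integral>x. s k x ^ 4 \<partial>M) - (\<integral>x. u x ^ 4 \<partial>M)) \<le> C\<^sub>4 * (A.nrm (u - s k) * (A.nrm (s k) + A.nrm u) * ((A.nrm (s k))\<^sup>2 + (A.nrm u)\<^sup>2))" by simp
  qed
qed

sublocale V: normed_dual W A.nrm
  using A.seminormed by (simp add: normed_dual_def)

text \<open>The right-hand side of the equation when it is solved for the time derivative.\<close>

definition flux :: "('a \<Rightarrow> real) \<Rightarrow> ('a \<Rightarrow> real) \<Rightarrow> ('a \<Rightarrow> real) \<Rightarrow> real" where
  "flux g w v = g \<bullet>\<^sub>2 v - A w v - dwell w v"

lemma ip_bound: assumes "g \<in> Lp M 2" "v \<in> W" shows "\<bar>g \<bullet>\<^sub>2 v\<bar> \<le> (sqrt C\<^sub>2 * nrm2 g) * A.nrm v"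
proof -
  have "\<bar>g \<bullet>\<^sub>2 v\<bar> \<le> nrm2 g * nrm2 v" by (intro L2.cauchy_schwarz W_L2 assms)
  also have "\<dots> \<le> nrm2 g * (sqrt C\<^sub>2 * A.nrm v)" by (intro mult_left_mono embed2_nrm L2.nrm_nonneg assms)
  finally show ?thesis by (simp only: ac_simps)
qed

lemma ip_dual: assumes "g \<in> Lp M 2" shows "(\<lambda>v. g \<bullet>\<^sub>2 v) \<in> V.X'"
proof (rule dual_spaceI[OF _ _ ip_bound[OF assms]])
  show "g \<bullet>\<^sub>2 (v + w) = g \<bullet>\<^sub>2 v + g \<bullet>\<^sub>2 w" if "v \<in> W" "w \<in> W" for v w
    by (intro L2.B_add2 W_L2 that assms)
  show "g \<bullet>\<^sub>2 (c *\<^sub>R v) = c * (g \<bullet>\<^sub>2 v)" if "v \<in> W" for c v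
    by (intro L2.B_scale2 W_L2 that assms)
qed

lemma ip_dual_norm_diff:
  assumes "g \<in> Lp M 2" "h \<in> Lp M 2"
  shows "V.N' ((\<lambda>v. g \<bullet>\<^sub>2 v) - (\<lambda>v. h \<bullet>\<^sub>2 v)) \<le> sqrt C\<^sub>2 * nrm2 (g - h)"
proof (rule V.dual_norm_le_mult)
  have gh: "g - h \<in> Lp M 2" by (intro L2.W_intros assms)
  show "\<bar>((\<lambda>v. g \<bullet>\<^sub>2 v) - (\<lambda>v. h \<bullet>\<^sub>2 v)) v\<bar> \<le> sqrt C\<^sub>2 * nrm2 (g - h) * A.nrm v" if v: "v \<in> W" for v
    using ip_bound[OF gh v] L2.B_diff[OF assms W_L2[OF v]] by (simp only: minus_apply)
  show "0 \<le> sqrt C\<^sub>2 * nrm2 (g - h)" using C2_pos L2.nrm_nonneg[OF gh] by simp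
qed

lemma flux_diff_bound:
  assumes g: "g \<in> Lp M 2" "g' \<in> Lp M 2" and w: "w \<in> W" "w' \<in> W" and v: "v \<in> W"
  shows "\<bar>flux g w v - flux g' w' v\<bar> \<le> (sqrt C\<^sub>2 * nrm2 (g - g') + (1 + (C\<^sub>4 * ((A.nrm w)\<^sup>2 + A.nrm w * A.nrm w' + (A.nrm w')\<^sup>2) + C\<^sub>2)) * A.nrm (w - w')) * A.nrm v"
proof -
  have 1: "g \<bullet>\<^sub>2 v - g' \<bullet>\<^sub>2 v = (g - g') \<bullet>\<^sub>2 v" using L2.B_diff[OF g W_L2[OF v]] by simp
  have 2: "\<bar>(g - g') \<bullet>\<^sub>2 v\<bar> \<le> (sqrt C\<^sub>2 * nrm2 (g - g')) * A.nrm v" by (intro ip_bound L2.W_intros g v)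
  have 3: "\<bar>A w v - A w' v\<bar> \<le> A.nrm (w - w') * A.nrm v"
    using A.cauchy_schwarz[OF A.W_intros(3)[OF w] v] A.B_diff[OF w v] by simp
  have 4: "\<bar>dwell w v - dwell w' v\<bar> \<le> (C\<^sub>4 * ((A.nrm w)\<^sup>2 + A.nrm w * A.nrm w' + (A.nrm w')\<^sup>2) + C\<^sub>2) * A.nrm (w - w') * A.nrm v"
    by (rule dwell_diff_bound[OF w v])
  have abs3: "\<bar>(p - q - r) - (p' - q' - r')\<bar> \<le> (x + (1 + y) * z) * n"
    if "\<bar>p - p'\<bar> \<le> x * n" "\<bar>q - q'\<bar> \<le> z * n" "\<bar>r - r'\<bar> \<le> y * z * n" for p q r p' q' r' x y z n :: real
    using that by (simp add: algebra_simps)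
  show ?thesis unfolding flux_def by (rule abs3[OF 2[folded 1] 3 4])
qed

lemma flux_0: "flux 0 0 v = 0" if "v \<in> W"
proof -
  have "A 0 v = 0" using A.B_scale[OF A.W_intros(1) that, of 0] by (simp only: scaleR_zero_left mult_zero_left)
  then show ?thesis by (simp add: flux_def dwell_def phi_def)
qed

lemma flux_bound:
  assumes "g \<in> Lp M 2" "w \<in> W" "v \<in> W"
  shows "\<bar>flux g w v\<bar> \<le> (sqrt C\<^sub>2 * nrm2 g + (1 + (C\<^sub>4 * (A.nrm w)\<^sup>2 + C\<^sub>2)) * A.nrm w) * A.nrm v"
  using flux_diff_bound[OF assms(1) L2.W_intros(1) assms(2) A.W_intros(1) assms(3)] flux_0[OF assms(3)]
  unfolding A.nrm_zero diff_0_right by (simp del: zero_fun_apply)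

lemma flux_dual: assumes "g \<in> Lp M 2" "w \<in> W" shows "flux g w \<in> V.X'"
proof (rule dual_spaceI[OF _ _ flux_bound[OF assms]])
  show "flux g w (v + v') = flux g w v + flux g w v'" if v: "v \<in> W" "v' \<in> W" for v v'
    using L2.B_add2[OF W_L2[OF v(1)] W_L2[OF v(2)] assms(1)] A.B_add2[OF v assms(2)] dwell_add[OF assms(2) v] unfolding flux_def by linarith
  show "flux g w (c *\<^sub>R v) = c * flux g w v" if v: "v \<in> W" for c v
    using L2.B_scale2[OF W_L2[OF v] assms(1)] A.B_scale2[OF v assms(2)] dwell_scale unfolding flux_def by (simp only: right_diff_distrib)
qed

lemma flux_dual_norm_diff:
  assumes g: "g \<in> Lp M 2" "g' \<in> Lp M 2" and w: "w \<in> W" "w' \<in> W"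
  shows "V.N' (flux g w - flux g' w') \<le> sqrt C\<^sub>2 * nrm2 (g - g') + (1 + (C\<^sub>4 * ((A.nrm w)\<^sup>2 + A.nrm w * A.nrm w' + (A.nrm w')\<^sup>2) + C\<^sub>2)) * A.nrm (w - w')"
proof (rule V.dual_norm_le_mult)
  have nn: "0 \<le> A.nrm w" "0 \<le> A.nrm w'" "0 \<le> A.nrm (w - w')" "0 \<le> nrm2 (g - g')"
    by (intro A.nrm_nonneg L2.nrm_nonneg A.W_intros L2.W_intros w g)+
  then show "0 \<le> sqrt C\<^sub>2 * nrm2 (g - g') + (1 + (C\<^sub>4 * ((A.nrm w)\<^sup>2 + A.nrm w * A.nrm w' + (A.nrm w')\<^sup>2) + C\<^sub>2)) * A.nrm (w - w')"
    using C2_pos C4_pos by (intro add_nonneg_nonneg mult_nonneg_nonneg) auto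
qed (use flux_diff_bound[OF g w] in simp)

end

lemma (in ginzburg_landau) flux_tendsto:
  assumes g: "g \<in> Lp M 2" and u: "u \<in> W" and s: "\<And>k. s k \<in> W" and lim: "(\<lambda>k. A.nrm (u - s k)) \<longlonglongrightarrow> 0" and v: "v \<in> W"
  shows "(\<lambda>k. flux g (s k) v) \<longlonglongrightarrow> flux g u v"
proof (rule LIM_zero_cancel, rule Lim_null_comparison)
  have lim': "(\<lambda>k. A.nrm (s k)) \<longlonglongrightarrow> A.nrm u" by (rule A.nrm_tendsto[OF u s lim])
  let ?b = "\<lambda>k. ((1 + (C\<^sub>4 * ((A.nrm u)\<^sup>2 + A.nrm u * A.nrm (s k) + (A.nrm (s k))\<^sup>2) + C\<^sub>2)) * A.nrm (u - s k)) * A.nrm v"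
  have "?b \<longlonglongrightarrow> ((1 + (C\<^sub>4 * ((A.nrm u)\<^sup>2 + A.nrm u * A.nrm u + (A.nrm u)\<^sup>2) + C\<^sub>2)) * 0) * A.nrm v"
    by (intro tendsto_intros lim lim')
  then show "?b \<longlonglongrightarrow> 0" by simp
  have "\<bar>flux g u v - flux g (s k) v\<bar> \<le> ?b k" for k
    using flux_diff_bound[OF g g u s v, of k] unfolding diff_self L2.nrm_zero mult_zero_right add_0_left .
  then show "\<forall>\<^sub>F k in sequentially. norm (flux g (s k) v - flux g u v) \<le> ?b k"
    unfolding real_norm_def abs_minus_commute[of "flux g (s _) v"] by (intro always_eventually allI)
qed

lemma (in time_domain) strongly_measurable_scale:
  fixes X :: "('b \<Rightarrow> real) set"
  assumes sn: "seminormed X N" and g: "strongly_measurable_in \<Lambda> X N g"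
    and a: "\<And>k::nat. simple_function \<Lambda> (a k)" "AE t in \<Lambda>. (\<lambda>k. a k t :: real) \<longlonglongrightarrow> b t"
  shows "strongly_measurable_in \<Lambda> X N (\<lambda>t. b t *\<^sub>R g t)"
proof -
  interpret seminormed X N by fact
  obtain s where s: "\<And>n::nat. simple_in \<Lambda> X (s n)" "AE t in \<Lambda>. (\<lambda>n. N (g t - s n t)) \<longlonglongrightarrow> 0"
    and gX: "AE t in \<Lambda>. g t \<in> X"
    using g unfolding strongly_measurable_in_def by blast
  have sX: "s n t \<in> X" if "t \<in> I" for n t using s(1)[of n] that by (auto simp: simple_in_def)
  have "simple_in \<Lambda> X (\<lambda>t. a k t *\<^sub>R s k t)" for k
    unfolding simple_in_def
  proof
    show "simple_function \<Lambda> (\<lambda>t. a k t *\<^sub>R s k t)"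
      using s(1)[of k] by (intro simple_function_compose2[OF a(1), where h="(*\<^sub>R)"]) (simp add: simple_in_def)
    show "(\<lambda>t. a k t *\<^sub>R s k t) ` space \<Lambda> \<subseteq> X" using sX by (intro image_subsetI X_intros(4)) simp
  qed
  moreover have "AE t in \<Lambda>. (\<lambda>k. N (b t *\<^sub>R g t - a k t *\<^sub>R s k t)) \<longlonglongrightarrow> 0"
    using s(2) gX a(2) AE_space
  proof eventually_elim
    case (elim t)
    have sXt: "s k t \<in> X" for k using elim sX by simp
    show ?case
    proof (rule Lim_null_comparison)
      have "(\<lambda>k. \<bar>b t - a k t\<bar> * N (g t) + \<bar>a k t\<bar> * N (g t - s k t)) \<longlonglongrightarrow> \<bar>b t - b t\<bar> * N (g t) + \<bar>b t\<bar> * 0"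
        by (intro tendsto_intros elim)
      then show "(\<lambda>k. \<bar>b t - a k t\<bar> * N (g t) + \<bar>a k t\<bar> * N (g t - s k t)) \<longlonglongrightarrow> 0" by simp
      show "\<forall>\<^sub>F k in sequentially. norm (N (b t *\<^sub>R g t - a k t *\<^sub>R s k t)) \<le> \<bar>b t - a k t\<bar> * N (g t) + \<bar>a k t\<bar> * N (g t - s k t)"
      proof (intro always_eventually allI)
        fix k
        have "b t *\<^sub>R g t - a k t *\<^sub>R s k t = (b t - a k t) *\<^sub>R g t + a k t *\<^sub>R (g t - s k t)"
          by (simp add: algebra_simps del: minus_apply plus_fun_apply scaleR_apply)
        then have "N (b t *\<^sub>R g t - a k t *\<^sub>R s k t) \<le> N ((b t - a k t) *\<^sub>R g t) + N (a k t *\<^sub>R (g t - s k t))"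
          using N_triangle[OF X_intros(4)[OF elim(2)] X_intros(4)[OF X_intros(3)[OF elim(2) sXt]], of "b t - a k t" "a k t" k] by (simp only:)
        also have "\<dots> = \<bar>b t - a k t\<bar> * N (g t) + \<bar>a k t\<bar> * N (g t - s k t)"
          by (simp only: N_scale[OF elim(2)] N_scale[OF X_intros(3)[OF elim(2) sXt]])
        finally show "norm (N (b t *\<^sub>R g t - a k t *\<^sub>R s k t)) \<le> \<bar>b t - a k t\<bar> * N (g t) + \<bar>a k t\<bar> * N (g t - s k t)"
          using N_nonneg[OF X_intros(3)[OF X_intros(4)[OF elim(2)] X_intros(4)[OF sXt]], of "b t" "a k t" k] by (simp only: real_norm_def abs_of_nonneg)
      qed
    qed
  qed
  moreover have "AE t in \<Lambda>. b t *\<^sub>R g t \<in> X" using gX by eventually_elim (rule X_intros(4))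
  ultimately show ?thesis unfolding strongly_measurable_in_def by (intro conjI exI[of _ "\<lambda>k t. a k t *\<^sub>R s k t"]) blast+
qed

section \<open>Passing to the limit in the scheme\<close>

locale allen_cahn = D: planar_domain \<Omega> + t: time_mesh T + V: ginzburg_landau "lebesgue_on \<Omega>" "sobolev_H0 m \<Omega>" "form_A m \<Omega>" C\<^sub>2 C\<^sub>4
  for \<Omega> T m C\<^sub>2 C\<^sub>4 +
  fixes f :: "real \<Rightarrow> real^2 \<Rightarrow> real"
  assumes f: "f \<in> bochner_Lp (lebesgue_on {0<..<T}) 2 (Lp (lebesgue_on \<Omega>) 2) (L2.nrm (lebesgue_on \<Omega>))"
begin

text \<open>
  The schemes consist of test functions, with the form and the embedding constants of
  \<open>H0\<close>.
\<close>

sublocale G: ginzburg_landau "lebesgue_on \<Omega>" "test_functions \<Omega>" "form_A m \<Omega>" C\<^sub>2 C\<^sub>4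
proof -
  note H = D.test_H0[where m=m]
  show "ginzburg_landau (lebesgue_on \<Omega>) (test_functions \<Omega>) (form_A m \<Omega>) C\<^sub>2 C\<^sub>4"
    by unfold_locales
      (simp_all add: subspace_test_functions H V.A.B_add V.A.B_scale V.A.B_nonneg V.C2_pos V.C4_pos V.W_L2 V.W_L4 V.embed2 V.embed4,
        intro V.A.B_sym H)
qed

abbreviation "nrmV \<equiv> V.A.nrm"
abbreviation "nrm2 \<equiv> V.nrm2"
abbreviation "H0 \<equiv> sobolev_H0 m \<Omega>"

lemma V_norm_eq: "V_norm m \<Omega> = nrmV" by (rule ext) (rule D.V_norm_nrm)

lemma test_H0: "\<phi> \<in> D.\<D> \<Longrightarrow> \<phi> \<in> H0" by (rule D.test_H0)

lemma L2_seminormed: "seminormed (Lp D.M 2) nrm2" by (rule L2.seminormed)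

lemma f_props:
  obtains s where "\<And>n::nat. simple_in t.\<Lambda> (Lp D.M 2) (s n)" "AE x in t.\<Lambda>. f x \<in> Lp D.M 2"
    "AE x in t.\<Lambda>. (\<lambda>n. nrm2 (f x - s n x)) \<longlonglongrightarrow> 0" "(\<lambda>x. nrm2 (f x)) \<in> borel_measurable t.\<Lambda>"
    "integrable t.\<Lambda> (\<lambda>x. (nrm2 (f x))\<^sup>2)"
proof -
  have sm: "strongly_measurable_in t.\<Lambda> (Lp D.M 2) nrm2 f" and i0: "integrable t.\<Lambda> (\<lambda>x. nrm2 (f x) powr 2)"
    using f by (auto simp: bochner_Lp_def)
  obtain s where s: "\<And>n::nat. simple_in t.\<Lambda> (Lp D.M 2) (s n)" "AE x in t.\<Lambda>. f x \<in> Lp D.M 2"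
    "AE x in t.\<Lambda>. (\<lambda>n. nrm2 (f x - s n x)) \<longlonglongrightarrow> 0" "(\<lambda>x. nrm2 (f x)) \<in> borel_measurable t.\<Lambda>"
    by (rule t.strongly_measurable_truncated[OF L2_seminormed sm]) blast
  have "integrable t.\<Lambda> (\<lambda>x. (nrm2 (f x))\<^sup>2)"
  proof (rule Bochner_Integration.integrable_cong_AE_imp[OF i0])
    show "AE x in t.\<Lambda>. nrm2 (f x) powr 2 = (nrm2 (f x))\<^sup>2"
      using s(2)
    proof eventually_elim
      case (elim x)
      show ?case using abs_powr_2[of "nrm2 (f x)"] unfolding abs_of_nonneg[OF L2.nrm_nonneg[OF elim]] .
    qed
  qed (use s(4) in simp)
  then show ?thesis using that s by blast
qed

text \<open>
  With the tolerance \<open>(mesh n)\<^sup>2\<close> per step, the \<open>2 ^ n\<close> steps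
  add at most \<open>T\<^sup>2\<close> to the energy estimate, and the residuals vanish in the
  limit.
\<close>

lemma euler_schemes:
  obtains F U E where "\<And>n k. F n k \<in> Lp D.M 2" "\<And>n. integrable t.\<Lambda> (\<lambda>s. (nrm2 (f s - F n (t.cell n s)))\<^sup>2)"
    "(\<lambda>n. \<integral>s. (nrm2 (f s - F n (t.cell n s)))\<^sup>2 \<partial>t.\<Lambda>) \<longlonglongrightarrow> 0"
    "\<And>n. G.euler (t.mesh n) ((t.mesh n)\<^sup>2) (F n) (U n)"
    "\<And>n k. k \<le> 2 ^ n \<Longrightarrow> (nrmV (U n k))\<^sup>2 \<le> 2 * E"
    "\<And>n. (\<Sum>k<2 ^ n. (nrm2 (U n (Suc k) - U n k))\<^sup>2) \<le> 4 * t.mesh n * E" "0 \<le> E"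
proof -
  obtain F where F: "\<And>n k. F n k \<in> Lp D.M 2" "\<And>n. integrable t.\<Lambda> (\<lambda>s. (nrm2 (f s - F n (t.cell n s)))\<^sup>2)"
    "(\<lambda>n. \<integral>s. (nrm2 (f s - F n (t.cell n s)))\<^sup>2 \<partial>t.\<Lambda>) \<longlonglongrightarrow> 0"
    by (rule t.step_approximation[OF L2_seminormed f]) blast
  have "\<exists>U. G.euler (t.mesh n) ((t.mesh n)\<^sup>2) (F n) U" for n
    by (intro G.euler_exists F t.mesh_pos zero_less_power)
  then obtain U where U: "\<And>n. G.euler (t.mesh n) ((t.mesh n)\<^sup>2) (F n) (U n)" by metis
  have UD: "U n k \<in> D.\<D>" for n k using U unfolding G.euler_def by blast
  obtain K where K: "K > 0" "\<And>n. norm (\<integral>s. (nrm2 (f s - F n (t.cell n s)))\<^sup>2 \<partial>t.\<Lambda>) \<le> K"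
    using convergent_imp_Bseq[OF convergentI[OF F(3)]] by (auto simp: Bseq_def)
  obtain s0 where fp: "AE x in t.\<Lambda>. f x \<in> Lp D.M 2" "integrable t.\<Lambda> (\<lambda>x. (nrm2 (f x))\<^sup>2)"
    by (rule f_props) blast
  have Fb: "t.mesh n * (\<Sum>k<2 ^ n. (nrm2 (F n k))\<^sup>2) \<le> 2 * (\<integral>x. (nrm2 (f x))\<^sup>2 \<partial>t.\<Lambda>) + 2 * K" for n
  proof -
    have "t.mesh n * (\<Sum>k<2 ^ n. (nrm2 (F n k))\<^sup>2) = (\<integral>x. (nrm2 (F n (t.cell n x)))\<^sup>2 \<partial>t.\<Lambda>)"
      by (rule t.integral_cell(2)[symmetric])
    also have "\<dots> \<le> (\<integral>x. 2 * (nrm2 (f x))\<^sup>2 + 2 * (nrm2 (f x - F n (t.cell n x)))\<^sup>2 \<partial>t.\<Lambda>)"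
    proof (rule integral_mono_AE)
      show "AE x in t.\<Lambda>. (nrm2 (F n (t.cell n x)))\<^sup>2 \<le> 2 * (nrm2 (f x))\<^sup>2 + 2 * (nrm2 (f x - F n (t.cell n x)))\<^sup>2"
        using fp(1)
      proof eventually_elim
        case (elim x)
        have d: "F n (t.cell n x) - f x \<in> Lp D.M 2" by (intro L2.W_intros F elim)
        have e: "f x + (F n (t.cell n x) - f x) = F n (t.cell n x)" by simp
        show ?case using L2.nrm_sq_triangle[OF elim d] unfolding e L2.nrm_minus[OF F(1) elim] .
      qed
    qed (use t.integral_cell(1) fp(2) F(2) in auto)
    also have "\<dots> = 2 * (\<integral>x. (nrm2 (f x))\<^sup>2 \<partial>t.\<Lambda>) + 2 * (\<integral>x. (nrm2 (f x - F n (t.cell n x)))\<^sup>2 \<partial>t.\<Lambda>)"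
      using fp(2) F(2)[of n] by simp
    also have "\<dots> \<le> 2 * (\<integral>x. (nrm2 (f x))\<^sup>2 \<partial>t.\<Lambda>) + 2 * K"
      using K(2)[of n] by simp
    finally show ?thesis .
  qed
  define E where "E = V.well 0 + (2 * (\<integral>x. (nrm2 (f x))\<^sup>2 \<partial>t.\<Lambda>) + 2 * K) + T\<^sup>2"
  have E0: "0 \<le> E" unfolding E_def using V.well_nonneg[of 0] K(1) by (intro add_nonneg_nonneg) auto
  have en: "G.energy (U n k) + (\<Sum>j<k. (nrm2 (U n (Suc j) - U n j))\<^sup>2) / (4 * t.mesh n) \<le> E" if k: "k \<le> 2 ^ n" for n k
  proof -
    have "G.energy (U n k) + (\<Sum>j<k. (nrm2 (U n (Suc j) - U n j))\<^sup>2) / (4 * t.mesh n)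
      \<le> V.well 0 + t.mesh n * (\<Sum>j<k. (nrm2 (F n j))\<^sup>2) + real k * (t.mesh n)\<^sup>2"
      by (rule G.euler_energy[OF t.mesh_pos U F(1)])
    also have "t.mesh n * (\<Sum>j<k. (nrm2 (F n j))\<^sup>2) \<le> t.mesh n * (\<Sum>j<2 ^ n. (nrm2 (F n j))\<^sup>2)"
      using k t.mesh_pos[of n] by (intro mult_left_mono sum_mono2) auto
    also have "\<dots> \<le> 2 * (\<integral>x. (nrm2 (f x))\<^sup>2 \<partial>t.\<Lambda>) + 2 * K" by (rule Fb)
    also have "real k * (t.mesh n)\<^sup>2 \<le> T\<^sup>2"
    proof -
      have "real k \<le> 2 ^ n" using k by (metis of_nat_le_iff of_nat_numeral of_nat_power)
      then have "real k * (t.mesh n)\<^sup>2 \<le> 2 ^ n * (t.mesh n)\<^sup>2" by (intro mult_right_mono) auto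
      also have "\<dots> = (t.mesh n * 2 ^ n) * t.mesh n" by (simp add: power2_eq_square)
      also have "\<dots> = T * t.mesh n" by (simp only: t.mesh_mult)
      also have "\<dots> \<le> T * T" using t.T_pos unfolding t.mesh_def by (intro mult_left_mono) (auto simp: divide_le_eq mult_le_cancel_left1)
      finally show ?thesis by (simp add: power2_eq_square)
    qed
    finally show ?thesis unfolding E_def by linarith
  qed
  have "(nrmV (U n k))\<^sup>2 \<le> 2 * E" if k: "k \<le> 2 ^ n" for n k
  proof -
    have "0 \<le> (\<Sum>j<k. (nrm2 (U n (Suc j) - U n j))\<^sup>2) / (4 * t.mesh n)"
      using t.mesh_pos[of n] by (intro divide_nonneg_pos sum_nonneg) auto
    then have "G.energy (U n k) \<le> E" using en[OF k] by linarith
    then show ?thesis using G.energy_nonneg(2)[OF UD, of n k] G.A.nrm_sq[OF UD, of n k] by linarith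
  qed
  moreover have "(\<Sum>k<2 ^ n. (nrm2 (U n (Suc k) - U n k))\<^sup>2) \<le> 4 * t.mesh n * E" for n
  proof -
    have "(\<Sum>j<2 ^ n. (nrm2 (U n (Suc j) - U n j))\<^sup>2) / (4 * t.mesh n) \<le> E"
      using en[of "2 ^ n" n] G.energy_nonneg(1)[OF UD, of n "2 ^ n"] by linarith
    then show ?thesis using t.mesh_pos[of n] by (simp add: pos_divide_le_eq mult.commute)
  qed
  ultimately show ?thesis using that[OF F U] E0 by blast
qed

end

locale allen_cahn_scheme = allen_cahn \<Omega> T m C\<^sub>2 C\<^sub>4 f for \<Omega> T m C\<^sub>2 C\<^sub>4 f +
  fixes F U :: "nat \<Rightarrow> nat \<Rightarrow> real^2 \<Rightarrow> real" and E :: real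
  assumes F: "\<And>n k. F n k \<in> Lp (lebesgue_on \<Omega>) 2"
    and F_int: "\<And>n. integrable t.\<Lambda> (\<lambda>s. (nrm2 (f s - F n (t.cell n s)))\<^sup>2)"
    and F_lim: "(\<lambda>n. \<integral>s. (nrm2 (f s - F n (t.cell n s)))\<^sup>2 \<partial>t.\<Lambda>) \<longlonglongrightarrow> 0"
    and U: "\<And>n. G.euler (t.mesh n) ((t.mesh n)\<^sup>2) (F n) (U n)"
    and U_bound: "\<And>n k. k \<le> 2 ^ n \<Longrightarrow> (nrmV (U n k))\<^sup>2 \<le> 2 * E"
    and U_increments: "\<And>n. (\<Sum>k<2 ^ n. (nrm2 (U n (Suc k) - U n k))\<^sup>2) \<le> 4 * t.mesh n * E"
    and E_nonneg: "0 \<le> E"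
begin

text \<open>
  On each cell, the value at the right end point: there the implicit scheme evaluates the
  equation.
\<close>

definition S :: "nat \<Rightarrow> real \<Rightarrow> real^2 \<Rightarrow> real" where "S n s = U n (Suc (t.cell n s))"
definition R :: real where "R = sqrt (2 * E)"

lemma U_test: "U n k \<in> D.\<D>" using U unfolding G.euler_def by blast
lemma S_test: "S n s \<in> D.\<D>" unfolding S_def by (rule U_test)
lemma S_H0: "S n s \<in> H0" by (intro test_H0 S_test)
lemma S_simple: "simple_function t.\<Lambda> (S n)" unfolding S_def by (rule simple_function_compose1[OF t.cell_simple])

lemma S_bound: assumes "s \<in> t.\<T>" shows "nrmV (S n s) \<le> R"
proof -
  have "Suc (t.cell n s) \<le> 2 ^ n" using t.cell_less[OF assms, of n] by simp
  from real_sqrt_le_mono[OF U_bound[OF this]] show ?thesis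
    using V.A.nrm_nonneg[OF S_H0, of n s] unfolding S_def R_def by simp
qed

lemma R_nonneg: "0 \<le> R" unfolding R_def using E_nonneg by simp

text \<open>
  Summands that depend on one mesh each, such that \<open>\<beta> n + \<beta> n'\<close>
  dominates the second factor of the bound in \<open>euler_comparison\<close>.
\<close>

definition \<beta> :: "nat \<Rightarrow> real" where
  "\<beta> n = 2 * (\<integral>s. (nrm2 (f s - F n (t.cell n s)))\<^sup>2 \<partial>t.\<Lambda>) + 2 * T * ((t.mesh n)\<^sup>2)\<^sup>2 + 240 * E * (t.mesh n + (t.mesh n)\<^sup>2)"

lemma \<beta>_tendsto: "\<beta> \<longlonglongrightarrow> 0"
proof -
  have "\<beta> \<longlonglongrightarrow> 2 * 0 + 2 * T * (0\<^sup>2)\<^sup>2 + 240 * E * (0 + 0\<^sup>2)"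
    unfolding \<beta>_def[abs_def] by (intro tendsto_intros F_lim t.mesh_tendsto)
  then show ?thesis by simp
qed

lemma S_diff_integrable: "integrable t.\<Lambda> (\<lambda>s. (nrmV (S n s - S n' s))\<^sup>2)"
  by (rule t.integrable_simple) (rule simple_function_compose2[OF S_simple S_simple, where h="\<lambda>a b. (nrmV (a - b))\<^sup>2"])

lemma S_comparison:
  assumes n: "n \<le> n'"
  shows "(\<integral>s. (nrmV (S n s - S n' s))\<^sup>2 \<partial>t.\<Lambda>) \<le> exp (6 * T) * (\<beta> n + \<beta> n')"
proof -
  define r where "r = (2::nat) ^ (n' - n)"
  have r: "r > 0" unfolding r_def by simp
  have rN: "r * 2 ^ n = 2 ^ n'" unfolding r_def using n by (simp flip: power_add)
  have h: "t.mesh n = real r * t.mesh n'"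
  proof -
    have "(2::real) ^ n' = 2 ^ (n' - n) * 2 ^ n" using n by (simp flip: power_add)
    then show ?thesis unfolding r_def t.mesh_def by simp
  qed
  have Tn: "t.mesh n * real (2 ^ n) = T" using t.mesh_mult by simp
  have "(\<integral>s. (nrmV (S n s - S n' s))\<^sup>2 \<partial>t.\<Lambda>) = (\<integral>s. (nrmV (U n (Suc (t.cell n' s div r)) - U n' (Suc (t.cell n' s))))\<^sup>2 \<partial>t.\<Lambda>)"
    using t.cell_div[OF n] unfolding S_def r_def by (intro Bochner_Integration.integral_cong refl) simp
  also have "\<dots> = t.mesh n' * (\<Sum>j<2 ^ n'. (nrmV (U n (Suc (j div r)) - U n' (Suc j)))\<^sup>2)"
    by (rule t.integral_cell(2))
  also have "\<dots> = (\<Sum>j<r * 2 ^ n. t.mesh n' * (nrmV (U n (Suc (j div r)) - U n' (Suc j)))\<^sup>2)"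
    unfolding rN sum_distrib_left ..
  also have "\<dots> \<le> exp (6 * (t.mesh n * real (2 ^ n))) * ((\<Sum>j<r * 2 ^ n. t.mesh n' * (nrm2 (F n (j div r) - F n' j))\<^sup>2)
      + t.mesh n * real (2 ^ n) * ((t.mesh n)\<^sup>2 + (t.mesh n')\<^sup>2)\<^sup>2 + 240 * E * (t.mesh n + (t.mesh n)\<^sup>2))"
    by (rule G.euler_comparison[OF t.mesh_pos r h _ _ U U F F]) (use U_increments rN in auto)
  also have "\<dots> \<le> exp (6 * T) * (\<beta> n + \<beta> n')"
    unfolding Tn
  proof (rule mult_left_mono)
    obtain s0 where fp: "AE x in t.\<Lambda>. f x \<in> Lp D.M 2" by (rule f_props) blast
    have "(\<Sum>j<r * 2 ^ n. t.mesh n' * (nrm2 (F n (j div r) - F n' j))\<^sup>2) = t.mesh n' * (\<Sum>j<2 ^ n'. (nrm2 (F n (j div r) - F n' j))\<^sup>2)"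
      unfolding rN sum_distrib_left ..
    also have "\<dots> = (\<integral>s. (nrm2 (F n (t.cell n' s div r) - F n' (t.cell n' s)))\<^sup>2 \<partial>t.\<Lambda>)"
      by (rule t.integral_cell(2)[symmetric])
    also have "\<dots> \<le> (\<integral>s. 2 * (nrm2 (f s - F n (t.cell n s)))\<^sup>2 + 2 * (nrm2 (f s - F n' (t.cell n' s)))\<^sup>2 \<partial>t.\<Lambda>)"
    proof (rule integral_mono_AE)
      show "integrable t.\<Lambda> (\<lambda>s. (nrm2 (F n (t.cell n' s div r) - F n' (t.cell n' s)))\<^sup>2)" by (rule t.integral_cell(1))
      show "AE s in t.\<Lambda>. (nrm2 (F n (t.cell n' s div r) - F n' (t.cell n' s)))\<^sup>2 \<le> 2 * (nrm2 (f s - F n (t.cell n s)))\<^sup>2 + 2 * (nrm2 (f s - F n' (t.cell n' s)))\<^sup>2"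
        using fp AE_space
      proof eventually_elim
        case (elim s)
        have c: "t.cell n' s div r = t.cell n s" using t.cell_div[OF n, of s] elim unfolding r_def by simp
        have d: "F n (t.cell n s) - f s \<in> Lp D.M 2" "f s - F n' (t.cell n' s) \<in> Lp D.M 2" by (intro L2.W_intros F elim)+
        have e: "(F n (t.cell n s) - f s) + (f s - F n' (t.cell n' s)) = F n (t.cell n s) - F n' (t.cell n' s)" by simp
        show ?case using L2.nrm_sq_triangle[OF d] unfolding e c L2.nrm_minus[OF F elim(1)] .
      qed
    qed (use F_int in auto)
    also have "\<dots> = 2 * (\<integral>s. (nrm2 (f s - F n (t.cell n s)))\<^sup>2 \<partial>t.\<Lambda>) + 2 * (\<integral>s. (nrm2 (f s - F n' (t.cell n' s)))\<^sup>2 \<partial>t.\<Lambda>)"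
      using F_int[of n] F_int[of n'] by simp
    finally have 1: "(\<Sum>j<r * 2 ^ n. t.mesh n' * (nrm2 (F n (j div r) - F n' j))\<^sup>2)
      \<le> 2 * (\<integral>s. (nrm2 (f s - F n (t.cell n s)))\<^sup>2 \<partial>t.\<Lambda>) + 2 * (\<integral>s. (nrm2 (f s - F n' (t.cell n' s)))\<^sup>2 \<partial>t.\<Lambda>)" .
    have "((t.mesh n)\<^sup>2 + (t.mesh n')\<^sup>2)\<^sup>2 \<le> 2 * ((t.mesh n)\<^sup>2)\<^sup>2 + 2 * ((t.mesh n')\<^sup>2)\<^sup>2"
      using sum_squares_bound[of "(t.mesh n)\<^sup>2" "(t.mesh n')\<^sup>2"] by (simp only: power2_sum)
    then have 2: "T * ((t.mesh n)\<^sup>2 + (t.mesh n')\<^sup>2)\<^sup>2 \<le> T * (2 * ((t.mesh n)\<^sup>2)\<^sup>2 + 2 * ((t.mesh n')\<^sup>2)\<^sup>2)"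
      using t.T_pos by (intro mult_left_mono) auto
    have 3: "0 \<le> 240 * E * (t.mesh n' + (t.mesh n')\<^sup>2)" using E_nonneg less_imp_le[OF t.mesh_pos[of n']] by (intro mult_nonneg_nonneg) auto
    have 4: "T * (2 * ((t.mesh n)\<^sup>2)\<^sup>2 + 2 * ((t.mesh n')\<^sup>2)\<^sup>2) = 2 * T * ((t.mesh n)\<^sup>2)\<^sup>2 + 2 * T * ((t.mesh n')\<^sup>2)\<^sup>2"
      by (simp only: distrib_left ac_simps)
    show "(\<Sum>j<r * 2 ^ n. t.mesh n' * (nrm2 (F n (j div r) - F n' j))\<^sup>2) + T * ((t.mesh n)\<^sup>2 + (t.mesh n')\<^sup>2)\<^sup>2 + 240 * E * (t.mesh n + (t.mesh n)\<^sup>2)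
      \<le> \<beta> n + \<beta> n'"
      using add_mono[OF 1 2[unfolded 4]] 3 unfolding \<beta>_def by linarith
  qed simp
  finally show ?thesis .
qed

text \<open>
  The schemes form a Cauchy sequence in \<open>L\<^sup>2(0,T;V)\<close>. Along a rapid
  subsequence their increments are summable in the norm of \<open>V\<close> at almost every
  time, and completeness of \<open>H0\<close> provides the limit there.
\<close>

lemma limit_exists:
  obtains \<rho> u where "strict_mono (\<rho> :: nat \<Rightarrow> nat)"
    "AE s in t.\<Lambda>. u s \<in> H0 \<and> (\<lambda>k. nrmV (u s - S (\<rho> k) s)) \<longlonglongrightarrow> 0"
proof -
  have "\<exists>K. \<forall>n\<ge>K. \<forall>n'\<ge>n. (\<integral>s. (nrmV (S n s - S n' s))\<^sup>2 \<partial>t.\<Lambda>) \<le> e" if e: "e > 0" for e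
  proof -
    have "e / (2 * exp (6 * T)) > 0" using e by simp
    then obtain K where K: "\<And>n. n \<ge> K \<Longrightarrow> \<beta> n < e / (2 * exp (6 * T))"
      using order_tendstoD(2)[OF \<beta>_tendsto] unfolding eventually_sequentially by blast
    have "(\<integral>s. (nrmV (S n s - S n' s))\<^sup>2 \<partial>t.\<Lambda>) \<le> e" if "n \<ge> K" "n' \<ge> n" for n n'
    proof -
      have "\<beta> n + \<beta> n' \<le> e / (2 * exp (6 * T)) + e / (2 * exp (6 * T))" using K[of n] K[of n'] that by (intro add_mono) auto
      then have "exp (6 * T) * (\<beta> n + \<beta> n') \<le> exp (6 * T) * (e / (2 * exp (6 * T)) + e / (2 * exp (6 * T)))" by (intro mult_left_mono) auto
      also have "\<dots> = e" by (simp add: field_simps)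
      finally show ?thesis using S_comparison[OF that(2)] by linarith
    qed
    then show ?thesis by blast
  qed
  then obtain \<rho> where \<rho>: "strict_mono (\<rho> :: nat \<Rightarrow> nat)" "\<And>k n. n \<ge> \<rho> k \<Longrightarrow> (\<integral>s. (nrmV (S (\<rho> k) s - S n s))\<^sup>2 \<partial>t.\<Lambda>) \<le> (1 / 4) ^ k"
    by (rule rapid_subsequence[of "\<lambda>n n'. \<integral>s. (nrmV (S n s - S n' s))\<^sup>2 \<partial>t.\<Lambda>"]) blast+
  have "AE s in t.\<Lambda>. summable (\<lambda>k. sqrt ((nrmV (S (\<rho> k) s - S (\<rho> (Suc k)) s))\<^sup>2))"
    using \<rho> by (intro AE_summable_sqrt S_diff_integrable) (auto simp: strict_mono_leD)
  then have "AE s in t.\<Lambda>. \<exists>v. v \<in> H0 \<and> (\<lambda>k. nrmV (v - S (\<rho> k) s)) \<longlonglongrightarrow> 0"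
  proof eventually_elim
    case (elim s)
    have "sqrt ((nrmV (S (\<rho> k) s - S (\<rho> (Suc k)) s))\<^sup>2) = nrmV (S (\<rho> k) s - S (\<rho> (Suc k)) s)" for k
      using V.A.nrm_nonneg[OF V.A.W_intros(3)[OF S_H0 S_H0]] by (simp only: real_sqrt_abs abs_of_nonneg)
    then have sm: "summable (\<lambda>k. nrmV (S (\<rho> k) s - S (\<rho> (Suc k)) s))" using elim by (simp only:)
    have c: "\<exists>K. \<forall>i\<ge>K. \<forall>j\<ge>K. V_norm m \<Omega> (S (\<rho> i) s - S (\<rho> j) s) \<le> e" if "e > 0" for e
      unfolding V_norm_eq by (rule V.A.nrm_cauchy_of_summable[OF S_H0 sm that])
    show ?case
      by (rule D.H0_complete[of "\<lambda>k. S (\<rho> k) s", OF S_test c]) (auto simp only: V_norm_eq)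
  qed
  then have "AE s in t.\<Lambda>. (SOME v. v \<in> H0 \<and> (\<lambda>k. nrmV (v - S (\<rho> k) s)) \<longlonglongrightarrow> 0) \<in> H0 \<and>
      (\<lambda>k. nrmV ((SOME v. v \<in> H0 \<and> (\<lambda>k. nrmV (v - S (\<rho> k) s)) \<longlonglongrightarrow> 0) - S (\<rho> k) s)) \<longlonglongrightarrow> 0"
  proof eventually_elim
    case (elim s)
    then show ?case by (rule someI_ex[where P="\<lambda>v. v \<in> H0 \<and> (\<lambda>k. nrmV (v - S (\<rho> k) s)) \<longlonglongrightarrow> 0"])
  qed
  then show ?thesis by (rule that[OF \<rho>(1)])
qed

end

locale allen_cahn_limit = allen_cahn_scheme \<Omega> T m C\<^sub>2 C\<^sub>4 f F U E for \<Omega> T m C\<^sub>2 C\<^sub>4 f F U E +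
  fixes \<rho> :: "nat \<Rightarrow> nat" and u :: "real \<Rightarrow> real^2 \<Rightarrow> real"
  assumes \<rho>: "strict_mono \<rho>"
    and u_AE: "AE s in t.\<Lambda>. u s \<in> H0 \<and> (\<lambda>k. nrmV (u s - S (\<rho> k) s)) \<longlonglongrightarrow> 0"
begin

lemma u_H0: "AE s in t.\<Lambda>. u s \<in> H0" using u_AE by eventually_elim blast
lemma u_lim: "AE s in t.\<Lambda>. (\<lambda>k. nrmV (u s - S (\<rho> k) s)) \<longlonglongrightarrow> 0" using u_AE by eventually_elim blast

lemma u_bound: "AE s in t.\<Lambda>. nrmV (u s) \<le> R"
  using u_H0 u_lim AE_space
proof eventually_elim
  case (elim s)
  have "(\<lambda>k. nrmV (S (\<rho> k) s)) \<longlonglongrightarrow> nrmV (u s)" by (rule V.A.nrm_tendsto[OF elim(1) S_H0 elim(2)])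
  then show ?case by (rule LIMSEQ_le_const2) (use S_bound elim in auto)
qed

text \<open>
  The functions \<open>S\<close> are simple, so one approximating sequence serves for every
  seminorm that the norm of \<open>V\<close> dominates.
\<close>

lemma u_strongly_measurable:
  assumes "\<And>v. v \<in> H0 \<Longrightarrow> v \<in> X" "\<And>v. v \<in> H0 \<Longrightarrow> 0 \<le> N v" "\<And>v. v \<in> H0 \<Longrightarrow> N v \<le> C * nrmV v"
  shows "strongly_measurable_in t.\<Lambda> X N u"
  unfolding strongly_measurable_in_def
proof (intro conjI exI[of _ "\<lambda>k. S (\<rho> k)"] allI)
  show "AE s in t.\<Lambda>. u s \<in> X" using u_H0 by eventually_elim (rule assms)
  show "simple_in t.\<Lambda> X (S (\<rho> k))" for k unfolding simple_in_def using S_simple assms(1) S_H0 by blast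
  show "AE s in t.\<Lambda>. (\<lambda>k. N (u s - S (\<rho> k) s)) \<longlonglongrightarrow> 0"
    using u_H0 u_lim
  proof eventually_elim
    case (elim s)
    show ?case
    proof (rule Lim_null_comparison)
      show "(\<lambda>k. C * nrmV (u s - S (\<rho> k) s)) \<longlonglongrightarrow> 0" by (rule tendsto_mult_right_zero[OF elim(2)])
      have W: "u s - S (\<rho> k) s \<in> H0" for k by (intro V.A.W_intros elim S_H0)
      show "\<forall>\<^sub>F k in sequentially. norm (N (u s - S (\<rho> k) s)) \<le> C * nrmV (u s - S (\<rho> k) s)"
        using assms(3)[OF W] by (intro always_eventually allI) (simp only: real_norm_def abs_of_nonneg[OF assms(2)[OF W]])
    qed
  qed
qed

lemma integrable_bounded: "g \<in> borel_measurable t.\<Lambda> \<Longrightarrow> AE s in t.\<Lambda>. \<bar>g s\<bar> \<le> B \<Longrightarrow> integrable t.\<Lambda> g" for g :: "real \<Rightarrow> real"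
  by (rule t.integrable_const_bound[of g B]) (simp_all only: real_norm_def)

lemma u_Linf_L2: "u \<in> bochner_Linf t.\<Lambda> (Lp D.M 2) (Lp_norm D.M 2)"
proof -
  have e: "Lp_norm D.M 2 = nrm2" by (rule ext) (simp add: L2_nrm)
  have "strongly_measurable_in t.\<Lambda> (Lp D.M 2) nrm2 u"
    by (rule u_strongly_measurable[OF V.W_L2 L2.nrm_nonneg[OF V.W_L2] V.embed2_nrm])
  moreover have "AE s in t.\<Lambda>. nrm2 (u s) \<le> sqrt C\<^sub>2 * R"
    using u_H0 u_bound
  proof eventually_elim
    case (elim s)
    show ?case by (rule order_trans[OF V.embed2_nrm[OF elim(1)] mult_left_mono[OF elim(2)]]) (use V.C2_pos in simp)
  qed
  ultimately show ?thesis unfolding bochner_Linf_def e by blast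
qed

lemma u_nrmV_measurable: "(\<lambda>s. nrmV (u s)) \<in> borel_measurable t.\<Lambda>"
proof (rule measurable_lebesgue_on_AE_lim[OF _ _ t.I_sets])
  show "(\<lambda>s. nrmV (S (\<rho> k) s)) \<in> borel_measurable t.\<Lambda>" for k by (rule simple_measurable[OF S_simple])
  show "AE s in t.\<Lambda>. (\<lambda>k. nrmV (S (\<rho> k) s)) \<longlonglongrightarrow> nrmV (u s)"
    using u_H0 u_lim by eventually_elim (rule V.A.nrm_tendsto[OF _ S_H0])
qed

lemma u_L2_V: "u \<in> bochner_Lp t.\<Lambda> 2 H0 (V_norm m \<Omega>)"
proof -
  have "strongly_measurable_in t.\<Lambda> H0 nrmV u"
    by (rule u_strongly_measurable[where C=1]) auto
  moreover have "integrable t.\<Lambda> (\<lambda>s. nrmV (u s) powr 2)"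
  proof (rule integrable_bounded)
    show "(\<lambda>s. nrmV (u s) powr 2) \<in> borel_measurable t.\<Lambda>" using u_nrmV_measurable by measurable
    show "AE s in t.\<Lambda>. \<bar>nrmV (u s) powr 2\<bar> \<le> R powr 2"
      using u_H0 u_bound unfolding abs_of_nonneg[OF powr_ge_zero]
      by eventually_elim (intro powr_mono2 V.A.nrm_nonneg, simp_all)
  qed
  ultimately show ?thesis unfolding bochner_Lp_def V_norm_eq by blast
qed

lemma u_L4_L4: "u \<in> bochner_Lp t.\<Lambda> 4 (Lp D.M 4) (Lp_norm D.M 4)"
proof -
  have i0: "0 \<le> (\<integral>x. v x ^ 4 \<partial>D.M)" for v :: "real^2 \<Rightarrow> real" by simp
  have bd: "(\<integral>x. v x ^ 4 \<partial>D.M) \<le> C\<^sub>4 * nrmV v ^ 4" if "v \<in> H0" for v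
  proof -
    have "(form_A m \<Omega> v v)\<^sup>2 = nrmV v ^ 4" unfolding V.A.nrm_sq[OF that, symmetric] by simp
    then show ?thesis using V.embed4[OF that] by simp
  qed
  have "strongly_measurable_in t.\<Lambda> (Lp D.M 4) (Lp_norm D.M 4) u"
  proof (rule u_strongly_measurable[OF V.W_L4])
    show "0 \<le> Lp_norm D.M 4 v" for v unfolding Lp_norm_def by simp
    show "Lp_norm D.M 4 v \<le> C\<^sub>4 powr (1 / 4) * nrmV v" if v: "v \<in> H0" for v
    proof -
      have "Lp_norm D.M 4 v \<le> (C\<^sub>4 * nrmV v ^ 4) powr (1 / 4)" unfolding Lp_norm_4 using bd[OF v] i0 by (intro powr_mono2) auto
      also have "nrmV v ^ 4 = nrmV v powr 4" using abs_powr_4[of "nrmV v"] V.A.nrm_nonneg[OF v] by simp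
      also have "(C\<^sub>4 * nrmV v powr 4) powr (1 / 4) = C\<^sub>4 powr (1 / 4) * (nrmV v powr 4) powr (1 / 4)"
        using V.C4_pos by (simp add: powr_mult)
      also have "(nrmV v powr 4) powr (1 / 4) = nrmV v" using V.A.nrm_nonneg[OF v] unfolding powr_powr by simp
      finally show ?thesis .
    qed
  qed
  moreover have "integrable t.\<Lambda> (\<lambda>s. Lp_norm D.M 4 (u s) powr 4)"
  proof -
    have e: "Lp_norm D.M 4 v powr 4 = (\<integral>x. v x ^ 4 \<partial>D.M)" for v
      using i0[of v] by (simp add: Lp_norm_4 powr_powr)
    show ?thesis unfolding e
    proof (rule integrable_bounded)
      show "(\<lambda>s. \<integral>x. u s x ^ 4 \<partial>D.M) \<in> borel_measurable t.\<Lambda>"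
      proof (rule measurable_lebesgue_on_AE_lim[OF _ _ t.I_sets])
        show "(\<lambda>s. \<integral>x. S (\<rho> k) s x ^ 4 \<partial>D.M) \<in> borel_measurable t.\<Lambda>" for k by (rule simple_measurable[OF S_simple])
        show "AE s in t.\<Lambda>. (\<lambda>k. \<integral>x. S (\<rho> k) s x ^ 4 \<partial>D.M) \<longlonglongrightarrow> (\<integral>x. u s x ^ 4 \<partial>D.M)"
          using u_H0 u_lim by eventually_elim (rule V.L4_norm_tendsto[OF _ S_H0])
      qed
      show "AE s in t.\<Lambda>. \<bar>\<integral>x. u s x ^ 4 \<partial>D.M\<bar> \<le> C\<^sub>4 * R ^ 4"
        using u_H0 u_bound
      proof eventually_elim
        case (elim s)
        have "C\<^sub>4 * nrmV (u s) ^ 4 \<le> C\<^sub>4 * R ^ 4" using V.C4_pos elim V.A.nrm_nonneg[OF elim(1)] by (intro mult_left_mono power_mono) auto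
        then show ?case using bd[OF elim(1)] i0[of "u s"] by simp
      qed
    qed
  qed
  ultimately show ?thesis unfolding bochner_Lp_def by blast
qed

text \<open>The time derivative is defined by the equation.\<close>

definition du :: "real \<Rightarrow> (real^2 \<Rightarrow> real) \<Rightarrow> real" where "du s = V.flux (f s) (u s)"

lemma du_strongly_measurable: "strongly_measurable_in t.\<Lambda> V.V.X' V.V.N' du"
proof -
  obtain s where s: "\<And>n::nat. simple_in t.\<Lambda> (Lp D.M 2) (s n)" "AE x in t.\<Lambda>. f x \<in> Lp D.M 2"
    "AE x in t.\<Lambda>. (\<lambda>n. nrm2 (f x - s n x)) \<longlonglongrightarrow> 0" by (rule f_props) blast
  have sX: "s n x \<in> Lp D.M 2" if "x \<in> t.\<T>" for n x using s(1)[of n] that by (auto simp: simple_in_def)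
  show ?thesis unfolding strongly_measurable_in_def
  proof (intro conjI exI[of _ "\<lambda>k x. V.flux (s k x) (S (\<rho> k) x)"] allI)
    show "AE x in t.\<Lambda>. du x \<in> V.V.X'" using s(2) u_H0 unfolding du_def by eventually_elim (rule V.flux_dual)
    show "simple_in t.\<Lambda> V.V.X' (\<lambda>x. V.flux (s k x) (S (\<rho> k) x))" for k unfolding simple_in_def
    proof
      show "simple_function t.\<Lambda> (\<lambda>x. V.flux (s k x) (S (\<rho> k) x))"
        using s(1)[of k] unfolding simple_in_def by (intro simple_function_compose2[where f="s k" and g="S (\<rho> k)" and h="V.flux"] S_simple) blast
      show "(\<lambda>x. V.flux (s k x) (S (\<rho> k) x)) ` space t.\<Lambda> \<subseteq> V.V.X'" using sX S_H0 V.flux_dual by auto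
    qed
    show "AE x in t.\<Lambda>. (\<lambda>k. V.V.N' (du x - V.flux (s k x) (S (\<rho> k) x))) \<longlonglongrightarrow> 0"
      using s(2,3) u_H0 u_lim AE_space
    proof eventually_elim
      case (elim x)
      have x: "x \<in> t.\<T>" using elim by simp
      have lim': "(\<lambda>k. nrmV (S (\<rho> k) x)) \<longlonglongrightarrow> nrmV (u x)" by (rule V.A.nrm_tendsto[OF elim(3) S_H0 elim(4)])
      show ?case
      proof (rule Lim_null_comparison)
        have "(\<lambda>k. sqrt C\<^sub>2 * nrm2 (f x - s k x) + (1 + (C\<^sub>4 * ((nrmV (u x))\<^sup>2 + nrmV (u x) * nrmV (S (\<rho> k) x) + (nrmV (S (\<rho> k) x))\<^sup>2) + C\<^sub>2)) * nrmV (u x - S (\<rho> k) x))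
          \<longlonglongrightarrow> sqrt C\<^sub>2 * 0 + (1 + (C\<^sub>4 * ((nrmV (u x))\<^sup>2 + nrmV (u x) * nrmV (u x) + (nrmV (u x))\<^sup>2) + C\<^sub>2)) * 0"
          by (intro tendsto_intros elim lim')
        then show "(\<lambda>k. sqrt C\<^sub>2 * nrm2 (f x - s k x) + (1 + (C\<^sub>4 * ((nrmV (u x))\<^sup>2 + nrmV (u x) * nrmV (S (\<rho> k) x) + (nrmV (S (\<rho> k) x))\<^sup>2) + C\<^sub>2)) * nrmV (u x - S (\<rho> k) x)) \<longlonglongrightarrow> 0"
          by simp
        have mem: "V.flux (f x) (u x) - V.flux (s k x) (S (\<rho> k) x) \<in> V.V.X'" for k
          by (intro V.V.dual.X_intros V.flux_dual elim sX x S_H0)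
        show "\<forall>\<^sub>F k in sequentially. norm (V.V.N' (du x - V.flux (s k x) (S (\<rho> k) x)))
          \<le> sqrt C\<^sub>2 * nrm2 (f x - s k x) + (1 + (C\<^sub>4 * ((nrmV (u x))\<^sup>2 + nrmV (u x) * nrmV (S (\<rho> k) x) + (nrmV (S (\<rho> k) x))\<^sup>2) + C\<^sub>2)) * nrmV (u x - S (\<rho> k) x)"
          unfolding du_def real_norm_def abs_of_nonneg[OF V.V.dual.N_nonneg[OF mem]]
          by (intro always_eventually allI V.flux_dual_norm_diff elim sX x S_H0)
      qed
    qed
  qed
qed

text \<open>
  The bound \<open>nrmV (u s) \<le> R\<close> makes the contribution of \<open>u s\<close> to
  the dual norm of \<open>du s\<close> at most \<open>K\<close>.
\<close>

definition K :: real where "K = (1 + (C\<^sub>4 * R\<^sup>2 + C\<^sub>2)) * R"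

lemma du_bound: "AE s in t.\<Lambda>. du s \<in> V.V.X' \<and> 0 \<le> V.V.N' (du s) \<and> V.V.N' (du s) \<le> sqrt C\<^sub>2 * nrm2 (f s) + K"
proof -
  obtain s0 where fL: "AE x in t.\<Lambda>. f x \<in> Lp D.M 2" by (rule f_props) blast
  then show ?thesis using u_H0 u_bound
  proof eventually_elim
    case (elim s)
    have X: "du s \<in> V.V.X'" unfolding du_def by (intro V.flux_dual elim)
    have n: "0 \<le> nrmV (u s)" by (intro V.A.nrm_nonneg elim)
    have le: "(1 + (C\<^sub>4 * (nrmV (u s))\<^sup>2 + C\<^sub>2)) * nrmV (u s) \<le> K"
      unfolding K_def using n elim(3) V.C4_pos V.C2_pos R_nonneg by (intro mult_mono add_mono mult_left_mono power_mono) auto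
    have nn: "0 \<le> sqrt C\<^sub>2 * nrm2 (f s) + (1 + (C\<^sub>4 * (nrmV (u s))\<^sup>2 + C\<^sub>2)) * nrmV (u s)"
      using n V.C4_pos V.C2_pos L2.nrm_nonneg[OF elim(1)] by (intro add_nonneg_nonneg mult_nonneg_nonneg) auto
    have "V.V.N' (du s) \<le> sqrt C\<^sub>2 * nrm2 (f s) + (1 + (C\<^sub>4 * (nrmV (u s))\<^sup>2 + C\<^sub>2)) * nrmV (u s)"
      unfolding du_def by (rule V.V.dual_norm_le_mult[OF V.flux_bound[OF elim(1,2)] nn])
    then show ?case using X V.V.dual.N_nonneg[OF X] le by simp
  qed
qed

lemma du_norm_measurable: "(\<lambda>s. V.V.N' (du s)) \<in> borel_measurable t.\<Lambda>"
  by (rule t.strongly_measurable_truncated[OF V.V.seminormed_dual du_strongly_measurable]) blast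

lemma nrm2_f_integrable: "integrable t.\<Lambda> (\<lambda>s. nrm2 (f s))"
proof -
  obtain s0 where f2: "(\<lambda>x. nrm2 (f x)) \<in> borel_measurable t.\<Lambda>" "integrable t.\<Lambda> (\<lambda>x. (nrm2 (f x))\<^sup>2)" by (rule f_props) blast
  show ?thesis
  proof (rule Bochner_Integration.integrable_bound[of _ "\<lambda>s. 1 + (nrm2 (f s))\<^sup>2"])
    have "\<bar>x\<bar> \<le> 1 + x\<^sup>2" for x :: real using sum_squares_bound[of 1 "\<bar>x\<bar>"] by simp
    then show "AE s in t.\<Lambda>. norm (nrm2 (f s)) \<le> norm (1 + (nrm2 (f s))\<^sup>2)" by simp
  qed (use f2 in auto)
qed

lemma du_norm_integrable: "integrable t.\<Lambda> (\<lambda>s. V.V.N' (du s))"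
proof (rule Bochner_Integration.integrable_bound)
  show "integrable t.\<Lambda> (\<lambda>s. sqrt C\<^sub>2 * nrm2 (f s) + K)" using nrm2_f_integrable by simp
  show "AE s in t.\<Lambda>. norm (V.V.N' (du s)) \<le> norm (sqrt C\<^sub>2 * nrm2 (f s) + K)"
    using du_bound by eventually_elim simp
qed (rule du_norm_measurable)

text \<open>
  The dual norm of \<open>du\<close> is at most a multiple of the \<open>L\<^sup>2\<close> norm
  of \<open>f\<close> plus a constant, hence square integrable; and \<open>x powr (4/3) \<le> 1
  + x\<^sup>2\<close>.
\<close>

lemma du_L43: "du \<in> bochner_Lp t.\<Lambda> (4/3) V.V.X' V.V.N'"
proof -
  obtain s0 where f2: "(\<lambda>x. nrm2 (f x)) \<in> borel_measurable t.\<Lambda>" "integrable t.\<Lambda> (\<lambda>x. (nrm2 (f x))\<^sup>2)" by (rule f_props) blast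
  have p: "x powr (4/3) \<le> 1 + x\<^sup>2" if "0 \<le> x" for x :: real
  proof (cases "x \<le> 1")
    case True
    then have "x powr (4/3) \<le> 1" using that by (intro powr_le1) auto
    then show ?thesis using zero_le_power2[of x] by linarith
  next
    case False
    then have "x powr (4/3) \<le> x powr 2" by (intro powr_mono) auto
    then show ?thesis using abs_powr_2[of x] that by simp
  qed
  have "integrable t.\<Lambda> (\<lambda>s. V.V.N' (du s) powr (4/3))"
  proof (rule Bochner_Integration.integrable_bound)
    show "integrable t.\<Lambda> (\<lambda>s. 1 + (2 * C\<^sub>2 * (nrm2 (f s))\<^sup>2 + 2 * K\<^sup>2))" using f2 by simp
    show "(\<lambda>s. V.V.N' (du s) powr (4/3)) \<in> borel_measurable t.\<Lambda>" using du_norm_measurable by measurable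
    show "AE s in t.\<Lambda>. norm (V.V.N' (du s) powr (4/3)) \<le> norm (1 + (2 * C\<^sub>2 * (nrm2 (f s))\<^sup>2 + 2 * K\<^sup>2))"
      using du_bound
    proof eventually_elim
      case (elim s)
      have "V.V.N' (du s) powr (4/3) \<le> 1 + (V.V.N' (du s))\<^sup>2" using elim by (intro p) blast
      also have "(V.V.N' (du s))\<^sup>2 \<le> (sqrt C\<^sub>2 * nrm2 (f s) + K)\<^sup>2" using elim by (intro power_mono) blast+
      also have "\<dots> \<le> 2 * (sqrt C\<^sub>2 * nrm2 (f s))\<^sup>2 + 2 * K\<^sup>2"
        using sum_squares_bound[of "sqrt C\<^sub>2 * nrm2 (f s)" K] by (simp only: power2_sum)
      also have "(sqrt C\<^sub>2 * nrm2 (f s))\<^sup>2 = C\<^sub>2 * (nrm2 (f s))\<^sup>2" using V.C2_pos by (simp add: power_mult_distrib)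
      finally show ?case by simp
    qed
  qed
  then show ?thesis unfolding bochner_Lp_def using du_strongly_measurable by blast
qed

end

section \<open>The weak time derivative\<close>

lemma summation_by_parts:
  fixes \<theta> a :: "nat \<Rightarrow> real"
  shows "(\<Sum>k<N. (\<theta> (Suc k) - \<theta> k) * a (Suc k)) + (\<Sum>k<N. \<theta> k * (a (Suc k) - a k)) = \<theta> N * a N - \<theta> 0 * a 0"
  by (induction N) (simp_all add: algebra_simps)

lemma test_function_real:
  fixes \<theta> :: "real \<Rightarrow> real"
  assumes "\<theta> \<in> test_functions J"
  shows "(\<theta> has_real_derivative deriv \<theta> s) (at s)" "continuous_on UNIV (deriv \<theta>)" "continuous_on UNIV \<theta>"
    "\<exists>B>0. \<forall>s. \<bar>\<theta> s\<bar> \<le> B \<and> \<bar>deriv \<theta> s\<bar> \<le> B"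
proof -
  have d: "(\<theta> has_real_derivative partials [1] \<theta> s) (at s)" for s
    using directional_derivative[of \<theta> 0 s 1] smooth_differentiable[OF test_smooth[OF assms]] by simp
  have p: "partials [1] \<theta> = deriv \<theta>" using DERIV_imp_deriv[OF d] by (simp add: fun_eq_iff)
  have t: "deriv \<theta> \<in> test_functions J" using test_partials[OF assms, of "[1]"] unfolding p by simp
  show "(\<theta> has_real_derivative deriv \<theta> s) (at s)" using d unfolding p .
  show "continuous_on UNIV (deriv \<theta>)" "continuous_on UNIV \<theta>" using test_continuous[OF t] test_continuous[OF assms] .
  obtain B B' where "B > 0" "\<And>s. \<bar>\<theta> s\<bar> \<le> B" "B' > 0" "\<And>s. \<bar>deriv \<theta> s\<bar> \<le> B'"
    using test_bounded[OF assms] test_bounded[OF t] by blast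
  then show "\<exists>B>0. \<forall>s. \<bar>\<theta> s\<bar> \<le> B \<and> \<bar>deriv \<theta> s\<bar> \<le> B"
    by (intro exI[of _ "max B B'"]) (auto simp: le_max_iff_disj)
qed

context time_mesh begin

text \<open>
  Discrete versions of \<open>\<theta>\<close> and of its derivative for which summation by
  parts is exact.
\<close>

definition node :: "(real \<Rightarrow> real) \<Rightarrow> nat \<Rightarrow> nat \<Rightarrow> real" where "node \<theta> n k = \<theta> (real k * mesh n)"
definition slope :: "(real \<Rightarrow> real) \<Rightarrow> nat \<Rightarrow> nat \<Rightarrow> real" where "slope \<theta> n k = (node \<theta> n (Suc k) - node \<theta> n k) / mesh n"

lemma node_tendsto:
  assumes "continuous_on UNIV \<theta>" "s \<in> \<T>" shows "(\<lambda>n. node \<theta> n (cell n s)) \<longlonglongrightarrow> \<theta> s"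
proof -
  have "(\<lambda>n. real (cell n s) * mesh n) \<longlonglongrightarrow> s"
  proof (rule LIM_zero_cancel, rule Lim_null_comparison[OF _ mesh_tendsto])
    have "\<bar>real (cell n s) * mesh n - s\<bar> \<le> mesh n" for n
      using cell_bounds[OF assms(2), of n] mesh_pos[of n] unfolding abs_le_iff distrib_right mult_1 by linarith
    then show "\<forall>\<^sub>F n in sequentially. norm (real (cell n s) * mesh n - s) \<le> mesh n" by simp
  qed
  then show ?thesis unfolding node_def
    using assms(1) by (intro isCont_tendsto_compose[of s \<theta>]) (simp_all add: continuous_on_eq_continuous_at)
qed

lemma slope_mvt:
  assumes "\<And>s. (\<theta> has_real_derivative \<theta>' s) (at s)"
  shows "\<exists>\<xi>. real k * mesh n < \<xi> \<and> \<xi> < (real k + 1) * mesh n \<and> slope \<theta> n k = \<theta>' \<xi>"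
proof -
  have lt: "real k * mesh n < (real k + 1) * mesh n" using mesh_pos[of n] by simp
  have len: "(real k + 1) * mesh n - real k * mesh n = mesh n" by (simp add: algebra_simps)
  obtain \<xi> where "real k * mesh n < \<xi>" "\<xi> < (real k + 1) * mesh n"
    "\<theta> ((real k + 1) * mesh n) - \<theta> (real k * mesh n) = ((real k + 1) * mesh n - real k * mesh n) * \<theta>' \<xi>"
    using MVT2[OF lt assms] by blast
  then show ?thesis using mesh_pos[of n] unfolding len slope_def node_def
    by (intro exI[of _ \<xi>]) (simp add: add.commute)
qed

lemma slope_tendsto:
  assumes d: "\<And>s. (\<theta> has_real_derivative \<theta>' s) (at s)" and c: "continuous_on UNIV \<theta>'" and s: "s \<in> \<T>"
  shows "(\<lambda>n. slope \<theta> n (cell n s)) \<longlonglongrightarrow> \<theta>' s"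
proof -
  obtain \<xi> where \<xi>: "\<And>n. real (cell n s) * mesh n < \<xi> n" "\<And>n. \<xi> n < (real (cell n s) + 1) * mesh n" "\<And>n. slope \<theta> n (cell n s) = \<theta>' (\<xi> n)"
  proof -
    have "\<forall>n. \<exists>\<xi>. real (cell n s) * mesh n < \<xi> \<and> \<xi> < (real (cell n s) + 1) * mesh n \<and> slope \<theta> n (cell n s) = \<theta>' \<xi>"
      using slope_mvt[of \<theta> \<theta>', OF d] by (intro allI)
    from choice[OF this] show ?thesis using that by blast
  qed
  have "\<xi> \<longlonglongrightarrow> s"
  proof (rule LIM_zero_cancel, rule Lim_null_comparison[OF _ mesh_tendsto])
    have "\<bar>\<xi> n - s\<bar> \<le> mesh n" for n
      using cell_bounds[OF s, of n] \<xi>(1,2)[of n] unfolding abs_le_iff distrib_right mult_1 by linarith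
    then show "\<forall>\<^sub>F n in sequentially. norm (\<xi> n - s) \<le> mesh n" by simp
  qed
  then show ?thesis unfolding \<xi>(3)
    using c by (intro isCont_tendsto_compose[of s \<theta>']) (simp_all add: continuous_on_eq_continuous_at)
qed

end

context allen_cahn_limit begin

lemma \<rho>_lim: "(\<lambda>n. a n) \<longlonglongrightarrow> l \<Longrightarrow> (\<lambda>k. a (\<rho> k)) \<longlonglongrightarrow> l"
  using LIMSEQ_subseq_LIMSEQ[OF _ \<rho>, of a l] by (simp add: o_def)

lemma ip_f_measurable: assumes v: "v \<in> H0" shows "(\<lambda>s. \<integral>x. f s x * v x \<partial>D.M) \<in> borel_measurable t.\<Lambda>"
proof -
  obtain s where s: "\<And>n::nat. simple_in t.\<Lambda> (Lp D.M 2) (s n)" "AE x in t.\<Lambda>. f x \<in> Lp D.M 2"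
    "AE x in t.\<Lambda>. (\<lambda>n. nrm2 (f x - s n x)) \<longlonglongrightarrow> 0" by (rule f_props) blast
  have sX: "s n x \<in> Lp D.M 2" if "x \<in> t.\<T>" for n x using s(1)[of n] that by (auto simp: simple_in_def)
  show ?thesis
  proof (rule measurable_lebesgue_on_AE_lim[OF _ _ t.I_sets])
    show "(\<lambda>y. \<integral>x. s k y x * v x \<partial>D.M) \<in> borel_measurable t.\<Lambda>" for k
      using s(1)[of k] unfolding simple_in_def by (intro simple_measurable[where s="s k" and h="\<lambda>w. \<integral>x. w x * v x \<partial>D.M"]) blast
    show "AE y in t.\<Lambda>. (\<lambda>k. \<integral>x. s k y x * v x \<partial>D.M) \<longlonglongrightarrow> (\<integral>x. f y x * v x \<partial>D.M)"
      using s(2,3) AE_space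
    proof eventually_elim
      case (elim y)
      show ?case by (rule L2.B_tendsto[OF elim(1) V.W_L2[OF v] sX elim(2)]) (use elim in simp)
    qed
  qed
qed

lemma ip_tendsto:
  assumes "u s \<in> H0" "(\<lambda>k. nrmV (u s - S (\<rho> k) s)) \<longlonglongrightarrow> 0" "v \<in> H0"
  shows "(\<lambda>k. \<integral>x. S (\<rho> k) s x * v x \<partial>D.M) \<longlonglongrightarrow> (\<integral>x. u s x * v x \<partial>D.M)"
proof (rule L2.B_tendsto[OF V.W_L2[OF assms(1)] V.W_L2[OF assms(3)] V.W_L2[OF S_H0]])
  show "(\<lambda>k. nrm2 (u s - S (\<rho> k) s)) \<longlonglongrightarrow> 0"
  proof (rule Lim_null_comparison)
    show "(\<lambda>k. sqrt C\<^sub>2 * nrmV (u s - S (\<rho> k) s)) \<longlonglongrightarrow> 0" by (rule tendsto_mult_right_zero[OF assms(2)])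
    have W: "u s - S (\<rho> k) s \<in> H0" for k by (intro V.A.W_intros assms S_H0)
    show "\<forall>\<^sub>F k in sequentially. norm (nrm2 (u s - S (\<rho> k) s)) \<le> sqrt C\<^sub>2 * nrmV (u s - S (\<rho> k) s)"
      unfolding real_norm_def abs_of_nonneg[OF L2.nrm_nonneg[OF V.W_L2[OF W]]]
      by (intro always_eventually allI V.embed2_nrm W)
  qed
qed

text \<open>
  The residual is kept in the formula, so that the scheme becomes an identity. Summation by
  parts moves the difference quotient from \<open>U\<close> to \<open>\<theta>\<close>, without
  boundary terms because \<open>\<theta>\<close> vanishes at 0 and \<open>T\<close>.
\<close>

lemma discrete_weak_form:
  assumes \<theta>: "\<theta> \<in> test_functions t.\<T>" and v: "v \<in> D.\<D>"
  shows "(\<integral>s. t.slope \<theta> n (t.cell n s) * (\<integral>x. S n s x * v x \<partial>D.M) \<partial>t.\<Lambda>)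
    = - (\<integral>s. t.node \<theta> n (t.cell n s) * (V.flux (F n (t.cell n s)) (S n s) v
        + G.residual (t.mesh n) (U n (t.cell n s)) (F n (t.cell n s)) (S n s) v) \<partial>t.\<Lambda>)"
proof -
  let ?a = "\<lambda>k. \<integral>x. U n k x * v x \<partial>D.M"
  have h: "t.mesh n > 0" by (rule t.mesh_pos)
  have ends: "t.node \<theta> n 0 = 0" "t.node \<theta> n (2 ^ n) = 0"
    using test_zero_outside[OF \<theta>] t.mesh_mult[of n] unfolding t.node_def by (simp_all add: mult.commute)
  have step: "V.flux (F n k) (U n (Suc k)) v + G.residual (t.mesh n) (U n k) (F n k) (U n (Suc k)) v = (?a (Suc k) - ?a k) / t.mesh n" for k
    using L2.B_diff[OF G.W_L2[OF U_test] G.W_L2[OF U_test] G.W_L2[OF v], of n "Suc k" n k]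
    unfolding V.flux_def G.residual_def by simp
  have "(\<integral>s. t.slope \<theta> n (t.cell n s) * (\<integral>x. S n s x * v x \<partial>D.M) \<partial>t.\<Lambda>) = t.mesh n * (\<Sum>k<2 ^ n. t.slope \<theta> n k * ?a (Suc k))"
    unfolding S_def by (rule t.integral_cell(2))
  also have "\<dots> = (\<Sum>k<2 ^ n. (t.node \<theta> n (Suc k) - t.node \<theta> n k) * ?a (Suc k))"
    unfolding sum_distrib_left t.slope_def using h by (intro sum.cong refl) simp
  also have "\<dots> = - (\<Sum>k<2 ^ n. t.node \<theta> n k * (?a (Suc k) - ?a k))"
    using summation_by_parts[of "t.node \<theta> n" ?a "2 ^ n"] unfolding ends by simp
  also have "(\<Sum>k<2 ^ n. t.node \<theta> n k * (?a (Suc k) - ?a k)) = t.mesh n * (\<Sum>k<2 ^ n. t.node \<theta> n k * ((?a (Suc k) - ?a k) / t.mesh n))"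
    unfolding sum_distrib_left using h by (intro sum.cong refl) simp
  also have "\<dots> = (\<integral>s. t.node \<theta> n (t.cell n s) * (V.flux (F n (t.cell n s)) (S n s) v
        + G.residual (t.mesh n) (U n (t.cell n s)) (F n (t.cell n s)) (S n s) v) \<partial>t.\<Lambda>)"
    unfolding step[symmetric] S_def by (rule t.integral_cell(2)[symmetric])
  finally show ?thesis .
qed

lemma nrm2_error_tendsto: "(\<lambda>n. \<integral>s. nrm2 (f s - F n (t.cell n s)) \<partial>t.\<Lambda>) \<longlonglongrightarrow> 0"
  and nrm2_error_integrable: "integrable t.\<Lambda> (\<lambda>s. nrm2 (f s - F n (t.cell n s)))"
proof -
  have sm: "strongly_measurable_in t.\<Lambda> (Lp D.M 2) nrm2 f" using f by (auto simp: bochner_Lp_def)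
  obtain s0 where fL: "AE x in t.\<Lambda>. f x \<in> Lp D.M 2" by (rule f_props) blast
  have meas: "(\<lambda>s. nrm2 (f s - F n (t.cell n s))) \<in> borel_measurable t.\<Lambda>" for n
  proof -
    have si: "simple_in t.\<Lambda> (Lp D.M 2) (\<lambda>s. F n (t.cell n s))"
      unfolding simple_in_def using F simple_function_compose1[OF t.cell_simple] by auto
    show ?thesis by (rule t.strongly_measurable_truncated[OF L2_seminormed sm]) (use si in blast)
  qed
  have L: "(\<lambda>s. nrm2 (f s - F n (t.cell n s))) \<in> Lp t.\<Lambda> 2" for n using meas F_int by (simp add: Lp2_iff)
  have one: "(\<lambda>s. 1) \<in> Lp t.\<Lambda> 2" by (simp add: Lp2_iff)
  show "integrable t.\<Lambda> (\<lambda>s. nrm2 (f s - F n (t.cell n s)))" for n using L2_mult_integrable[OF L one] by simp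
  have cs: "(\<integral>s. nrm2 (f s - F n (t.cell n s)) \<partial>t.\<Lambda>)\<^sup>2 \<le> (\<integral>s. (nrm2 (f s - F n (t.cell n s)))\<^sup>2 \<partial>t.\<Lambda>) * measure t.\<Lambda> t.\<T>" for n
    using L2.cauchy_schwarz_sq[OF L one, of n] by (simp add: power2_eq_square)
  have nn: "0 \<le> (\<integral>s. nrm2 (f s - F n (t.cell n s)) \<partial>t.\<Lambda>)" for n
  proof (rule integral_nonneg_AE)
    show "AE s in t.\<Lambda>. 0 \<le> nrm2 (f s - F n (t.cell n s))"
      using fL by eventually_elim (intro L2.nrm_nonneg L2.W_intros F)
  qed
  show "(\<lambda>n. \<integral>s. nrm2 (f s - F n (t.cell n s)) \<partial>t.\<Lambda>) \<longlonglongrightarrow> 0"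
  proof (rule Lim_null_comparison)
    have "(\<lambda>n. sqrt ((\<integral>s. (nrm2 (f s - F n (t.cell n s)))\<^sup>2 \<partial>t.\<Lambda>) * measure t.\<Lambda> t.\<T>)) \<longlonglongrightarrow> sqrt (0 * measure t.\<Lambda> t.\<T>)"
      by (intro tendsto_real_sqrt tendsto_mult F_lim tendsto_const)
    then show "(\<lambda>n. sqrt ((\<integral>s. (nrm2 (f s - F n (t.cell n s)))\<^sup>2 \<partial>t.\<Lambda>) * measure t.\<Lambda> t.\<T>)) \<longlonglongrightarrow> 0" by simp
    show "\<forall>\<^sub>F n in sequentially. norm (\<integral>s. nrm2 (f s - F n (t.cell n s)) \<partial>t.\<Lambda>) \<le> sqrt ((\<integral>s. (nrm2 (f s - F n (t.cell n s)))\<^sup>2 \<partial>t.\<Lambda>) * measure t.\<Lambda> t.\<T>)"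
      using real_le_rsqrt[OF cs] nn by (intro always_eventually allI) (simp only: real_norm_def abs_of_nonneg)
  qed
qed

text \<open>
  The limit of \<open>discrete_weak_form\<close> along the subsequence. The integrand on the
  right splits into \<open>q\<close>, which contains the exact source and converges because
  \<open>flux\<close> is continuous, and an error \<open>e\<close>, which comes from the
  residual and from the approximation of \<open>f\<close> and tends to 0 in the mean.
\<close>

lemma weak_form_test:
  assumes \<theta>: "\<theta> \<in> test_functions t.\<T>" and v: "v \<in> D.\<D>"
  shows "(\<integral>s. deriv \<theta> s * (\<integral>x. u s x * v x \<partial>D.M) \<partial>t.\<Lambda>) = - (\<integral>s. \<theta> s * du s v \<partial>t.\<Lambda>)"
proof -
  note \<theta>p = test_function_real[OF \<theta>]
  obtain B where B: "B > 0" "\<And>s. \<bar>\<theta> s\<bar> \<le> B" "\<And>s. \<bar>deriv \<theta> s\<bar> \<le> B" using \<theta>p(4) by blast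
  have vH: "v \<in> H0" by (rule test_H0[OF v])
  have v0: "0 \<le> nrmV v" by (rule V.A.nrm_nonneg[OF vH])
  have slope_B: "\<bar>t.slope \<theta> n k\<bar> \<le> B" for n k using t.slope_mvt[OF \<theta>p(1), of k n] B(3) by metis
  have node_B: "\<bar>t.node \<theta> n k\<bar> \<le> B" for n k unfolding t.node_def by (rule B)
  obtain s0 where fL: "AE x in t.\<Lambda>. f x \<in> Lp D.M 2" by (rule f_props) blast
  have lhs: "(\<lambda>k. \<integral>s. t.slope \<theta> (\<rho> k) (t.cell (\<rho> k) s) * (\<integral>x. S (\<rho> k) s x * v x \<partial>D.M) \<partial>t.\<Lambda>)
      \<longlonglongrightarrow> (\<integral>s. deriv \<theta> s * (\<integral>x. u s x * v x \<partial>D.M) \<partial>t.\<Lambda>)"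
  proof (rule integral_dominated_convergence[where w="\<lambda>_. B * ((sqrt C\<^sub>2 * (sqrt C\<^sub>2 * R)) * nrmV v)"])
    have m1: "(\<lambda>s. \<integral>x. u s x * v x \<partial>D.M) \<in> borel_measurable t.\<Lambda>"
    proof (rule measurable_lebesgue_on_AE_lim[OF _ _ t.I_sets])
      show "(\<lambda>s. \<integral>x. S (\<rho> k) s x * v x \<partial>D.M) \<in> borel_measurable t.\<Lambda>" for k by (rule simple_measurable[OF S_simple])
      show "AE s in t.\<Lambda>. (\<lambda>k. \<integral>x. S (\<rho> k) s x * v x \<partial>D.M) \<longlonglongrightarrow> (\<integral>x. u s x * v x \<partial>D.M)"
        using u_H0 u_lim by eventually_elim (rule ip_tendsto[OF _ _ vH])
    qed
    have "deriv \<theta> \<in> borel_measurable borel" by (rule borel_measurable_continuous_onI[OF \<theta>p(2)])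
    then have m2: "deriv \<theta> \<in> borel_measurable t.\<Lambda>" by (simp add: measurable_completion measurable_restrict_space1)
    show "(\<lambda>s. deriv \<theta> s * (\<integral>x. u s x * v x \<partial>D.M)) \<in> borel_measurable t.\<Lambda>" using m1 m2 by simp
    show "(\<lambda>s. t.slope \<theta> (\<rho> k) (t.cell (\<rho> k) s) * (\<integral>x. S (\<rho> k) s x * v x \<partial>D.M)) \<in> borel_measurable t.\<Lambda>" for k
      by (intro borel_measurable_times simple_measurable[OF S_simple] simple_measurable[OF t.cell_simple])
    show "AE s in t.\<Lambda>. (\<lambda>k. t.slope \<theta> (\<rho> k) (t.cell (\<rho> k) s) * (\<integral>x. S (\<rho> k) s x * v x \<partial>D.M)) \<longlonglongrightarrow> deriv \<theta> s * (\<integral>x. u s x * v x \<partial>D.M)"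
      using u_H0 u_lim AE_space
    proof eventually_elim
      case (elim s)
      then have s: "s \<in> t.\<T>" by simp
      show ?case
        by (intro tendsto_mult ip_tendsto[OF elim(1,2) vH] \<rho>_lim[OF t.slope_tendsto[OF \<theta>p(1,2) s]])
    qed
    show "AE s in t.\<Lambda>. norm (t.slope \<theta> (\<rho> k) (t.cell (\<rho> k) s) * (\<integral>x. S (\<rho> k) s x * v x \<partial>D.M)) \<le> B * ((sqrt C\<^sub>2 * (sqrt C\<^sub>2 * R)) * nrmV v)" for k
      using AE_space
    proof eventually_elim
      case (elim s)
      have "nrm2 (S (\<rho> k) s) \<le> sqrt C\<^sub>2 * R"
        by (rule order_trans[OF V.embed2_nrm[OF S_H0] mult_left_mono[OF S_bound]]) (use elim V.C2_pos in auto)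
      then have "(sqrt C\<^sub>2 * nrm2 (S (\<rho> k) s)) * nrmV v \<le> (sqrt C\<^sub>2 * (sqrt C\<^sub>2 * R)) * nrmV v"
        using v0 V.C2_pos by (intro mult_right_mono mult_left_mono) auto
      then have "\<bar>\<integral>x. S (\<rho> k) s x * v x \<partial>D.M\<bar> \<le> (sqrt C\<^sub>2 * (sqrt C\<^sub>2 * R)) * nrmV v"
        by (rule order_trans[OF V.ip_bound[OF V.W_L2[OF S_H0] vH]])
      then show ?case unfolding real_norm_def abs_mult using slope_B B(1) by (intro mult_mono) auto
    qed
  qed simp
  define e where "e n s = t.node \<theta> n (t.cell n s) * ((\<integral>x. (F n (t.cell n s) - f s) x * v x \<partial>D.M)
      + G.residual (t.mesh n) (U n (t.cell n s)) (F n (t.cell n s)) (S n s) v)" for n s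
  define q where "q n s = t.node \<theta> n (t.cell n s) * V.flux (f s) (S n s) v" for n s
  have split: "AE s in t.\<Lambda>. t.node \<theta> n (t.cell n s) * (V.flux (F n (t.cell n s)) (S n s) v
        + G.residual (t.mesh n) (U n (t.cell n s)) (F n (t.cell n s)) (S n s) v) = q n s + e n s" for n
    using fL
  proof eventually_elim
    case (elim s)
    have eq: "(\<integral>x. (F n (t.cell n s) - f s) x * v x \<partial>D.M) = (\<integral>x. F n (t.cell n s) x * v x \<partial>D.M) - (\<integral>x. f s x * v x \<partial>D.M)"
      by (rule L2.B_diff[OF F elim V.W_L2[OF vH]])
    have "c * ((a - b - d) + r) = c * (a' - b - d) + c * ((a - a') + r)" for a a' b c d r :: real
      by (simp add: algebra_simps)
    then show ?case unfolding q_def e_def V.flux_def eq .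
  qed
  have fm: "(\<lambda>s. V.flux (f s) (S n s) v) \<in> borel_measurable t.\<Lambda>" for n
    unfolding V.flux_def by (intro borel_measurable_diff ip_f_measurable vH simple_measurable[OF S_simple])
  have qm: "q n \<in> borel_measurable t.\<Lambda>" for n
    unfolding q_def by (intro borel_measurable_times fm simple_measurable[OF t.cell_simple])
  have tot_m: "(\<lambda>s. t.node \<theta> n (t.cell n s) * (V.flux (F n (t.cell n s)) (S n s) v
        + G.residual (t.mesh n) (U n (t.cell n s)) (F n (t.cell n s)) (S n s) v)) \<in> borel_measurable t.\<Lambda>" for n
    unfolding S_def by (rule simple_measurable[OF t.cell_simple])
  have em: "e n \<in> borel_measurable t.\<Lambda>" for n
  proof (rule measurable_lebesgue_on_AE_eq[OF _ _ t.I_sets])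
    show "(\<lambda>s. t.node \<theta> n (t.cell n s) * (V.flux (F n (t.cell n s)) (S n s) v
        + G.residual (t.mesh n) (U n (t.cell n s)) (F n (t.cell n s)) (S n s) v) - q n s) \<in> borel_measurable t.\<Lambda>"
      by (intro borel_measurable_diff tot_m qm)
    show "AE s in t.\<Lambda>. t.node \<theta> n (t.cell n s) * (V.flux (F n (t.cell n s)) (S n s) v
        + G.residual (t.mesh n) (U n (t.cell n s)) (F n (t.cell n s)) (S n s) v) - q n s = e n s"
      using split[of n] by eventually_elim simp
  qed
  have e_bound: "AE s in t.\<Lambda>. \<bar>e n s\<bar> \<le> B * ((sqrt C\<^sub>2 * nrm2 (f s - F n (t.cell n s))) * nrmV v + (t.mesh n)\<^sup>2 * nrmV v)" for n
    using fL
  proof eventually_elim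
    case (elim s)
    have "\<bar>\<integral>x. (F n (t.cell n s) - f s) x * v x \<partial>D.M\<bar> \<le> (sqrt C\<^sub>2 * nrm2 (F n (t.cell n s) - f s)) * nrmV v"
      by (intro V.ip_bound L2.W_intros F elim vH)
    moreover have "\<bar>G.residual (t.mesh n) (U n (t.cell n s)) (F n (t.cell n s)) (S n s) v\<bar> \<le> (t.mesh n)\<^sup>2 * nrmV v"
      using U[of n] v unfolding G.euler_def S_def by blast
    ultimately show ?case unfolding e_def abs_mult L2.nrm_minus[OF F elim]
      using node_B B(1) by (intro mult_mono order_trans[OF abs_triangle_ineq] add_mono) auto
  qed
  have bound_int: "integrable t.\<Lambda> (\<lambda>s. B * ((sqrt C\<^sub>2 * nrm2 (f s - F n (t.cell n s))) * nrmV v + (t.mesh n)\<^sup>2 * nrmV v))" for n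
    using nrm2_error_integrable[of n] by simp
  have e_int: "integrable t.\<Lambda> (e n)" for n
  proof (rule Bochner_Integration.integrable_bound[OF bound_int em])
    show "AE s in t.\<Lambda>. norm (e n s) \<le> norm (B * ((sqrt C\<^sub>2 * nrm2 (f s - F n (t.cell n s))) * nrmV v + (t.mesh n)\<^sup>2 * nrmV v))"
      using e_bound[of n] by eventually_elim simp
  qed
  have e_lim: "(\<lambda>n. \<integral>s. e n s \<partial>t.\<Lambda>) \<longlonglongrightarrow> 0"
  proof (rule Lim_null_comparison)
    let ?b = "\<lambda>n. B * ((sqrt C\<^sub>2 * (\<integral>s. nrm2 (f s - F n (t.cell n s)) \<partial>t.\<Lambda>)) * nrmV v + (t.mesh n)\<^sup>2 * nrmV v * measure t.\<Lambda> t.\<T>)"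
    have "?b \<longlonglongrightarrow> B * ((sqrt C\<^sub>2 * 0) * nrmV v + 0\<^sup>2 * nrmV v * measure t.\<Lambda> t.\<T>)"
      by (intro tendsto_intros nrm2_error_tendsto t.mesh_tendsto)
    then show "?b \<longlonglongrightarrow> 0" by simp
    have "\<bar>\<integral>s. e n s \<partial>t.\<Lambda>\<bar> \<le> ?b n" for n
    proof -
      have "\<bar>\<integral>s. e n s \<partial>t.\<Lambda>\<bar> \<le> (\<integral>s. \<bar>e n s\<bar> \<partial>t.\<Lambda>)" using integral_norm_bound[of t.\<Lambda> "e n"] by simp
      also have "\<dots> \<le> (\<integral>s. B * ((sqrt C\<^sub>2 * nrm2 (f s - F n (t.cell n s))) * nrmV v + (t.mesh n)\<^sup>2 * nrmV v) \<partial>t.\<Lambda>)"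
        by (rule integral_mono_AE[OF integrable_abs[OF e_int] bound_int e_bound])
      also have "\<dots> = ?b n" using nrm2_error_integrable[of n] by (simp add: mult.commute)
      finally show ?thesis .
    qed
    then show "\<forall>\<^sub>F n in sequentially. norm (\<integral>s. e n s \<partial>t.\<Lambda>) \<le> ?b n" by (simp only: real_norm_def eventually_True)
  qed
  have W: "integrable t.\<Lambda> (\<lambda>s. B * ((sqrt C\<^sub>2 * nrm2 (f s) + K) * nrmV v))" using nrm2_f_integrable by simp
  have q_bound: "AE s in t.\<Lambda>. norm (q n s) \<le> B * ((sqrt C\<^sub>2 * nrm2 (f s) + K) * nrmV v)" for n
    using fL AE_space
  proof eventually_elim
    case (elim s)
    have n: "0 \<le> nrmV (S n s)" "nrmV (S n s) \<le> R" using V.A.nrm_nonneg[OF S_H0] S_bound elim by auto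
    have "(1 + (C\<^sub>4 * (nrmV (S n s))\<^sup>2 + C\<^sub>2)) * nrmV (S n s) \<le> K"
      unfolding K_def using n V.C4_pos V.C2_pos R_nonneg by (intro mult_mono add_mono mult_left_mono power_mono) auto
    then have "(sqrt C\<^sub>2 * nrm2 (f s) + (1 + (C\<^sub>4 * (nrmV (S n s))\<^sup>2 + C\<^sub>2)) * nrmV (S n s)) * nrmV v \<le> (sqrt C\<^sub>2 * nrm2 (f s) + K) * nrmV v"
      using v0 by (intro mult_right_mono) auto
    then have "\<bar>V.flux (f s) (S n s) v\<bar> \<le> (sqrt C\<^sub>2 * nrm2 (f s) + K) * nrmV v"
      by (rule order_trans[OF V.flux_bound[OF elim(1) S_H0 vH]])
    then show ?case unfolding q_def real_norm_def abs_mult using node_B B(1) by (intro mult_mono) auto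
  qed
  have q_int: "integrable t.\<Lambda> (q n)" for n
  proof (rule Bochner_Integration.integrable_bound[OF W qm])
    show "AE s in t.\<Lambda>. norm (q n s) \<le> norm (B * ((sqrt C\<^sub>2 * nrm2 (f s) + K) * nrmV v))"
      using q_bound[of n] by eventually_elim simp
  qed
  have q_pt: "AE s in t.\<Lambda>. (\<lambda>k. q (\<rho> k) s) \<longlonglongrightarrow> \<theta> s * du s v"
    using fL u_H0 u_lim AE_space
  proof eventually_elim
    case (elim s)
    then have s: "s \<in> t.\<T>" by simp
    show ?case unfolding q_def du_def
      by (intro tendsto_mult \<rho>_lim[OF t.node_tendsto[OF \<theta>p(3) s]] V.flux_tendsto[OF elim(1,2) S_H0 elim(3) vH])
  qed
  have q_lim: "(\<lambda>k. \<integral>s. q (\<rho> k) s \<partial>t.\<Lambda>) \<longlonglongrightarrow> (\<integral>s. \<theta> s * du s v \<partial>t.\<Lambda>)"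
    by (rule integral_dominated_convergence[OF measurable_lebesgue_on_AE_lim[OF qm q_pt t.I_sets] qm W q_pt q_bound])
  have tot: "(\<integral>s. t.node \<theta> n (t.cell n s) * (V.flux (F n (t.cell n s)) (S n s) v
        + G.residual (t.mesh n) (U n (t.cell n s)) (F n (t.cell n s)) (S n s) v) \<partial>t.\<Lambda>) = (\<integral>s. q n s \<partial>t.\<Lambda>) + (\<integral>s. e n s \<partial>t.\<Lambda>)" for n
  proof -
    have "(\<integral>s. t.node \<theta> n (t.cell n s) * (V.flux (F n (t.cell n s)) (S n s) v
        + G.residual (t.mesh n) (U n (t.cell n s)) (F n (t.cell n s)) (S n s) v) \<partial>t.\<Lambda>) = (\<integral>s. q n s + e n s \<partial>t.\<Lambda>)"
      by (rule integral_cong_AE[OF tot_m borel_measurable_add[OF qm em] split])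
    also have "\<dots> = (\<integral>s. q n s \<partial>t.\<Lambda>) + (\<integral>s. e n s \<partial>t.\<Lambda>)" by (rule Bochner_Integration.integral_add[OF q_int e_int])
    finally show ?thesis .
  qed
  have "(\<lambda>k. - ((\<integral>s. q (\<rho> k) s \<partial>t.\<Lambda>) + (\<integral>s. e (\<rho> k) s \<partial>t.\<Lambda>))) \<longlonglongrightarrow> - ((\<integral>s. \<theta> s * du s v \<partial>t.\<Lambda>) + 0)"
    by (intro tendsto_minus tendsto_add q_lim \<rho>_lim[OF e_lim])
  then have "(\<lambda>k. \<integral>s. t.slope \<theta> (\<rho> k) (t.cell (\<rho> k) s) * (\<integral>x. S (\<rho> k) s x * v x \<partial>D.M) \<partial>t.\<Lambda>) \<longlonglongrightarrow> - (\<integral>s. \<theta> s * du s v \<partial>t.\<Lambda>)"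
    unfolding discrete_weak_form[OF \<theta> v] tot by simp
  then show ?thesis using lhs LIMSEQ_unique by blast
qed

text \<open>
  Test functions are dense in \<open>H0\<close>, and elements of the dual are continuous.
\<close>

lemma dual_zero_of_test:
  assumes l: "l \<in> V.V.X'" and z: "\<And>\<phi>. \<phi> \<in> D.\<D> \<Longrightarrow> l \<phi> = 0" and v: "v \<in> H0"
  shows "l v = 0"
proof -
  obtain \<phi> where phi: "\<And>n::nat. \<phi> n \<in> D.\<D>" "\<And>k. k \<le> m \<Longrightarrow> (\<lambda>n. semi_inner.nrm (form_A k \<Omega>) (v - \<phi> n)) \<longlonglongrightarrow> 0"
    using D.H0_approx[OF v] by blast
  have "(\<lambda>n. V.V.N' l * nrmV (v - \<phi> n)) \<longlonglongrightarrow> 0" by (rule tendsto_mult_right_zero[OF phi(2)[OF order_refl]])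
  moreover have "\<bar>l v\<bar> \<le> V.V.N' l * nrmV (v - \<phi> n)" for n
  proof -
    have d: "v - \<phi> n \<in> H0" by (intro V.A.W_intros v test_H0 phi)
    have "v - \<phi> n + \<phi> n = v" by simp
    then have "l v = l (v - \<phi> n)" using dual_add[OF l d test_H0[OF phi(1)], of n] z[OF phi(1), of n] by simp
    then show ?thesis using V.V.dual_bound[OF l d] by (simp only:)
  qed
  ultimately have "\<bar>l v\<bar> \<le> 0" by (intro LIMSEQ_le_const) auto
  then show ?thesis by simp
qed

lemma embedded_u_strongly_measurable: "strongly_measurable_in t.\<Lambda> V.V.X' V.V.N' (\<lambda>s v. \<integral>x. u s x * v x \<partial>D.M)"
  unfolding strongly_measurable_in_def
proof (intro conjI exI[of _ "\<lambda>k s v. \<integral>x. S (\<rho> k) s x * v x \<partial>D.M"] allI)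
  show "AE s in t.\<Lambda>. (\<lambda>v. \<integral>x. u s x * v x \<partial>D.M) \<in> V.V.X'"
    using u_H0 by eventually_elim (intro V.ip_dual V.W_L2)
  show "simple_in t.\<Lambda> V.V.X' (\<lambda>s v. \<integral>x. S (\<rho> k) s x * v x \<partial>D.M)" for k
    unfolding simple_in_def using simple_function_compose1[OF S_simple, of "\<lambda>w v. \<integral>x. w x * v x \<partial>D.M" "\<rho> k"] V.ip_dual[OF V.W_L2[OF S_H0]] by blast
  show "AE s in t.\<Lambda>. (\<lambda>k. V.V.N' ((\<lambda>v. \<integral>x. u s x * v x \<partial>D.M) - (\<lambda>v. \<integral>x. S (\<rho> k) s x * v x \<partial>D.M))) \<longlonglongrightarrow> 0"
    using u_H0 u_lim
  proof eventually_elim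
    case (elim s)
    show ?case
    proof (rule Lim_null_comparison)
      show "(\<lambda>k. sqrt C\<^sub>2 * (sqrt C\<^sub>2 * nrmV (u s - S (\<rho> k) s))) \<longlonglongrightarrow> 0"
        by (intro tendsto_mult_right_zero elim)
      have "norm (V.V.N' ((\<lambda>v. \<integral>x. u s x * v x \<partial>D.M) - (\<lambda>v. \<integral>x. S (\<rho> k) s x * v x \<partial>D.M))) \<le> sqrt C\<^sub>2 * (sqrt C\<^sub>2 * nrmV (u s - S (\<rho> k) s))" for k
      proof -
        have mem: "(\<lambda>v. \<integral>x. u s x * v x \<partial>D.M) - (\<lambda>v. \<integral>x. S (\<rho> k) s x * v x \<partial>D.M) \<in> V.V.X'"
          by (intro V.V.dual.X_intros V.ip_dual V.W_L2 elim S_H0)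
        have "V.V.N' ((\<lambda>v. \<integral>x. u s x * v x \<partial>D.M) - (\<lambda>v. \<integral>x. S (\<rho> k) s x * v x \<partial>D.M)) \<le> sqrt C\<^sub>2 * nrm2 (u s - S (\<rho> k) s)"
          by (rule V.ip_dual_norm_diff[OF V.W_L2[OF elim(1)] V.W_L2[OF S_H0]])
        also have "\<dots> \<le> sqrt C\<^sub>2 * (sqrt C\<^sub>2 * nrmV (u s - S (\<rho> k) s))"
          using V.C2_pos by (intro mult_left_mono V.embed2_nrm V.A.W_intros elim S_H0) simp
        finally show ?thesis using V.V.dual.N_nonneg[OF mem] by (simp only: real_norm_def abs_of_nonneg)
      qed
      then show "\<forall>\<^sub>F k in sequentially. norm (V.V.N' ((\<lambda>v. \<integral>x. u s x * v x \<partial>D.M) - (\<lambda>v. \<integral>x. S (\<rho> k) s x * v x \<partial>D.M))) \<le> sqrt C\<^sub>2 * (sqrt C\<^sub>2 * nrmV (u s - S (\<rho> k) s))"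
        by (intro always_eventually allI)
    qed
  qed
qed

lemma embedded_u_bound: "AE s in t.\<Lambda>. (\<lambda>v. \<integral>x. u s x * v x \<partial>D.M) \<in> V.V.X' \<and> V.V.N' (\<lambda>v. \<integral>x. u s x * v x \<partial>D.M) \<le> sqrt C\<^sub>2 * (sqrt C\<^sub>2 * R)"
  using u_H0 u_bound
proof eventually_elim
  case (elim s)
  note L = V.W_L2[OF elim(1)]
  have "V.V.N' (\<lambda>v. \<integral>x. u s x * v x \<partial>D.M) \<le> sqrt C\<^sub>2 * nrm2 (u s)"
    by (rule V.V.dual_norm_le_mult[OF V.ip_bound[OF L]]) (use V.C2_pos L2.nrm_nonneg[OF L] in auto)
  also have "\<dots> \<le> sqrt C\<^sub>2 * (sqrt C\<^sub>2 * R)"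
    using V.C2_pos by (intro mult_left_mono order_trans[OF V.embed2_nrm[OF elim(1)]] elim) auto
  finally show ?case using V.ip_dual[OF L] by blast
qed

lemma scaled_bochner_integral:
  assumes g: "strongly_measurable_in t.\<Lambda> V.V.X' V.V.N' g" and gi: "integrable t.\<Lambda> (\<lambda>s. V.V.N' (g s))"
    and a: "\<And>k::nat. simple_function t.\<Lambda> (a k)" "AE s in t.\<Lambda>. (\<lambda>k. a k s :: real) \<longlonglongrightarrow> b s" and B: "\<And>s. \<bar>b s\<bar> \<le> B"
    and y: "\<And>v. v \<in> H0 \<Longrightarrow> y v = (\<integral>s. b s * g s v \<partial>t.\<Lambda>)"
  shows "has_bochner_integral_in t.\<Lambda> V.V.X' V.V.N' (\<lambda>s v. b s * g s v) y"
proof -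
  have eq: "(\<lambda>s v. b s * g s v) = (\<lambda>s. b s *\<^sub>R g s)" by (simp add: scaleR_fun_def)
  have gX: "AE s in t.\<Lambda>. g s \<in> V.V.X'" using g by (simp add: strongly_measurable_in_def)
  have sm: "strongly_measurable_in t.\<Lambda> V.V.X' V.V.N' (\<lambda>s. b s *\<^sub>R g s)"
    by (rule t.strongly_measurable_scale[OF V.V.seminormed_dual g a])
  have "integrable t.\<Lambda> (\<lambda>s. V.V.N' (b s *\<^sub>R g s))"
  proof (rule Bochner_Integration.integrable_bound)
    show "integrable t.\<Lambda> (\<lambda>s. B * V.V.N' (g s))" using gi by simp
    show "(\<lambda>s. V.V.N' (b s *\<^sub>R g s)) \<in> borel_measurable t.\<Lambda>"
      by (rule t.strongly_measurable_truncated[OF V.V.seminormed_dual sm]) blast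
    show "AE s in t.\<Lambda>. norm (V.V.N' (b s *\<^sub>R g s)) \<le> norm (B * V.V.N' (g s))"
      using gX
    proof eventually_elim
      case (elim s)
      have "\<bar>b s\<bar> * V.V.N' (g s) \<le> B * V.V.N' (g s)" using B V.V.dual.N_nonneg[OF elim] by (intro mult_right_mono)
      moreover have "0 \<le> B" using order_trans[OF abs_ge_zero B] .
      ultimately show ?case unfolding V.V.dual.N_scale[OF elim] real_norm_def
        using V.V.dual.N_nonneg[OF elim] by (simp add: abs_mult)
    qed
  qed
  then show ?thesis unfolding eq
    by (intro t.has_bochner_integral_dual[OF _ sm]) (use y V.V.normed_dual_axioms in auto)
qed

text \<open>
  Both integrals exist as elements \<open>y\<close> and \<open>z\<close> of the dual, given by
  pairing. Their sum vanishes on test functions by \<open>weak_form_test\<close>, hence on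
  \<open>H0\<close> by density.
\<close>

lemma u_weak_time_deriv: "is_weak_time_deriv m \<Omega> T u du"
  unfolding is_weak_time_deriv_def V_norm_eq
proof (intro ballI)
  fix \<theta> :: "real \<Rightarrow> real" assume \<theta>: "\<theta> \<in> test_functions t.\<T>"
  note \<theta>p = test_function_real[OF \<theta>]
  obtain B where B: "\<And>s. \<bar>\<theta> s\<bar> \<le> B" "\<And>s. \<bar>deriv \<theta> s\<bar> \<le> B" using \<theta>p(4) by blast
  have slope: "simple_function t.\<Lambda> (\<lambda>s. t.slope \<theta> k (t.cell k s))" "simple_function t.\<Lambda> (\<lambda>s. t.node \<theta> k (t.cell k s))" for k
    by (rule simple_function_compose1[OF t.cell_simple])+
  have slope_lim: "AE s in t.\<Lambda>. (\<lambda>k. t.slope \<theta> k (t.cell k s)) \<longlonglongrightarrow> deriv \<theta> s"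
    using t.slope_tendsto[OF \<theta>p(1,2)] by (intro AE_I2) simp
  have node_lim: "AE s in t.\<Lambda>. (\<lambda>k. t.node \<theta> k (t.cell k s)) \<longlonglongrightarrow> \<theta> s"
    using t.node_tendsto[OF \<theta>p(3)] by (intro AE_I2) simp
  have u_int: "integrable t.\<Lambda> (\<lambda>s. V.V.N' (\<lambda>v. \<integral>x. u s x * v x \<partial>D.M))"
  proof (rule integrable_bounded)
    show "(\<lambda>s. V.V.N' (\<lambda>v. \<integral>x. u s x * v x \<partial>D.M)) \<in> borel_measurable t.\<Lambda>"
      by (rule t.strongly_measurable_truncated[OF V.V.seminormed_dual embedded_u_strongly_measurable]) blast
    show "AE s in t.\<Lambda>. \<bar>V.V.N' (\<lambda>v. \<integral>x. u s x * v x \<partial>D.M)\<bar> \<le> sqrt C\<^sub>2 * (sqrt C\<^sub>2 * R)"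
      using embedded_u_bound
    proof eventually_elim
      case (elim s)
      then show ?case using V.V.dual.N_nonneg by (simp add: abs_of_nonneg)
    qed
  qed
  define y where "y v = (\<integral>s. deriv \<theta> s * (\<integral>x. u s x * v x \<partial>D.M) \<partial>t.\<Lambda>)" for v
  define z where "z v = (\<integral>s. \<theta> s * du s v \<partial>t.\<Lambda>)" for v
  have hy: "has_bochner_integral_in t.\<Lambda> V.V.X' V.V.N' (\<lambda>s v. deriv \<theta> s * (\<integral>x. u s x * v x \<partial>D.M)) y"
    by (rule scaled_bochner_integral[OF embedded_u_strongly_measurable u_int slope(1) slope_lim B(2) y_def])
  have hz: "has_bochner_integral_in t.\<Lambda> V.V.X' V.V.N' (\<lambda>s v. \<theta> s * du s v) z"
    by (rule scaled_bochner_integral[OF du_strongly_measurable du_norm_integrable slope(2) node_lim B(1) z_def])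
  have "y + z \<in> V.V.X'" using hy hz V.V.dual.X_intros(2) unfolding has_bochner_integral_in_def by blast
  moreover have "(y + z) \<phi> = 0" if "\<phi> \<in> D.\<D>" for \<phi>
    using weak_form_test[OF \<theta> that] by (simp add: y_def z_def)
  ultimately have yz: "(y + z) v = 0" if "v \<in> H0" for v using dual_zero_of_test that by blast
  have "has_bochner_integral_in t.\<Lambda> V.V.X' V.V.N' (\<lambda>s v. \<theta> s * du s v) (\<lambda>v. - y v)"
  proof (rule scaled_bochner_integral[OF du_strongly_measurable du_norm_integrable slope(2) node_lim B(1)])
    show "- y v = (\<integral>s. \<theta> s * du s v \<partial>t.\<Lambda>)" if "v \<in> H0" for v using yz[OF that] unfolding z_def[symmetric] plus_fun_apply by linarith
  qed
  then show "\<exists>y. has_bochner_integral_in t.\<Lambda> V.V.X' V.V.N' (\<lambda>s v. deriv \<theta> s * pairing \<Omega> (u s) v) y \<and>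
      has_bochner_integral_in t.\<Lambda> V.V.X' V.V.N' (\<lambda>s v. \<theta> s * du s v) (\<lambda>v. - y v)"
    using hy unfolding pairing_def by blast
qed

lemma u_equation: "du s v + form_A m \<Omega> (u s) v + pairing \<Omega> (\<lambda>x. phi (u s x)) v = pairing \<Omega> (f s) v"
  by (simp add: du_def V.flux_def V.dwell_def pairing_def)

end

section \<open>Existence of a weak solution\<close>

theorem theorem3p2:
  fixes m :: nat and \<Omega> :: "(real^2) set" and T :: real
    and f :: "real \<Rightarrow> real^2 \<Rightarrow> real" and u0 :: "real^2 \<Rightarrow> real"
  assumes "m \<in> {1, 2}"
    and "lipschitz_polygonal_domain \<Omega>"
    and "0 < T"
    and "f \<in> bochner_Lp (lebesgue_on {0<..<T}) 2 (Lp (lebesgue_on \<Omega>) 2) (Lp_norm (lebesgue_on \<Omega>) 2)"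
    and "u0 \<in> Lp (lebesgue_on \<Omega>) 2"
  shows "\<exists>(u :: real \<Rightarrow> real^2 \<Rightarrow> real) (u' :: real \<Rightarrow> (real^2 \<Rightarrow> real) \<Rightarrow> real).
    u \<in> bochner_Linf (lebesgue_on {0<..<T}) (Lp (lebesgue_on \<Omega>) 2) (Lp_norm (lebesgue_on \<Omega>) 2) \<and>
    u \<in> bochner_Lp (lebesgue_on {0<..<T}) 2 (sobolev_H0 m \<Omega>) (V_norm m \<Omega>) \<and>
    u \<in> bochner_Lp (lebesgue_on {0<..<T}) 4 (Lp (lebesgue_on \<Omega>) 4) (Lp_norm (lebesgue_on \<Omega>) 4) \<and>
    u' \<in> bochner_Lp (lebesgue_on {0<..<T}) (4/3) (V_dual m \<Omega>) (V_dual_norm m \<Omega>) \<and>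
    is_weak_time_deriv m \<Omega> T u u' \<and>
    (\<forall>v\<in>sobolev_H0 m \<Omega>. AE t in lebesgue_on {0<..<T}.
       u' t v + form_A m \<Omega> (u t) v + pairing \<Omega> (\<lambda>x. phi (u t x)) v = pairing \<Omega> (f t) v)"
proof -
  have m: "m \<ge> 1" using assms(1) by auto
  interpret D: planar_domain \<Omega>
    using assms(2) by unfold_locales (auto simp: lipschitz_polygonal_domain_def)
  obtain C\<^sub>2 where C2: "C\<^sub>2 > 0" "\<And>v. v \<in> sobolev_H0 m \<Omega> \<Longrightarrow> (\<integral>x. (v x)\<^sup>2 \<partial>D.M) \<le> C\<^sub>2 * form_A m \<Omega> v v"
    using D.H0_poincare by blast
  obtain C\<^sub>4 where C4: "C\<^sub>4 > 0" "\<And>v. v \<in> sobolev_H0 m \<Omega> \<Longrightarrow> v \<in> Lp D.M 4"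
    "\<And>v. v \<in> sobolev_H0 m \<Omega> \<Longrightarrow> (\<integral>x. v x ^ 4 \<partial>D.M) \<le> C\<^sub>4 * (form_A m \<Omega> v v)\<^sup>2"
    using D.H0_L4[OF m] by blast
  interpret V: ginzburg_landau D.M "sobolev_H0 m \<Omega>" "form_A m \<Omega>" C\<^sub>2 C\<^sub>4
  proof -
    interpret A: semi_inner "sobolev_H0 m \<Omega>" "form_A m \<Omega>" by (rule D.semi_inner_H0) simp
    show "ginzburg_landau D.M (sobolev_H0 m \<Omega>) (form_A m \<Omega>) C\<^sub>2 C\<^sub>4"
      by unfold_locales (use C2 C4 D.sobolev_L2[OF D.H0_sobolev] in auto)
  qed
  have nrm: "Lp_norm D.M 2 = L2.nrm D.M" by (rule ext) (simp add: L2_nrm)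
  interpret allen_cahn \<Omega> T m C\<^sub>2 C\<^sub>4 f
    by unfold_locales (use assms(3,4) nrm in auto)
  obtain F U E where "allen_cahn_scheme \<Omega> T m C\<^sub>2 C\<^sub>4 f F U E"
    by (rule euler_schemes) (blast intro: allen_cahn_scheme.intro[OF allen_cahn_axioms allen_cahn_scheme_axioms.intro])
  then interpret scheme: allen_cahn_scheme \<Omega> T m C\<^sub>2 C\<^sub>4 f F U E .
  obtain \<rho> u where "allen_cahn_limit \<Omega> T m C\<^sub>2 C\<^sub>4 f F U E \<rho> u"
    by (rule scheme.limit_exists) (blast intro: allen_cahn_limit.intro[OF scheme.allen_cahn_scheme_axioms allen_cahn_limit_axioms.intro])
  then interpret limit: allen_cahn_limit \<Omega> T m C\<^sub>2 C\<^sub>4 f F U E \<rho> u .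
  show ?thesis
    using limit.u_Linf_L2 limit.u_L2_V limit.u_L4_L4 limit.du_L43 limit.u_weak_time_deriv limit.u_equation
    unfolding V_norm_eq by (intro exI[of _ u] exI[of _ limit.du]) auto
qed

end
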